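(* Let $\mathscr{A}=(\{\mathcal{A}_{s,t}\}_{0<s<t},\{\Delta_{r,s,t}\}_{0<r<s<t})$ be a unital $C^*$-subproduct system with unit $\{p_{s,t}\}_{0<s<t}$. There exists a $*$-isomorphism $\delta:C^*_{\{p_{s,t}\}}(\mathscr{A})\to\mathcal{A}^\diamond_{\{p_{s,t}\}}$, uniquely determined by the condition $$\delta\Delta^\times_I=\Delta^\diamond_{s,t}\Delta^\sharp_I$$ for all $I\in\mathcal{P}_{s,t}$ and $0<s<t$.
   Context: All tensor products of $C^*$-algebras are injective (minimal) tensor products; $\mathrm{id}$ denotes identity maps; a $*$-monomorphism is an injective $*$-homomorphism. A $C^*$-subproduct system is a pair $\mathscr{A}=(\{\mathcal{A}_{s,t}\}_{0<s<t},\{\Delta_{r,s,t}\}_{0<r<s<t})$ of $C^*$-algebras $\mathcal{A}_{s,t}$ and $*$-monomorphisms $\Delta_{r,s,t}:\mathcal{A}_{r,t}\to\mathcal{A}_{r,s}\otimes\mathcal{A}_{s,t}$ such that $(\mathrm{id}_{\mathcal{A}_{r,s}}\otimes\Delta_{s,t,u})\Delta_{r,s,u}=(\Delta_{r,s,t}\otimes\mathrm{id}_{\mathcal{A}_{t,u}})\Delta_{r,t,u}$ for all $0<r<s<t<u$; it is a $C^*$-product system if all $\Delta_{r,s,t}$ are $*$-isomorphisms. A unit of $\mathscr{A}$ is a family of non-zero projections $p_{s,t}\in\mathcal{A}_{s,t}$, $0<s<t$, with $\Delta_{r,s,t}(p_{r,t})=p_{r,s}\otimes p_{s,t}$ for all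 $0<r<s<t$; $\mathscr{A}$ is unital if it admits a unit. Partitions. For $0<s<t$, $\mathcal{P}_{s,t}$ is the set, ordered by inclusion, of finite partitions $I=\{s=\iota_0<\iota_1<\dots<\iota_m<\iota_{m+1}=t\}$ of $[s,t]$ ($m\ge 0$). Put $\mathcal{A}_I=\mathcal{A}_{\iota_0,\iota_1}\otimes\cdots\otimes\mathcal{A}_{\iota_m,\iota_{m+1}}$ and $p_I=p_{\iota_0,\iota_1}\otimes\cdots\otimes p_{\iota_m,\iota_{m+1}}$. Define $\Delta_{\{s,t\},I}:\mathcal{A}_{s,t}\to\mathcal{A}_I$ as the identity if $m=0$, as $\Delta_{\iota_0,\iota_1,\iota_2}$ if $m=1$, and as $(\Delta_{\{\iota_0,\iota_m\},I\setminus\{\iota_{m+1}\}}\otimes\mathrm{id}_{\mathcal{A}_{\iota_m,\iota_{m+1}}})\Delta_{\iota_0,\iota_m,\iota_{m+1}}$ if $m\ge2$. For $I\subseteq J$ in $\mathcal{P}_{s,t}$, with $I_i=J\cap[\iota_i,\iota_{i+1}]$, put $\Delta_{I,J}=\Delta_{\{\iota_0,\iota_1\},I_0}\otimes\cdots\otimes\Delta_{\{\iota_m,\iota_{m+1}\},I_m}:\mathcal{A}_I\to\mathcal{A}_J=\mathcal{A}_{I_0}\otimes\cdots\otimes\mathcal{A}_{I_m}$. Inductive dilation. $\mathcal{A}^\sharp_{s,t}$ is the $C^*$-inductive limit of the inductive system $\{(\mathcal{A}_I,\Delta_{I,J})\,|\,I\subseteq J\in\mathcal{P}_{s,t}\}$,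 with connecting $*$-monomorphisms $\Delta^\sharp_I:\mathcal{A}_I\to\mathcal{A}^\sharp_{s,t}$ ($\Delta^\sharp_J\Delta_{I,J}=\Delta^\sharp_I$); write $\Delta^\sharp_{s,t}=\Delta^\sharp_{\{s,t\}}$. For $0<r<s<t$, $\Delta^\sharp_{r,s,t}:\mathcal{A}^\sharp_{r,t}\to\mathcal{A}^\sharp_{r,s}\otimes\mathcal{A}^\sharp_{s,t}$ is the unique $*$-isomorphism with $\Delta^\sharp_{r,s,t}\Delta^\sharp_{I\cup J}=\Delta^\sharp_I\otimes\Delta^\sharp_J$ for all $I\in\mathcal{P}_{r,s}$, $J\in\mathcal{P}_{s,t}$. These form a $C^*$-product system $\mathscr{A}^\sharp$, with unit $p^\sharp_{s,t}=\Delta^\sharp_{s,t}(p_{s,t})$. The algebra $\mathcal{A}^\diamond_{\{p_{s,t}\}}$. For $0<u\le s<t\le v$, define $\Delta^\sharp_{(s,t),(u,v)}:\mathcal{A}^\sharp_{s,t}\to\mathcal{A}^\sharp_{u,v}$ by: $x\mapsto x$ if $u=s$, $t=v$; $x\mapsto(\Delta^\sharp_{s,t,v})^{-1}(x\otimes p^\sharp_{t,v})$ if $u=s$, $t<v$; $x\mapsto(\Delta^\sharp_{u,s,t})^{-1}(p^\sharp_{u,s}\otimes x)$ if $u<s$, $t=v$; $x\mapsto(\Delta^\sharp_{u,s,v})^{-1}(\mathrm{id}_{\mathcal{A}^\sharp_{u,s}}\otimes\Delta^\sharp_{s,t,v})^{-1}(p^\sharp_{u,s}\otimes x\otimes p^\sharp_{t,v})$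 if $u<s$, $t<v$. These form an inductive system over the set of open intervals $(s,t)$, $0<s<t$, ordered by inclusion; $\mathcal{A}^\diamond_{\{p_{s,t}\}}$ is its $C^*$-inductive limit, with connecting $*$-monomorphisms $\Delta^\diamond_{s,t}:\mathcal{A}^\sharp_{s,t}\to\mathcal{A}^\diamond_{\{p_{s,t}\}}$. The algebra $C^*_{\{p_{s,t}\}}(\mathscr{A})$. $\mathcal{P}=\bigcup_{0<s<t}\mathcal{P}_{s,t}$ is the set of all finite subsets of $(0,\infty)$ with at least two elements, ordered by inclusion. For $I\subseteq J$ in $\mathcal{P}$ with $I\in\mathcal{P}_{s,t}$, write $J=\underline{I}\cup I^\times\cup\overline{I}$, where $\underline{I}=\{j\in J: j\le s\}$, $I^\times=J\cap[s,t]$, $\overline{I}=\{j\in J: j\ge t\}$, so that $\mathcal{A}_J=\mathcal{A}_{\underline{I}}\otimes\mathcal{A}_{I^\times}\otimes\mathcal{A}_{\overline{I}}$, and define $\Delta^\times_{I,J}(x)=p_{\underline{I}}\otimes\Delta_{I,I^\times}(x)\otimes p_{\overline{I}}$ for $x\in\mathcal{A}_I$; tensor factors corresponding to single-point $\underline{I}$ or $\overline{I}$ are omitted (so $\Delta^\times_{I,J}=\Delta_{I,J}$ if $I,J\in\mathcal{P}_{s,t}$). These form an inductive system over $(\mathcal{P},\subseteq)$; $C^*_{\{p_{s,t}\}}(\mathscr{A})$ is its $C^*$-inductive limit, with connecting $*$-monomorphisms $\Delta^\times_I:\mathcal{A}_I\to C^*_{\{p_{s,t}\}}(\mathscr{A})$.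 *)

theory Defs
  imports "HOL-Analysis.Analysis"
begin

section \<open>C*-algebras and *-homomorphisms\<close>

text \<open>C*-algebras are not assumed to be unital.\<close>

record 'a cstar =
  carrier :: "'a set"
  czero :: 'a ("\<zero>\<index>")
  cadd :: "'a \<Rightarrow> 'a \<Rightarrow> 'a" (infixl "\<oplus>\<index>" 65)
  cscale :: "complex \<Rightarrow> 'a \<Rightarrow> 'a" (infixr "\<odot>\<index>" 75)
  cmult :: "'a \<Rightarrow> 'a \<Rightarrow> 'a" (infixl "\<cdot>\<index>" 70)
  cadj :: "'a \<Rightarrow> 'a"
  cnorm :: "'a \<Rightarrow> real"

definition cdiff :: "('a, 'm) cstar_scheme \<Rightarrow> 'a \<Rightarrow> 'a \<Rightarrow> 'a" where
  "cdiff A x y = x \<oplus>\<^bsub>A\<^esub> ((-1) \<odot>\<^bsub>A\<^esub> y)"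

definition cconverges :: "('a, 'm) cstar_scheme \<Rightarrow> (nat \<Rightarrow> 'a) \<Rightarrow> 'a \<Rightarrow> bool" where
  "cconverges A f l \<longleftrightarrow> (\<lambda>n. cnorm A (cdiff A (f n) l)) \<longlonglongrightarrow> 0"

definition ccauchy :: "('a, 'm) cstar_scheme \<Rightarrow> (nat \<Rightarrow> 'a) \<Rightarrow> bool" where
  "ccauchy A f \<longleftrightarrow> (\<forall>e>0. \<exists>N. \<forall>m\<ge>N. \<forall>n\<ge>N. cnorm A (cdiff A (f m) (f n)) < e)"

locale cstar_algebra =
  fixes A :: "('a, 'm) cstar_scheme" (structure)
  assumes zero_closed: "\<zero> \<in> carrier A"
    and add_closed: "\<lbrakk>x \<in> carrier A; y \<in> carrier A\<rbrakk> \<Longrightarrow> x \<oplus> y \<in> carrier A"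
    and scale_closed: "x \<in> carrier A \<Longrightarrow> c \<odot> x \<in> carrier A"
    and mult_closed: "\<lbrakk>x \<in> carrier A; y \<in> carrier A\<rbrakk> \<Longrightarrow> x \<cdot> y \<in> carrier A"
    and adj_closed: "x \<in> carrier A \<Longrightarrow> cadj A x \<in> carrier A"
    and add_assoc: "\<lbrakk>x \<in> carrier A; y \<in> carrier A; z \<in> carrier A\<rbrakk> \<Longrightarrow> (x \<oplus> y) \<oplus> z = x \<oplus> (y \<oplus> z)"
    and add_comm: "\<lbrakk>x \<in> carrier A; y \<in> carrier A\<rbrakk> \<Longrightarrow> x \<oplus> y = y \<oplus> x"
    and add_zero: "x \<in> carrier A \<Longrightarrow> x \<oplus> \<zero> = x"
    and add_inverse: "x \<in> carrier A \<Longrightarrow> x \<oplus> ((-1) \<odot> x) = \<zero>"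
    and scale_add_right: "\<lbrakk>x \<in> carrier A; y \<in> carrier A\<rbrakk> \<Longrightarrow> c \<odot> (x \<oplus> y) = (c \<odot> x) \<oplus> (c \<odot> y)"
    and scale_add_left: "x \<in> carrier A \<Longrightarrow> (c + d) \<odot> x = (c \<odot> x) \<oplus> (d \<odot> x)"
    and scale_scale: "x \<in> carrier A \<Longrightarrow> c \<odot> (d \<odot> x) = (c * d) \<odot> x"
    and scale_one: "x \<in> carrier A \<Longrightarrow> 1 \<odot> x = x"
    and mult_assoc: "\<lbrakk>x \<in> carrier A; y \<in> carrier A; z \<in> carrier A\<rbrakk> \<Longrightarrow> (x \<cdot> y) \<cdot> z = x \<cdot> (y \<cdot> z)"
    and mult_add_left: "\<lbrakk>x \<in> carrier A; y \<in> carrier A; z \<in> carrier A\<rbrakk> \<Longrightarrow> (x \<oplus> y) \<cdot> z = (x \<cdot> z) \<oplus> (y \<cdot> z)"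
    and mult_add_right: "\<lbrakk>x \<in> carrier A; y \<in> carrier A; z \<in> carrier A\<rbrakk> \<Longrightarrow> x \<cdot> (y \<oplus> z) = (x \<cdot> y) \<oplus> (x \<cdot> z)"
    and mult_scale_left: "\<lbrakk>x \<in> carrier A; y \<in> carrier A\<rbrakk> \<Longrightarrow> (c \<odot> x) \<cdot> y = c \<odot> (x \<cdot> y)"
    and mult_scale_right: "\<lbrakk>x \<in> carrier A; y \<in> carrier A\<rbrakk> \<Longrightarrow> x \<cdot> (c \<odot> y) = c \<odot> (x \<cdot> y)"
    and adj_adj: "x \<in> carrier A \<Longrightarrow> cadj A (cadj A x) = x"
    and adj_add: "\<lbrakk>x \<in> carrier A; y \<in> carrier A\<rbrakk> \<Longrightarrow> cadj A (x \<oplus> y) = cadj A x \<oplus> cadj A y"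
    and adj_scale: "x \<in> carrier A \<Longrightarrow> cadj A (c \<odot> x) = cnj c \<odot> cadj A x"
    and adj_mult: "\<lbrakk>x \<in> carrier A; y \<in> carrier A\<rbrakk> \<Longrightarrow> cadj A (x \<cdot> y) = cadj A y \<cdot> cadj A x"
    and norm_nonneg: "x \<in> carrier A \<Longrightarrow> 0 \<le> cnorm A x"
    and norm_eq_zero: "x \<in> carrier A \<Longrightarrow> cnorm A x = 0 \<longleftrightarrow> x = \<zero>"
    and norm_scale: "x \<in> carrier A \<Longrightarrow> cnorm A (c \<odot> x) = cmod c * cnorm A x"
    and norm_triangle: "\<lbrakk>x \<in> carrier A; y \<in> carrier A\<rbrakk> \<Longrightarrow> cnorm A (x \<oplus> y) \<le> cnorm A x + cnorm A y"
    and norm_mult: "\<lbrakk>x \<in> carrier A; y \<in> carrier A\<rbrakk> \<Longrightarrow> cnorm A (x \<cdot> y) \<le> cnorm A x * cnorm A y"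
    and cstar_identity: "x \<in> carrier A \<Longrightarrow> cnorm A (cadj A x \<cdot> x) = (cnorm A x)\<^sup>2"
    and complete: "\<lbrakk>\<And>n. f n \<in> carrier A; ccauchy A f\<rbrakk> \<Longrightarrow> \<exists>l\<in>carrier A. cconverges A f l"

definition star_hom :: "('a, 'm) cstar_scheme \<Rightarrow> ('b, 'n) cstar_scheme \<Rightarrow> ('a \<Rightarrow> 'b) \<Rightarrow> bool" where
  "star_hom A B f \<longleftrightarrow>
     (\<forall>x\<in>carrier A. f x \<in> carrier B) \<and>
     (\<forall>x\<in>carrier A. \<forall>y\<in>carrier A. f (x \<oplus>\<^bsub>A\<^esub> y) = f x \<oplus>\<^bsub>B\<^esub> f y) \<and>
     (\<forall>c. \<forall>x\<in>carrier A. f (c \<odot>\<^bsub>A\<^esub> x) = c \<odot>\<^bsub>B\<^esub> f x) \<and>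
     (\<forall>x\<in>carrier A. \<forall>y\<in>carrier A. f (x \<cdot>\<^bsub>A\<^esub> y) = f x \<cdot>\<^bsub>B\<^esub> f y) \<and>
     (\<forall>x\<in>carrier A. f (cadj A x) = cadj B (f x))"

definition star_mono :: "('a, 'm) cstar_scheme \<Rightarrow> ('b, 'n) cstar_scheme \<Rightarrow> ('a \<Rightarrow> 'b) \<Rightarrow> bool" where
  "star_mono A B f \<longleftrightarrow> star_hom A B f \<and> inj_on f (carrier A)"

definition star_iso :: "('a, 'm) cstar_scheme \<Rightarrow> ('b, 'n) cstar_scheme \<Rightarrow> ('a \<Rightarrow> 'b) \<Rightarrow> bool" where
  "star_iso A B f \<longleftrightarrow> star_hom A B f \<and> bij_betw f (carrier A) (carrier B)"

definition is_projection :: "('a, 'm) cstar_scheme \<Rightarrow> 'a \<Rightarrow> bool" where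
  "is_projection A p \<longleftrightarrow> p \<in> carrier A \<and> cadj A p = p \<and> p \<cdot>\<^bsub>A\<^esub> p = p"

definition closed_span :: "('a, 'm) cstar_scheme \<Rightarrow> 'a set \<Rightarrow> 'a set" where
  "closed_span A E = \<Inter>{M. E \<subseteq> M \<and> M \<subseteq> carrier A \<and> \<zero>\<^bsub>A\<^esub> \<in> M \<and>
      (\<forall>x\<in>M. \<forall>y\<in>M. x \<oplus>\<^bsub>A\<^esub> y \<in> M) \<and> (\<forall>c. \<forall>x\<in>M. c \<odot>\<^bsub>A\<^esub> x \<in> M) \<and>
      (\<forall>f. \<forall>l\<in>carrier A. (\<forall>n. f n \<in> M) \<longrightarrow> cconverges A f l \<longrightarrow> l \<in> M)}"

section \<open>C*-inductive limits\<close>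

text \<open>
  A C*-inductive limit of a system of *-homomorphisms \<open>f i j : B i \<rightarrow> B j\<close> (\<open>i \<le> j\<close> in the directed
  set \<open>D\<close>) is the separated completion of the algebraic inductive limit for the C*-seminorm
  \<open>lim\<^sub>j \<parallel>f i j x\<parallel>\<close>, together with the canonical maps. The net is decreasing, so the
  limit is an infimum; if the \<open>f i j\<close> are *-monomorphisms (hence isometric), so are the \<open>\<phi> i\<close>.
\<close>

definition inductive_limit ::
  "'i set \<Rightarrow> ('i \<Rightarrow> 'i \<Rightarrow> bool) \<Rightarrow> ('i \<Rightarrow> ('a, 'm) cstar_scheme) \<Rightarrow> ('i \<Rightarrow> 'i \<Rightarrow> 'a \<Rightarrow> 'a) \<Rightarrow>
   ('b, 'n) cstar_scheme \<Rightarrow> ('i \<Rightarrow> 'a \<Rightarrow> 'b) \<Rightarrow> bool" where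
  "inductive_limit D le B f L \<phi> \<longleftrightarrow>
     cstar_algebra L \<and>
     (\<forall>i\<in>D. star_hom (B i) L (\<phi> i)) \<and>
     (\<forall>i\<in>D. \<forall>j\<in>D. le i j \<longrightarrow> (\<forall>x\<in>carrier (B i). \<phi> j (f i j x) = \<phi> i x)) \<and>
     (\<forall>i\<in>D. \<forall>x\<in>carrier (B i). cnorm L (\<phi> i x) = (INF j\<in>{j\<in>D. le i j}. cnorm (B j) (f i j x))) \<and>
     (\<forall>y\<in>carrier L. \<forall>e>0. \<exists>i\<in>D. \<exists>x\<in>carrier (B i). cnorm L (cdiff L y (\<phi> i x)) < e)"

section \<open>Bounded operators on \<open>\<ell>\<^sup>2(X)\<close>\<close>

definition l2 :: "'x set \<Rightarrow> ('x \<Rightarrow> complex) set" where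
  "l2 X = {f. (\<forall>x. x \<notin> X \<longrightarrow> f x = 0) \<and> (\<lambda>x. (cmod (f x))\<^sup>2) summable_on UNIV}"

definition l2_inner :: "('x \<Rightarrow> complex) \<Rightarrow> ('x \<Rightarrow> complex) \<Rightarrow> complex" where
  "l2_inner f g = (\<Sum>\<^sub>\<infinity>x. cnj (f x) * g x)"

definition l2_norm :: "('x \<Rightarrow> complex) \<Rightarrow> real" where
  "l2_norm f = sqrt (\<Sum>\<^sub>\<infinity>x. (cmod (f x))\<^sup>2)"

definition ket :: "'x \<Rightarrow> 'x \<Rightarrow> complex" where
  "ket x = (\<lambda>y. if y = x then 1 else 0)"

type_synonym 'x oper = "('x \<Rightarrow> complex) \<Rightarrow> ('x \<Rightarrow> complex)"

text \<open>Operators are set to \<open>0\<close> outside \<open>l2 X\<close>, so that they are determined by their values on it.\<close>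

definition bounded_ops :: "'x set \<Rightarrow> 'x oper set" where
  "bounded_ops X = {T.
     (\<forall>f. f \<notin> l2 X \<longrightarrow> T f = (\<lambda>_. 0)) \<and>
     (\<forall>f\<in>l2 X. T f \<in> l2 X) \<and>
     (\<forall>f\<in>l2 X. \<forall>g\<in>l2 X. T (\<lambda>x. f x + g x) = (\<lambda>x. T f x + T g x)) \<and>
     (\<forall>c. \<forall>f\<in>l2 X. T (\<lambda>x. c * f x) = (\<lambda>x. c * T f x)) \<and>
     (\<exists>C. \<forall>f\<in>l2 X. l2_norm (T f) \<le> C * l2_norm f)}"

text \<open>The adjoint is given by \<open>(T* f)(x) = \<langle>e\<^sub>x, T* f\<rangle> = \<langle>T e\<^sub>x, f\<rangle>\<close>.\<close>

definition op_alg :: "'x set \<Rightarrow> 'x oper cstar" where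
  "op_alg X = \<lparr>
     carrier = bounded_ops X,
     czero = (\<lambda>f x. 0),
     cadd = (\<lambda>S T f x. S f x + T f x),
     cscale = (\<lambda>c T f x. c * T f x),
     cmult = (\<lambda>S T f. S (T f)),
     cadj = (\<lambda>T f. if f \<in> l2 X then (\<lambda>x. l2_inner (T (ket x)) f) else (\<lambda>_. 0)),
     cnorm = (\<lambda>T. SUP f\<in>{f \<in> l2 X. l2_norm f \<le> 1}. l2_norm (T f)) \<rparr>"

section \<open>Minimal tensor products\<close>

text \<open>
  The minimal tensor product is the spatial one: \<open>A \<otimes> B\<close> is the closed linear span of the operators
  \<open>\<pi>\<^sub>A(a) \<otimes> \<pi>\<^sub>B(b)\<close> on \<open>H\<^sub>A \<otimes> H\<^sub>B\<close>, for faithful representations \<open>\<pi>\<^sub>A, \<pi>\<^sub>B\<close>; up to canonical isomorphism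
  it does not depend on the representations. A C*-algebra is therefore carried along with the
  faithful representation that is used to form its tensor products. Nothing more than a C*-algebra is
  given: any C*-algebra has a faithful representation on some \<open>\<ell>\<^sup>2(H)\<close> (Gelfand-Naimark), and all
  statements are made for an arbitrary choice.

  To have \<open>\<ell>\<^sup>2(X) \<otimes> \<ell>\<^sup>2(Y) = \<ell>\<^sup>2(X \<times> Y)\<close> strictly associative, all Hilbert spaces are of the form
  \<open>\<ell>\<^sup>2(H\<^sup>n)\<close>, with \<open>H\<^sup>n\<close> the set of lists of length \<open>n\<close> over the type \<open>'h\<close> and
  \<open>H\<^sup>m \<times> H\<^sup>n = H\<^sup>m\<^sup>+\<^sup>n\<close> by concatenation. The exponent \<open>n\<close> is recorded in the field \<open>deg\<close>.
\<close>

definition words :: "nat \<Rightarrow> 'h list set" where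
  "words n = {xs. length xs = n}"

record ('a, 'h) rep_cstar = "'a cstar" +
  deg :: nat
  rep :: "'a \<Rightarrow> 'h list oper"

definition represented_cstar :: "('a, 'h) rep_cstar \<Rightarrow> bool" where
  "represented_cstar A \<longleftrightarrow> cstar_algebra A \<and> star_mono A (op_alg (words (deg A))) (rep A)"

definition op_subalg :: "nat \<Rightarrow> 'h list oper set \<Rightarrow> ('h list oper, 'h) rep_cstar" where
  "op_subalg n M = cstar.extend ((op_alg (words n))\<lparr>carrier := M\<rparr>) (rep_cstar.fields n (\<lambda>T. T))"

text \<open>
  \<open>S \<otimes> T\<close> for operators \<open>S\<close> on \<open>\<ell>\<^sup>2(H\<^sup>m)\<close> and \<open>T\<close> on \<open>\<ell>\<^sup>2(H\<^sup>n)\<close>: first \<open>T\<close> is applied in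
  the last \<open>n\<close> variables, then \<open>S\<close> in the first \<open>m\<close> variables.
\<close>

definition tensor_op :: "nat \<Rightarrow> nat \<Rightarrow> 'h list oper \<Rightarrow> 'h list oper \<Rightarrow> 'h list oper" where
  "tensor_op m n S T = (\<lambda>f. if f \<in> l2 (words (m + n))
     then (\<lambda>zs. S (\<lambda>xs. T (\<lambda>ys. f (xs @ ys)) (drop m zs)) (take m zs))
     else (\<lambda>_. 0))"

definition tensor_elem :: "('a, 'h) rep_cstar \<Rightarrow> ('b, 'h) rep_cstar \<Rightarrow> 'a \<Rightarrow> 'b \<Rightarrow> 'h list oper" where
  "tensor_elem A B a b = tensor_op (deg A) (deg B) (rep A a) (rep B b)"

definition tensor :: "('a, 'h) rep_cstar \<Rightarrow> ('b, 'h) rep_cstar \<Rightarrow> ('h list oper, 'h) rep_cstar" where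
  "tensor A B = op_subalg (deg A + deg B)
     (closed_span (op_alg (words (deg A + deg B)))
       {tensor_elem A B a b | a b. a \<in> carrier A \<and> b \<in> carrier B})"

text \<open>\<open>f \<otimes> g : A \<otimes> B \<rightarrow> A' \<otimes> B'\<close> for *-homomorphisms \<open>f : A \<rightarrow> A'\<close> and \<open>g : B \<rightarrow> B'\<close>.\<close>

definition tensor_map ::
  "('a, 'h) rep_cstar \<Rightarrow> ('b, 'h) rep_cstar \<Rightarrow> ('c, 'k) rep_cstar \<Rightarrow> ('d, 'k) rep_cstar \<Rightarrow>
   ('a \<Rightarrow> 'c) \<Rightarrow> ('b \<Rightarrow> 'd) \<Rightarrow> 'h list oper \<Rightarrow> 'k list oper" where
  "tensor_map A B A' B' f g = (THE h.
     h \<in> extensional (carrier (tensor A B)) \<and> star_hom (tensor A B) (tensor A' B') h \<and>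
     (\<forall>a\<in>carrier A. \<forall>b\<in>carrier B. h (tensor_elem A B a b) = tensor_elem A' B' (f a) (g b)))"

section \<open>C*-subproduct systems\<close>

type_synonym ('a, 'h) alg_family = "real \<Rightarrow> real \<Rightarrow> ('a, 'h) rep_cstar"
type_synonym ('a, 'h) comult_family = "real \<Rightarrow> real \<Rightarrow> real \<Rightarrow> 'a \<Rightarrow> 'h list oper"

definition cstar_subproduct_system :: "('a, 'h) alg_family \<Rightarrow> ('a, 'h) comult_family \<Rightarrow> bool" where
  "cstar_subproduct_system A \<Delta> \<longleftrightarrow>
     (\<forall>s t. 0 < s \<and> s < t \<longrightarrow> represented_cstar (A s t)) \<and>
     (\<forall>r s t. 0 < r \<and> r < s \<and> s < t \<longrightarrow> star_mono (A r t) (tensor (A r s) (A s t)) (\<Delta> r s t)) \<and>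
     (\<forall>r s t u. 0 < r \<and> r < s \<and> s < t \<and> t < u \<longrightarrow> (\<forall>a\<in>carrier (A r u).
        tensor_map (A r s) (A s u) (A r s) (tensor (A s t) (A t u)) (\<lambda>x. x) (\<Delta> s t u) (\<Delta> r s u a) =
        tensor_map (A r t) (A t u) (tensor (A r s) (A s t)) (A t u) (\<Delta> r s t) (\<lambda>x. x) (\<Delta> r t u a)))"

definition cstar_unit ::
  "('a, 'h) alg_family \<Rightarrow> ('a, 'h) comult_family \<Rightarrow> (real \<Rightarrow> real \<Rightarrow> 'a) \<Rightarrow> bool" where
  "cstar_unit A \<Delta> p \<longleftrightarrow>
     (\<forall>s t. 0 < s \<and> s < t \<longrightarrow> is_projection (A s t) (p s t) \<and> p s t \<noteq> \<zero>\<^bsub>A s t\<^esub>) \<and>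
     (\<forall>r s t. 0 < r \<and> r < s \<and> s < t \<longrightarrow>
        \<Delta> r s t (p r t) = tensor_elem (A r s) (A s t) (p r s) (p s t))"

section \<open>Partitions\<close>

definition partitions :: "real \<Rightarrow> real \<Rightarrow> real set set" where
  "partitions s t = {I. finite I \<and> s \<in> I \<and> t \<in> I \<and> I \<subseteq> {s..t}}"

definition all_partitions :: "real set set" where
  "all_partitions = (\<Union>s\<in>{0<..}. \<Union>t\<in>{s<..}. partitions s t)"

text \<open>
  \<open>part_alg A I\<close> is \<open>\<A>\<^sub>I\<close>. For \<open>I = {s, t}\<close> it is \<open>A s t\<close>, identified with its image
  under the representation. As the tensor product is strictly associative, \<open>\<A>\<^sub>I \<otimes> \<A>\<^sub>J = \<A>\<^sub>I\<^sub>\<union>\<^sub>J\<close>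
  for adjacent partitions \<open>I\<close> and \<open>J\<close>.
\<close>

fun list_alg :: "('a, 'h) alg_family \<Rightarrow> real list \<Rightarrow> ('h list oper, 'h) rep_cstar" where
  "list_alg A [s, t] = op_subalg (deg (A s t)) (rep (A s t) ` carrier (A s t))"
| "list_alg A (r # s # t # xs) = tensor (A r s) (list_alg A (s # t # xs))"

definition part_alg :: "('a, 'h) alg_family \<Rightarrow> real set \<Rightarrow> ('h list oper, 'h) rep_cstar" where
  "part_alg A I = list_alg A (sorted_list_of_set I)"

fun list_unit :: "('a, 'h) alg_family \<Rightarrow> (real \<Rightarrow> real \<Rightarrow> 'a) \<Rightarrow> real list \<Rightarrow> 'h list oper" where
  "list_unit A p [s, t] = rep (A s t) (p s t)"
| "list_unit A p (r # s # t # xs) =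
     tensor_elem (A r s) (list_alg A (s # t # xs)) (p r s) (list_unit A p (s # t # xs))"

definition part_unit :: "('a, 'h) alg_family \<Rightarrow> (real \<Rightarrow> real \<Rightarrow> 'a) \<Rightarrow> real set \<Rightarrow> 'h list oper" where
  "part_unit A p I = list_unit A p (sorted_list_of_set I)"

text \<open>
  \<open>refine_top A \<Delta> [\<iota>\<^sub>0, \<dots>, \<iota>\<^sub>m\<^sub>+\<^sub>1]\<close> is \<open>\<Delta>\<^bsub>{s,t},I\<^esub> : \<A>\<^bsub>s,t\<^esub> \<rightarrow> \<A>\<^sub>I\<close>. For \<open>m = 0\<close>
  the identity \<open>\<A>\<^bsub>s,t\<^esub> \<rightarrow> \<A>\<^bsub>{s,t}\<^esub>\<close> is the representation.
\<close>

fun refine_top ::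
  "('a, 'h) alg_family \<Rightarrow> ('a, 'h) comult_family \<Rightarrow> real list \<Rightarrow> 'a \<Rightarrow> 'h list oper" where
  "refine_top A \<Delta> xs =
     (if length xs \<le> 2 then rep (A (hd xs) (last xs))
      else if length xs = 3 then \<Delta> (xs ! 0) (xs ! 1) (xs ! 2)
      else (let ys = butlast xs; s = hd xs; r = last ys; t = last xs in
        (\<lambda>a. tensor_map (A s r) (A r t) (list_alg A ys) (A r t) (refine_top A \<Delta> ys) (\<lambda>x. x)
               (\<Delta> s r t a))))"

declare refine_top.simps [simp del]

text \<open>\<open>refine A \<Delta> I J\<close> is \<open>\<Delta>\<^bsub>I,J\<^esub> : \<A>\<^sub>I \<rightarrow> \<A>\<^sub>J\<close>.\<close>

fun list_refine ::
  "('a, 'h) alg_family \<Rightarrow> ('a, 'h) comult_family \<Rightarrow> real list \<Rightarrow> real set \<Rightarrow>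
   'h list oper \<Rightarrow> 'h list oper" where
  "list_refine A \<Delta> [s, t] J =
     (\<lambda>x. refine_top A \<Delta> (sorted_list_of_set (J \<inter> {s..t})) (inv_into (carrier (A s t)) (rep (A s t)) x))"
| "list_refine A \<Delta> (r # s # t # xs) J =
     tensor_map (A r s) (list_alg A (s # t # xs))
       (part_alg A (J \<inter> {r..s})) (part_alg A (J \<inter> {s..last (t # xs)}))
       (refine_top A \<Delta> (sorted_list_of_set (J \<inter> {r..s})))
       (list_refine A \<Delta> (s # t # xs) J)"

definition refine ::
  "('a, 'h) alg_family \<Rightarrow> ('a, 'h) comult_family \<Rightarrow> real set \<Rightarrow> real set \<Rightarrow>
   'h list oper \<Rightarrow> 'h list oper" where
  "refine A \<Delta> I J = list_refine A \<Delta> (sorted_list_of_set I) J"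

text \<open>\<open>refine_unit A \<Delta> p I J\<close> is \<open>\<Delta>\<^sup>\<times>\<^bsub>I,J\<^esub> : \<A>\<^sub>I \<rightarrow> \<A>\<^sub>J\<close>.\<close>

definition refine_unit ::
  "('a, 'h) alg_family \<Rightarrow> ('a, 'h) comult_family \<Rightarrow> (real \<Rightarrow> real \<Rightarrow> 'a) \<Rightarrow> real set \<Rightarrow> real set \<Rightarrow>
   'h list oper \<Rightarrow> 'h list oper" where
  "refine_unit A \<Delta> p I J x =
     (let lo = {j\<in>J. j \<le> Min I};
          mid = J \<inter> {Min I..Max I};
          hi = {j\<in>J. Max I \<le> j};
          y = refine A \<Delta> I mid x;
          z = (if card hi = 1 then y
               else tensor_elem (part_alg A mid) (part_alg A hi) y (part_unit A p hi))
      in if card lo = 1 then z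
         else tensor_elem (part_alg A lo) (part_alg A (mid \<union> hi)) (part_unit A p lo) z)"

section \<open>The inductive dilation\<close>

text \<open>
  \<open>As s t\<close> is \<open>\<A>\<^sup>\<sharp>\<^bsub>s,t\<^esub>\<close> and \<open>\<phi> I\<close> is \<open>\<Delta>\<^sup>\<sharp>\<^sub>I\<close>. The representations carried by the algebras
  \<open>As s t\<close> serve to form \<open>\<A>\<^sup>\<sharp>\<^bsub>r,s\<^esub> \<otimes> \<A>\<^sup>\<sharp>\<^bsub>s,t\<^esub>\<close> and are unrelated to those of the \<open>A s t\<close>.
\<close>

definition inductive_dilation ::
  "('a, 'h) alg_family \<Rightarrow> ('a, 'h) comult_family \<Rightarrow> ('b, 'k) alg_family \<Rightarrow>
   (real set \<Rightarrow> 'h list oper \<Rightarrow> 'b) \<Rightarrow> bool" where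
  "inductive_dilation A \<Delta> As \<phi> \<longleftrightarrow>
     (\<forall>s t. 0 < s \<and> s < t \<longrightarrow> represented_cstar (As s t) \<and>
        inductive_limit (partitions s t) (\<subseteq>) (part_alg A) (refine A \<Delta>) (As s t) \<phi>)"

text \<open>\<open>\<Delta>\<^sup>\<sharp>\<^bsub>r,s,t\<^esub>\<close>\<close>

definition sharp_comult ::
  "('a, 'h) alg_family \<Rightarrow> ('b, 'k) alg_family \<Rightarrow> (real set \<Rightarrow> 'h list oper \<Rightarrow> 'b) \<Rightarrow>
   ('b, 'k) comult_family" where
  "sharp_comult A As \<phi> r s t = (THE h.
     h \<in> extensional (carrier (As r t)) \<and> star_iso (As r t) (tensor (As r s) (As s t)) h \<and>
     (\<forall>I\<in>partitions r s. \<forall>J\<in>partitions s t. \<forall>x\<in>carrier (part_alg A (I \<union> J)).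
        h (\<phi> (I \<union> J) x) =
        tensor_map (part_alg A I) (part_alg A J) (As r s) (As s t) (\<phi> I) (\<phi> J) x))"

definition sharp_unit ::
  "('a, 'h) alg_family \<Rightarrow> (real \<Rightarrow> real \<Rightarrow> 'a) \<Rightarrow> (real set \<Rightarrow> 'h list oper \<Rightarrow> 'b) \<Rightarrow>
   real \<Rightarrow> real \<Rightarrow> 'b" where
  "sharp_unit A p \<phi> s t = \<phi> {s, t} (rep (A s t) (p s t))"

definition intervals :: "(real \<times> real) set" where
  "intervals = {(s, t). 0 < s \<and> s < t}"

definition interval_le :: "real \<times> real \<Rightarrow> real \<times> real \<Rightarrow> bool" where
  "interval_le i j \<longleftrightarrow> {fst i<..<snd i} \<subseteq> {fst j<..<snd j}"

text \<open>\<open>\<Delta>\<^sup>\<sharp>\<^bsub>(s,t),(u,v)\<^esub>\<close>, for \<open>q = p\<^sup>\<sharp>\<close> and \<open>D = \<Delta>\<^sup>\<sharp>\<close>\<close>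

definition interval_embed ::
  "('b, 'k) alg_family \<Rightarrow> ('b, 'k) comult_family \<Rightarrow> (real \<Rightarrow> real \<Rightarrow> 'b) \<Rightarrow>
   real \<times> real \<Rightarrow> real \<times> real \<Rightarrow> 'b \<Rightarrow> 'b" where
  "interval_embed As D q = (\<lambda>(s, t) (u, v) x.
     if u = s \<and> t = v then x
     else if u = s then
       inv_into (carrier (As s v)) (D s t v) (tensor_elem (As s t) (As t v) x (q t v))
     else if t = v then
       inv_into (carrier (As u t)) (D u s t) (tensor_elem (As u s) (As s t) (q u s) x)
     else
       inv_into (carrier (As u v)) (D u s v)
         (inv_into (carrier (tensor (As u s) (As s v)))
           (tensor_map (As u s) (As s v) (As u s) (tensor (As s t) (As t v)) (\<lambda>y. y) (D s t v))
           (tensor_elem (As u s) (tensor (As s t) (As t v)) (q u s)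
             (tensor_elem (As s t) (As t v) x (q t v)))))"

text \<open>\<open>(L, \<psi>)\<close> is \<open>\<A>\<^sup>\<diamond>\<close> with its connecting maps, \<open>(C, \<eta>)\<close> is \<open>C*(\<A>)\<close> with its connecting maps.\<close>

definition diamond_algebra ::
  "('a, 'h) alg_family \<Rightarrow> (real \<Rightarrow> real \<Rightarrow> 'a) \<Rightarrow> ('b, 'k) alg_family \<Rightarrow>
   (real set \<Rightarrow> 'h list oper \<Rightarrow> 'b) \<Rightarrow> 'c cstar \<Rightarrow> (real \<times> real \<Rightarrow> 'b \<Rightarrow> 'c) \<Rightarrow> bool" where
  "diamond_algebra A p As \<phi> L \<psi> \<longleftrightarrow>
     inductive_limit intervals interval_le (\<lambda>(s, t). As s t)
       (interval_embed As (sharp_comult A As \<phi>) (sharp_unit A p \<phi>)) L \<psi>"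

definition unit_limit_algebra ::
  "('a, 'h) alg_family \<Rightarrow> ('a, 'h) comult_family \<Rightarrow> (real \<Rightarrow> real \<Rightarrow> 'a) \<Rightarrow>
   'd cstar \<Rightarrow> (real set \<Rightarrow> 'h list oper \<Rightarrow> 'd) \<Rightarrow> bool" where
  "unit_limit_algebra A \<Delta> p C \<eta> \<longleftrightarrow>
     inductive_limit all_partitions (\<subseteq>) (part_alg A) (refine_unit A \<Delta> p) C \<eta>"

end

theory Submission
  imports Defs "HOL-Complex_Analysis.Cauchy_Integral_Formula"
begin

text \<open>
  Let \<open>I\<close> be a partition of \<open>[s, t]\<close> and \<open>(s, t) \<subseteq> (u, v)\<close>. Adjoining \<open>u\<close> and \<open>v\<close> to \<open>I\<close> and tensoring
  with the units \<open>p\<^bsub>u,s\<^esub>\<close> and \<open>p\<^bsub>t,v\<^esub>\<close> embeds \<open>\<A>\<^sub>I\<close> into \<open>\<A>\<^bsub>I'\<^esub>\<close> for a partition \<open>I'\<close> of \<open>[u, v]\<close>. Composed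
  with this embedding, the connecting map of \<open>\<A>\<^sup>\<diamondop>\<close> from \<open>(s, t)\<close> to \<open>(u, v)\<close> becomes \<open>\<Delta>\<^sup>\<sharp>\<^bsub>I'\<^esub>\<close>, and
  \<open>\<Delta>\<^sup>\<times>\<close> from \<open>I\<close> to \<open>J\<close> becomes \<open>\<Delta>\<close> from \<open>I'\<close> to \<open>J\<close>. Hence the maps \<open>\<Delta>\<^sup>\<times>\<^sub>I\<close> and \<open>\<Delta>\<^sup>\<diamondop> \<Delta>\<^sup>\<sharp>\<^sub>I\<close> are two compatible
  families of isometries with dense unions of ranges, and \<open>\<Delta>\<^sup>\<times>\<^sub>I x \<mapsto> \<Delta>\<^sup>\<diamondop> (\<Delta>\<^sup>\<sharp>\<^sub>I x)\<close> extends to an isomorphism.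

  This rests on injective *-homomorphisms being isometric, and on their tensor products being
  injective. For the former, a self-adjoint \<open>a\<close> of norm below \<open>1\<close> is \<open>(U + U\<^sup>*) / 2\<close> with \<open>U = a + \<i> \<surd>(1 - a\<^sup>2)\<close>
  unitary, so \<open>Q(a)\<close> is a Laurent polynomial in \<open>U\<close> whose coefficients are bounded by the supremum of
  \<open>Q\<close> on \<open>[-1, 1]\<close>. This gives \<open>\<parallel>Q(a)\<parallel> \<le> sup |Q|\<close> for real \<open>Q\<close>, and polynomials
  approximating a cut-off function show that a homomorphism decreasing \<open>\<parallel>a\<parallel>\<close> is not injective. For
  the latter, the compression of an element of \<open>A \<otimes> B(l\<^sup>2(Z))\<close> to a finite \<open>F \<subseteq> Z\<close> is an \<open>F \<times> F\<close> matrix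
  over \<open>A\<close>, so that its norm is the same for all faithful representations of \<open>A\<close>.
\<close>

text \<open>The maps \<open>tensor_map\<close> and \<open>sharp_comult\<close> are definite
  descriptions, so they say nothing until existence and uniqueness are established. Uniqueness is
  density of elementary tensors. Existence requires comparing norms of finite sums of elementary
  tensors in two representations at a stage where no *-homomorphism between the represented tensor
  products is available; a matrix algebra over \<open>A\<close> provides one, given entrywise.

  The norm of an inductive limit is an infimum over all later stages. It is evaluated through
  isometry of the connecting maps, which makes it the infimum of a constant; hence isometry of
  injective *-homomorphisms lies at the bottom of everything. The algebras may fail to have a unit:
  the square root appears only as b = 1 - \<surd>(1 - a^2), the unitary is an operator acting on the
  algebra, and polynomials are applied to vectors.

  One statement, \<open>directed_iso\<close>, yields the isomorphisms \<open>sharp_comult\<close> as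
  well as the final one.\<close>

context cstar_algebra
begin

section \<open>Elementary calculus in an abstract C*-algebra\<close>

lemmas closed [simp, intro] = zero_closed add_closed scale_closed mult_closed adj_closed

lemma cdiff_closed [simp, intro]: "x \<in> carrier A \<Longrightarrow> y \<in> carrier A \<Longrightarrow> cdiff A x y \<in> carrier A"
  by (simp add: cdiff_def)

lemma add_left_comm:
  assumes "x \<in> carrier A" "y \<in> carrier A" "z \<in> carrier A"
  shows "x \<oplus> (y \<oplus> z) = y \<oplus> (x \<oplus> z)"
  using assms by (metis add_assoc add_comm)

lemma zero_add [simp]: "x \<in> carrier A \<Longrightarrow> \<zero> \<oplus> x = x"
  by (metis add_comm add_zero zero_closed)

lemma add_cdiff [simp]: "x \<in> carrier A \<Longrightarrow> y \<in> carrier A \<Longrightarrow> cdiff A x y \<oplus> y = x"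
  unfolding cdiff_def by (metis add_assoc add_comm add_inverse add_zero scale_closed)

lemma add_right_cancel:
  assumes "x \<in> carrier A" "y \<in> carrier A" "z \<in> carrier A" "x \<oplus> z = y \<oplus> z"
  shows "x = y"
  using assms by (metis add_assoc add_inverse add_zero scale_closed)

lemma cdiff_eqI: "w \<in> carrier A \<Longrightarrow> y \<in> carrier A \<Longrightarrow> x = w \<oplus> y \<Longrightarrow> cdiff A x y = w"
  by (rule add_right_cancel[of _ _ y]) simp_all

lemma cdiff_self [simp]: "x \<in> carrier A \<Longrightarrow> cdiff A x x = \<zero>"
  by (simp add: cdiff_def add_inverse)

lemma cdiff_zero_right [simp]: "x \<in> carrier A \<Longrightarrow> cdiff A x \<zero> = x"
  by (rule cdiff_eqI) (simp_all add: add_zero)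

lemma cdiff_eq_zero_iff: "x \<in> carrier A \<Longrightarrow> y \<in> carrier A \<Longrightarrow> cdiff A x y = \<zero> \<longleftrightarrow> x = y"
  by (metis add_cdiff cdiff_self zero_add)

lemma scale_zero_left [simp]: "x \<in> carrier A \<Longrightarrow> 0 \<odot> x = \<zero>"
  using add_inverse[of x] scale_add_left[of x 1 "-1"] scale_one[of x] by simp

lemma scale_zero_right [simp]: "c \<odot> \<zero> = \<zero>"
  by (metis mult_zero_right scale_scale scale_zero_left zero_closed)

lemma mult_zero_left [simp]: "x \<in> carrier A \<Longrightarrow> \<zero> \<cdot> x = \<zero>"
  by (metis mult_closed mult_scale_left scale_zero_left zero_closed)

lemma mult_zero_right [simp]: "x \<in> carrier A \<Longrightarrow> x \<cdot> \<zero> = \<zero>"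
  by (metis mult_closed mult_scale_right scale_zero_left zero_closed)

lemma adj_zero [simp]: "cadj A \<zero> = \<zero>"
  by (metis adj_closed adj_scale complex_cnj_zero scale_zero_left zero_closed)

lemma cdiff_add:
  "\<lbrakk>x \<in> carrier A; y \<in> carrier A; x' \<in> carrier A; y' \<in> carrier A\<rbrakk> \<Longrightarrow>
   cdiff A (x \<oplus> y) (x' \<oplus> y') = cdiff A x x' \<oplus> cdiff A y y'"
  by (simp add: cdiff_def scale_add_right add_assoc add_comm add_left_comm)

lemma cdiff_scale:
  "\<lbrakk>x \<in> carrier A; y \<in> carrier A\<rbrakk> \<Longrightarrow> cdiff A (c \<odot> x) (c \<odot> y) = c \<odot> cdiff A x y"
  by (simp add: cdiff_def scale_add_right scale_scale mult.commute)

lemma cdiff_mult_right: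
  "\<lbrakk>z \<in> carrier A; x \<in> carrier A; y \<in> carrier A\<rbrakk> \<Longrightarrow> cdiff A (z \<cdot> x) (z \<cdot> y) = z \<cdot> cdiff A x y"
  by (simp add: cdiff_def mult_add_right mult_scale_right)

lemma cdiff_mult_left:
  "\<lbrakk>z \<in> carrier A; x \<in> carrier A; y \<in> carrier A\<rbrakk> \<Longrightarrow> cdiff A (x \<cdot> z) (y \<cdot> z) = cdiff A x y \<cdot> z"
  by (simp add: cdiff_def mult_add_left mult_scale_left)

lemma cdiff_adj:
  "\<lbrakk>x \<in> carrier A; y \<in> carrier A\<rbrakk> \<Longrightarrow> cdiff A (cadj A x) (cadj A y) = cadj A (cdiff A x y)"
  by (simp add: cdiff_def adj_add adj_scale)

lemma cdiff_trans:
  "\<lbrakk>x \<in> carrier A; y \<in> carrier A; z \<in> carrier A\<rbrakk> \<Longrightarrow> cdiff A x z = cdiff A x y \<oplus> cdiff A y z"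
  by (rule cdiff_eqI) (simp_all add: add_assoc)

lemma cdiff_mult:
  assumes "x \<in> carrier A" "y \<in> carrier A" "x' \<in> carrier A" "y' \<in> carrier A"
  shows "cdiff A (x \<cdot> y) (x' \<cdot> y') = (x \<cdot> cdiff A y y') \<oplus> (cdiff A x x' \<cdot> y')"
  using assms cdiff_trans[of "x \<cdot> y" "x \<cdot> y'" "x' \<cdot> y'"]
  by (simp add: cdiff_mult_left cdiff_mult_right)

lemma cdiff_commute: "\<lbrakk>x \<in> carrier A; y \<in> carrier A\<rbrakk> \<Longrightarrow> cdiff A y x = (-1) \<odot> cdiff A x y"
  by (simp add: cdiff_def scale_add_right scale_scale scale_one add_comm)

lemma norm_zero [simp]: "cnorm A \<zero> = 0"
  using norm_eq_zero by blast

lemma norm_cdiff_commute: "\<lbrakk>x \<in> carrier A; y \<in> carrier A\<rbrakk> \<Longrightarrow> cnorm A (cdiff A x y) = cnorm A (cdiff A y x)"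
  by (simp add: cdiff_commute[of x y] norm_scale)

lemma norm_cdiff_triangle:
  "\<lbrakk>x \<in> carrier A; y \<in> carrier A; z \<in> carrier A\<rbrakk> \<Longrightarrow>
   cnorm A (cdiff A x z) \<le> cnorm A (cdiff A x y) + cnorm A (cdiff A y z)"
  by (metis cdiff_closed cdiff_trans norm_triangle)

lemma norm_le_cdiff:
  "\<lbrakk>x \<in> carrier A; y \<in> carrier A\<rbrakk> \<Longrightarrow> cnorm A x \<le> cnorm A y + cnorm A (cdiff A x y)"
  by (metis add.commute add_cdiff cdiff_closed norm_triangle)

lemma abs_norm_diff_le:
  "\<lbrakk>x \<in> carrier A; y \<in> carrier A\<rbrakk> \<Longrightarrow> \<bar>cnorm A x - cnorm A y\<bar> \<le> cnorm A (cdiff A x y)"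
  using norm_le_cdiff[of x y] norm_le_cdiff[of y x] norm_cdiff_commute[of x y] by auto

lemma norm_cdiff_eq_zero: "\<lbrakk>x \<in> carrier A; y \<in> carrier A\<rbrakk> \<Longrightarrow> cnorm A (cdiff A x y) = 0 \<longleftrightarrow> x = y"
  by (simp add: cdiff_eq_zero_iff norm_eq_zero)

lemma norm_adj [simp]:
  assumes "x \<in> carrier A" shows "cnorm A (cadj A x) = cnorm A x"
proof -
  \<comment> \<open>The C*-identity gives ||y||^2 = ||y* y|| <= ||y*|| ||y||; one factor cancels,
    and the resulting inequality is applied to \<open>x\<close> and to its adjoint.\<close>
  have *: "cnorm A y \<le> cnorm A (cadj A y)" if y: "y \<in> carrier A" for y
  proof (cases "cnorm A y = 0")
    case False
    have "cnorm A y * cnorm A y \<le> cnorm A (cadj A y) * cnorm A y"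
      using norm_mult[of "cadj A y" y] cstar_identity[OF y] y by (simp add: power2_eq_square)
    then show ?thesis using False norm_nonneg[OF y] by (simp add: mult_le_cancel_right)
  qed (use y norm_nonneg in auto)
  show ?thesis using *[OF assms] *[of "cadj A x"] assms adj_adj by auto
qed

lemma converges_iff_eps:
  "cconverges A f l \<longleftrightarrow> (\<forall>e>0. \<exists>N. \<forall>n\<ge>N. \<bar>cnorm A (cdiff A (f n) l)\<bar> < e)"
  unfolding cconverges_def LIMSEQ_iff by simp

lemma converges_bound:
  assumes "g \<longlonglongrightarrow> 0" "\<And>n. f n \<in> carrier A" "l \<in> carrier A" "\<And>n. cnorm A (cdiff A (f n) l) \<le> g n"
  shows "cconverges A f l"
  unfolding cconverges_def
  by (rule tendsto_sandwich[OF _ _ tendsto_const assms(1)]) (auto simp: assms norm_nonneg)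

lemma converges_norm:
  assumes "\<And>n. f n \<in> carrier A" "l \<in> carrier A" "cconverges A f l"
  shows "(\<lambda>n. cnorm A (f n)) \<longlonglongrightarrow> cnorm A l"
proof (rule LIM_zero_cancel, rule tendsto_rabs_zero_cancel)
  show "(\<lambda>n. \<bar>cnorm A (f n) - cnorm A l\<bar>) \<longlonglongrightarrow> 0"
    by (rule tendsto_sandwich[OF _ _ tendsto_const assms(3)[unfolded cconverges_def]])
       (auto simp: assms abs_norm_diff_le)
qed

lemma converges_unique:
  assumes "\<And>n. f n \<in> carrier A" "l \<in> carrier A" "l' \<in> carrier A"
    and "cconverges A f l" "cconverges A f l'"
  shows "l = l'"
proof -
  have "(\<lambda>n. cnorm A (cdiff A (f n) l) + cnorm A (cdiff A (f n) l')) \<longlonglongrightarrow> 0 + 0"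
    using assms(4,5) unfolding cconverges_def by (intro tendsto_add)
  moreover have "cnorm A (cdiff A l l') \<le> cnorm A (cdiff A (f n) l) + cnorm A (cdiff A (f n) l')" for n
    using assms norm_cdiff_triangle[of l "f n" l'] norm_cdiff_commute[of l "f n"] by simp
  ultimately have "cnorm A (cdiff A l l') \<le> 0"
    by (intro tendsto_lowerbound[of _ _ sequentially]) auto
  then show ?thesis using assms norm_cdiff_eq_zero norm_nonneg
    by (metis cdiff_closed order_antisym)
qed

lemma converges_add:
  assumes "\<And>n. f n \<in> carrier A" "l \<in> carrier A" "\<And>n. g n \<in> carrier A" "l' \<in> carrier A"
    and "cconverges A f l" "cconverges A g l'"
  shows "cconverges A (\<lambda>n. f n \<oplus> g n) (l \<oplus> l')"
proof (rule converges_bound)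
  show "(\<lambda>n. cnorm A (cdiff A (f n) l) + cnorm A (cdiff A (g n) l')) \<longlonglongrightarrow> 0"
    using tendsto_add[OF assms(5,6)[unfolded cconverges_def]] by simp
qed (use assms in \<open>auto simp: cdiff_add norm_triangle\<close>)

lemma converges_scale:
  assumes "\<And>n. f n \<in> carrier A" "l \<in> carrier A" "cconverges A f l"
  shows "cconverges A (\<lambda>n. c \<odot> f n) (c \<odot> l)"
proof (rule converges_bound)
  show "(\<lambda>n. cmod c * cnorm A (cdiff A (f n) l)) \<longlonglongrightarrow> 0"
    using tendsto_mult_left[OF assms(3)[unfolded cconverges_def], of "cmod c"] by simp
qed (use assms in \<open>auto simp: cdiff_scale norm_scale\<close>)

lemma converges_adj:
  assumes "\<And>n. f n \<in> carrier A" "l \<in> carrier A" "cconverges A f l"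
  shows "cconverges A (\<lambda>n. cadj A (f n)) (cadj A l)"
  using assms by (simp add: cconverges_def cdiff_adj)

lemma converges_mult:
  assumes "\<And>n. f n \<in> carrier A" "l \<in> carrier A" "\<And>n. g n \<in> carrier A" "l' \<in> carrier A"
    and "cconverges A f l" "cconverges A g l'"
  shows "cconverges A (\<lambda>n. f n \<cdot> g n) (l \<cdot> l')"
proof (rule converges_bound)
  show "(\<lambda>n. cnorm A (f n) * cnorm A (cdiff A (g n) l') + cnorm A (cdiff A (f n) l) * cnorm A l') \<longlonglongrightarrow> 0"
    using tendsto_add[OF tendsto_mult[OF converges_norm[OF assms(1,2,5)] assms(6)[unfolded cconverges_def]]
        tendsto_mult_right[OF assms(5)[unfolded cconverges_def], of "cnorm A l'"]]
    by simp
  fix n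
  have "cnorm A (cdiff A (f n \<cdot> g n) (l \<cdot> l'))
      \<le> cnorm A (f n \<cdot> cdiff A (g n) l') + cnorm A (cdiff A (f n) l \<cdot> l')"
    using assms by (simp add: cdiff_mult norm_triangle)
  also have "\<dots> \<le> cnorm A (f n) * cnorm A (cdiff A (g n) l') + cnorm A (cdiff A (f n) l) * cnorm A l'"
    using assms by (intro add_mono norm_mult) auto
  finally show "cnorm A (cdiff A (f n \<cdot> g n) (l \<cdot> l'))
      \<le> cnorm A (f n) * cnorm A (cdiff A (g n) l') + cnorm A (cdiff A (f n) l) * cnorm A l'" .
qed (use assms in auto)

lemma converges_const: "l \<in> carrier A \<Longrightarrow> cconverges A (\<lambda>_. l) l"
  by (simp add: cconverges_def)

lemma converges_cauchy:
  assumes "\<And>n. f n \<in> carrier A" "l \<in> carrier A" "cconverges A f l"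
  shows "ccauchy A f"
  unfolding ccauchy_def
proof (intro allI impI)
  fix e :: real assume "0 < e"
  then obtain N where N: "\<And>n. n \<ge> N \<Longrightarrow> cnorm A (cdiff A (f n) l) < e / 2"
    using assms(3) unfolding converges_iff_eps by (metis half_gt_zero abs_less_iff)
  show "\<exists>N. \<forall>m\<ge>N. \<forall>n\<ge>N. cnorm A (cdiff A (f m) (f n)) < e"
  proof (intro exI allI impI)
    fix m n assume "N \<le> m" "N \<le> n"
    then show "cnorm A (cdiff A (f m) (f n)) < e"
      using N[of m] N[of n] norm_cdiff_triangle[of "f m" l "f n"] norm_cdiff_commute[of l "f n"] assms
      by auto
  qed
qed

lemma approx_sequence:
  assumes "x \<in> carrier A" "\<forall>e>0. \<exists>y\<in>S. cnorm A (cdiff A x y) < e" "S \<subseteq> carrier A"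
  obtains f where "\<And>n. f n \<in> S" "cconverges A f x"
proof -
  have "\<exists>y\<in>S. cnorm A (cdiff A x y) < 1 / real (Suc n)" for n
    using assms(2) by simp
  then obtain f where f: "\<And>n. f n \<in> S" "\<And>n. cnorm A (cdiff A x (f n)) < 1 / real (Suc n)"
    by metis
  have "cconverges A f x"
  proof (rule converges_bound)
    show "(\<lambda>n. 1 / real (Suc n)) \<longlonglongrightarrow> 0" using LIMSEQ_inverse_real_of_nat by (simp add: inverse_eq_divide)
    fix n show "cnorm A (cdiff A (f n) x) \<le> 1 / real (Suc n)"
      using f[of n] assms norm_cdiff_commute[of x "f n"] by auto
  qed (use f assms in auto)
  with f(1) show ?thesis using that by blast
qed

lemma geometric_cauchy:
  assumes f: "\<And>n. f n \<in> carrier A" and r: "0 \<le> r" "r < 1"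
    and step: "\<And>n. cnorm A (cdiff A (f (Suc n)) (f n)) \<le> K * r ^ n"
  shows "ccauchy A f"
proof -
  have tele: "cnorm A (cdiff A (f (n + k)) (f n)) \<le> (\<Sum>i\<in>{n..<n+k}. K * r ^ i)" for n k
  proof (induction k)
    case (Suc k)
    have "cnorm A (cdiff A (f (n + Suc k)) (f n))
       \<le> cnorm A (cdiff A (f (Suc (n + k))) (f (n + k))) + cnorm A (cdiff A (f (n + k)) (f n))"
      using norm_cdiff_triangle f by simp
    also have "\<dots> \<le> K * r ^ (n + k) + (\<Sum>i\<in>{n..<n+k}. K * r ^ i)" using Suc step by (intro add_mono)
    finally show ?case by simp
  qed (use f in simp)
  have "summable (\<lambda>i. K * r ^ i)" using r by (intro summable_mult summable_geometric) simp
  then have cau: "\<forall>e>0. \<exists>N. \<forall>m\<ge>N. \<forall>n. norm (\<Sum>i\<in>{m..<n}. K * r ^ i) < e"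
    unfolding summable_Cauchy .
  show ?thesis unfolding ccauchy_def
  proof (intro allI impI)
    fix e :: real assume "0 < e"
    then obtain N where N: "\<And>m n. m \<ge> N \<Longrightarrow> norm (\<Sum>i\<in>{m..<n}. K * r ^ i) < e" using cau by blast
    have *: "cnorm A (cdiff A (f m) (f n)) < e" if "N \<le> n" "n \<le> m" for m n
      using tele[of n "m - n"] N[of n m] that by auto
    show "\<exists>N. \<forall>m\<ge>N. \<forall>n\<ge>N. cnorm A (cdiff A (f m) (f n)) < e"
    proof (intro exI[of _ N] allI impI)
      fix m n assume "N \<le> m" "N \<le> n"
      then show "cnorm A (cdiff A (f m) (f n)) < e"
        using *[of n m] *[of m n] f norm_cdiff_commute by (cases "n \<le> m") auto
    qed
  qed
qed

text \<open>The fixed point \<open>b = (a\<^sup>2 + b\<^sup>2) / 2\<close> satisfies \<open>(1 - b)\<^sup>2 = 1 - a\<^sup>2\<close>, without mentioning a unit.\<close>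

lemma quasi_sqrt:
  assumes a: "a \<in> carrier A" "cadj A a = a" "cnorm A a < 1"
  obtains b where "b \<in> carrier A" "cadj A b = b" "a \<cdot> b = b \<cdot> a" "b \<oplus> b = (a \<cdot> a) \<oplus> (b \<cdot> b)"
proof -
  define T where "T b = (1/2) \<odot> ((a \<cdot> a) \<oplus> (b \<cdot> b))" for b
  define r where "r = cnorm A a"
  have r: "0 \<le> r" "r < 1" using a norm_nonneg by (auto simp: r_def)
  \<comment> \<open>\<open>T\<close> maps this set into itself, because (r^2 + r^2)/2 <= r for r <=
    1. Self-adjointness and commutation with \<open>a\<close> are recorded because both pass to the
    limit of the iterates.\<close>
  define P where "P b \<longleftrightarrow> b \<in> carrier A \<and> cadj A b = b \<and> a \<cdot> b = b \<cdot> a \<and> cnorm A b \<le> r" for b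
  have P0: "P \<zero>" using a r by (simp add: P_def)
  have PT: "P (T b)" if "P b" for b
  proof -
    have b: "b \<in> carrier A" "cadj A b = b" "a \<cdot> b = b \<cdot> a" "cnorm A b \<le> r" using that by (auto simp: P_def)
    have "cnorm A (T b) \<le> (1/2) * (cnorm A (a \<cdot> a) + cnorm A (b \<cdot> b))"
      using a b norm_triangle[of "a \<cdot> a" "b \<cdot> b"] by (simp add: T_def norm_scale)
    also have "\<dots> \<le> (1/2) * (r * r + r * r)"
    proof -
      have "cnorm A (b \<cdot> b) \<le> r * r"
        using norm_mult[of b b] b mult_mono[of "cnorm A b" r "cnorm A b" r] norm_nonneg r by fastforce
      then show ?thesis using norm_mult[of a a] a by (simp add: r_def)
    qed
    also have "\<dots> \<le> r" using r by (simp add: mult_left_le)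
    finally have n: "cnorm A (T b) \<le> r" .
    have "a \<cdot> (b \<cdot> b) = b \<cdot> b \<cdot> a" using a b by (metis mult_assoc)
    then have "a \<cdot> T b = T b \<cdot> a" using a b
      by (simp add: T_def mult_scale_right mult_scale_left mult_add_left mult_add_right mult_assoc)
    with n show ?thesis using a b by (simp add: P_def) (simp add: T_def adj_scale adj_add adj_mult)
  qed
  define f where "f n = (T ^^ n) \<zero>" for n
  have Pf: "P (f n)" for n by (induction n) (auto simp: f_def P0 PT)
  then have fc: "f n \<in> carrier A" for n by (auto simp: P_def)
  have fS: "f (Suc n) = T (f n)" for n by (simp add: f_def)
  have contr: "cnorm A (cdiff A (T b) (T c)) \<le> r * cnorm A (cdiff A b c)" if "P b" "P c" for b c
  proof -
    have bc: "b \<in> carrier A" "c \<in> carrier A" "cnorm A b \<le> r" "cnorm A c \<le> r" using that by (auto simp: P_def)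
    \<comment> \<open>From b^2 - c^2 = b (b - c) + (b - c) c, which holds without commutativity.
      Both outer factors have norm at most \<open>r\<close>, and this makes \<open>r\<close> a
      contraction constant.\<close>
    have "cdiff A (T b) (T c) = (1/2) \<odot> ((b \<cdot> cdiff A b c) \<oplus> (cdiff A b c \<cdot> c))"
      using a bc by (simp add: T_def cdiff_scale cdiff_add cdiff_mult)
    then have "cnorm A (cdiff A (T b) (T c)) \<le> (1/2) * (cnorm A (b \<cdot> cdiff A b c) + cnorm A (cdiff A b c \<cdot> c))"
      using norm_triangle bc by (simp add: norm_scale)
    also have "\<dots> \<le> (1/2) * (r * cnorm A (cdiff A b c) + cnorm A (cdiff A b c) * r)"
    proof -
      have "cnorm A (b \<cdot> cdiff A b c) \<le> r * cnorm A (cdiff A b c)"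
        using norm_mult[of b "cdiff A b c"] mult_right_mono[OF bc(3), of "cnorm A (cdiff A b c)"] bc norm_nonneg by force
      moreover have "cnorm A (cdiff A b c \<cdot> c) \<le> cnorm A (cdiff A b c) * r"
        using norm_mult[of "cdiff A b c" c] mult_left_mono[OF bc(4), of "cnorm A (cdiff A b c)"] bc norm_nonneg by force
      ultimately show ?thesis by (intro mult_left_mono add_mono) auto
    qed
    finally show ?thesis by (simp add: mult.commute)
  qed
  have "cnorm A (cdiff A (f (Suc n)) (f n)) \<le> cnorm A (cdiff A (f 1) (f 0)) * r ^ n" for n
  proof (induction n)
    case (Suc n)
    have "cnorm A (cdiff A (f (Suc (Suc n))) (f (Suc n))) \<le> r * cnorm A (cdiff A (f (Suc n)) (f n))"
      unfolding fS[of "Suc n"] fS[of n] using contr[OF PT[OF Pf] Pf] by simp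
    also have "\<dots> \<le> r * (cnorm A (cdiff A (f 1) (f 0)) * r ^ n)" using Suc r by (intro mult_left_mono)
    finally show ?case by (simp add: mult_ac)
  qed simp
  from complete[OF fc geometric_cauchy[OF fc r this]] obtain b where
    b: "b \<in> carrier A" "cconverges A f b" by blast
  have "cconverges A (\<lambda>n. T (f n)) (T b)" unfolding T_def
    using a b fc by (intro converges_scale converges_add converges_const converges_mult) auto
  moreover have "cconverges A (\<lambda>n. T (f n)) b"
    using b(2) unfolding cconverges_def fS[symmetric] by (rule LIMSEQ_Suc)
  ultimately have Tb: "T b = b"
    using a b fc by (intro converges_unique[of "\<lambda>n. T (f n)"]) (auto simp: T_def)
  have "cconverges A f (cadj A b)"
    using converges_adj[OF fc b] Pf by (simp add: P_def)
  then have "cadj A b = b" using b fc by (intro converges_unique[of f]) auto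
  moreover have "a \<cdot> b = b \<cdot> a"
  proof (rule converges_unique[of "\<lambda>n. a \<cdot> f n"])
    show "cconverges A (\<lambda>n. a \<cdot> f n) (a \<cdot> b)" using a b fc by (intro converges_mult converges_const) auto
    have "cconverges A (\<lambda>n. f n \<cdot> a) (b \<cdot> a)" using a b fc by (intro converges_mult converges_const) auto
    then show "cconverges A (\<lambda>n. a \<cdot> f n) (b \<cdot> a)" using Pf by (simp add: P_def)
  qed (use a b fc in auto)
  moreover have "b \<oplus> b = (a \<cdot> a) \<oplus> (b \<cdot> b)"
  proof -
    have "b \<oplus> b = 2 \<odot> b" using b scale_add_left[of b 1 1] scale_one by simp
    also have "\<dots> = 2 \<odot> T b" using Tb by simp
    also have "\<dots> = (a \<cdot> a) \<oplus> (b \<cdot> b)" using a b by (simp add: T_def scale_scale scale_one)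
    finally show ?thesis .
  qed
  ultimately show ?thesis using that b(1) by blast
qed

end

section \<open>Polynomials in self-adjoint elements\<close>

context cstar_algebra
begin

definition lin_op :: "('a \<Rightarrow> 'a) \<Rightarrow> bool" where
  "lin_op T \<longleftrightarrow> (\<forall>x\<in>carrier A. T x \<in> carrier A) \<and>
     (\<forall>x\<in>carrier A. \<forall>y\<in>carrier A. T (x \<oplus> y) = T x \<oplus> T y) \<and>
     (\<forall>c. \<forall>x\<in>carrier A. T (c \<odot> x) = c \<odot> T x)"

lemma lin_opD:
  assumes "lin_op T"
  shows lin_op_closed: "x \<in> carrier A \<Longrightarrow> T x \<in> carrier A"
    and lin_op_add: "x \<in> carrier A \<Longrightarrow> y \<in> carrier A \<Longrightarrow> T (x \<oplus> y) = T x \<oplus> T y"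
    and lin_op_scale: "x \<in> carrier A \<Longrightarrow> T (c \<odot> x) = c \<odot> T x"
  using assms by (auto simp: lin_op_def)

lemma lin_op_zero: "lin_op T \<Longrightarrow> T \<zero> = \<zero>"
  by (metis lin_op_scale scale_zero_left zero_closed lin_op_closed)

lemma lin_op_mult: "a \<in> carrier A \<Longrightarrow> lin_op (\<lambda>x. a \<cdot> x)"
  by (simp add: lin_op_def mult_add_right mult_scale_right)

text \<open>Horner's scheme for Q(T) z. Letting the polynomial act on a vector gives its constant
  term a meaning in an algebra that may have no unit.\<close>

definition poly_op :: "('a \<Rightarrow> 'a) \<Rightarrow> complex poly \<Rightarrow> 'a \<Rightarrow> 'a" where
  "poly_op T Q z = fold_coeffs (\<lambda>c w. (c \<odot> z) \<oplus> T w) Q \<zero>"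

lemma poly_op_0 [simp]: "poly_op T 0 z = \<zero>"
  by (simp add: poly_op_def)

lemma poly_op_pCons:
  assumes "lin_op T" "z \<in> carrier A"
  shows "poly_op T (pCons c Q) z = (c \<odot> z) \<oplus> T (poly_op T Q z)"
proof (cases "c = 0 \<and> Q = 0")
  case True
  then show ?thesis using assms by (simp add: lin_op_zero)
next
  case False
  then show ?thesis by (auto simp: poly_op_def)
qed

lemma poly_op_closed [simp]: "lin_op T \<Longrightarrow> z \<in> carrier A \<Longrightarrow> poly_op T Q z \<in> carrier A"
  by (induction Q) (auto simp: poly_op_pCons lin_op_closed)

lemma add_swap:
  "\<lbrakk>x \<in> carrier A; y \<in> carrier A; z \<in> carrier A; w \<in> carrier A\<rbrakk> \<Longrightarrow> (x \<oplus> y) \<oplus> (z \<oplus> w) = (x \<oplus> z) \<oplus> (y \<oplus> w)"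
  by (simp add: add_assoc add_comm add_left_comm)

lemma poly_op_scale_vec:
  assumes T: "lin_op T" and "z \<in> carrier A"
  shows "poly_op T Q (c \<odot> z) = c \<odot> poly_op T Q z"
  using assms
  by (induction Q)
    (simp_all add: poly_op_pCons lin_op_scale lin_op_closed scale_add_right scale_scale mult.commute)

lemma poly_op_commute:
  assumes T: "lin_op T" and S: "lin_op S" "\<And>x. x \<in> carrier A \<Longrightarrow> S (T x) = T (S x)" and "z \<in> carrier A"
  shows "S (poly_op T Q z) = poly_op T Q (S z)"
  using assms
  by (induction Q) (simp_all add: poly_op_pCons lin_op_zero lin_op_add lin_op_scale lin_op_closed)

lemma poly_op_add:
  assumes T: "lin_op T" and "z \<in> carrier A"
  shows "poly_op T (Q + R) z = poly_op T Q z \<oplus> poly_op T R z"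
proof (induction Q arbitrary: R)
  case (pCons c Q)
  obtain d R' where R: "R = pCons d R'" by (cases R)
  show ?case using assms
    by (simp add: R pCons poly_op_pCons lin_op_add lin_op_closed scale_add_left add_swap)
qed (use assms in simp)

lemma poly_op_smult:
  assumes T: "lin_op T" and "z \<in> carrier A"
  shows "poly_op T (smult c Q) z = c \<odot> poly_op T Q z"
  using assms
  by (induction Q)
    (simp_all add: poly_op_pCons lin_op_scale lin_op_closed scale_add_right scale_scale)

lemma poly_op_mult:
  assumes T: "lin_op T" and "z \<in> carrier A"
  shows "poly_op T (Q * R) z = poly_op T Q (poly_op T R z)"
  using assms
  by (induction Q) (simp_all add: poly_op_pCons poly_op_add poly_op_smult lin_op_closed)

lemma poly_op_monom:
  assumes T: "lin_op T" and "z \<in> carrier A"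
  shows "poly_op T (monom c n) z = c \<odot> (T ^^ n) z"
proof (induction n)
  case (Suc n)
  have "(T ^^ n) z \<in> carrier A" using assms by (induction n) (auto simp: lin_op_closed)
  then show ?case using Suc assms by (simp add: monom_Suc poly_op_pCons lin_op_closed lin_op_scale)
qed (use assms in \<open>simp add: monom_0 poly_op_pCons lin_op_zero add_zero\<close>)

text \<open>The triangle inequality over the powers of an isometry. The price is the number of
  coefficients, a factor that is only linear in the degree.\<close>

lemma norm_poly_op_le:
  assumes T: "lin_op T" and z: "z \<in> carrier A"
    and iso: "\<And>x. x \<in> carrier A \<Longrightarrow> cnorm A (T x) = cnorm A x"
    and M: "\<And>k. cmod (coeff Q k) \<le> M"
  shows "cnorm A (poly_op T Q z) \<le> real (length (coeffs Q)) * M * cnorm A z"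
  using M
proof (induction Q)
  case (pCons c Q)
  have c: "cmod c \<le> M" using pCons.prems[of 0] by simp
  have Q: "cmod (coeff Q k) \<le> M" for k using pCons.prems[of "Suc k"] by simp
  have "cnorm A (poly_op T (pCons c Q) z) \<le> cnorm A (c \<odot> z) + cnorm A (T (poly_op T Q z))"
    using T z by (simp add: poly_op_pCons norm_triangle lin_op_closed)
  also have "\<dots> = cmod c * cnorm A z + cnorm A (poly_op T Q z)"
    using T z iso by (simp add: norm_scale)
  also have "\<dots> \<le> M * cnorm A z + real (length (coeffs Q)) * M * cnorm A z"
    using pCons.IH[OF Q] c z norm_nonneg by (intro add_mono mult_right_mono) auto
  finally show ?case using pCons.hyps by (simp add: algebra_simps cCons_def)
qed simp

text \<open>Allows \<open>a\<close> to be normalized to norm below 1, where a quasi-square-root can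
  be constructed.\<close>

lemma poly_op_pcompose_scale:
  assumes a: "a \<in> carrier A" and z: "z \<in> carrier A"
  shows "poly_op (\<lambda>x. (c \<odot> a) \<cdot> x) Q z = poly_op (\<lambda>x. a \<cdot> x) (pcompose Q [:0, c:]) z"
  using assms
  by (induction Q)
    (simp_all add: pcompose_pCons poly_op_pCons poly_op_add poly_op_smult lin_op_mult mult_scale_left
      mult_scale_right add_zero)

text \<open>A quasi-square-root makes \<open>a + e (1 - b)\<close> and \<open>a - e (1 - b)\<close>, for \<open>e = \<plusminus> \<i>\<close>, mutually
  inverse unitaries of the unitization; they are used as operators on the algebra itself.\<close>

definition cayley_op :: "'a \<Rightarrow> 'a \<Rightarrow> complex \<Rightarrow> 'a \<Rightarrow> 'a" where
  "cayley_op a b e z = (a \<cdot> z) \<oplus> (e \<odot> cdiff A z (b \<cdot> z))"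

definition quasi_sqrt_of :: "'a \<Rightarrow> 'a \<Rightarrow> bool" where
  "quasi_sqrt_of a b \<longleftrightarrow> a \<in> carrier A \<and> b \<in> carrier A \<and> cadj A a = a \<and> cadj A b = b \<and>
     a \<cdot> b = b \<cdot> a \<and> b \<oplus> b = (a \<cdot> a) \<oplus> (b \<cdot> b)"

text \<open>The expansion of (1 - b)^2 as 1 - 2 b + b^2, evaluated at a vector: in the application
  \<open>p\<close>, \<open>q\<close>, \<open>r\<close>, \<open>s\<close> are z, b z, b^2 z and a^2
  z.\<close>

lemma quasi_sqrt_cancel:
  assumes "p \<in> carrier A" "q \<in> carrier A" "r \<in> carrier A" "s \<in> carrier A" "q \<oplus> q = s \<oplus> r"
  shows "s \<oplus> cdiff A (cdiff A p q) (cdiff A q r) = p"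
proof -
  define X where "X = cdiff A (cdiff A p q) (cdiff A q r)"
  have X: "X \<in> carrier A" using assms(1-4) by (simp add: X_def)
  have "X \<oplus> cdiff A q r = cdiff A p q" using assms(1-4) by (simp add: X_def)
  have "(s \<oplus> X) \<oplus> r = X \<oplus> (s \<oplus> r)" using assms(1-4) X by (simp add: add_assoc add_left_comm[of s X])
  also have "\<dots> = X \<oplus> (q \<oplus> q)" by (simp only: assms(5))
  also have "\<dots> = X \<oplus> ((cdiff A q r \<oplus> r) \<oplus> q)" using assms(1-4) by simp
  also have "\<dots> = X \<oplus> (cdiff A q r \<oplus> (q \<oplus> r))" using assms(1-4)
    by (simp add: add_assoc add_comm[of r q] del: add_cdiff)
  also have "\<dots> = ((X \<oplus> cdiff A q r) \<oplus> q) \<oplus> r" using assms(1-4) X by (simp add: add_assoc del: add_cdiff)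
  also have "\<dots> = p \<oplus> r" using assms(1-4) \<open>X \<oplus> cdiff A q r = cdiff A p q\<close> by simp
  finally show ?thesis unfolding X_def[symmetric]
    by (rule add_right_cancel[rotated 3]) (use assms(1-4) X in auto)
qed

lemma cayley_op_lin: "quasi_sqrt_of a b \<Longrightarrow> lin_op (cayley_op a b e)"
  unfolding lin_op_def cayley_op_def quasi_sqrt_of_def
  by (auto simp: mult_add_right mult_scale_right cdiff_add cdiff_scale scale_add_right scale_scale
      add_swap mult.commute)

text \<open>The identity a^2 + (1 - b)^2 = 1, which makes a + e (1 - b) unitary, in a form free of
  the unit element.\<close>

lemma quasi_sqrt_vec:
  assumes "quasi_sqrt_of a b" "z \<in> carrier A"
  shows "(a \<cdot> (a \<cdot> z)) \<oplus> cdiff A (cdiff A z (b \<cdot> z)) (b \<cdot> cdiff A z (b \<cdot> z)) = z"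
proof -
  have b: "b \<in> carrier A" using assms(1) by (simp add: quasi_sqrt_of_def)
  have "(b \<cdot> z) \<oplus> (b \<cdot> z) = (b \<oplus> b) \<cdot> z" using b assms(2) by (intro mult_add_left[symmetric])
  also have "\<dots> = ((a \<cdot> a) \<oplus> (b \<cdot> b)) \<cdot> z" using assms(1) by (simp only: quasi_sqrt_of_def)
  also have "\<dots> = (a \<cdot> (a \<cdot> z)) \<oplus> (b \<cdot> (b \<cdot> z))"
    using assms by (simp add: quasi_sqrt_of_def mult_add_left mult_assoc)
  finally show ?thesis
    using assms quasi_sqrt_cancel[of z "b \<cdot> z" "b \<cdot> (b \<cdot> z)" "a \<cdot> (a \<cdot> z)"]
    by (simp add: quasi_sqrt_of_def cdiff_mult_right)
qed

text \<open>By the C*-identity it is enough to compute (U z)* (U z). With v = a z and w = (1 - b) z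
  the mixed terms e v* w and - e w* v cancel because a and b are self-adjoint and commute, and v* v
  + w* w = z* z by \<open>quasi_sqrt_vec\<close>.\<close>

lemma cayley_op_isometric:
  assumes ab: "quasi_sqrt_of a b" and z: "z \<in> carrier A" and e: "e = \<i> \<or> e = - \<i>"
  shows "cnorm A (cayley_op a b e z) = cnorm A z"
proof -
  have a: "a \<in> carrier A" "b \<in> carrier A" "cadj A a = a" "cadj A b = b" "a \<cdot> b = b \<cdot> a"
    using ab by (auto simp: quasi_sqrt_of_def)
  have e': "cnj e = - e" "e * e = - 1" using e by auto
  define z' v w where "z' = cadj A z" and "v = a \<cdot> z" and "w = cdiff A z (b \<cdot> z)"
  have c: "z' \<in> carrier A" "v \<in> carrier A" "w \<in> carrier A" using a z by (auto simp: z'_def v_def w_def)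
  have v': "cadj A v = z' \<cdot> a" using a z by (simp add: v_def z'_def adj_mult)
  have w': "cadj A w = cdiff A z' (z' \<cdot> b)" using a z by (simp add: w_def z'_def adj_mult flip: cdiff_adj)
  have "cadj A v \<cdot> w = cadj A w \<cdot> v"
    unfolding v' w' using a c z
    by (simp add: v_def w_def mult_assoc flip: cdiff_mult_left cdiff_mult_right)
       (metis a(5) mult_assoc)
  then have cross: "(e \<odot> (cadj A v \<cdot> w)) \<oplus> ((- e) \<odot> (cadj A w \<cdot> v)) = \<zero>"
    using c by (metis add_inverse adj_closed mult_closed mult_minus1 scale_closed scale_scale)
  have ww: "cadj A w \<cdot> w = z' \<cdot> cdiff A w (b \<cdot> w)"
    unfolding w' using a c by (simp add: mult_assoc flip: cdiff_mult_left cdiff_mult_right)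
  have vv: "cadj A v \<cdot> v = z' \<cdot> (a \<cdot> (a \<cdot> z))"
    unfolding v' using a c z by (simp add: v_def mult_assoc)
  have sq: "(cadj A v \<cdot> v) \<oplus> (cadj A w \<cdot> w) = z' \<cdot> z"
    unfolding vv ww using a c z quasi_sqrt_vec[OF ab z] by (simp flip: mult_add_right w_def)
  have U: "cayley_op a b e z = v \<oplus> (e \<odot> w)" by (simp add: cayley_op_def v_def w_def)
  have "cadj A (v \<oplus> (e \<odot> w)) \<cdot> (v \<oplus> (e \<odot> w)) =
     ((cadj A v \<cdot> v) \<oplus> (e \<odot> (cadj A v \<cdot> w))) \<oplus> (((- e) \<odot> (cadj A w \<cdot> v)) \<oplus> (cadj A w \<cdot> w))"
    using c e' by (simp add: adj_add adj_scale mult_add_left mult_add_right mult_scale_left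
        mult_scale_right scale_add_right scale_scale scale_one add_assoc add_left_comm)
  also have "\<dots> = ((cadj A v \<cdot> v) \<oplus> (cadj A w \<cdot> w)) \<oplus> ((e \<odot> (cadj A v \<cdot> w)) \<oplus> ((- e) \<odot> (cadj A w \<cdot> v)))"
    using c by (simp add: add_assoc add_comm add_left_comm)
  also have "\<dots> = z' \<cdot> z" unfolding cross sq using c z by (simp add: add_zero)
  finally have "(cnorm A (cayley_op a b e z))\<^sup>2 = (cnorm A z)\<^sup>2"
    unfolding U using c z cstar_identity[of "v \<oplus> (e \<odot> w)"] cstar_identity[of z] by (simp add: z'_def)
  then show ?thesis using c z unfolding U by (simp add: norm_nonneg power2_eq_iff_nonneg)
qed

text \<open>The product of a + e (1 - b) and a - e (1 - b) is a^2 - e^2 (1 - b)^2, and e^2 =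
  -1.\<close>

lemma cayley_op_inverse:
  assumes ab: "quasi_sqrt_of a b" and z: "z \<in> carrier A" and e: "e * e = - 1"
  shows "cayley_op a b e (cayley_op a b (- e) z) = z"
proof -
  have a: "a \<in> carrier A" "b \<in> carrier A" "a \<cdot> b = b \<cdot> a" using ab by (auto simp: quasi_sqrt_of_def)
  define w y where "w = cdiff A z (b \<cdot> z)" and "y = cayley_op a b (- e) z"
  have w: "w \<in> carrier A" using a z by (simp add: w_def)
  have y: "y = (a \<cdot> z) \<oplus> ((- e) \<odot> w)" by (simp add: y_def cayley_op_def w_def)
  have aw: "cdiff A (a \<cdot> z) (b \<cdot> (a \<cdot> z)) = a \<cdot> w"
    using a z unfolding w_def by (simp add: mult_assoc flip: cdiff_mult_right) (metis a(3) mult_assoc)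
  have ay: "a \<cdot> y = (a \<cdot> (a \<cdot> z)) \<oplus> ((- e) \<odot> (a \<cdot> w))"
    using a z w by (simp add: y mult_add_right mult_scale_right)
  have by': "e \<odot> cdiff A y (b \<cdot> y) = (e \<odot> (a \<cdot> w)) \<oplus> cdiff A w (b \<cdot> w)"
    using a z w e by (simp add: y mult_add_right mult_scale_right cdiff_add cdiff_scale aw
        scale_add_right scale_scale scale_one)
  have "(a \<cdot> y) \<oplus> (e \<odot> cdiff A y (b \<cdot> y)) =
     ((a \<cdot> (a \<cdot> z)) \<oplus> cdiff A w (b \<cdot> w)) \<oplus> ((e \<odot> (a \<cdot> w)) \<oplus> ((- e) \<odot> (a \<cdot> w)))"
    unfolding ay by' using a z w by (simp add: add_assoc add_comm add_left_comm)
  also have "(e \<odot> (a \<cdot> w)) \<oplus> ((- e) \<odot> (a \<cdot> w)) = \<zero>"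
    using a w scale_add_left[of "a \<cdot> w" e "-e"] by simp
  also have "(a \<cdot> (a \<cdot> z)) \<oplus> cdiff A w (b \<cdot> w) = z"
    unfolding w_def by (rule quasi_sqrt_vec[OF ab z])
  finally show ?thesis using z by (simp add: cayley_op_def[of a b e] add_zero flip: y_def)
qed

lemma cayley_op_sum:
  assumes ab: "quasi_sqrt_of a b" and z: "z \<in> carrier A"
  shows "cayley_op a b e z \<oplus> cayley_op a b (- e) z = 2 \<odot> (a \<cdot> z)"
proof -
  have a: "a \<in> carrier A" "b \<in> carrier A" using ab by (auto simp: quasi_sqrt_of_def)
  define w where "w = cdiff A z (b \<cdot> z)"
  have w: "w \<in> carrier A" using a z by (simp add: w_def)
  have "cayley_op a b e z \<oplus> cayley_op a b (- e) z
     = ((a \<cdot> z) \<oplus> (a \<cdot> z)) \<oplus> ((e \<odot> w) \<oplus> ((- e) \<odot> w))"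
    unfolding cayley_op_def w_def[symmetric] using a z w by (simp add: add_swap)
  moreover have "(e \<odot> w) \<oplus> ((- e) \<odot> w) = \<zero>" using w scale_add_left[of w e "-e"] by simp
  ultimately show ?thesis using a z w scale_add_left[of "a \<cdot> z" 1 1]
    by (simp add: scale_one add_zero)
qed

text \<open>As 2 a is the sum of two isometries, multiplication by a is a contraction. Applied to z
  = a this becomes ||a||^2 <= ||a||, from which contractivity of *-homomorphisms is
  obtained.\<close>

lemma norm_quasi_sqrt_mult_le:
  assumes ab: "quasi_sqrt_of a b" and z: "z \<in> carrier A"
  shows "cnorm A (a \<cdot> z) \<le> cnorm A z"
proof -
  have a: "a \<in> carrier A" using ab by (auto simp: quasi_sqrt_of_def)
  have "2 * cnorm A (a \<cdot> z) = cnorm A (cayley_op a b \<i> z \<oplus> cayley_op a b (- \<i>) z)"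
    using a z by (simp add: cayley_op_sum[OF ab z] norm_scale)
  also have "\<dots> \<le> cnorm A z + cnorm A z"
    using norm_triangle[OF lin_op_closed[OF cayley_op_lin[OF ab] z] lin_op_closed[OF cayley_op_lin[OF ab] z], of \<i> "- \<i>"]
    by (simp add: cayley_op_isometric[OF ab z])
  finally show ?thesis by simp
qed

end

text \<open>Cauchy's estimate at 0 on the circle of radius 1; the factor k! appears on both sides
  and cancels.\<close>

lemma norm_coeff_le_of_unit_circle:
  fixes S :: "complex poly"
  assumes "\<And>w. cmod w = 1 \<Longrightarrow> cmod (poly S w) \<le> M"
  shows "cmod (coeff S k) \<le> M"
proof -
  have "(deriv ^^ n) (poly S) = poly ((pderiv ^^ n) S)" for n
  proof (induction n)
    case (Suc n)
    have "deriv (poly ((pderiv ^^ n) S)) = poly (pderiv ((pderiv ^^ n) S))"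
      by (rule ext, rule DERIV_imp_deriv) (rule poly_DERIV)
    then show ?case by (simp add: Suc)
  qed simp
  then have d: "(deriv ^^ k) (poly S) 0 = fact k * coeff S k"
    by (simp add: poly_0_coeff_0 coeff_higher_pderiv pochhammer_fact)
  have "norm ((deriv ^^ k) (poly S) 0) \<le> fact k * M / 1 ^ k"
    using assms by (intro Cauchy_inequality) (auto intro!: holomorphic_intros continuous_intros)
  then show ?thesis by (simp add: d norm_mult)
qed

definition real_poly :: "complex poly \<Rightarrow> bool" where
  "real_poly Q \<longleftrightarrow> (\<forall>n. coeff Q n \<in> \<real>)"

lemma real_poly_mult: "real_poly P \<Longrightarrow> real_poly Q \<Longrightarrow> real_poly (P * Q)"
  unfolding real_poly_def by (auto simp: coeff_mult intro!: sum_in_Reals)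

lemma real_poly_power: "real_poly Q \<Longrightarrow> real_poly (Q ^ n)"
  by (induction n) (auto simp: real_poly_mult, simp add: real_poly_def)

lemma real_poly_pCons: "real_poly (pCons c Q) \<longleftrightarrow> c \<in> \<real> \<and> real_poly Q"
  unfolding real_poly_def by (metis coeff_pCons_0 coeff_pCons_Suc not0_implies_Suc)

context cstar_algebra
begin

text \<open>Since a = (U + U^-1)/2, multiplying Q(a) by U^d clears the negative powers and leaves a
  polynomial S in U. The exponent d is the number of coefficients and not the degree: it starts at 0
  for the zero polynomial and grows by exactly one in each induction step.\<close>

lemma cayley_poly:
  assumes ab: "quasi_sqrt_of a b"
  defines "U \<equiv> cayley_op a b \<i>"
  shows "\<exists>S. degree S \<le> 2 * length (coeffs Q) \<and>
     (\<forall>w. w \<noteq> 0 \<longrightarrow> poly S w = w ^ length (coeffs Q) * poly Q ((w + 1 / w) / 2)) \<and>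
     (\<forall>z\<in>carrier A. (U ^^ length (coeffs Q)) (poly_op (\<lambda>x. a \<cdot> x) Q z) = poly_op U S z)"
proof (induction Q)
  case 0
  show ?case by (rule exI[of _ 0]) simp
next
  case (pCons c Q)
  have a: "a \<in> carrier A" "b \<in> carrier A" "a \<cdot> b = b \<cdot> a" using ab by (auto simp: quasi_sqrt_of_def)
  have U: "lin_op U" unfolding U_def by (rule cayley_op_lin[OF ab])
  note Uc = lin_op_closed[OF U]
  have aU: "U (a \<cdot> z) = a \<cdot> U z" if "z \<in> carrier A" for z
    using a that by (simp add: U_def cayley_op_def mult_add_right mult_scale_right flip: cdiff_mult_right)
       (metis a(3) mult_assoc)
  \<comment> \<open>On vectors U a = (U^2 + 1)/2, that is a = (U + U^-1)/2 multiplied by U.\<close>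
  have UU: "U (a \<cdot> z) = (1/2) \<odot> (U (U z) \<oplus> z)" if z: "z \<in> carrier A" for z
  proof -
    have V: "cayley_op a b (- \<i>) z \<in> carrier A" using lin_op_closed[OF cayley_op_lin[OF ab] z] .
    have "U (U z) \<oplus> z = U (U z \<oplus> cayley_op a b (- \<i>) z)"
      using lin_op_add[OF U Uc[OF z] V] cayley_op_inverse[OF ab z, of \<i>] by (simp add: U_def)
    also have "\<dots> = 2 \<odot> U (a \<cdot> z)"
      using a z cayley_op_sum[OF ab z, of \<i>] lin_op_scale[OF U, of "a \<cdot> z" 2] by (simp add: U_def)
    finally show ?thesis using a z by (simp add: scale_scale scale_one Uc)
  qed
  define d where "d = length (coeffs Q)"
  obtain S where S: "degree S \<le> 2 * d"
    "\<And>w. w \<noteq> 0 \<Longrightarrow> poly S w = w ^ d * poly Q ((w + 1 / w) / 2)"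
    "\<And>z. z \<in> carrier A \<Longrightarrow> (U ^^ d) (poly_op (\<lambda>x. a \<cdot> x) Q z) = poly_op U S z"
    using pCons.IH unfolding d_def by blast
  have Udc: "(U ^^ n) z \<in> carrier A" if "z \<in> carrier A" for n z using that by (induction n) (auto simp: Uc)
  have Udlin: "lin_op (U ^^ n)" for n
    by (induction n) (auto simp: lin_op_def lin_op_add[OF U] lin_op_scale[OF U] Uc)
  have aUd: "(U ^^ n) (a \<cdot> z) = a \<cdot> (U ^^ n) z" if "z \<in> carrier A" for n z
    using that by (induction n) (auto simp: aU Udc)
  \<comment> \<open>For x = (w + 1/w)/2 one has w^(d+1) (c + x Q(x)) = c w^(d+1) + (1 + w^2)/2 w^d
    Q(x).\<close>
  define S' where "S' = monom c (Suc d) + [:1/2, 0, 1/2:] * S"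
  have len: "length (coeffs (pCons c Q)) = Suc d" using pCons.hyps by (auto simp: d_def cCons_def)
  have "degree S' \<le> 2 * Suc d"
  proof -
    have "degree ([:1/2, 0, 1/2:] * S) \<le> degree [:1/2, 0, 1/2 :: complex:] + degree S" by (rule degree_mult_le)
    also have "\<dots> \<le> 2 * Suc d" using S(1) by simp
    finally show ?thesis unfolding S'_def
      by (intro degree_add_le order.trans[OF degree_monom_le]) auto
  qed
  moreover have "poly S' w = w ^ Suc d * poly (pCons c Q) ((w + 1 / w) / 2)" if "w \<noteq> 0" for w
    using that S(2)[OF that] by (simp add: S'_def poly_monom field_simps)
  moreover have "(U ^^ Suc d) (poly_op (\<lambda>x. a \<cdot> x) (pCons c Q) z) = poly_op U S' z" if z: "z \<in> carrier A" for z
  proof -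
    define y where "y = poly_op (\<lambda>x. a \<cdot> x) Q z"
    have y: "y \<in> carrier A" using a z by (simp add: y_def lin_op_mult)
    have Sz: "poly_op U S z \<in> carrier A" using U z by simp
    have "(U ^^ Suc d) (poly_op (\<lambda>x. a \<cdot> x) (pCons c Q) z) = (U ^^ Suc d) ((c \<odot> z) \<oplus> (a \<cdot> y))"
      using a z by (simp add: poly_op_pCons lin_op_mult y_def)
    also have "\<dots> = (c \<odot> (U ^^ Suc d) z) \<oplus> U (a \<cdot> (U ^^ d) y)"
      using lin_op_add[OF Udlin, of "c \<odot> z" "a \<cdot> y" "Suc d"] lin_op_scale[OF Udlin z, of "Suc d" c] aUd[OF y, of d] a z y
      by simp
    also have "U (a \<cdot> (U ^^ d) y) = (1/2) \<odot> (U (U (poly_op U S z)) \<oplus> poly_op U S z)"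
      using UU[OF Udc[OF y], of d] unfolding y_def S(3)[OF z] .
    also have "\<dots> = poly_op U ([:1/2, 0, 1/2:] * S) z"
      using U z Sz by (simp add: poly_op_add poly_op_smult poly_op_mult poly_op_pCons
          lin_op_zero lin_op_add lin_op_scale Uc add_zero scale_add_right add_comm del: mult_pCons_left)
    finally show ?thesis using U z by (simp add: S'_def poly_op_add poly_op_monom)
  qed
  ultimately show ?case unfolding len by blast
qed

text \<open>S(U) differs from Q(a) by the isometry U^d, and on the unit circle |S(w)| = |Q(Re w)|
  with Re w in [-1, 1], so that \<open>M\<close> bounds every coefficient of S. There are at most 2
  d + 1 of them and d <= degree Q + 1; this is the origin of the factor 2 degree Q + 3.\<close>

lemma norm_poly_op_crude:
  assumes ab: "quasi_sqrt_of a b" and z: "z \<in> carrier A"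
    and M: "\<And>x::real. \<bar>x\<bar> \<le> 1 \<Longrightarrow> cmod (poly Q (of_real x)) \<le> M"
  shows "cnorm A (poly_op (\<lambda>x. a \<cdot> x) Q z) \<le> (2 * real (degree Q) + 3) * M * cnorm A z"
proof -
  define U where "U = cayley_op a b \<i>"
  define d where "d = length (coeffs Q)"
  have U: "lin_op U" unfolding U_def by (rule cayley_op_lin[OF ab])
  have Uiso: "\<And>x. x \<in> carrier A \<Longrightarrow> cnorm A (U x) = cnorm A x"
    unfolding U_def by (rule cayley_op_isometric[OF ab]) auto
  have Udc: "(U ^^ n) x \<in> carrier A" if "x \<in> carrier A" for n x
    using that by (induction n) (auto simp: lin_op_closed[OF U])
  have Udiso: "cnorm A ((U ^^ n) x) = cnorm A x" if "x \<in> carrier A" for n x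
    using that by (induction n) (auto simp: Uiso Udc)
  obtain S where S: "degree S \<le> 2 * d"
    "\<And>w. w \<noteq> 0 \<Longrightarrow> poly S w = w ^ d * poly Q ((w + 1 / w) / 2)"
    "\<And>z. z \<in> carrier A \<Longrightarrow> (U ^^ d) (poly_op (\<lambda>x. a \<cdot> x) Q z) = poly_op U S z"
    using cayley_poly[OF ab, of Q] unfolding U_def d_def by blast
  have a: "a \<in> carrier A" using ab by (simp add: quasi_sqrt_of_def)
  have M0: "0 \<le> M" using M[of 0] by (intro order_trans[OF norm_ge_zero]) simp
  have coe: "cmod (coeff S k) \<le> M" for k
  proof (rule norm_coeff_le_of_unit_circle)
    fix w :: complex assume w: "cmod w = 1"
    then have "w \<noteq> 0" by auto
    have "w * cnj w = 1" using w complex_norm_square[of w] by simp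
    then have "1 / w = cnj w" using \<open>w \<noteq> 0\<close> by (simp add: field_simps)
    then have "(w + 1 / w) / 2 = of_real (Re w)" by (simp add: complex_add_cnj)
    moreover have "\<bar>Re w\<bar> \<le> 1" using abs_Re_le_cmod[of w] w by simp
    ultimately have "cmod (poly Q ((w + 1 / w) / 2)) \<le> M" using M[of "Re w"] by simp
    then show "cmod (poly S w) \<le> M" using w unfolding S(2)[OF \<open>w \<noteq> 0\<close>] real_normed_div_algebra_class.norm_mult norm_power by simp
  qed
  have "length (coeffs S) \<le> 2 * d + 1" using S(1) by (cases "S = 0") (auto simp: length_coeffs)
  moreover have "d \<le> degree Q + 1" unfolding d_def by (cases "Q = 0") (auto simp: length_coeffs)
  ultimately have len: "real (length (coeffs S)) \<le> 2 * real (degree Q) + 3" by linarith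
  have "cnorm A (poly_op (\<lambda>x. a \<cdot> x) Q z) = cnorm A (poly_op U S z)"
    using S(3)[OF z] Udiso[of "poly_op (\<lambda>x. a \<cdot> x) Q z" d] a z by (simp add: lin_op_mult)
  also have "\<dots> \<le> real (length (coeffs S)) * M * cnorm A z"
    by (rule norm_poly_op_le[OF U z Uiso coe])
  also have "\<dots> \<le> (2 * real (degree Q) + 3) * M * cnorm A z"
    using len M0 z norm_nonneg by (intro mult_right_mono) auto
  finally show ?thesis .
qed

text \<open>For real coefficients Q(a) is self-adjoint. As Q(a) need not lie in the algebra, this is
  expressed by moving it across a product.\<close>

lemma poly_op_adj:
  assumes "a \<in> carrier A" "cadj A a = a" "real_poly Q" "y \<in> carrier A" "z \<in> carrier A"
  shows "cadj A (poly_op (\<lambda>x. a \<cdot> x) Q z) \<cdot> y = cadj A z \<cdot> poly_op (\<lambda>x. a \<cdot> x) Q y"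
  using assms(3-5)
proof (induction Q arbitrary: y z)
  case (pCons c Q)
  have T: "lin_op (\<lambda>x. a \<cdot> x)" using assms(1) by (rule lin_op_mult)
  have c: "cnj c = c" and Q: "real_poly Q" using pCons.prems(1) by (auto simp: real_poly_pCons Reals_cnj_iff)
  have "a \<cdot> poly_op (\<lambda>x. a \<cdot> x) Q z = poly_op (\<lambda>x. a \<cdot> x) Q (a \<cdot> z)"
    using poly_op_commute[OF T T refl pCons.prems(3)] .
  then have "cadj A (poly_op (\<lambda>x. a \<cdot> x) (pCons c Q) z) \<cdot> y
      = (c \<odot> (cadj A z \<cdot> y)) \<oplus> (cadj A (poly_op (\<lambda>x. a \<cdot> x) Q (a \<cdot> z)) \<cdot> y)"
    using assms(1,2) T pCons.prems
    by (simp add: poly_op_pCons adj_add adj_scale c mult_add_left mult_scale_left)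
  also have "\<dots> = (c \<odot> (cadj A z \<cdot> y)) \<oplus> (cadj A (a \<cdot> z) \<cdot> poly_op (\<lambda>x. a \<cdot> x) Q y)"
    using pCons.IH[OF Q, of y "a \<cdot> z"] assms(1) pCons.prems by simp
  also have "\<dots> = cadj A z \<cdot> poly_op (\<lambda>x. a \<cdot> x) (pCons c Q) y"
    using assms(1,2) T pCons.prems
    by (simp add: poly_op_pCons mult_add_right mult_scale_right adj_mult mult_assoc)
  finally show ?case .
qed auto

text \<open>The crude bound is linear in the degree, so that applying it to \<open>Q\<^bsup>2\<^sup>n\<^esup>\<close> and taking roots by
  means of the C*-identity removes the factor.\<close>

lemma norm_poly_op_unit_interval:
  assumes ab: "quasi_sqrt_of a b" and z: "z \<in> carrier A" and Q: "real_poly Q"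
    and M: "\<And>x::real. \<bar>x\<bar> \<le> 1 \<Longrightarrow> cmod (poly Q (of_real x)) \<le> M" and M0: "0 < M"
  shows "cnorm A (poly_op (\<lambda>x. a \<cdot> x) Q z) \<le> M * cnorm A z"
proof (rule ccontr)
  let ?P = "poly_op (\<lambda>x. a \<cdot> x)"
  have a: "a \<in> carrier A" "cadj A a = a" using ab by (auto simp: quasi_sqrt_of_def)
  have T: "lin_op (\<lambda>x. a \<cdot> x)" using a(1) by (rule lin_op_mult)
  assume neg: "\<not> cnorm A (?P Q z) \<le> M * cnorm A z"
  have zpos: "0 < cnorm A z"
  proof (rule ccontr)
    assume "\<not> 0 < cnorm A z"
    then have "z = \<zero>" using norm_nonneg[OF z] norm_eq_zero[OF z] by linarith
    moreover have "?P Q \<zero> = \<zero>"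
      using poly_op_scale_vec[OF T zero_closed, of Q 0] T by simp
    ultimately show False using neg by simp
  qed
  define t where "t = cnorm A (?P Q z) / cnorm A z"
  have t: "M < t" "0 \<le> t" using neg zpos M0 T z by (auto simp: t_def field_simps norm_nonneg)
  \<comment> \<open>With R(a) for the operator, ||R(a) z||^2 = ||z* R(a)^2 z|| <= ||z|| ||R(a)^2
    z||: squaring the polynomial at least squares the ratio \<open>t\<close> of the norms.\<close>
  have pow: "t ^ (2 ^ n) * cnorm A z \<le> cnorm A (?P (Q ^ (2 ^ n)) z)" for n
  proof (induction n)
    case 0
    then show ?case using zpos by (simp add: t_def)
  next
    case (Suc n)
    define R where "R = Q ^ (2 ^ n)"
    have R: "real_poly R" using Q by (simp add: R_def real_poly_power)
    have "(t ^ (2 ^ n) * cnorm A z)\<^sup>2 \<le> (cnorm A (?P R z))\<^sup>2"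
      using Suc t(2) zpos by (intro power_mono) (auto simp: R_def)
    also have "\<dots> = cnorm A (cadj A (?P R z) \<cdot> ?P R z)" using T z by (simp add: cstar_identity)
    also have "\<dots> = cnorm A (cadj A z \<cdot> ?P (R * R) z)"
      using poly_op_adj[OF a R _ z] T z by (simp add: poly_op_mult)
    also have "\<dots> \<le> cnorm A z * cnorm A (?P (R * R) z)"
      using norm_mult[of "cadj A z" "?P (R * R) z"] T z by simp
    finally have "t ^ (2 ^ n) * (t ^ (2 ^ n)) * cnorm A z \<le> cnorm A (?P (R * R) z)"
      using zpos by (simp add: power2_eq_square mult_ac)
    then show ?case by (simp add: R_def mult_2 flip: power_add)
  qed
  define D where "D = 2 * real (degree Q) + 3"
  have bound: "(t / M) ^ (2 ^ n) \<le> D * 2 ^ n" for n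
  proof -
    have "cmod (poly (Q ^ (2 ^ n)) (of_real x)) \<le> M ^ (2 ^ n)" if "\<bar>x\<bar> \<le> 1" for x :: real
      using M[OF that] by (simp add: norm_power power_mono)
    from norm_poly_op_crude[OF ab z this]
    have "cnorm A (?P (Q ^ (2 ^ n)) z) \<le> (2 * real (degree (Q ^ (2 ^ n))) + 3) * M ^ (2 ^ n) * cnorm A z" .
    with pow[of n] have "t ^ (2 ^ n) * cnorm A z \<le> (2 * real (degree (Q ^ (2 ^ n))) + 3) * M ^ (2 ^ n) * cnorm A z"
      by linarith
    then have "t ^ (2 ^ n) \<le> (2 * real (degree (Q ^ (2 ^ n))) + 3) * M ^ (2 ^ n)" using zpos by simp
    also have "\<dots> \<le> (D * 2 ^ n) * M ^ (2 ^ n)"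
    proof -
      have "degree (Q ^ (2 ^ n)) \<le> degree Q * 2 ^ n" by (rule degree_power_le)
      then have "real (degree (Q ^ (2 ^ n))) \<le> real (degree Q * 2 ^ n)" by (rule of_nat_mono)
      moreover have "1 \<le> (2::real) ^ n" by simp
      ultimately have "2 * real (degree (Q ^ (2 ^ n))) + 3 \<le> D * 2 ^ n"
        by (simp only: D_def distrib_right of_nat_mult of_nat_power of_nat_numeral)
      then show ?thesis using M0 by (intro mult_right_mono) auto
    qed
    finally show ?thesis using M0 by (simp add: power_divide field_simps)
  qed
  \<comment> \<open>In \<open>bound\<close> the left side is exponential in 2^n and the right side
    linear in 2^n, so t / M > 1 is contradicted at the index 2^N.\<close>
  have "((\<lambda>n. real n / (t / M) ^ n) \<longlongrightarrow> 0) sequentially"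
    using t M0 by (intro lim_n_over_pown) simp
  then have "eventually (\<lambda>n. real n / (t / M) ^ n < 1 / D) sequentially"
    by (rule order_tendstoD) (simp add: D_def add_pos_nonneg)
  then obtain N where N: "\<And>n. n \<ge> N \<Longrightarrow> real n / (t / M) ^ n < 1 / D" by (auto simp: eventually_sequentially)
  have "N \<le> 2 ^ N" by (rule less_imp_le[OF less_exp])
  from N[OF this] have "D * 2 ^ N < (t / M) ^ (2 ^ N)"
    using t M0 by (simp add: D_def field_simps add_pos_nonneg)
  with bound[of N] show False by simp
qed

text \<open>Rescaling by \<open>s\<close> reduces the claim to the interval [-1, 1]. The strict
  inequality ||a|| < s gives a / s norm below 1 and thereby a quasi-square-root.\<close>

lemma norm_poly_op_self_adjoint:
  assumes a: "a \<in> carrier A" "cadj A a = a" "cnorm A a < s" and z: "z \<in> carrier A" and Q: "real_poly Q"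
    and M: "\<And>x::real. \<bar>x\<bar> \<le> s \<Longrightarrow> cmod (poly Q (of_real x)) \<le> M" and M0: "0 < M"
  shows "cnorm A (poly_op (\<lambda>x. a \<cdot> x) Q z) \<le> M * cnorm A z"
proof -
  have s: "0 < s" using a norm_nonneg[of a] by simp
  define a' where "a' = of_real (1 / s) \<odot> a"
  have a': "a' \<in> carrier A" "cadj A a' = a'" "cnorm A a' < 1"
    using a s by (auto simp: a'_def adj_scale norm_scale norm_divide)
  from quasi_sqrt[OF this] obtain b where "quasi_sqrt_of a' b"
    using a' unfolding quasi_sqrt_of_def by metis
  moreover have "real_poly (pcompose Q [:0, of_real s:])"
  proof -
    have "real_poly (pcompose P [:0, of_real s:])" if "real_poly P" for P using that
      by (induction P) (auto simp: pcompose_pCons real_poly_pCons real_poly_def coeff_pCons split: nat.splits)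
    then show ?thesis using Q .
  qed
  moreover have "cmod (poly (pcompose Q [:0, of_real s:]) (of_real x)) \<le> M" if "\<bar>x\<bar> \<le> 1" for x :: real
    using M[of "x * s"] that s by (simp add: poly_pcompose abs_mult mult_le_cancel_right2)
  ultimately have "cnorm A (poly_op (\<lambda>x. a' \<cdot> x) (pcompose Q [:0, of_real s:]) z) \<le> M * cnorm A z"
    using norm_poly_op_unit_interval z M0 by blast
  moreover have "of_real s \<odot> a' = a" using a s by (simp add: a'_def scale_scale scale_one)
  ultimately show ?thesis
    using poly_op_pcompose_scale[OF a'(1) z, of "of_real s" Q] by simp
qed

end

section \<open>Injective homomorphisms are isometric\<close>

lemma star_homD:
  assumes "star_hom A B f"
  shows star_hom_closed: "x \<in> carrier A \<Longrightarrow> f x \<in> carrier B"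
    and star_hom_add: "x \<in> carrier A \<Longrightarrow> y \<in> carrier A \<Longrightarrow> f (x \<oplus>\<^bsub>A\<^esub> y) = f x \<oplus>\<^bsub>B\<^esub> f y"
    and star_hom_scale: "x \<in> carrier A \<Longrightarrow> f (c \<odot>\<^bsub>A\<^esub> x) = c \<odot>\<^bsub>B\<^esub> f x"
    and star_hom_mult: "x \<in> carrier A \<Longrightarrow> y \<in> carrier A \<Longrightarrow> f (x \<cdot>\<^bsub>A\<^esub> y) = f x \<cdot>\<^bsub>B\<^esub> f y"
    and star_hom_adj: "x \<in> carrier A \<Longrightarrow> f (cadj A x) = cadj B (f x)"
  using assms by (auto simp: star_hom_def)

lemma star_hom_cdiff:
  assumes "cstar_algebra A" "star_hom A B f" "x \<in> carrier A" "y \<in> carrier A"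
  shows "f (cdiff A x y) = cdiff B (f x) (f y)"
  using assms cstar_algebra.scale_closed[OF assms(1)]
  by (simp add: cdiff_def star_hom_add star_hom_scale)

lemma star_hom_zero:
  assumes "cstar_algebra A" "cstar_algebra B" "star_hom A B f"
  shows "f \<zero>\<^bsub>A\<^esub> = \<zero>\<^bsub>B\<^esub>"
  using assms cstar_algebra.scale_zero_left[OF assms(1)] cstar_algebra.scale_zero_left[OF assms(2)]
  by (metis cstar_algebra.zero_closed star_hom_closed star_hom_scale)

text \<open>Spectra are avoided: a *-homomorphism carries a quasi-square-root of a to one of f a, so
  multiplication by f a is a contraction. Applied to f a itself this gives ||f a||^2 <= ||f a||,
  hence ||f a|| <= 1 whenever a is self-adjoint of norm below 1. Scaling and the C*-identity give
  the general case.\<close>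

lemma star_hom_contractive:
  assumes A: "cstar_algebra A" and B: "cstar_algebra B" and f: "star_hom A B f" and x: "x \<in> carrier A"
  shows "cnorm B (f x) \<le> cnorm A x"
proof -
  interpret A: cstar_algebra A by (rule A)
  interpret B: cstar_algebra B by (rule B)
  have unit: "cnorm B (f a) \<le> 1" if a: "a \<in> carrier A" "cadj A a = a" "cnorm A a < 1" for a
  proof -
    obtain b where b: "b \<in> carrier A" "cadj A b = b" "a \<cdot>\<^bsub>A\<^esub> b = b \<cdot>\<^bsub>A\<^esub> a"
      "b \<oplus>\<^bsub>A\<^esub> b = (a \<cdot>\<^bsub>A\<^esub> a) \<oplus>\<^bsub>A\<^esub> (b \<cdot>\<^bsub>A\<^esub> b)"
      using A.quasi_sqrt[OF a] by blast
    have fb: "f b \<oplus>\<^bsub>B\<^esub> f b = (f a \<cdot>\<^bsub>B\<^esub> f a) \<oplus>\<^bsub>B\<^esub> (f b \<cdot>\<^bsub>B\<^esub> f b)"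
      using arg_cong[OF b(4), of f] a b(1) f
      by (simp add: star_hom_add[OF f] star_hom_mult[OF f])
    have "B.quasi_sqrt_of (f a) (f b)"
      unfolding B.quasi_sqrt_of_def
      using a b fb star_hom_adj[OF f a(1)] star_hom_adj[OF f b(1)] star_hom_mult[OF f a(1) b(1)]
        star_hom_mult[OF f b(1) a(1)]
      by (simp add: star_hom_closed[OF f])
    from B.norm_quasi_sqrt_mult_le[OF this star_hom_closed[OF f a(1)]]
    have "cnorm B (f a) * cnorm B (f a) \<le> cnorm B (f a)"
      using B.cstar_identity[OF star_hom_closed[OF f a(1)]] star_hom_adj[OF f a(1)] a
      by (simp add: power2_eq_square)
    moreover have False if "1 < cnorm B (f a)" "cnorm B (f a) * cnorm B (f a) \<le> cnorm B (f a)"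
      using mult_strict_right_mono[OF that(1), of "cnorm B (f a)"] that by simp
    ultimately show ?thesis by (meson not_less)
  qed
  have sa: "cnorm B (f a) \<le> cnorm A a" if a: "a \<in> carrier A" "cadj A a = a" for a
  proof (rule dense_ge)
    fix s assume s: "cnorm A a < s"
    then have s0: "0 < s" using A.norm_nonneg[OF a(1)] by simp
    have "cnorm B (f (of_real (1 / s) \<odot>\<^bsub>A\<^esub> a)) \<le> 1"
      using a s s0 by (intro unit) (auto simp: A.adj_scale A.norm_scale norm_divide)
    then show "cnorm B (f a) \<le> s" using a s0
      by (simp add: star_hom_scale[OF f] B.norm_scale star_hom_closed[OF f] norm_divide field_simps)
  qed
  have "(cnorm B (f x))\<^sup>2 = cnorm B (f (cadj A x \<cdot>\<^bsub>A\<^esub> x))"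
    using x by (simp add: star_hom_mult[OF f] star_hom_adj[OF f] B.cstar_identity star_hom_closed[OF f])
  also have "\<dots> \<le> cnorm A (cadj A x \<cdot>\<^bsub>A\<^esub> x)"
    using x by (intro sa) (auto simp: A.adj_mult A.adj_adj)
  also have "\<dots> = (cnorm A x)\<^sup>2" using x by (simp add: A.cstar_identity)
  finally show ?thesis using A.norm_nonneg[OF x] by (rule power2_le_imp_le)
qed

lemma star_hom_poly_op:
  assumes A: "cstar_algebra A" and B: "cstar_algebra B" and f: "star_hom A B f"
    and a: "a \<in> carrier A" and z: "z \<in> carrier A"
  shows "f (cstar_algebra.poly_op A (\<lambda>x. a \<cdot>\<^bsub>A\<^esub> x) Q z) = cstar_algebra.poly_op B (\<lambda>x. f a \<cdot>\<^bsub>B\<^esub> x) Q (f z)"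
proof -
  interpret A: cstar_algebra A by (rule A)
  interpret B: cstar_algebra B by (rule B)
  note T = A.lin_op_mult[OF a] and T' = B.lin_op_mult[OF star_hom_closed[OF f a]]
  show ?thesis using a z
    by (induction Q)
      (simp_all add: star_hom_zero[OF A B f] A.poly_op_pCons[OF T] B.poly_op_pCons[OF T']
        star_hom_closed[OF f] star_hom_add[OF f] star_hom_scale[OF f] star_hom_mult[OF f] A.poly_op_closed[OF T])
qed

text \<open>The real form of the Stone-Weierstrass theorem, so that the coefficients are real and
  the bound for self-adjoint elements applies.\<close>

lemma approx_real_poly:
  fixes g :: "real \<Rightarrow> real"
  assumes g: "continuous_on {-s..s} g" and e: "0 < e"
  obtains Q where "real_poly Q" "\<And>x. \<bar>x\<bar> \<le> s \<Longrightarrow> cmod (of_real (g x) - poly Q (of_real x)) < e"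
proof -
  obtain h where h: "real_polynomial_function h" "\<And>x. x \<in> {-s..s} \<Longrightarrow> \<bar>g x - h x\<bar> < e"
    using Stone_Weierstrass_real_polynomial_function[OF _ g e] by auto
  then obtain a n where an: "h = (\<lambda>x. \<Sum>i\<le>n. a i * x ^ i)"
    by (auto simp: real_polynomial_function_iff_sum)
  define Q :: "complex poly" where "Q = (\<Sum>i\<le>n. monom (of_real (a i)) i)"
  have "poly Q (of_real x) = of_real (h x)" for x
    by (simp add: Q_def an poly_sum poly_monom)
  moreover have "real_poly Q" unfolding real_poly_def Q_def by (auto simp: coeff_sum intro!: sum_in_Reals)
  ultimately show ?thesis
    using that[of Q] h(2) by (metis abs_le_iff atLeastAtMost_iff minus_le_iff norm_of_real of_real_diff)
qed

text \<open>For self-adjoint a with ||f a|| < r1 < r2 < ||a|| let g vanish on [-r1, r1] and be 1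
  beyond r2. Then g(a) a is mapped to g(f a) f a = 0, so it is 0 by injectivity; but then a^2 = a (1
  - g(a)) a has norm at most r2 ||a||, which is less than ||a||^2. A limit of polynomials takes the
  place of g(a) a.\<close>

theorem star_mono_isometric:
  assumes A: "cstar_algebra A" and B: "cstar_algebra B" and f: "star_mono A B f" and x: "x \<in> carrier A"
  shows "cnorm B (f x) = cnorm A x"
proof -
  interpret A: cstar_algebra A by (rule A)
  interpret B: cstar_algebra B by (rule B)
  have h: "star_hom A B f" and inj: "inj_on f (carrier A)" using f by (auto simp: star_mono_def)
  note fc = star_hom_closed[OF h]
  have sa: "cnorm A a \<le> cnorm B (f a)" if a: "a \<in> carrier A" "cadj A a = a" for a
  proof (rule ccontr)
    assume "\<not> cnorm A a \<le> cnorm B (f a)"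
    then obtain r2 where r2: "cnorm B (f a) < r2" "r2 < cnorm A a" using dense by (metis not_less)
    then obtain r1 where r1: "cnorm B (f a) < r1" "r1 < r2" using dense by blast
    define s where "s = cnorm A a + 1"
    have r0: "0 < r1" using B.norm_nonneg[OF fc[OF a(1)]] r1 by simp
    \<comment> \<open>A piecewise linear cut-off. The product x (1 - g x) stays within [-r2, r2]
      because its second factor vanishes for |x| >= r2.\<close>
    define g where "g x = min 1 (max 0 ((\<bar>x\<bar> - r1) / (r2 - r1)))" for x :: real
    have g: "continuous_on {-s..s} g" unfolding g_def using r1 by (intro continuous_intros) auto
    have g0: "g x = 0" if "\<bar>x\<bar> \<le> r1" for x using that r1 by (simp add: g_def divide_le_0_iff)
    have g1: "\<bar>x * (1 - g x)\<bar> \<le> r2" for x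
    proof (cases "\<bar>x\<bar> \<le> r2")
      case True
      have "\<bar>1 - g x\<bar> \<le> 1" by (auto simp: g_def)
      then have "\<bar>x\<bar> * \<bar>1 - g x\<bar> \<le> r2 * 1" using True by (intro mult_mono) auto
      then show ?thesis by (simp add: abs_mult)
    next
      case False
      then have "1 \<le> (\<bar>x\<bar> - r1) / (r2 - r1)" using r1 by simp
      then show ?thesis using r1 r0 by (simp add: g_def)
    qed
    have "\<exists>Q. real_poly Q \<and> (\<forall>x. \<bar>x\<bar> \<le> s \<longrightarrow> cmod (of_real (g x) - poly Q (of_real x)) < 1 / real (Suc n))" for n
      by (rule approx_real_poly[OF g, of "1 / real (Suc n)"]) auto
    then obtain Q where Q: "\<And>n. real_poly (Q n)"
      "\<And>n x. \<bar>x\<bar> \<le> s \<Longrightarrow> cmod (of_real (g x) - poly (Q n) (of_real x)) < 1 / real (Suc n)"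
      by metis
    \<comment> \<open>This is R(a) a and not R(a): the trailing factor keeps the expression inside
      the algebra.\<close>
    define P where "P R = A.poly_op (\<lambda>x. a \<cdot>\<^bsub>A\<^esub> x) R a" for R
    have T: "A.lin_op (\<lambda>x. a \<cdot>\<^bsub>A\<^esub> x)" using a by (intro A.lin_op_mult)
    have Pc: "P R \<in> carrier A" for R using T a by (simp add: P_def)
    have Pdiff: "cdiff A (P R) (P R') = P (R - R')" for R R'
      using A.poly_op_add[OF T a(1), of R "smult (-1) R'"] A.poly_op_smult[OF T a(1), of "-1" R']
      by (simp add: P_def cdiff_def)
    have bound: "cnorm A (P R) \<le> M * cnorm A a"
      if "real_poly R" "0 < M" "\<And>x. \<bar>x\<bar> \<le> s \<Longrightarrow> cmod (poly R (of_real x)) \<le> M" for R M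
      unfolding P_def using that a by (intro A.norm_poly_op_self_adjoint[of a s]) (auto simp: s_def)
    have inv0: "(\<lambda>n. 1 / real (Suc n)) \<longlonglongrightarrow> 0"
      using LIMSEQ_inverse_real_of_nat by (simp add: inverse_eq_divide)
    have rdiff: "real_poly (R - R')" if "real_poly R" "real_poly R'" for R R'
      using that by (auto simp: real_poly_def)
    have "ccauchy A (\<lambda>n. P (Q n))" unfolding ccauchy_def
    proof (intro allI impI)
      fix e :: real assume "0 < e"
      define e' where "e' = e / (2 * (cnorm A a + 1))"
      have na: "0 \<le> cnorm A a" using A.norm_nonneg a by simp
      then have e': "0 < e'" using \<open>0 < e\<close> by (simp add: e'_def)
      obtain N where N: "\<And>n. n \<ge> N \<Longrightarrow> 1 / real (Suc n) < e'"
        using order_tendstoD(2)[OF inv0 e'] by (auto simp: eventually_sequentially)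
      show "\<exists>N. \<forall>m\<ge>N. \<forall>n\<ge>N. cnorm A (cdiff A (P (Q m)) (P (Q n))) < e"
      proof (intro exI[of _ N] allI impI)
        fix m n assume mn: "N \<le> m" "N \<le> n"
        have "cmod (poly (Q m - Q n) (of_real x)) \<le> 2 * e'" if "\<bar>x\<bar> \<le> s" for x
        proof -
          have "poly (Q m - Q n) (of_real x) =
             (of_real (g x) - poly (Q n) (of_real x)) - (of_real (g x) - poly (Q m) (of_real x))" by simp
          then have "cmod (poly (Q m - Q n) (of_real x)) \<le>
             cmod (of_real (g x) - poly (Q n) (of_real x)) + cmod (of_real (g x) - poly (Q m) (of_real x))"
            by (metis norm_triangle_ineq4)
          also have "\<dots> \<le> 2 * e'" using Q(2)[OF that, of m] Q(2)[OF that, of n] N[OF mn(1)] N[OF mn(2)] by linarith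
          finally show ?thesis .
        qed
        then have "cnorm A (cdiff A (P (Q m)) (P (Q n))) \<le> 2 * e' * cnorm A a"
          unfolding Pdiff using e' Q(1) by (intro bound rdiff) auto
        also have "\<dots> < e" using \<open>0 < e\<close> na by (simp add: e'_def field_simps)
        finally show "cnorm A (cdiff A (P (Q m)) (P (Q n))) < e" .
      qed
    qed
    \<comment> \<open>\<open>c\<close> plays the part of g(a) a.\<close>
    from A.complete[OF Pc this] obtain c where c: "c \<in> carrier A" "cconverges A (\<lambda>n. P (Q n)) c" by blast
    have "cconverges B (\<lambda>n. f (P (Q n))) (f c)"
    proof (rule B.converges_bound[OF c(2)[unfolded cconverges_def]])
      fix n show "cnorm B (cdiff B (f (P (Q n))) (f c)) \<le> cnorm A (cdiff A (P (Q n)) c)"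
        using star_hom_contractive[OF A B h, of "cdiff A (P (Q n)) c"] Pc c
        by (simp add: star_hom_cdiff[OF A h])
    qed (use fc Pc c in auto)
    \<comment> \<open>Here ||f a|| < r1 enters: on [-r1, r1] the polynomial \<open>Q n\<close> is
      within 1/(n+1) of g = 0.\<close>
    moreover have "cconverges B (\<lambda>n. f (P (Q n))) \<zero>\<^bsub>B\<^esub>"
    proof (rule B.converges_bound)
      show "(\<lambda>n. 1 / real (Suc n) * cnorm B (f a)) \<longlonglongrightarrow> 0"
        using tendsto_mult_right[OF inv0, of "cnorm B (f a)"] by simp
      fix n
      have "cnorm B (B.poly_op (\<lambda>x. f a \<cdot>\<^bsub>B\<^esub> x) (Q n) (f a)) \<le> 1 / real (Suc n) * cnorm B (f a)"
      proof (rule B.norm_poly_op_self_adjoint[OF _ _ r1(1)])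
        fix x :: real assume "\<bar>x\<bar> \<le> r1"
        then show "cmod (poly (Q n) (of_real x)) \<le> 1 / real (Suc n)"
          using Q(2)[of x n] g0[of x] r1 r2 by (simp add: s_def)
      qed (use a fc Q star_hom_adj[OF h, of a] in auto)
      then have "cnorm B (f (P (Q n))) \<le> 1 / real (Suc n) * cnorm B (f a)"
        unfolding P_def star_hom_poly_op[OF A B h a(1) a(1)] .
      then show "cnorm B (cdiff B (f (P (Q n))) \<zero>\<^bsub>B\<^esub>) \<le> 1 / real (Suc n) * cnorm B (f a)"
        using B.cdiff_zero_right[OF fc[OF Pc]] by simp
    qed (use fc Pc in auto)
    ultimately have "f c = \<zero>\<^bsub>B\<^esub>" using fc Pc c by (intro B.converges_unique[of "\<lambda>n. f (P (Q n))"]) auto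
    then have "c = \<zero>\<^bsub>A\<^esub>" using inj c star_hom_zero[OF A B h] by (metis A.zero_closed inj_onD)
    then have c0: "(\<lambda>n. cnorm A (P (Q n))) \<longlonglongrightarrow> 0" using A.converges_norm[OF Pc c] by simp
    \<comment> \<open>Split a a into a Q_n(a) a and a (1 - Q_n(a)) a. On [-s, s] the polynomial x (1
      - Q_n(x)) of the second part is at most r2 + s/(n+1), by \<open>g1\<close> and the error of
      approximation.\<close>
    have "cnorm A a * cnorm A a \<le> (r2 + s * (1 / real (Suc n))) * cnorm A a + cnorm A a * cnorm A (P (Q n))" for n
    proof -
      have "P (pCons 0 (1 - Q n)) = cdiff A (a \<cdot>\<^bsub>A\<^esub> a) (a \<cdot>\<^bsub>A\<^esub> P (Q n))"
      proof -
        have "P 1 = a" using T a A.poly_op_pCons[OF T a(1), of 1 0]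
          by (simp add: P_def A.scale_one one_pCons A.add_zero)
        then have "P (1 - Q n) = cdiff A a (P (Q n))" using Pdiff[of 1 "Q n"] by simp
        moreover have "P (pCons 0 (1 - Q n)) = a \<cdot>\<^bsub>A\<^esub> P (1 - Q n)"
          using T a Pc unfolding P_def by (simp add: A.poly_op_pCons)
        ultimately show ?thesis using a Pc by (simp add: A.cdiff_mult_right)
      qed
      moreover have "cnorm A (P (pCons 0 (1 - Q n))) \<le> (r2 + s * (1 / real (Suc n))) * cnorm A a"
      proof (rule bound)
        have "real_poly 1" by (auto simp: real_poly_def)
        then show "real_poly (pCons 0 (1 - Q n))" using rdiff Q(1) by (simp add: real_poly_pCons)
        show "0 < r2 + s * (1 / real (Suc n))" using r0 r1 A.norm_nonneg[OF a(1)]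
          by (intro add_pos_nonneg) (auto simp: s_def)
        fix x :: real assume x: "\<bar>x\<bar> \<le> s"
        have "poly (pCons 0 (1 - Q n)) (of_real x) =
          of_real (x * (1 - g x)) + of_real x * (of_real (g x) - poly (Q n) (of_real x))"
          by (simp add: algebra_simps)
        then have "cmod (poly (pCons 0 (1 - Q n)) (of_real x)) \<le>
           cmod (of_real (x * (1 - g x))) + cmod (of_real x * (of_real (g x) - poly (Q n) (of_real x)))"
          by (metis norm_triangle_ineq)
        also have "\<dots> \<le> r2 + s * (1 / real (Suc n))"
          unfolding norm_mult norm_of_real using g1[of x] x less_imp_le[OF Q(2)[OF x, of n]] by (intro add_mono mult_mono) auto
        finally show "cmod (poly (pCons 0 (1 - Q n)) (of_real x)) \<le> r2 + s * (1 / real (Suc n))" .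
      qed
      moreover have "cnorm A (a \<cdot>\<^bsub>A\<^esub> a) \<le> cnorm A (a \<cdot>\<^bsub>A\<^esub> P (Q n)) + cnorm A (cdiff A (a \<cdot>\<^bsub>A\<^esub> a) (a \<cdot>\<^bsub>A\<^esub> P (Q n)))"
        using A.norm_le_cdiff a Pc by simp
      moreover have "cnorm A (a \<cdot>\<^bsub>A\<^esub> P (Q n)) \<le> cnorm A a * cnorm A (P (Q n))"
        using A.norm_mult a Pc by simp
      moreover have "cnorm A (a \<cdot>\<^bsub>A\<^esub> a) = cnorm A a * cnorm A a"
        using A.cstar_identity[OF a(1)] a(2) by (simp add: power2_eq_square)
      ultimately show ?thesis by simp
    qed
    moreover have "(\<lambda>n. (r2 + s * (1 / real (Suc n))) * cnorm A a + cnorm A a * cnorm A (P (Q n)))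
        \<longlonglongrightarrow> (r2 + s * 0) * cnorm A a + cnorm A a * 0"
      by (intro tendsto_intros inv0 c0)
    ultimately have "cnorm A a * cnorm A a \<le> r2 * cnorm A a"
      by (intro tendsto_lowerbound[of _ _ sequentially]) auto
    then show False using r2 r1 r0 by simp
  qed
  have "(cnorm A x)\<^sup>2 = cnorm A (cadj A x \<cdot>\<^bsub>A\<^esub> x)" using x by (simp add: A.cstar_identity)
  also have "\<dots> \<le> cnorm B (f (cadj A x \<cdot>\<^bsub>A\<^esub> x))"
    using x by (intro sa) (auto simp: A.adj_mult A.adj_adj)
  also have "\<dots> = (cnorm B (f x))\<^sup>2"
    using x by (simp add: star_hom_mult[OF h] star_hom_adj[OF h] B.cstar_identity fc)
  finally have "cnorm A x \<le> cnorm B (f x)" using B.norm_nonneg[OF fc[OF x]] by (rule power2_le_imp_le)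
  then show ?thesis using star_hom_contractive[OF A B h x] by simp
qed

section \<open>Extension of isometric *-homomorphisms from dense subsets\<close>

definition cdense :: "('a, 'm) cstar_scheme \<Rightarrow> 'a set \<Rightarrow> bool" where
  "cdense A S \<longleftrightarrow> S \<subseteq> carrier A \<and> (\<forall>x\<in>carrier A. \<forall>e>0. \<exists>y\<in>S. cnorm A (cdiff A x y) < e)"

lemma star_hom_eq_on_dense:
  assumes L: "cstar_algebra L" and M: "cstar_algebra M" and h: "star_hom L M h" "star_hom L M h'"
    and S: "cdense L S" "\<And>x. x \<in> S \<Longrightarrow> h x = h' x" and x: "x \<in> carrier L"
  shows "h x = h' x"
proof -
  interpret L: cstar_algebra L by (rule L)
  interpret M: cstar_algebra M by (rule M)
  have SL: "S \<subseteq> carrier L" using S(1) by (simp add: cdense_def)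
  obtain X where X: "\<And>n. X n \<in> S" "cconverges L X x"
    using L.approx_sequence[OF x _ SL] S(1) x unfolding cdense_def by blast
  then have Xc: "X n \<in> carrier L" for n using SL by blast
  have *: "cconverges M (\<lambda>n. k (X n)) (k x)" if k: "star_hom L M k" for k
  proof (rule M.converges_bound[OF X(2)[unfolded cconverges_def]])
    fix n show "cnorm M (cdiff M (k (X n)) (k x)) \<le> cnorm L (cdiff L (X n) x)"
      using star_hom_contractive[OF L M k, of "cdiff L (X n) x"] Xc x by (simp add: star_hom_cdiff[OF L k])
  qed (use star_hom_closed[OF k] Xc x in auto)
  show ?thesis
  proof (rule M.converges_unique)
    show "cconverges M (\<lambda>n. h (X n)) (h x)" using *[OF h(1)] .
    show "cconverges M (\<lambda>n. h (X n)) (h' x)" using *[OF h(2)] S(2)[OF X(1)] by simp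
  qed (use star_hom_closed[OF h(1)] star_hom_closed[OF h(2)] Xc x in auto)
qed

text \<open>Norms agree along \<open>G\<close>, so a Cauchy sequence on the left is matched by a
  Cauchy sequence on the right. Used with \<open>G\<close> for the existence of values and with the
  converse relation for surjectivity.\<close>

lemma star_graph_limit:
  assumes L: "cstar_algebra L" and M: "cstar_algebra M" and G: "G \<subseteq> carrier L \<times> carrier M"
    and diff: "\<And>x y x' y'. (x, y) \<in> G \<Longrightarrow> (x', y') \<in> G \<Longrightarrow> (cdiff L x x', cdiff M y y') \<in> G"
    and norm: "\<And>x y. (x, y) \<in> G \<Longrightarrow> cnorm M y = cnorm L x"
    and dense: "cdense L (fst ` G)" and x: "x \<in> carrier L"
  shows "\<exists>y\<in>carrier M. \<exists>X Y. (\<forall>n. (X n, Y n) \<in> G) \<and> cconverges L X x \<and> cconverges M Y y"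
proof -
  interpret L: cstar_algebra L by (rule L)
  interpret M: cstar_algebra M by (rule M)
  obtain X where X: "\<And>n. X n \<in> fst ` G" "cconverges L X x"
    using L.approx_sequence[OF x] dense x unfolding cdense_def by metis
  then have "\<exists>y. (X n, y) \<in> G" for n by (metis imageE prod.collapse)
  then obtain Y where XY: "\<And>n. (X n, Y n) \<in> G" by metis
  then have c: "X n \<in> carrier L" "Y n \<in> carrier M" for n using G by blast+
  have "ccauchy L X" using L.converges_cauchy[OF c(1) x X(2)] .
  then have "ccauchy M Y" unfolding ccauchy_def using norm[OF diff[OF XY XY]] by simp
  from M.complete[OF c(2) this] show ?thesis using XY X(2) by blast
qed

text \<open>The map is given by its graph and not as a function on the dense part: single-valuedness
  follows from equality of norms, applied to differences of pairs, and does not have to be checked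
  for a concrete \<open>G\<close>.\<close>

lemma star_graph_extension:
  assumes L: "cstar_algebra L" and M: "cstar_algebra M" and G: "G \<subseteq> carrier L \<times> carrier M"
    and add: "\<And>x y x' y'. (x, y) \<in> G \<Longrightarrow> (x', y') \<in> G \<Longrightarrow> (x \<oplus>\<^bsub>L\<^esub> x', y \<oplus>\<^bsub>M\<^esub> y') \<in> G"
    and scale: "\<And>x y c. (x, y) \<in> G \<Longrightarrow> (c \<odot>\<^bsub>L\<^esub> x, c \<odot>\<^bsub>M\<^esub> y) \<in> G"
    and mult: "\<And>x y x' y'. (x, y) \<in> G \<Longrightarrow> (x', y') \<in> G \<Longrightarrow> (x \<cdot>\<^bsub>L\<^esub> x', y \<cdot>\<^bsub>M\<^esub> y') \<in> G"
    and adj: "\<And>x y. (x, y) \<in> G \<Longrightarrow> (cadj L x, cadj M y) \<in> G"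
    and norm: "\<And>x y. (x, y) \<in> G \<Longrightarrow> cnorm M y = cnorm L x"
    and dense: "cdense L (fst ` G)"
  obtains h where "star_mono L M h" "\<And>x y. (x, y) \<in> G \<Longrightarrow> h x = y"
    "cdense M (snd ` G) \<Longrightarrow> h ` carrier L = carrier M"
proof -
  interpret L: cstar_algebra L by (rule L)
  interpret M: cstar_algebra M by (rule M)
  define lim where "lim x y \<longleftrightarrow> x \<in> carrier L \<and> y \<in> carrier M \<and>
    (\<exists>X Y. (\<forall>n. (X n, Y n) \<in> G) \<and> cconverges L X x \<and> cconverges M Y y)" for x y
  have Gc: "x \<in> carrier L" "y \<in> carrier M" if "(x, y) \<in> G" for x y using that G by auto
  have Gs: "X n \<in> carrier L" "Y n \<in> carrier M" if "\<forall>n. (X n, Y n) \<in> G" for X Y n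
    using that Gc by blast+
  have diff: "(cdiff L x x', cdiff M y y') \<in> G" if "(x, y) \<in> G" "(x', y') \<in> G" for x y x' y'
    using that unfolding cdiff_def by (intro add scale)
  have limI: "lim x y" if "\<forall>n. (X n, Y n) \<in> G" "cconverges L X x" "cconverges M Y y"
    "x \<in> carrier L" "y \<in> carrier M" for X Y x y
    using that unfolding lim_def by blast
  have lim_add: "lim (x \<oplus>\<^bsub>L\<^esub> x') (y \<oplus>\<^bsub>M\<^esub> y')" if xy: "lim x y" "lim x' y'" for x y x' y'
  proof -
    obtain X Y X' Y' where XY: "\<forall>n. (X n, Y n) \<in> G" "cconverges L X x" "cconverges M Y y"
      "\<forall>n. (X' n, Y' n) \<in> G" "cconverges L X' x'" "cconverges M Y' y'"
      using xy unfolding lim_def by blast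
    show ?thesis
      by (rule limI[of "\<lambda>n. X n \<oplus>\<^bsub>L\<^esub> X' n" "\<lambda>n. Y n \<oplus>\<^bsub>M\<^esub> Y' n"])
         (use XY xy Gs[OF XY(1)] Gs[OF XY(4)] in \<open>auto simp: lim_def intro!: L.converges_add M.converges_add add\<close>)
  qed
  have lim_scale: "lim (c \<odot>\<^bsub>L\<^esub> x) (c \<odot>\<^bsub>M\<^esub> y)" if xy: "lim x y" for x y c
  proof -
    obtain X Y where XY: "\<forall>n. (X n, Y n) \<in> G" "cconverges L X x" "cconverges M Y y"
      using xy unfolding lim_def by blast
    show ?thesis
      by (rule limI[of "\<lambda>n. c \<odot>\<^bsub>L\<^esub> X n" "\<lambda>n. c \<odot>\<^bsub>M\<^esub> Y n"])
         (use XY xy Gs[OF XY(1)] in \<open>auto simp: lim_def intro!: L.converges_scale M.converges_scale scale\<close>)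
  qed
  have lim_mult: "lim (x \<cdot>\<^bsub>L\<^esub> x') (y \<cdot>\<^bsub>M\<^esub> y')" if xy: "lim x y" "lim x' y'" for x y x' y'
  proof -
    obtain X Y X' Y' where XY: "\<forall>n. (X n, Y n) \<in> G" "cconverges L X x" "cconverges M Y y"
      "\<forall>n. (X' n, Y' n) \<in> G" "cconverges L X' x'" "cconverges M Y' y'"
      using xy unfolding lim_def by blast
    show ?thesis
      by (rule limI[of "\<lambda>n. X n \<cdot>\<^bsub>L\<^esub> X' n" "\<lambda>n. Y n \<cdot>\<^bsub>M\<^esub> Y' n"])
         (use XY xy Gs[OF XY(1)] Gs[OF XY(4)] in \<open>auto simp: lim_def intro!: L.converges_mult M.converges_mult mult\<close>)
  qed
  have lim_adj: "lim (cadj L x) (cadj M y)" if xy: "lim x y" for x y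
  proof -
    obtain X Y where XY: "\<forall>n. (X n, Y n) \<in> G" "cconverges L X x" "cconverges M Y y"
      using xy unfolding lim_def by blast
    show ?thesis
      by (rule limI[of "\<lambda>n. cadj L (X n)" "\<lambda>n. cadj M (Y n)"])
         (use XY xy Gs[OF XY(1)] in \<open>auto simp: lim_def intro!: L.converges_adj M.converges_adj adj\<close>)
  qed
  have lim_norm: "cnorm M y = cnorm L x" if xy: "lim x y" for x y
  proof -
    obtain X Y where XY: "\<forall>n. (X n, Y n) \<in> G" "cconverges L X x" "cconverges M Y y"
      using xy unfolding lim_def by blast
    have "(\<lambda>n. cnorm M (Y n)) \<longlonglongrightarrow> cnorm M y" "(\<lambda>n. cnorm L (X n)) \<longlonglongrightarrow> cnorm L x"
      using XY xy Gs[OF XY(1)] by (auto simp: lim_def intro!: L.converges_norm M.converges_norm)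
    moreover have "(\<lambda>n. cnorm M (Y n)) = (\<lambda>n. cnorm L (X n))" using norm XY(1) by auto
    ultimately show ?thesis using LIMSEQ_unique by metis
  qed
  have lim_unique: "y = y'" if "lim x y" "lim x y'" for x y y'
  proof -
    have "lim (cdiff L x x) (cdiff M y y')" unfolding cdiff_def by (intro lim_add lim_scale that)
    from lim_norm[OF this] show ?thesis using that M.norm_cdiff_eq_zero by (simp add: lim_def)
  qed
  have lim_ex: "\<exists>y. lim x y" if "x \<in> carrier L" for x
    using star_graph_limit[OF L M G diff norm dense that] that unfolding lim_def by blast
  define h where "h x = (THE y. lim x y)" for x
  have h: "lim x (h x)" if "x \<in> carrier L" for x
    unfolding h_def using lim_ex[OF that] lim_unique by (metis theI)
  have hI: "h x = y" if "lim x y" for x y using lim_unique[OF h that] that by (simp add: lim_def)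
  have "star_hom L M h"
    unfolding star_hom_def using h by (auto intro!: hI lim_add lim_scale lim_mult lim_adj simp: lim_def[of _ "h _"])
  moreover have "inj_on h (carrier L)"
  proof (rule inj_onI)
    fix x x' assume x: "x \<in> carrier L" "x' \<in> carrier L" "h x = h x'"
    have "cnorm L (cdiff L x x') = cnorm M (h (cdiff L x x'))" using lim_norm[OF h] x by simp
    also have "\<dots> = 0" using x star_hom_cdiff[OF L \<open>star_hom L M h\<close>] star_hom_closed[OF \<open>star_hom L M h\<close>] by simp
    finally show "x = x'" using x L.norm_cdiff_eq_zero by simp
  qed
  ultimately have "star_mono L M h" by (simp add: star_mono_def)
  moreover have "h x = y" if "(x, y) \<in> G" for x y
    by (rule hI, rule limI[of "\<lambda>_. x" "\<lambda>_. y"]) (use that Gc L.converges_const M.converges_const in auto)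
  moreover have "h ` carrier L = carrier M" if d: "cdense M (snd ` G)"
  proof
    show "h ` carrier L \<subseteq> carrier M" using h by (auto simp: lim_def)
    show "carrier M \<subseteq> h ` carrier L"
    proof
      fix y assume y: "y \<in> carrier M"
      have "\<exists>x\<in>carrier L. \<exists>Y X. (\<forall>n. (Y n, X n) \<in> G\<inverse>) \<and> cconverges M Y y \<and> cconverges L X x"
      proof (rule star_graph_limit[OF M L])
        have "fst ` G\<inverse> = snd ` G" by force
        then show "cdense M (fst ` G\<inverse>)" using d by simp
      qed (use G diff norm y in auto)
      then obtain x where "lim x y" using y unfolding lim_def by auto
      then show "y \<in> h ` carrier L" using hI[of x y] by (auto simp: lim_def)
    qed
  qed
  ultimately show ?thesis using that by blast
qed

section \<open>Bounded operators on square-summable functions\<close>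

lemma l2_D: "f \<in> l2 X \<Longrightarrow> x \<notin> X \<Longrightarrow> f x = 0"
  by (simp add: l2_def)

lemma l2_finite_le:
  assumes "f \<in> l2 X" "finite F"
  shows "L2_set (\<lambda>x. cmod (f x)) F \<le> l2_norm f"
  unfolding L2_set_def l2_norm_def
  using assms by (intro real_sqrt_le_mono finite_sum_le_infsum) (auto simp: l2_def)

lemma sum_le_of_L2_set_le:
  assumes "L2_set g F \<le> C" shows "(\<Sum>x\<in>F. (g x)\<^sup>2) \<le> C\<^sup>2"
  using assms unfolding L2_set_def by (metis real_sqrt_le_iff real_sqrt_abs abs_ge_self order_trans)

lemma l2_bound:
  assumes "\<And>x. x \<notin> X \<Longrightarrow> f x = 0" "\<And>F. finite F \<Longrightarrow> L2_set (\<lambda>x. cmod (f x)) F \<le> C"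
  shows l2_boundI: "f \<in> l2 X" and l2_norm_le: "l2_norm f \<le> C"
proof -
  have *: "(\<Sum>x\<in>F. (cmod (f x))\<^sup>2) \<le> C\<^sup>2" if "finite F" for F
    by (rule sum_le_of_L2_set_le) (rule assms(2)[OF that])
  have C: "0 \<le> C" using assms(2)[of "{}"] by simp
  have s: "(\<lambda>x. (cmod (f x))\<^sup>2) summable_on UNIV"
    by (rule nonneg_bdd_above_summable_on) (auto intro!: bdd_aboveI[of _ "C\<^sup>2"] *)
  then show "f \<in> l2 X" using assms(1) by (simp add: l2_def)
  have "(\<Sum>\<^sub>\<infinity>x. (cmod (f x))\<^sup>2) \<le> C\<^sup>2" by (rule infsum_le_finite_sums[OF s]) (auto intro: *)
  then show "l2_norm f \<le> C" unfolding l2_norm_def using C by (simp add: real_le_lsqrt infsum_nonneg)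
qed

lemma l2_norm_nonneg [simp]: "0 \<le> l2_norm f"
  by (simp add: l2_norm_def infsum_nonneg)

lemma l2_norm_sq: "(l2_norm f)\<^sup>2 = (\<Sum>\<^sub>\<infinity>x. (cmod (f x))\<^sup>2)"
  by (simp add: l2_norm_def infsum_nonneg)

lemma l2_zero [simp]: "(\<lambda>_. 0) \<in> l2 X" "l2_norm (\<lambda>_. 0) = 0"
  by (auto simp: l2_def l2_norm_def)

lemma l2_point_le: assumes "f \<in> l2 X" shows "cmod (f x) \<le> l2_norm f"
  using l2_finite_le[OF assms, of "{x}"] by (simp add: L2_set_def)

lemma l2_norm_eq_0: assumes "f \<in> l2 X" "l2_norm f = 0" shows "f = (\<lambda>_. 0)"
  using l2_point_le[OF assms(1)] assms(2) by fastforce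

lemma L2_set_cmod_triangle:
  "L2_set (\<lambda>x. cmod (f x + g x)) F \<le> L2_set (\<lambda>x. cmod (f x)) F + L2_set (\<lambda>x. cmod (g x)) F"
  by (rule order_trans[OF L2_set_mono L2_set_triangle_ineq]) (auto intro: norm_triangle_ineq)

lemma
  assumes "f \<in> l2 X" "g \<in> l2 X"
  shows l2_add: "(\<lambda>x. f x + g x) \<in> l2 X" and l2_norm_triangle: "l2_norm (\<lambda>x. f x + g x) \<le> l2_norm f + l2_norm g"
proof -
  have *: "L2_set (\<lambda>x. cmod (f x + g x)) F \<le> l2_norm f + l2_norm g" if "finite F" for F
    by (rule order_trans[OF L2_set_cmod_triangle
          add_mono[OF l2_finite_le[OF assms(1) that] l2_finite_le[OF assms(2) that]]])
  show "(\<lambda>x. f x + g x) \<in> l2 X" "l2_norm (\<lambda>x. f x + g x) \<le> l2_norm f + l2_norm g"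
    using l2_bound[of X "\<lambda>x. f x + g x", OF _ *] l2_D[OF assms(1)] l2_D[OF assms(2)] by auto
qed

lemma l2_scale: "f \<in> l2 X \<Longrightarrow> (\<lambda>x. c * f x) \<in> l2 X"
  by (auto simp: l2_def norm_mult power_mult_distrib intro: summable_on_cmult_right)

lemma l2_norm_scale: "l2_norm (\<lambda>x. c * f x) = cmod c * l2_norm f"
proof -
  have "(\<Sum>\<^sub>\<infinity>x. (cmod (c * f x))\<^sup>2) = (cmod c)\<^sup>2 * (\<Sum>\<^sub>\<infinity>x. (cmod (f x))\<^sup>2)"
    by (simp add: norm_mult power_mult_distrib infsum_cmult_right')
  then show ?thesis by (simp add: l2_norm_def real_sqrt_mult)
qed

lemma l2_diff: "f \<in> l2 X \<Longrightarrow> g \<in> l2 X \<Longrightarrow> (\<lambda>x. f x - g x) \<in> l2 X"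
  using l2_add[of f X "\<lambda>x. (-1) * g x"] l2_scale[of g X "-1"] by simp

lemma l2_sum: "(\<And>i. i \<in> I \<Longrightarrow> f i \<in> l2 X) \<Longrightarrow> (\<lambda>x. \<Sum>i\<in>I. f i x) \<in> l2 X"
  by (induction I rule: infinite_finite_induct) (auto intro: l2_add)

lemma l2_ket: "x \<in> X \<Longrightarrow> ket x \<in> l2 X"
proof (rule l2_boundI)
  fix F :: "'a set" assume "finite F"
  then have "(\<Sum>y\<in>F. (cmod (ket x y))\<^sup>2) \<le> 1"
    by (simp add: ket_def if_distrib[of "\<lambda>z. (cmod z)\<^sup>2"] sum.delta cong: if_cong)
  then show "L2_set (\<lambda>y. cmod (ket x y)) F \<le> 1" by (simp add: L2_set_def)
qed (auto simp: ket_def)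

lemma sum_ket: "finite F \<Longrightarrow> (\<Sum>y\<in>F. c y * ket y x) = (if x \<in> F then c x else 0)"
  by (simp add: ket_def if_distrib[of "\<lambda>z. _ * z"] sum.delta' cong: if_cong)

lemma
  assumes "f \<in> l2 X" "g \<in> l2 X"
  shows l2_inner_abs_summable: "(\<lambda>x. norm (cnj (f x) * g x)) summable_on UNIV"
    and cmod_l2_inner_le: "cmod (l2_inner f g) \<le> l2_norm f * l2_norm g"
proof -
  have *: "(\<Sum>x\<in>F. norm (cnj (f x) * g x)) \<le> l2_norm f * l2_norm g" if "finite F" for F
  proof -
    have "(\<Sum>x\<in>F. norm (cnj (f x) * g x)) = (\<Sum>x\<in>F. \<bar>cmod (f x)\<bar> * \<bar>cmod (g x)\<bar>)" by (simp add: norm_mult)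
    also have "\<dots> \<le> L2_set (\<lambda>x. cmod (f x)) F * L2_set (\<lambda>x. cmod (g x)) F" by (rule L2_set_mult_ineq)
    also have "\<dots> \<le> l2_norm f * l2_norm g" using that assms by (intro mult_mono l2_finite_le) auto
    finally show ?thesis .
  qed
  show s: "(\<lambda>x. norm (cnj (f x) * g x)) summable_on UNIV"
    by (rule nonneg_bdd_above_summable_on) (auto intro!: bdd_aboveI[of _ "l2_norm f * l2_norm g"] *)
  have "cmod (l2_inner f g) \<le> (\<Sum>\<^sub>\<infinity>x. norm (cnj (f x) * g x))"
    unfolding l2_inner_def by (rule norm_infsum_bound[OF s])
  also have "\<dots> \<le> l2_norm f * l2_norm g" by (rule infsum_le_finite_sums[OF s]) (auto intro: *)
  finally show "cmod (l2_inner f g) \<le> l2_norm f * l2_norm g" .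
qed

lemmas l2_inner_summable = abs_summable_summable[OF l2_inner_abs_summable]

lemma l2_inner_add_right:
  "f \<in> l2 X \<Longrightarrow> g \<in> l2 X \<Longrightarrow> h \<in> l2 X \<Longrightarrow> l2_inner f (\<lambda>x. g x + h x) = l2_inner f g + l2_inner f h"
  by (simp add: l2_inner_def distrib_left infsum_add l2_inner_summable)

lemma l2_inner_scale_right: "l2_inner f (\<lambda>x. c * g x) = c * l2_inner f g"
  by (simp add: l2_inner_def infsum_cmult_right' mult.left_commute[of _ c])

lemma l2_inner_commute: "l2_inner g f = cnj (l2_inner f g)"
  by (simp add: l2_inner_def mult.commute flip: infsum_cnj)

lemma l2_inner_add_left:
  "f \<in> l2 X \<Longrightarrow> g \<in> l2 X \<Longrightarrow> h \<in> l2 X \<Longrightarrow> l2_inner (\<lambda>x. f x + g x) h = l2_inner f h + l2_inner g h"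
  by (simp add: l2_inner_commute[of _ h] l2_inner_add_right)

lemma l2_inner_scale_left: "l2_inner (\<lambda>x. c * f x) g = cnj c * l2_inner f g"
  by (simp add: l2_inner_commute[of _ g] l2_inner_scale_right)

lemma l2_inner_self: assumes "f \<in> l2 X" shows "l2_inner f f = of_real ((l2_norm f)\<^sup>2)"
proof -
  have "l2_inner f f = (\<Sum>\<^sub>\<infinity>x. of_real ((cmod (f x))\<^sup>2))"
    unfolding l2_inner_def by (simp add: complex_norm_square mult.commute del: of_real_power)
  also have "\<dots> = of_real ((l2_norm f)\<^sup>2)"
    unfolding l2_norm_sq using assms by (intro infsumI has_sum_of_real has_sum_infsum) (simp add: l2_def)
  finally show ?thesis .
qed

lemma l2_inner_ket: "l2_inner (ket x) f = f x"
proof -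
  have "(\<Sum>\<^sub>\<infinity>y. cnj (ket x y) * f y) = (\<Sum>\<^sub>\<infinity>y\<in>{x}. cnj (ket x y) * f y)"
    by (rule infsum_cong_neutral) (auto simp: ket_def)
  then show ?thesis by (simp add: l2_inner_def ket_def)
qed

lemma l2_ext_inner:
  assumes "f \<in> l2 X" "g \<in> l2 X" "\<And>h. h \<in> l2 X \<Longrightarrow> l2_inner h f = l2_inner h g"
  shows "f = g"
proof
  fix x show "f x = g x"
    using assms(3)[OF l2_ket, of x] l2_D[OF assms(1), of x] l2_D[OF assms(2), of x]
    by (cases "x \<in> X") (auto simp: l2_inner_ket)
qed

definition l2_restrict :: "'x set \<Rightarrow> ('x \<Rightarrow> complex) \<Rightarrow> 'x \<Rightarrow> complex" where
  "l2_restrict F f = (\<lambda>x. if x \<in> F then f x else 0)"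

lemma
  assumes "f \<in> l2 X"
  shows l2_restrict_closed: "l2_restrict F f \<in> l2 X" and l2_norm_restrict_le: "l2_norm (l2_restrict F f) \<le> l2_norm f"
proof -
  have *: "L2_set (\<lambda>x. cmod (l2_restrict F f x)) G \<le> l2_norm f" if "finite G" for G
    by (rule order_trans[OF L2_set_mono l2_finite_le[OF assms that]]) (auto simp: l2_restrict_def)
  show "l2_restrict F f \<in> l2 X" "l2_norm (l2_restrict F f) \<le> l2_norm f"
    using l2_bound[of X "l2_restrict F f", OF _ *] l2_D[OF assms] by (auto simp: l2_restrict_def)
qed

text \<open>The squared norm of the difference is the total sum of squares minus the sum over
  \<open>F\<close>.\<close>

lemma l2_restrict_tendsto:
  assumes f: "f \<in> l2 X"
  shows "((\<lambda>F. l2_norm (\<lambda>x. f x - l2_restrict F f x)) \<longlongrightarrow> 0) (finite_subsets_at_top UNIV)"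
proof -
  let ?q = "\<lambda>x. (cmod (f x))\<^sup>2"
  have s: "?q summable_on UNIV" using f by (simp add: l2_def)
  have sq: "(l2_norm (\<lambda>x. f x - l2_restrict F f x))\<^sup>2 = (\<Sum>\<^sub>\<infinity>x. ?q x) - sum ?q F" if "finite F" for F
  proof -
    have "(\<Sum>\<^sub>\<infinity>x. ?q x) = (\<Sum>\<^sub>\<infinity>x\<in>F \<union> - F. ?q x)" by simp
    also have "\<dots> = infsum ?q F + infsum ?q (- F)"
      by (intro infsum_Un_disjoint summable_on_subset_banach[OF s]) auto
    also have "infsum ?q (- F) = (\<Sum>\<^sub>\<infinity>x. (cmod (f x - l2_restrict F f x))\<^sup>2)"
      by (rule infsum_cong_neutral) (auto simp: l2_restrict_def)
    finally show ?thesis using that by (simp add: l2_norm_sq)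
  qed
  have "((\<lambda>F. (\<Sum>\<^sub>\<infinity>x. ?q x) - sum ?q F) \<longlongrightarrow> (\<Sum>\<^sub>\<infinity>x. ?q x) - (\<Sum>\<^sub>\<infinity>x. ?q x)) (finite_subsets_at_top UNIV)"
    by (intro tendsto_intros infsum_tendsto s)
  moreover have "eventually (\<lambda>F. (\<Sum>\<^sub>\<infinity>x. ?q x) - sum ?q F = (l2_norm (\<lambda>x. f x - l2_restrict F f x))\<^sup>2)
      (finite_subsets_at_top UNIV)"
    by (rule eventually_finite_subsets_at_top_weakI) (simp add: sq)
  ultimately have "((\<lambda>F. (l2_norm (\<lambda>x. f x - l2_restrict F f x))\<^sup>2) \<longlongrightarrow> 0) (finite_subsets_at_top UNIV)"
    using Lim_transform_eventually by fastforce
  then have "((\<lambda>F. sqrt ((l2_norm (\<lambda>x. f x - l2_restrict F f x))\<^sup>2)) \<longlongrightarrow> sqrt 0) (finite_subsets_at_top UNIV)"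
    by (rule tendsto_real_sqrt)
  then show ?thesis by simp
qed

text \<open>A form of Fatou's lemma: finite partial sums follow pointwise limits, and membership and
  norm in l2 are governed by finite partial sums.\<close>

lemma l2_limit:
  assumes lim: "\<And>x. (\<lambda>n. f n x) \<longlonglongrightarrow> g x" and f: "\<And>n. f n \<in> l2 X" and C: "\<And>n. n \<ge> N \<Longrightarrow> l2_norm (f n) \<le> C"
  shows l2_limit_closed: "g \<in> l2 X" and l2_norm_limit_le: "l2_norm g \<le> C"
proof -
  have *: "L2_set (\<lambda>x. cmod (g x)) F \<le> C" if "finite F" for F
  proof (rule tendsto_upperbound)
    show "(\<lambda>n. L2_set (\<lambda>x. cmod (f n x)) F) \<longlonglongrightarrow> L2_set (\<lambda>x. cmod (g x)) F"
      unfolding L2_set_def by (intro tendsto_intros lim)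
    show "eventually (\<lambda>n. L2_set (\<lambda>x. cmod (f n x)) F \<le> C) sequentially"
      using C l2_finite_le[OF f that] by (auto simp: eventually_sequentially intro: order_trans)
  qed simp
  have "g x = 0" if "x \<notin> X" for x
    using lim[of x] l2_D[OF f that] by (simp add: LIMSEQ_const_iff)
  then show "g \<in> l2 X" "l2_norm g \<le> C" using l2_bound[of X g, OF _ *] by auto
qed

section \<open>The C*-algebra of bounded operators on l2\<close>

lemma op_alg_simps [simp]:
  "carrier (op_alg X) = bounded_ops X"
  "czero (op_alg X) = (\<lambda>f x. 0)"
  "cadd (op_alg X) = (\<lambda>S T f x. S f x + T f x)"
  "cscale (op_alg X) = (\<lambda>c T f x. c * T f x)"
  "cmult (op_alg X) = (\<lambda>S T f. S (T f))"
  by (simp_all add: op_alg_def)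

abbreviation op_norm :: "'x set \<Rightarrow> 'x oper \<Rightarrow> real" where "op_norm X \<equiv> cnorm (op_alg X)"
abbreviation op_adj :: "'x set \<Rightarrow> 'x oper \<Rightarrow> 'x oper" where "op_adj X \<equiv> cadj (op_alg X)"

lemma op_norm_def: "op_norm X T = (SUP f\<in>{f \<in> l2 X. l2_norm f \<le> 1}. l2_norm (T f))"
  by (simp add: op_alg_def)

lemma op_adj_def: "op_adj X T = (\<lambda>f. if f \<in> l2 X then (\<lambda>x. l2_inner (T (ket x)) f) else (\<lambda>_. 0))"
  by (simp add: op_alg_def)

lemma bounded_opsI:
  assumes "\<And>f. f \<notin> l2 X \<Longrightarrow> T f = (\<lambda>_. 0)" "\<And>f. f \<in> l2 X \<Longrightarrow> T f \<in> l2 X"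
    and "\<And>f g. f \<in> l2 X \<Longrightarrow> g \<in> l2 X \<Longrightarrow> T (\<lambda>x. f x + g x) = (\<lambda>x. T f x + T g x)"
    and "\<And>c f. f \<in> l2 X \<Longrightarrow> T (\<lambda>x. c * f x) = (\<lambda>x. c * T f x)"
    and "\<And>f. f \<in> l2 X \<Longrightarrow> l2_norm (T f) \<le> C * l2_norm f"
  shows "T \<in> bounded_ops X"
  unfolding bounded_ops_def using assms by blast

lemma bounded_opsD:
  assumes "T \<in> bounded_ops X"
  shows op_outside: "f \<notin> l2 X \<Longrightarrow> T f = (\<lambda>_. 0)" and op_closed: "f \<in> l2 X \<Longrightarrow> T f \<in> l2 X"
    and op_add: "f \<in> l2 X \<Longrightarrow> g \<in> l2 X \<Longrightarrow> T (\<lambda>x. f x + g x) = (\<lambda>x. T f x + T g x)"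
    and op_scale: "f \<in> l2 X \<Longrightarrow> T (\<lambda>x. c * f x) = (\<lambda>x. c * T f x)"
    and op_bounded: "\<exists>C. \<forall>f\<in>l2 X. l2_norm (T f) \<le> C * l2_norm f"
  using assms unfolding bounded_ops_def by blast+

lemma op_closed': "T \<in> bounded_ops X \<Longrightarrow> T f \<in> l2 X"
  by (cases "f \<in> l2 X") (auto simp: op_closed op_outside)

lemma op_zero: assumes "T \<in> bounded_ops X" shows "T (\<lambda>_. 0) = (\<lambda>_. 0)"
  using op_scale[OF assms l2_zero(1), of 0] by simp

lemma op_sum:
  assumes "T \<in> bounded_ops X" "\<And>i. i \<in> I \<Longrightarrow> f i \<in> l2 X"
  shows "T (\<lambda>x. \<Sum>i\<in>I. f i x) = (\<lambda>x. \<Sum>i\<in>I. T (f i) x)"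
  using assms(2)
  by (induction I rule: infinite_finite_induct) (auto simp: op_zero[OF assms(1)] op_add[OF assms(1)] l2_sum)

lemma op_diff:
  assumes T: "T \<in> bounded_ops X" and "f \<in> l2 X" "g \<in> l2 X"
  shows "T (\<lambda>x. f x - g x) = (\<lambda>x. T f x - T g x)"
  using op_add[OF T assms(2) l2_scale[OF assms(3), of "-1"]] op_scale[OF T assms(3), of "-1"] by simp

lemma op_norm_bdd:
  assumes "T \<in> bounded_ops X"
  shows "bdd_above ((\<lambda>f. l2_norm (T f)) ` {f \<in> l2 X. l2_norm f \<le> 1})"
proof -
  obtain C where C: "\<forall>f\<in>l2 X. l2_norm (T f) \<le> C * l2_norm f" using op_bounded[OF assms] by blast
  show ?thesis
  proof (rule bdd_aboveI2)
    fix f assume "f \<in> {f \<in> l2 X. l2_norm f \<le> 1}"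
    then have "l2_norm (T f) \<le> C * l2_norm f" "l2_norm f \<le> 1" using C by auto
    moreover have "C * l2_norm f \<le> \<bar>C\<bar> * 1" using \<open>l2_norm f \<le> 1\<close> by (intro mult_mono) auto
    ultimately show "l2_norm (T f) \<le> \<bar>C\<bar>" by simp
  qed
qed

lemma op_norm_nonneg: assumes "T \<in> bounded_ops X" shows "0 \<le> op_norm X T"
  unfolding op_norm_def
  by (rule cSUP_upper2[OF op_norm_bdd[OF assms], of "\<lambda>_. 0"]) auto

lemma op_norm_bound:
  assumes T: "T \<in> bounded_ops X" and f: "f \<in> l2 X"
  shows "l2_norm (T f) \<le> op_norm X T * l2_norm f"
proof (cases "l2_norm f = 0")
  case True
  then show ?thesis using l2_norm_eq_0[OF f] op_zero[OF T] by simp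
next
  case False
  define c where "c = complex_of_real (1 / l2_norm f)"
  have pos: "0 < l2_norm f" using False l2_norm_nonneg[of f] by linarith
  have c: "cmod c * l2_norm f = 1" using pos by (simp add: c_def norm_divide)
  have "l2_norm (T (\<lambda>x. c * f x)) \<le> op_norm X T"
    unfolding op_norm_def using f pos
    by (intro cSUP_upper op_norm_bdd[OF T]) (auto simp: l2_scale l2_norm_scale c)
  then have "(cmod c * l2_norm (T f)) * l2_norm f \<le> op_norm X T * l2_norm f"
    using pos by (simp add: op_scale[OF T f] l2_norm_scale)
  moreover have "(cmod c * l2_norm (T f)) * l2_norm f = (cmod c * l2_norm f) * l2_norm (T f)" by simp
  ultimately show ?thesis unfolding c by simp
qed

lemma op_norm_le:
  assumes "\<And>f. f \<in> l2 X \<Longrightarrow> l2_norm (T f) \<le> C * l2_norm f" "0 \<le> C"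
  shows "op_norm X T \<le> C"
  unfolding op_norm_def
proof (rule cSUP_least)
  fix f assume "f \<in> {f \<in> l2 X. l2_norm f \<le> 1}"
  then show "l2_norm (T f) \<le> C" using assms(1)[of f] mult_left_mono[of "l2_norm f" 1 C] assms(2) by auto
qed (auto intro: exI[of _ "\<lambda>_. 0"])

text \<open>For the restriction of \<open>g\<close> to a finite set the formula is linearity, and
  these restrictions converge to \<open>g\<close> in norm. The adjoint is defined by coordinates,
  and this expansion along the basis is the access to it.\<close>

lemma op_inner_tendsto:
  assumes T: "T \<in> bounded_ops X" and f: "f \<in> l2 X" and g: "g \<in> l2 X"
  shows "((\<lambda>x. l2_inner f (T (ket x)) * g x) has_sum l2_inner f (T g)) UNIV"
  unfolding has_sum_def
proof (rule Lim_null[THEN iffD2, rotated], rule tendsto_norm_zero_cancel)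
  let ?C = "l2_norm f * op_norm X T"
  show "((\<lambda>F. cmod ((\<Sum>x\<in>F. l2_inner f (T (ket x)) * g x) - l2_inner f (T g))) \<longlongrightarrow> 0) (finite_subsets_at_top UNIV)"
  proof (rule tendsto_sandwich[OF _ _ tendsto_const])
    show "((\<lambda>F. ?C * l2_norm (\<lambda>x. g x - l2_restrict F g x)) \<longlongrightarrow> 0) (finite_subsets_at_top UNIV)"
      using tendsto_mult_left[OF l2_restrict_tendsto[OF g], of ?C] by simp
    show "eventually (\<lambda>F. cmod ((\<Sum>x\<in>F. l2_inner f (T (ket x)) * g x) - l2_inner f (T g))
       \<le> ?C * l2_norm (\<lambda>x. g x - l2_restrict F g x)) (finite_subsets_at_top UNIV)"
    proof (rule eventually_finite_subsets_at_top_weakI)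
      fix F :: "'a set" assume F: "finite F"
      have inner_sum: "l2_inner f (\<lambda>x. \<Sum>i\<in>I. h i x) = (\<Sum>i\<in>I. l2_inner f (h i))"
        if "finite I" "\<And>i. i \<in> I \<Longrightarrow> h i \<in> l2 X" for I :: "'a set" and h
        using that by (induction I) (auto simp: l2_inner_add_right[OF f] l2_sum, simp add: l2_inner_def)
      have g': "g x = 0" if "x \<notin> X" for x using l2_D[OF g that] .
      have "l2_restrict F g = (\<lambda>x. \<Sum>y\<in>F \<inter> X. g y * ket y x)"
        using g' F by (auto simp: sum_ket l2_restrict_def)
      then have "T (l2_restrict F g) = (\<lambda>x. \<Sum>y\<in>F \<inter> X. g y * T (ket y) x)"
        using op_sum[OF T, of "F \<inter> X" "\<lambda>y x. g y * ket y x"] by (simp add: l2_scale l2_ket op_scale[OF T])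
      then have "l2_inner f (T (l2_restrict F g)) = (\<Sum>y\<in>F \<inter> X. l2_inner f (T (ket y)) * g y)"
        using F inner_sum[of "F \<inter> X" "\<lambda>y x. g y * T (ket y) x"]
        by (simp add: l2_scale l2_ket op_closed[OF T] l2_inner_scale_right mult.commute)
      also have "\<dots> = (\<Sum>y\<in>F. l2_inner f (T (ket y)) * g y)"
        using F g' by (intro sum.mono_neutral_left) auto
      finally have "(\<Sum>x\<in>F. l2_inner f (T (ket x)) * g x) - l2_inner f (T g)
         = l2_inner f (\<lambda>x. T (l2_restrict F g) x + (-1) * T g x)"
        using g by (subst l2_inner_add_right[OF f])
          (auto simp: op_closed[OF T] l2_restrict_closed l2_inner_scale_right[of _ "-1", simplified] intro: l2_scale[of _ _ "-1", simplified])
      also have "(\<lambda>x. T (l2_restrict F g) x + (-1) * T g x) = (\<lambda>x. (-1) * T (\<lambda>x. g x - l2_restrict F g x) x)"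
        by (simp add: op_diff[OF T g l2_restrict_closed[OF g]])
      also have "cmod (l2_inner f \<dots>) \<le> l2_norm f * l2_norm (T (\<lambda>x. g x - l2_restrict F g x))"
        unfolding l2_inner_scale_right norm_mult
        using cmod_l2_inner_le[OF f op_closed'[OF T]] by simp
      also have "\<dots> \<le> ?C * l2_norm (\<lambda>x. g x - l2_restrict F g x)"
        unfolding mult.assoc by (intro mult_left_mono op_norm_bound[OF T] l2_diff l2_restrict_closed g) auto
      finally show "cmod ((\<Sum>x\<in>F. l2_inner f (T (ket x)) * g x) - l2_inner f (T g))
         \<le> ?C * l2_norm (\<lambda>x. g x - l2_restrict F g x)" .
    qed
  qed (auto intro!: always_eventually)
qed

lemma op_ext_ket:
  assumes S: "S \<in> bounded_ops X" and T: "T \<in> bounded_ops X" and "\<And>x. x \<in> X \<Longrightarrow> S (ket x) = T (ket x)"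
  shows "S = T"
proof
  fix f show "S f = T f"
  proof (cases "f \<in> l2 X")
    case f: True
    show ?thesis
    proof (rule l2_ext_inner)
      fix h assume h: "h \<in> l2 X"
      have "l2_inner h (S (ket x)) * f x = l2_inner h (T (ket x)) * f x" for x
        using assms(3)[of x] l2_D[OF f, of x] by (cases "x \<in> X") auto
      then have "(\<lambda>x. l2_inner h (S (ket x)) * f x) = (\<lambda>x. l2_inner h (T (ket x)) * f x)" by auto
      then show "l2_inner h (S f) = l2_inner h (T f)"
        using op_inner_tendsto[OF S h f] op_inner_tendsto[OF T h f] has_sum_unique by metis
    qed (use f in \<open>auto simp: op_closed[OF S] op_closed[OF T]\<close>)
  qed (simp add: op_outside[OF S] op_outside[OF T])
qed

text \<open>The adjoint is given by a formula for its coordinates, so membership in l2 has to be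
  shown. For the restriction \<open>h\<close> of the candidate to a finite set, ||h||^2 = <f, T h>
  <= ||f|| ||T|| ||h||, which bounds all finite partial sums by ||T|| ||f||. The inner product
  formula is then the basis expansion of T g.\<close>

lemma
  assumes T: "T \<in> bounded_ops X"
  shows op_adj_closed: "op_adj X T \<in> bounded_ops X"
    and op_adj_inner: "f \<in> l2 X \<Longrightarrow> g \<in> l2 X \<Longrightarrow> l2_inner (op_adj X T f) g = l2_inner f (T g)"
    and op_norm_adj_le: "op_norm X (op_adj X T) \<le> op_norm X T"
proof -
  have ketc: "T (ket x) \<in> l2 X" for x by (rule op_closed'[OF T])
  have ket0: "T (ket x) = (\<lambda>_. 0)" if "x \<notin> X" for x
    using that op_outside[OF T, of "ket x"] l2_D[of "ket x" X x] by (auto simp: ket_def)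
  have bound: "op_adj X T f \<in> l2 X \<and> l2_norm (op_adj X T f) \<le> op_norm X T * l2_norm f" if f: "f \<in> l2 X" for f
  proof -
    define g where "g = op_adj X T f"
    have gx: "g x = l2_inner (T (ket x)) f" for x using f by (simp add: g_def op_adj_def)
    have g0: "g x = 0" if "x \<notin> X" for x using ket0[OF that] by (simp add: gx l2_inner_def)
    have "L2_set (\<lambda>x. cmod (g x)) F \<le> op_norm X T * l2_norm f" if F: "finite F" for F
    proof -
      define h where "h = (\<lambda>x. \<Sum>y\<in>F \<inter> X. g y * ket y x)"
      have h: "h \<in> l2 X" by (auto simp: h_def intro!: l2_sum l2_scale l2_ket)
      have hx: "h x = l2_restrict F g x" for x using F g0 by (auto simp: h_def sum_ket l2_restrict_def)
      have nh: "l2_norm h = L2_set (\<lambda>x. cmod (g x)) F"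
      proof -
        have "(\<Sum>\<^sub>\<infinity>x. (cmod (h x))\<^sup>2) = (\<Sum>\<^sub>\<infinity>x\<in>F. (cmod (g x))\<^sup>2)"
          by (rule infsum_cong_neutral) (auto simp: hx l2_restrict_def)
        then show ?thesis using F by (simp add: l2_norm_def L2_set_def)
      qed
      have "l2_inner f (T h) = (\<Sum>\<^sub>\<infinity>x. l2_inner f (T (ket x)) * h x)"
        using infsumI[OF op_inner_tendsto[OF T f h]] by simp
      also have "\<dots> = (\<Sum>\<^sub>\<infinity>x. cnj (h x) * h x)"
      proof (rule infsum_cong)
        fix x show "l2_inner f (T (ket x)) * h x = cnj (h x) * h x"
          by (simp add: hx l2_restrict_def gx l2_inner_commute[of f])
      qed
      also have "\<dots> = of_real ((l2_norm h)\<^sup>2)" using l2_inner_self[OF h] by (simp add: l2_inner_def)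
      finally have "(l2_norm h)\<^sup>2 = cmod (l2_inner f (T h))" by (simp add: norm_power)
      also have "\<dots> \<le> l2_norm f * l2_norm (T h)" by (rule cmod_l2_inner_le[OF f op_closed[OF T h]])
      also have "\<dots> \<le> l2_norm f * (op_norm X T * l2_norm h)"
        by (intro mult_left_mono op_norm_bound[OF T h]) auto
      finally have "l2_norm h * l2_norm h \<le> (op_norm X T * l2_norm f) * l2_norm h"
        by (simp add: power2_eq_square mult_ac)
      then have "l2_norm h \<le> op_norm X T * l2_norm f"
        using l2_norm_nonneg[of h] op_norm_nonneg[OF T] by (cases "l2_norm h = 0") (auto simp: mult_le_cancel_right)
      then show ?thesis by (simp add: nh)
    qed
    from l2_bound[of X g, OF g0 this] show ?thesis by (simp add: g_def)
  qed
  show c: "op_adj X T \<in> bounded_ops X"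
  proof (rule bounded_opsI)
    fix f g assume "f \<in> l2 X" "g \<in> l2 X"
    then show "op_adj X T (\<lambda>x. f x + g x) = (\<lambda>x. op_adj X T f x + op_adj X T g x)"
      by (auto simp: op_adj_def l2_add l2_inner_add_right[OF ketc])
  qed (use bound in \<open>auto simp: op_adj_def l2_scale l2_inner_scale_right\<close>)
  show "op_norm X (op_adj X T) \<le> op_norm X T"
    using bound op_norm_nonneg[OF T] by (intro op_norm_le) auto
  assume f: "f \<in> l2 X" and g: "g \<in> l2 X"
  have "l2_inner f (T g) = (\<Sum>\<^sub>\<infinity>x. l2_inner f (T (ket x)) * g x)"
    using infsumI[OF op_inner_tendsto[OF T f g]] by simp
  also have "\<dots> = l2_inner (op_adj X T f) g"
    unfolding l2_inner_def[of "op_adj X T f"] using f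
    by (intro infsum_cong) (simp add: op_adj_def l2_inner_commute[of f])
  finally show "l2_inner (op_adj X T f) g = l2_inner f (T g)" by simp
qed

lemma op_adj_unique:
  assumes T: "T \<in> bounded_ops X" and S: "S \<in> bounded_ops X"
    and eq: "\<And>f g. f \<in> l2 X \<Longrightarrow> g \<in> l2 X \<Longrightarrow> l2_inner f (S g) = l2_inner (T f) g"
  shows "op_adj X T = S"
proof
  fix g show "op_adj X T g = S g"
  proof (cases "g \<in> l2 X")
    case g: True
    show ?thesis
    proof (rule l2_ext_inner)
      fix h assume h: "h \<in> l2 X"
      have "l2_inner h (op_adj X T g) = cnj (l2_inner (op_adj X T g) h)" by (rule l2_inner_commute)
      also have "\<dots> = cnj (l2_inner g (T h))" by (simp add: op_adj_inner[OF T g h])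
      also have "\<dots> = l2_inner (T h) g" by (rule l2_inner_commute[symmetric])
      finally show "l2_inner h (op_adj X T g) = l2_inner h (S g)" using eq[OF h g] by simp
    qed (use g op_closed[OF S] op_closed[OF op_adj_closed[OF T]] in auto)
  qed (simp add: op_outside[OF S] op_outside[OF op_adj_closed[OF T]])
qed

lemma op_add_closed:
  assumes "S \<in> bounded_ops X" "T \<in> bounded_ops X"
  shows "(\<lambda>f x. S f x + T f x) \<in> bounded_ops X" "op_norm X (\<lambda>f x. S f x + T f x) \<le> op_norm X S + op_norm X T"
proof -
  have *: "l2_norm (\<lambda>x. S f x + T f x) \<le> (op_norm X S + op_norm X T) * l2_norm f" if f: "f \<in> l2 X" for f
    using l2_norm_triangle[OF op_closed[OF assms(1) f] op_closed[OF assms(2) f]]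
      op_norm_bound[OF assms(1) f] op_norm_bound[OF assms(2) f] by (simp add: distrib_right)
  show "(\<lambda>f x. S f x + T f x) \<in> bounded_ops X"
    by (rule bounded_opsI[OF _ _ _ _ *])
       (use assms in \<open>auto simp: op_outside op_add op_scale op_closed l2_add algebra_simps\<close>)
  show "op_norm X (\<lambda>f x. S f x + T f x) \<le> op_norm X S + op_norm X T"
    by (rule op_norm_le[OF *]) (use op_norm_nonneg[OF assms(1)] op_norm_nonneg[OF assms(2)] in auto)
qed

lemma op_scale_closed:
  assumes "T \<in> bounded_ops X"
  shows "(\<lambda>f x. c * T f x) \<in> bounded_ops X" "op_norm X (\<lambda>f x. c * T f x) = cmod c * op_norm X T"
proof -
  have *: "l2_norm (\<lambda>x. c * T f x) \<le> (cmod c * op_norm X T) * l2_norm f" if f: "f \<in> l2 X" and T: "T \<in> bounded_ops X"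
    for c f and T :: "'a oper"
    using op_norm_bound[OF T f] by (simp add: l2_norm_scale mult.assoc mult_left_mono)
  have le: "op_norm X (\<lambda>f x. c * T f x) \<le> cmod c * op_norm X T" if "T \<in> bounded_ops X" for c and T :: "'a oper"
    by (rule op_norm_le[OF *]) (use op_norm_nonneg[OF that] that in auto)
  have cl: "(\<lambda>f x. c * T f x) \<in> bounded_ops X" if T: "T \<in> bounded_ops X" for c and T :: "'a oper"
    by (rule bounded_opsI[OF _ _ _ _ *[OF _ T]])
       (use T in \<open>auto simp: op_outside op_add op_scale op_closed l2_scale algebra_simps\<close>)
  show "(\<lambda>f x. c * T f x) \<in> bounded_ops X" by (rule cl[OF assms])
  show "op_norm X (\<lambda>f x. c * T f x) = cmod c * op_norm X T"
  proof (cases "c = 0")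
    case True
    have "op_norm X (\<lambda>f x. 0) \<le> 0" by (rule op_norm_le) auto
    moreover have "0 \<le> op_norm X (\<lambda>f x. 0)" using op_norm_nonneg[OF cl[OF assms, of 0]] by simp
    ultimately show ?thesis using True by simp
  next
    case False
    have "op_norm X T = op_norm X (\<lambda>f x. (1 / c) * (c * T f x))" using False by simp
    also have "\<dots> \<le> cmod (1 / c) * op_norm X (\<lambda>f x. c * T f x)" by (rule le[OF cl[OF assms]])
    finally have "cmod c * op_norm X T \<le> op_norm X (\<lambda>f x. c * T f x)"
      using False by (simp add: norm_divide field_simps)
    then show ?thesis using le[OF assms, of c] by simp
  qed
qed

lemma op_mult_closed:
  assumes S: "S \<in> bounded_ops X" and T: "T \<in> bounded_ops X"
  shows "(\<lambda>f. S (T f)) \<in> bounded_ops X" "op_norm X (\<lambda>f. S (T f)) \<le> op_norm X S * op_norm X T"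
proof -
  have *: "l2_norm (S (T f)) \<le> (op_norm X S * op_norm X T) * l2_norm f" if f: "f \<in> l2 X" for f
  proof -
    have "l2_norm (S (T f)) \<le> op_norm X S * l2_norm (T f)" by (rule op_norm_bound[OF S op_closed[OF T f]])
    also have "\<dots> \<le> op_norm X S * (op_norm X T * l2_norm f)"
      by (intro mult_left_mono op_norm_bound[OF T f] op_norm_nonneg[OF S])
    finally show ?thesis by (simp add: mult.assoc)
  qed
  show "(\<lambda>f. S (T f)) \<in> bounded_ops X"
    by (rule bounded_opsI[OF _ _ _ _ *])
       (use S T in \<open>auto simp: op_outside op_zero op_add op_scale op_closed\<close>)
  show "op_norm X (\<lambda>f. S (T f)) \<le> op_norm X S * op_norm X T"
    by (rule op_norm_le[OF *]) (use op_norm_nonneg[OF S] op_norm_nonneg[OF T] in auto)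
qed

lemma op_norm_eq_0:
  assumes T: "T \<in> bounded_ops X" and "op_norm X T = 0"
  shows "T = (\<lambda>f x. 0)"
proof
  fix f show "T f = (\<lambda>x. 0)"
  proof (cases "f \<in> l2 X")
    case True
    then have "l2_norm (T f) \<le> 0" using op_norm_bound[OF T True] assms(2) by simp
    then show ?thesis using l2_norm_eq_0[OF op_closed[OF T True]] l2_norm_nonneg[of "T f"] by simp
  qed (simp add: op_outside[OF T])
qed

lemma zero_bounded_op: "(\<lambda>f x. 0) \<in> bounded_ops X"
  by (rule bounded_opsI[of _ _ 0]) auto

lemma op_norm_zero: "op_norm X (\<lambda>f x. 0) = 0"
  using op_scale_closed(2)[OF zero_bounded_op, of X 0] by simp

text \<open>The limit is taken coordinatewise; the Cauchy estimate passes to it by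
  \<open>l2_limit\<close>, applied to the differences with a fixed \<open>T m\<close>.\<close>

lemma op_alg_complete:
  assumes T: "\<And>n. T n \<in> bounded_ops X" and cau: "ccauchy (op_alg X) T"
  shows "\<exists>S\<in>bounded_ops X. cconverges (op_alg X) T S"
proof -
  have diff: "(\<lambda>f x. T m f x + - 1 * T n f x) \<in> bounded_ops X" for m n
    by (rule op_add_closed(1)[OF T op_scale_closed(1)[OF T]])
  have cau': "\<exists>N. \<forall>m\<ge>N. \<forall>n\<ge>N. op_norm X (\<lambda>f x. T m f x + - 1 * T n f x) < e" if "0 < e" for e
    using cau that unfolding ccauchy_def cdiff_def by simp
  have df: "l2_norm (\<lambda>x. T m f x - T n f x) \<le> op_norm X (\<lambda>f x. T m f x + - 1 * T n f x) * l2_norm f"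
    if "f \<in> l2 X" for m n f
    using op_norm_bound[OF diff that, of m n] by simp
  have "convergent (\<lambda>n. T n f x)" for f x
  proof (cases "f \<in> l2 X")
    case f: True
    show ?thesis
    proof (rule Cauchy_convergent, rule CauchyI)
      fix e :: real assume e: "0 < e"
      define e' where "e' = e / (l2_norm f + 1)"
      have nf: "0 < l2_norm f + 1" using l2_norm_nonneg[of f] by linarith
      then obtain N where N: "\<forall>m\<ge>N. \<forall>n\<ge>N. op_norm X (\<lambda>f x. T m f x + - 1 * T n f x) < e'"
        using cau'[of e'] e by (auto simp: e'_def)
      show "\<exists>M. \<forall>m\<ge>M. \<forall>n\<ge>M. norm (T m f x - T n f x) < e"
      proof (intro exI[of _ N] allI impI)
        fix m n assume mn: "N \<le> m" "N \<le> n"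
        have "cmod (T m f x - T n f x) \<le> l2_norm (\<lambda>x. T m f x - T n f x)"
          by (rule l2_point_le[OF l2_diff[OF op_closed[OF T f] op_closed[OF T f]]])
        also have "\<dots> \<le> op_norm X (\<lambda>f x. T m f x + - 1 * T n f x) * l2_norm f" by (rule df[OF f])
        also have "\<dots> \<le> e' * l2_norm f" using N mn by (intro mult_right_mono) (auto intro: less_imp_le)
        also have "\<dots> < e" using e nf by (simp add: e'_def field_simps)
        finally show "norm (T m f x - T n f x) < e" .
      qed
    qed
  next
    case False
    then show ?thesis using op_outside[OF T False] by (simp add: convergent_const)
  qed
  then obtain S where S: "\<And>f x. (\<lambda>n. T n f x) \<longlonglongrightarrow> S f x" unfolding convergent_def by metis
  have close: "(\<lambda>x. T m f x - S f x) \<in> l2 X \<and> l2_norm (\<lambda>x. T m f x - S f x) \<le> e * l2_norm f"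
    if N: "\<forall>m\<ge>N. \<forall>n\<ge>N. op_norm X (\<lambda>f x. T m f x + - 1 * T n f x) < e" and m: "N \<le> m" and f: "f \<in> l2 X" for N e m f
  proof -
    have b: "l2_norm (\<lambda>x. T m f x - T n f x) \<le> e * l2_norm f" if "n \<ge> N" for n
    proof -
      have "op_norm X (\<lambda>f x. T m f x + - 1 * T n f x) \<le> e" using N m that by (auto intro: less_imp_le)
      then show ?thesis using order_trans[OF df[OF f] mult_right_mono] by simp
    qed
    have l: "(\<lambda>n. T m f x - T n f x) \<longlonglongrightarrow> T m f x - S f x" for x by (intro tendsto_intros S)
    show ?thesis
      using l2_limit[of "\<lambda>n x. T m f x - T n f x" "\<lambda>x. T m f x - S f x" X N, OF l _ b] op_closed[OF T f] l2_diff by blast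
  qed
  have S0: "S f = (\<lambda>_. 0)" if "f \<notin> l2 X" for f
    using S[of f] op_outside[OF T that] LIMSEQ_unique[OF tendsto_const] by fastforce
  \<comment> \<open>Only the differences T m - S are under control so far. Boundedness of
    \<open>S\<close> is read off from T N1 - S, whose bound 1 comes from the choice of
    \<open>N1\<close>.\<close>
  obtain N1 where N1: "\<forall>m\<ge>N1. \<forall>n\<ge>N1. op_norm X (\<lambda>f x. T m f x + - 1 * T n f x) < 1"
    using cau'[of 1] by auto
  have R: "(\<lambda>f x. T N1 f x - S f x) \<in> bounded_ops X"
  proof (rule bounded_opsI)
    fix f g assume fg: "f \<in> l2 X" "g \<in> l2 X"
    have "S (\<lambda>x. f x + g x) = (\<lambda>x. S f x + S g x)"
      using S[of "\<lambda>x. f x + g x"] tendsto_add[OF S[of f] S[of g]] LIMSEQ_unique by (fastforce simp: op_add[OF T fg])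
    then show "(\<lambda>x. T N1 (\<lambda>x. f x + g x) x - S (\<lambda>x. f x + g x) x) = (\<lambda>x. T N1 f x - S f x + (T N1 g x - S g x))"
      by (simp add: op_add[OF T fg] algebra_simps)
  next
    fix c f assume f: "f \<in> l2 X"
    have "S (\<lambda>x. c * f x) = (\<lambda>x. c * S f x)"
      using S[of "\<lambda>x. c * f x"] tendsto_mult_left[OF S[of f], of c] LIMSEQ_unique by (fastforce simp: op_scale[OF T f])
    then show "(\<lambda>x. T N1 (\<lambda>x. c * f x) x - S (\<lambda>x. c * f x) x) = (\<lambda>x. c * (T N1 f x - S f x))"
      by (simp add: op_scale[OF T f] right_diff_distrib)
  next
    fix f assume "f \<in> l2 X"
    then show "l2_norm (\<lambda>x. T N1 f x - S f x) \<le> 1 * l2_norm f" using close[OF N1 order_refl] by blast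
  qed (use close[OF N1 order_refl] S0 op_outside[OF T] in auto)
  have "(\<lambda>f x. T N1 f x + - 1 * (T N1 f x - S f x)) \<in> bounded_ops X"
    by (rule op_add_closed(1)[OF T op_scale_closed(1)[OF R]])
  then have Sb: "S \<in> bounded_ops X" by simp
  have "cconverges (op_alg X) T S"
    unfolding cconverges_def LIMSEQ_iff
  proof (intro allI impI)
    fix e :: real assume e: "0 < e"
    obtain N where N: "\<forall>m\<ge>N. \<forall>n\<ge>N. op_norm X (\<lambda>f x. T m f x + - 1 * T n f x) < e / 2"
      using cau'[of "e / 2"] e by auto
    show "\<exists>N. \<forall>n\<ge>N. norm (op_norm X (cdiff (op_alg X) (T n) S) - 0) < e"
    proof (intro exI[of _ N] allI impI)
      fix n assume n: "N \<le> n"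
      have "op_norm X (cdiff (op_alg X) (T n) S) \<le> e / 2"
        by (rule op_norm_le) (use close[OF N n] e in \<open>auto simp: cdiff_def\<close>)
      moreover have "0 \<le> op_norm X (cdiff (op_alg X) (T n) S)"
        using op_norm_nonneg[OF op_add_closed(1)[OF T[of n] op_scale_closed(1)[OF Sb, of "-1"]]]
        by (simp add: cdiff_def)
      ultimately show "norm (op_norm X (cdiff (op_alg X) (T n) S) - 0) < e" using e by simp
    qed
  qed
  with Sb show ?thesis by blast
qed

theorem cstar_algebra_op_alg: "cstar_algebra (op_alg X)"
proof
  fix T assume T: "T \<in> carrier (op_alg X)"
  then have T': "T \<in> bounded_ops X" by simp
  note A = op_adj_closed[OF T']
  show "op_adj X (op_adj X T) = T"
    by (rule op_adj_unique) (use A T' op_adj_inner[OF T'] in auto)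
  have ATT: "(\<lambda>f. op_adj X T (T f)) \<in> bounded_ops X" by (rule op_mult_closed(1)[OF A T'])
  \<comment> \<open>The essential half of the C*-identity: ||T f||^2 = <T* T f, f> <= ||T* T||
    ||f||^2.\<close>
  have "op_norm X T \<le> sqrt (op_norm X (\<lambda>f. op_adj X T (T f)))"
  proof (rule op_norm_le)
    fix f assume f: "f \<in> l2 X"
    have "of_real ((l2_norm (T f))\<^sup>2) = l2_inner (T f) (T f)" by (simp add: l2_inner_self[OF op_closed[OF T' f]])
    also have "\<dots> = l2_inner (op_adj X T (T f)) f" by (simp add: op_adj_inner[OF T' op_closed[OF T' f] f])
    finally have "(l2_norm (T f))\<^sup>2 = cmod (l2_inner (op_adj X T (T f)) f)"
      by (metis norm_of_real abs_of_nonneg zero_le_power2)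
    also have "\<dots> \<le> l2_norm (op_adj X T (T f)) * l2_norm f"
      by (rule cmod_l2_inner_le[OF op_closed[OF ATT f] f])
    also have "\<dots> \<le> op_norm X (\<lambda>f. op_adj X T (T f)) * l2_norm f * l2_norm f"
      by (intro mult_right_mono op_norm_bound[OF ATT f]) simp
    finally have "(l2_norm (T f))\<^sup>2 \<le> (sqrt (op_norm X (\<lambda>f. op_adj X T (T f))) * l2_norm f)\<^sup>2"
      unfolding power_mult_distrib real_sqrt_pow2[OF op_norm_nonneg[OF ATT]] by (simp add: power2_eq_square mult.assoc)
    then show "l2_norm (T f) \<le> sqrt (op_norm X (\<lambda>f. op_adj X T (T f))) * l2_norm f"
      by (rule power2_le_imp_le) (use op_norm_nonneg[OF ATT] in simp)
  qed (use op_norm_nonneg[OF ATT] in simp)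
  then have "(op_norm X T)\<^sup>2 \<le> op_norm X (\<lambda>f. op_adj X T (T f))"
    using op_norm_nonneg[OF ATT] op_norm_nonneg[OF T'] by (metis power_mono real_sqrt_pow2)
  moreover have "op_norm X (\<lambda>f. op_adj X T (T f)) \<le> op_norm X (op_adj X T) * op_norm X T"
    by (rule op_mult_closed(2)[OF A T'])
  moreover have "\<dots> \<le> (op_norm X T)\<^sup>2" unfolding power2_eq_square
    by (intro mult_right_mono op_norm_adj_le[OF T'] op_norm_nonneg[OF T'])
  ultimately show "op_norm X (op_adj X T \<cdot>\<^bsub>op_alg X\<^esub> T) = (op_norm X T)\<^sup>2" by simp
  fix c
  show "op_adj X (c \<odot>\<^bsub>op_alg X\<^esub> T) = cnj c \<odot>\<^bsub>op_alg X\<^esub> op_adj X T"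
    by (rule op_adj_unique)
       (use T' A op_adj_inner[OF T'] in \<open>auto simp: op_scale_closed l2_inner_scale_left l2_inner_scale_right
          op_adj_inner[OF A] l2_inner_commute[of _ "op_adj X T _"] op_adj_inner[OF T'] l2_inner_commute[of "T _"]\<close>)
next
  fix S T assume "S \<in> carrier (op_alg X)" "T \<in> carrier (op_alg X)"
  then have ST: "S \<in> bounded_ops X" "T \<in> bounded_ops X" by auto
  have adj': "l2_inner f (op_adj X R g) = l2_inner (R f) g" if "R \<in> bounded_ops X" "f \<in> l2 X" "g \<in> l2 X" for R f g
    by (metis op_adj_inner[OF that(1,3,2)] l2_inner_commute)
  note A = op_adj_closed[OF ST(1)] op_adj_closed[OF ST(2)]
  show "op_adj X (S \<oplus>\<^bsub>op_alg X\<^esub> T) = op_adj X S \<oplus>\<^bsub>op_alg X\<^esub> op_adj X T"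
    by (rule op_adj_unique)
       (use ST A in \<open>auto simp: op_add_closed l2_inner_add_right[of _ X] l2_inner_add_left[of _ X] adj' op_closed\<close>)
  show "op_adj X (S \<cdot>\<^bsub>op_alg X\<^esub> T) = op_adj X T \<cdot>\<^bsub>op_alg X\<^esub> op_adj X S"
    by (rule op_adj_unique) (use ST A in \<open>auto simp: op_mult_closed adj' op_closed\<close>)
next
  fix T assume "\<And>n::nat. T n \<in> carrier (op_alg X)" "ccauchy (op_alg X) T"
  then show "\<exists>l\<in>carrier (op_alg X). cconverges (op_alg X) T l" using op_alg_complete[of T X] by simp
qed (auto simp: zero_bounded_op op_add_closed op_scale_closed op_mult_closed op_adj_closed
      op_norm_nonneg op_norm_zero op_norm_eq_0 op_add op_scale op_closed' algebra_simps)

section \<open>Tensor products of operators\<close>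

definition closed_subalg :: "('a, 'm) cstar_scheme \<Rightarrow> 'a set \<Rightarrow> bool" where
  "closed_subalg A M \<longleftrightarrow> M \<subseteq> carrier A \<and> \<zero>\<^bsub>A\<^esub> \<in> M \<and>
     (\<forall>x\<in>M. \<forall>y\<in>M. x \<oplus>\<^bsub>A\<^esub> y \<in> M) \<and> (\<forall>c. \<forall>x\<in>M. c \<odot>\<^bsub>A\<^esub> x \<in> M) \<and>
     (\<forall>x\<in>M. \<forall>y\<in>M. x \<cdot>\<^bsub>A\<^esub> y \<in> M) \<and> (\<forall>x\<in>M. cadj A x \<in> M) \<and>
     (\<forall>f. \<forall>l\<in>carrier A. (\<forall>n. f n \<in> M) \<longrightarrow> cconverges A f l \<longrightarrow> l \<in> M)"

lemma closed_subalgD: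
  assumes "closed_subalg A M"
  shows closed_subalg_subset: "M \<subseteq> carrier A" and closed_subalg_zero: "\<zero>\<^bsub>A\<^esub> \<in> M"
    and closed_subalg_add: "x \<in> M \<Longrightarrow> y \<in> M \<Longrightarrow> x \<oplus>\<^bsub>A\<^esub> y \<in> M"
    and closed_subalg_scale: "x \<in> M \<Longrightarrow> c \<odot>\<^bsub>A\<^esub> x \<in> M"
    and closed_subalg_mult: "x \<in> M \<Longrightarrow> y \<in> M \<Longrightarrow> x \<cdot>\<^bsub>A\<^esub> y \<in> M"
    and closed_subalg_adj: "x \<in> M \<Longrightarrow> cadj A x \<in> M"
    and closed_subalg_limit: "\<lbrakk>\<And>n. f n \<in> M; l \<in> carrier A; cconverges A f l\<rbrakk> \<Longrightarrow> l \<in> M"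
  using assms unfolding closed_subalg_def by blast+

lemma op_subalg_simps [simp]:
  "carrier (op_subalg n M) = M"
  "czero (op_subalg n M) = (\<lambda>f x. 0)"
  "cadd (op_subalg n M) = (\<lambda>S T f x. S f x + T f x)"
  "cscale (op_subalg n M) = (\<lambda>c T f x. c * T f x)"
  "cmult (op_subalg n M) = (\<lambda>S T f. S (T f))"
  "cadj (op_subalg n M) = op_adj (words n)"
  "cnorm (op_subalg n M) = op_norm (words n)"
  "deg (op_subalg n M) = n"
  "rep (op_subalg n M) = (\<lambda>T. T)"
  by (simp_all add: op_subalg_def cstar.extend_def rep_cstar.fields_def op_alg_def)

lemma cdiff_op_alg: "cdiff (op_alg X) S T = (\<lambda>f x. S f x + - 1 * T f x)"
  by (simp add: cdiff_def)

lemma cdiff_op_subalg [simp]: "cdiff (op_subalg n M) = cdiff (op_alg (words n))"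
  by (intro ext) (simp add: cdiff_def)

lemma cconverges_op_subalg [simp]: "cconverges (op_subalg n M) = cconverges (op_alg (words n))"
  by (intro ext) (simp add: cconverges_def)

lemma ccauchy_op_subalg [simp]: "ccauchy (op_subalg n M) = ccauchy (op_alg (words n))"
  by (intro ext) (simp add: ccauchy_def)

lemma cstar_algebra_op_subalg:
  fixes M :: "'h list oper set"
  assumes M: "closed_subalg (op_alg (words n)) M"
  shows "cstar_algebra (op_subalg n M)"
proof -
  interpret O: cstar_algebra "op_alg (words n) :: 'h list oper cstar" by (rule cstar_algebra_op_alg)
  have MO: "x \<in> bounded_ops (words n)" if "x \<in> M" for x using closed_subalg_subset[OF M] that by auto
  show ?thesis
  proof
    fix f assume f: "\<And>k::nat. f k \<in> carrier (op_subalg n M)" and c: "ccauchy (op_subalg n M) f"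
    then obtain l where l: "l \<in> carrier (op_alg (words n))" "cconverges (op_alg (words n)) f l"
      using O.complete[of f] MO by auto
    then have "l \<in> M" using closed_subalg_limit[OF M, of f l] f by simp
    then show "\<exists>l\<in>carrier (op_subalg n M). cconverges (op_subalg n M) f l" using l by auto
  qed (use closed_subalg_zero[OF M] closed_subalg_add[OF M] closed_subalg_scale[OF M] closed_subalg_mult[OF M]
       closed_subalg_adj[OF M] O.norm_nonneg O.norm_eq_zero O.cstar_identity
       in \<open>simp_all add: MO O.adj_adj O.adj_add[simplified] O.adj_scale[simplified] O.adj_mult[simplified]
         O.norm_scale[simplified] O.norm_triangle[simplified] O.norm_mult[simplified]
         op_add[OF MO] op_scale[OF MO] op_closed'[OF MO] op_zero[OF MO] algebra_simps\<close>)
qed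

lemma represented_op_subalg:
  assumes M: "closed_subalg (op_alg (words n)) M"
  shows "represented_cstar (op_subalg n M)"
proof -
  have "M \<subseteq> bounded_ops (words n)" using closed_subalg_subset[OF M] by simp
  then show ?thesis unfolding represented_cstar_def using cstar_algebra_op_subalg[OF M]
    by (auto simp: star_mono_def star_hom_def)
qed

text \<open>Isometry makes the preimages of a convergent sequence a Cauchy sequence, so the range is
  complete and hence closed.\<close>

lemma closed_subalg_image:
  assumes A: "cstar_algebra A" and B: "cstar_algebra B" and f: "star_mono A B f"
  shows "closed_subalg B (f ` carrier A)"
proof -
  interpret A: cstar_algebra A by (rule A)
  interpret B: cstar_algebra B by (rule B)
  have h: "star_hom A B f" using f by (simp add: star_mono_def)
  have "l \<in> f ` carrier A" if F: "\<And>n. F n \<in> f ` carrier A" "l \<in> carrier B" "cconverges B F l" for F l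
  proof -
    obtain G where G: "\<And>n. G n \<in> carrier A" "\<And>n. F n = f (G n)" using F(1) unfolding image_iff by metis
    have Fc: "F n \<in> carrier B" for n using star_hom_closed[OF h] G by simp
    have "cnorm A (cdiff A (G m) (G n)) = cnorm B (cdiff B (F m) (F n))" for m n
      using star_mono_isometric[OF A B f A.cdiff_closed[OF G(1) G(1)], of m n] G
      by (simp add: star_hom_cdiff[OF A h])
    then have "ccauchy A G" using B.converges_cauchy[OF Fc F(2,3)] unfolding ccauchy_def by simp
    then obtain k where k: "k \<in> carrier A" "cconverges A G k" using A.complete[of G] G by blast
    have "cnorm B (cdiff B (F n) (f k)) = cnorm A (cdiff A (G n) k)" for n
      using star_mono_isometric[OF A B f A.cdiff_closed[OF G(1) k(1)], of n] G k
      by (simp add: star_hom_cdiff[OF A h])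
    then have "cconverges B F (f k)" using k(2) by (simp add: cconverges_def)
    then have "l = f k" using B.converges_unique[OF Fc F(2) _ F(3)] star_hom_closed[OF h k(1)] by blast
    then show ?thesis using k by blast
  qed
  then show ?thesis unfolding closed_subalg_def
    using star_hom_closed[OF h] star_hom_zero[OF A B h, symmetric] A.zero_closed
    by (auto simp: image_iff simp flip: star_hom_add[OF h] star_hom_scale[OF h] star_hom_mult[OF h] star_hom_adj[OF h])
qed

lemma rep_closed_subalg:
  assumes "represented_cstar A" shows "closed_subalg (op_alg (words (deg A))) (rep A ` carrier A)"
  using assms cstar_algebra_op_alg closed_subalg_image unfolding represented_cstar_def by blast

section \<open>Linear spans, their closures, and the subalgebras they form\<close>

inductive_set lin_span :: "('a, 'm) cstar_scheme \<Rightarrow> 'a set \<Rightarrow> 'a set" for A E where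
  lin_span_zero: "\<zero>\<^bsub>A\<^esub> \<in> lin_span A E"
| lin_span_base: "x \<in> E \<Longrightarrow> x \<in> lin_span A E"
| lin_span_add: "x \<in> lin_span A E \<Longrightarrow> y \<in> lin_span A E \<Longrightarrow> x \<oplus>\<^bsub>A\<^esub> y \<in> lin_span A E"
| lin_span_scale: "x \<in> lin_span A E \<Longrightarrow> c \<odot>\<^bsub>A\<^esub> x \<in> lin_span A E"

context cstar_algebra
begin

lemma lin_span_subset: assumes "E \<subseteq> carrier A" shows "lin_span A E \<subseteq> carrier A"
proof
  fix x assume "x \<in> lin_span A E" then show "x \<in> carrier A" by induction (use assms in auto)
qed

text \<open>Turns the definition by intersection into approximation by the inductively generated
  span, on which identities can be proved by induction.\<close>

lemma closed_span_eq:
  assumes E: "E \<subseteq> carrier A"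
  shows "closed_span A E = {l \<in> carrier A. \<forall>e>0. \<exists>x\<in>lin_span A E. cnorm A (cdiff A l x) < e}" (is "_ = ?R")
proof
  have LS: "x \<in> carrier A" if "x \<in> lin_span A E" for x using lin_span_subset[OF E] that by blast
  have approx: "\<exists>X. (\<forall>n. X n \<in> lin_span A E) \<and> cconverges A X l" if "l \<in> ?R" for l
    using approx_sequence[of l "lin_span A E"] that lin_span_subset[OF E] by (smt (verit) mem_Collect_eq)
  have RI: "l \<in> ?R" if "l \<in> carrier A" "\<And>n. X n \<in> lin_span A E" "cconverges A X l" for l X
  proof -
    have "\<exists>x\<in>lin_span A E. cnorm A (cdiff A l x) < e" if "0 < e" for e
    proof -
      obtain N where "\<forall>n\<ge>N. \<bar>cnorm A (cdiff A (X n) l)\<bar> < e"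
        using \<open>cconverges A X l\<close> \<open>0 < e\<close> unfolding converges_iff_eps by blast
      then have "cnorm A (cdiff A (X N) l) < e" by (meson abs_ge_self le_less_trans order_refl)
      then show ?thesis using \<open>\<And>n. X n \<in> lin_span A E\<close> norm_cdiff_commute[of l "X N"] LS \<open>l \<in> carrier A\<close>
        by (intro bexI[of _ "X N"]) simp_all
    qed
    then show ?thesis using that by blast
  qed
  show "?R \<subseteq> closed_span A E"
  proof
    fix l assume l: "l \<in> ?R"
    then obtain X where X: "\<And>n. X n \<in> lin_span A E" "cconverges A X l" using approx by blast
    show "l \<in> closed_span A E" unfolding closed_span_def
    proof (intro InterI, elim CollectE conjE)
      fix M assume M: "E \<subseteq> M" "M \<subseteq> carrier A" "\<zero> \<in> M" "\<forall>x\<in>M. \<forall>y\<in>M. x \<oplus> y \<in> M" "\<forall>c. \<forall>x\<in>M. c \<odot> x \<in> M"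
        "\<forall>f. \<forall>l\<in>carrier A. (\<forall>n. f n \<in> M) \<longrightarrow> cconverges A f l \<longrightarrow> l \<in> M"
      have "x \<in> M" if "x \<in> lin_span A E" for x using that by induction (use M in auto)
      then show "l \<in> M" using M(6) X l by blast
    qed
  qed
  show "closed_span A E \<subseteq> ?R" unfolding closed_span_def
  proof (rule Inter_lower, rule CollectI, intro conjI)
    have mem: "x \<in> ?R" if "x \<in> lin_span A E" for x
      using that LS by (auto intro!: bexI[of _ x])
    then show "E \<subseteq> ?R" "\<zero> \<in> ?R" by (blast intro: lin_span_base lin_span_zero)+
    show "?R \<subseteq> carrier A" by blast
    show "\<forall>x\<in>?R. \<forall>y\<in>?R. x \<oplus> y \<in> ?R"
    proof (intro ballI)
      fix x y assume xy: "x \<in> ?R" "y \<in> ?R"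
      then obtain X Y where "\<forall>n. X n \<in> lin_span A E" "cconverges A X x" "\<forall>n. Y n \<in> lin_span A E" "cconverges A Y y"
        using approx by meson
      then show "x \<oplus> y \<in> ?R"
        using xy by (intro RI[of _ "\<lambda>n. X n \<oplus> Y n"]) (auto intro!: lin_span_add converges_add LS)
    qed
    show "\<forall>c. \<forall>x\<in>?R. c \<odot> x \<in> ?R"
    proof (intro allI ballI)
      fix c x assume x: "x \<in> ?R"
      then obtain X where "\<forall>n. X n \<in> lin_span A E" "cconverges A X x" using approx by meson
      then show "c \<odot> x \<in> ?R"
        using x by (intro RI[of _ "\<lambda>n. c \<odot> X n"]) (auto intro!: lin_span_scale converges_scale LS)
    qed
    show "\<forall>f. \<forall>l\<in>carrier A. (\<forall>n. f n \<in> ?R) \<longrightarrow> cconverges A f l \<longrightarrow> l \<in> ?R"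
    proof (intro allI ballI impI)
      fix f l assume l: "l \<in> carrier A" and f: "\<forall>n. f n \<in> ?R" and c: "cconverges A f l"
      have "\<exists>x\<in>lin_span A E. cnorm A (cdiff A l x) < e" if e: "0 < e" for e
      proof -
        obtain N where "\<forall>n\<ge>N. \<bar>cnorm A (cdiff A (f n) l)\<bar> < e / 2"
          using c e unfolding converges_iff_eps by (meson half_gt_zero)
        then have N: "cnorm A (cdiff A (f N) l) < e / 2" by (meson abs_ge_self le_less_trans order_refl)
        have "\<forall>e>0. \<exists>x\<in>lin_span A E. cnorm A (cdiff A (f N) x) < e" using f by blast
        then obtain x where x: "x \<in> lin_span A E" "cnorm A (cdiff A (f N) x) < e / 2"
          using half_gt_zero[OF e] by blast
        have fN: "f N \<in> carrier A" using f by blast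
        have "cnorm A (cdiff A l x) < e"
          using norm_cdiff_triangle[OF l fN LS[OF x(1)]] norm_cdiff_commute[OF l fN] N x(2) by simp
        then show ?thesis using x(1) by blast
      qed
      then show "l \<in> ?R" using l by blast
    qed
  qed
qed

lemma closed_span_dense:
  assumes "E \<subseteq> carrier A" "l \<in> closed_span A E"
  obtains X where "\<And>n. X n \<in> lin_span A E" "cconverges A X l"
  using approx_sequence[of l "lin_span A E"] assms closed_span_eq[OF assms(1)] lin_span_subset[OF assms(1)]
  by (smt (verit) mem_Collect_eq)

lemma closed_span_subset_carrier: "E \<subseteq> carrier A \<Longrightarrow> closed_span A E \<subseteq> carrier A"
  by (simp add: closed_span_eq)

lemma closed_span_closed:
  "closed_span A E \<subseteq> carrier A \<Longrightarrow> (\<And>n. f n \<in> closed_span A E) \<Longrightarrow> cconverges A f l \<Longrightarrow> l \<in> carrier A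
   \<Longrightarrow> l \<in> closed_span A E"
  unfolding closed_span_def by blast

lemma closed_span_base: "E \<subseteq> closed_span A E"
  unfolding closed_span_def by blast

lemma closed_span_linear:
  shows closed_span_zero: "\<zero> \<in> closed_span A E"
    and closed_span_add: "x \<in> closed_span A E \<Longrightarrow> y \<in> closed_span A E \<Longrightarrow> x \<oplus> y \<in> closed_span A E"
    and closed_span_scale: "x \<in> closed_span A E \<Longrightarrow> c \<odot> x \<in> closed_span A E"
  unfolding closed_span_def by blast+

lemma lin_span_closed_span: "lin_span A E \<subseteq> closed_span A E"
proof
  fix x assume "x \<in> lin_span A E" then show "x \<in> closed_span A E"
    by induction (use closed_span_base in \<open>auto intro: closed_span_linear\<close>)
qed

lemma closed_span_minimal:
  assumes "E \<subseteq> closed_span A E'" "E' \<subseteq> carrier A"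
  shows "closed_span A E \<subseteq> closed_span A E'"
  unfolding closed_span_def[of A E]
proof (rule Inter_lower, rule CollectI, intro conjI)
  show "closed_span A E' \<subseteq> carrier A" using closed_span_subset_carrier assms by blast
  then show "\<forall>f. \<forall>l\<in>carrier A. (\<forall>n. f n \<in> closed_span A E') \<longrightarrow> cconverges A f l \<longrightarrow> l \<in> closed_span A E'"
    using closed_span_closed[of E'] by (intro allI ballI impI) meson
qed (use assms in \<open>auto intro: closed_span_linear\<close>)

text \<open>The span of a multiplicative self-adjoint set inherits both properties, and continuity
  of the operations carries them to the closure.\<close>

lemma closed_subalg_closed_span:
  assumes E: "E \<subseteq> carrier A" and mult: "\<And>x y. x \<in> E \<Longrightarrow> y \<in> E \<Longrightarrow> x \<cdot> y \<in> E"
    and adj: "\<And>x. x \<in> E \<Longrightarrow> cadj A x \<in> E"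
  shows "closed_subalg A (closed_span A E)"
proof -
  let ?S = "closed_span A E"
  have SA: "?S \<subseteq> carrier A" by (rule closed_span_subset_carrier[OF E])
  have LS: "x \<in> carrier A" if "x \<in> lin_span A E" for x using lin_span_subset[OF E] that by blast
  have EA: "x \<in> carrier A" if "x \<in> E" for x using that E by blast
  have adjL: "cadj A x \<in> lin_span A E" if "x \<in> lin_span A E" for x
    using that
  proof induction
    case (lin_span_base x) then show ?case by (intro lin_span.lin_span_base adj)
  qed (simp_all add: adj_add adj_scale LS lin_span.intros)
  have multL1: "x \<cdot> y \<in> lin_span A E" if x: "x \<in> E" and "y \<in> lin_span A E" for x y
    using that(2)
  proof induction
    case (lin_span_base y) then show ?case using x by (intro lin_span.lin_span_base mult)
  qed (use EA[OF x] in \<open>simp_all add: mult_add_right mult_scale_right LS lin_span.intros\<close>)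
  have multL: "x \<cdot> y \<in> lin_span A E" if "x \<in> lin_span A E" and y: "y \<in> lin_span A E" for x y
    using that(1)
  proof induction
    case (lin_span_base x) then show ?case using y by (intro multL1)
  qed (use LS[OF y] in \<open>simp_all add: mult_add_left mult_scale_left LS lin_span.intros\<close>)
  have LinS: "x \<in> ?S" if "x \<in> lin_span A E" for x using lin_span_closed_span that by blast
  have "cadj A x \<in> ?S" if x: "x \<in> ?S" for x
  proof -
    obtain X where X: "\<And>n. X n \<in> lin_span A E" "cconverges A X x" using closed_span_dense[OF E x] by blast
    show ?thesis
      by (rule closed_span_closed[OF SA, of "\<lambda>n. cadj A (X n)"])
         (use X subsetD[OF SA x] in \<open>auto simp: LS intro!: LinS adjL converges_adj\<close>)
  qed
  moreover have "x \<cdot> y \<in> ?S" if x: "x \<in> ?S" and y: "y \<in> ?S" for x y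
  proof -
    obtain X where X: "\<And>n. X n \<in> lin_span A E" "cconverges A X x" using closed_span_dense[OF E x] by blast
    obtain Y where Y: "\<And>n. Y n \<in> lin_span A E" "cconverges A Y y" using closed_span_dense[OF E y] by blast
    show ?thesis
      by (rule closed_span_closed[OF SA, of "\<lambda>n. X n \<cdot> Y n"])
         (use X Y subsetD[OF SA x] subsetD[OF SA y] in \<open>auto simp: LS intro!: LinS multL converges_mult\<close>)
  qed
  ultimately show ?thesis unfolding closed_subalg_def
  proof (intro conjI allI ballI impI)
    fix f l assume "l \<in> carrier A" "\<forall>n. f n \<in> ?S" "cconverges A f l"
    then show "l \<in> ?S" using closed_span_closed[OF SA, of f l] by simp
  qed (use SA in \<open>simp_all add: closed_span_linear\<close>)
qed

end

lemma star_hom_eq_on_span: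
  assumes E: "E \<subseteq> bounded_ops (words n)" and A: "cstar_algebra (op_subalg n (closed_span (op_alg (words n)) E))"
    and B: "cstar_algebra B"
    and h: "star_hom (op_subalg n (closed_span (op_alg (words n)) E)) B h"
    and h': "star_hom (op_subalg n (closed_span (op_alg (words n)) E)) B h'"
    and eq: "\<And>x. x \<in> E \<Longrightarrow> h x = h' x" and x: "x \<in> closed_span (op_alg (words n)) E"
  shows "h x = h' x"
proof -
  let ?O = "op_alg (words n)" and ?A = "op_subalg n (closed_span (op_alg (words n)) E)"
  interpret O: cstar_algebra ?O by (rule cstar_algebra_op_alg)
  have E': "E \<subseteq> carrier ?O" using E by simp
  have L: "y \<in> closed_span ?O E" if "y \<in> lin_span ?O E" for y using O.lin_span_closed_span that by blast
  have "h y = h' y" if "y \<in> lin_span ?O E" for y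
    using that
  proof induction
    case lin_span_zero
    show ?case using star_hom_zero[OF A B h] star_hom_zero[OF A B h'] by simp
  next
    case (lin_span_add x y)
    then show ?case using star_hom_add[OF h, of x y] star_hom_add[OF h', of x y] L by simp
  next
    case (lin_span_scale x c)
    then show ?case using star_hom_scale[OF h, of x c] star_hom_scale[OF h', of x c] L by simp
  qed (rule eq)
  moreover have "cdense ?A (lin_span ?O E)"
    unfolding cdense_def using O.lin_span_closed_span[of E] by (simp add: O.closed_span_eq[OF E'])
  ultimately show ?thesis using star_hom_eq_on_dense[OF A B h h'] x by simp
qed

text \<open>A pairing identifies the word set \<open>X\<close> with \<open>Z \<times> Y\<close>; both factors of a tensor product are then
  treated alike.\<close>

definition pairing :: "('z \<Rightarrow> 'y \<Rightarrow> 'x) \<Rightarrow> 'z set \<Rightarrow> 'y set \<Rightarrow> 'x set \<Rightarrow> bool" where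
  "pairing c Z Y X \<longleftrightarrow> inj_on (\<lambda>(a, b). c a b) (Z \<times> Y) \<and> X = (\<lambda>(a, b). c a b) ` (Z \<times> Y) \<and>
     (\<forall>a\<in>Z. \<forall>b. c a b \<in> X \<longrightarrow> b \<in> Y)"

lemma pairing_append: "pairing (@) (words m) (words n) (words (m + n) :: 'h list set)"
  unfolding pairing_def
proof (intro conjI)
  show "(words (m + n) :: 'h list set) = (\<lambda>(a, b). a @ b) ` (words m \<times> words n)"
  proof (intro set_eqI iffI)
    fix zs :: "'h list" assume "zs \<in> words (m + n)"
    then have "zs = (\<lambda>(a, b). a @ b) (take m zs, drop m zs)" "(take m zs, drop m zs) \<in> words m \<times> words n"
      by (auto simp: words_def)
    then show "zs \<in> (\<lambda>(a, b). a @ b) ` (words m \<times> words n)" by blast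
  qed (auto simp: words_def)
qed (auto simp: words_def inj_on_def)

lemma pairing_swap: "pairing (\<lambda>b a. a @ b) (words n) (words m) (words (m + n) :: 'h list set)"
proof -
  have "(words (m + n) :: 'h list set) = (\<lambda>(a, b). a @ b) ` (words m \<times> words n)"
    using pairing_append[where 'h='h, of m n] by (simp add: pairing_def)
  also have "\<dots> = (\<lambda>(b, a). a @ b) ` (words n \<times> words m)" by (force simp: image_def)
  finally show ?thesis unfolding pairing_def by (auto simp: words_def inj_on_def)
qed

text \<open>Finite subsets of \<open>X\<close> lie in images of finite rectangles, so it is enough
  to bound sums over rectangles, where the two coordinates can be treated in turn.\<close>

lemma pairing_l2_bound:
  assumes c: "pairing c Z Y X" and k: "\<And>x. x \<notin> X \<Longrightarrow> k x = 0"
    and le: "\<And>F G. finite F \<Longrightarrow> finite G \<Longrightarrow> F \<subseteq> Z \<Longrightarrow> G \<subseteq> Y \<Longrightarrow> (\<Sum>a\<in>F. \<Sum>b\<in>G. (cmod (k (c a b)))\<^sup>2) \<le> C\<^sup>2"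
    and C: "0 \<le> C"
  shows "k \<in> l2 X" "l2_norm k \<le> C"
proof -
  have inj: "inj_on (\<lambda>(a, b). c a b) (Z \<times> Y)" and X: "X = (\<lambda>(a, b). c a b) ` (Z \<times> Y)"
    using c by (auto simp: pairing_def)
  have "L2_set (\<lambda>x. cmod (k x)) H \<le> C" if H: "finite H" for H
  proof -
    obtain P where P: "P \<subseteq> Z \<times> Y" "H \<inter> X = (\<lambda>(a, b). c a b) ` P" "finite P"
      using finite_subset_image[of "H \<inter> X" "\<lambda>(a, b). c a b" "Z \<times> Y"] H X by auto
    define F G where "F = fst ` P" and "G = snd ` P"
    have FG: "finite F" "finite G" "F \<subseteq> Z" "G \<subseteq> Y" "P \<subseteq> F \<times> G" using P by (force simp: F_def G_def)+
    have inj': "inj_on (\<lambda>(a, b). c a b) P" using inj P(1) by (rule inj_on_subset)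
    have "(\<Sum>x\<in>H. (cmod (k x))\<^sup>2) = (\<Sum>x\<in>H \<inter> X. (cmod (k x))\<^sup>2)"
      using H k by (intro sum.mono_neutral_right) auto
    also have "\<dots> = (\<Sum>(a, b)\<in>P. (cmod (k (c a b)))\<^sup>2)"
      unfolding P(2) by (subst sum.reindex[OF inj']) (simp add: case_prod_unfold)
    also have "\<dots> \<le> (\<Sum>(a, b)\<in>F \<times> G. (cmod (k (c a b)))\<^sup>2)" using FG by (intro sum_mono2) auto
    also have "\<dots> = (\<Sum>a\<in>F. \<Sum>b\<in>G. (cmod (k (c a b)))\<^sup>2)" by (simp add: sum.cartesian_product)
    also have "\<dots> \<le> C\<^sup>2" using FG by (intro le)
    finally show ?thesis using C by (simp add: L2_set_def real_le_lsqrt sum_nonneg)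
  qed
  from l2_bound[of X k, OF k this] show "k \<in> l2 X" "l2_norm k \<le> C" by auto
qed

lemma infsum_finite_sum:
  fixes g :: "'a \<Rightarrow> 'b \<Rightarrow> real"
  assumes "finite F" "\<And>a. a \<in> F \<Longrightarrow> g a summable_on UNIV"
  shows "(\<Sum>\<^sub>\<infinity>b. \<Sum>a\<in>F. g a b) = (\<Sum>a\<in>F. \<Sum>\<^sub>\<infinity>b. g a b) \<and> (\<lambda>b. \<Sum>a\<in>F. g a b) summable_on UNIV"
  using assms by (induction F) (auto simp: infsum_add intro: summable_on_add)

text \<open>Finite rectangles embed into \<open>X\<close>, so their sums are bounded by ||f||^2; the
  second coordinate is then summed completely by passing from finite sums to their supremum.\<close>

lemma
  assumes c: "pairing c Z Y X" and f: "f \<in> l2 X"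
  shows pairing_slice_l2: "a \<in> Z \<Longrightarrow> (\<lambda>b. f (c a b)) \<in> l2 Y"
    and pairing_slice_sum: "finite F \<Longrightarrow> F \<subseteq> Z \<Longrightarrow> (\<Sum>a\<in>F. (l2_norm (\<lambda>b. f (c a b)))\<^sup>2) \<le> (l2_norm f)\<^sup>2"
proof -
  have inj: "inj_on (\<lambda>(a, b). c a b) (Z \<times> Y)" and off: "\<And>a b. a \<in> Z \<Longrightarrow> b \<notin> Y \<Longrightarrow> f (c a b) = 0"
    using c l2_D[OF f] by (auto simp: pairing_def)
  have fin: "(\<Sum>a\<in>F. \<Sum>b\<in>G. (cmod (f (c a b)))\<^sup>2) \<le> (l2_norm f)\<^sup>2"
    if "finite F" "finite G" "F \<subseteq> Z" for F G
  proof -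
    have "(\<Sum>a\<in>F. \<Sum>b\<in>G. (cmod (f (c a b)))\<^sup>2) = (\<Sum>a\<in>F. \<Sum>b\<in>G \<inter> Y. (cmod (f (c a b)))\<^sup>2)"
    proof (rule sum.cong[OF refl])
      fix a assume "a \<in> F"
      then have "a \<in> Z" using that by blast
      then show "(\<Sum>b\<in>G. (cmod (f (c a b)))\<^sup>2) = (\<Sum>b\<in>G \<inter> Y. (cmod (f (c a b)))\<^sup>2)"
        using that(2) off by (intro sum.mono_neutral_right) auto
    qed
    also have "\<dots> = (\<Sum>(a, b)\<in>F \<times> (G \<inter> Y). (cmod (f (c a b)))\<^sup>2)" by (simp add: sum.cartesian_product)
    also have "\<dots> = (\<Sum>x\<in>(\<lambda>(a, b). c a b) ` (F \<times> (G \<inter> Y)). (cmod (f x))\<^sup>2)"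
    proof -
      have "inj_on (\<lambda>(a, b). c a b) (F \<times> (G \<inter> Y))" using that by (intro inj_on_subset[OF inj]) auto
      then show ?thesis by (subst sum.reindex) (auto simp: case_prod_unfold)
    qed
    also have "\<dots> \<le> (l2_norm f)\<^sup>2"
      using that by (intro sum_le_of_L2_set_le l2_finite_le[OF f]) auto
    finally show ?thesis .
  qed
  show sl: "(\<lambda>b. f (c a b)) \<in> l2 Y" if a: "a \<in> Z" for a
  proof (rule l2_boundI)
    fix G :: "'b set" assume "finite G"
    then have "(\<Sum>b\<in>G. (cmod (f (c a b)))\<^sup>2) \<le> (l2_norm f)\<^sup>2" using fin[of "{a}" G] a by simp
    then show "L2_set (\<lambda>b. cmod (f (c a b))) G \<le> l2_norm f"
      by (simp add: L2_set_def real_le_lsqrt sum_nonneg)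
  qed (rule off[OF a])
  assume F: "finite F" "F \<subseteq> Z"
  have s: "(\<lambda>b. (cmod (f (c a b)))\<^sup>2) summable_on UNIV" if "a \<in> F" for a
    using sl[of a] that F by (auto simp: l2_def)
  have "(\<Sum>a\<in>F. (l2_norm (\<lambda>b. f (c a b)))\<^sup>2) = (\<Sum>\<^sub>\<infinity>b. \<Sum>a\<in>F. (cmod (f (c a b)))\<^sup>2)"
    unfolding l2_norm_sq using infsum_finite_sum[OF F(1) s] by simp
  also have "\<dots> \<le> (l2_norm f)\<^sup>2"
  proof (rule infsum_le_finite_sums)
    show "(\<lambda>b. \<Sum>a\<in>F. (cmod (f (c a b)))\<^sup>2) summable_on UNIV" using infsum_finite_sum[OF F(1) s] by simp
    fix G :: "'b set" assume "finite G"
    then show "(\<Sum>b\<in>G. \<Sum>a\<in>F. (cmod (f (c a b)))\<^sup>2) \<le> (l2_norm f)\<^sup>2"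
      using fin[OF F(1) _ F(2)] by (subst sum.swap) auto
  qed
  finally show "(\<Sum>a\<in>F. (l2_norm (\<lambda>b. f (c a b)))\<^sup>2) \<le> (l2_norm f)\<^sup>2" .
qed

text \<open>Applying \<open>R\<close> to every slice is the operator 1 \<otimes> R. The slices are
  estimated one at a time, and the sum of their squared norms is at most ||f||^2.\<close>

lemma pairing_apply:
  assumes c: "pairing c Z Y X" and f: "f \<in> l2 X" and R: "R \<in> bounded_ops Y"
    and k: "\<And>x. x \<notin> X \<Longrightarrow> k x = 0" "\<And>a b. a \<in> Z \<Longrightarrow> b \<in> Y \<Longrightarrow> k (c a b) = R (\<lambda>b'. f (c a b')) b"
  shows "k \<in> l2 X" "l2_norm k \<le> op_norm Y R * l2_norm f"
proof -
  have "(\<Sum>a\<in>F. \<Sum>b\<in>G. (cmod (k (c a b)))\<^sup>2) \<le> (op_norm Y R * l2_norm f)\<^sup>2"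
    if FG: "finite F" "finite G" "F \<subseteq> Z" "G \<subseteq> Y" for F G
  proof -
    have "(\<Sum>a\<in>F. \<Sum>b\<in>G. (cmod (k (c a b)))\<^sup>2) = (\<Sum>a\<in>F. \<Sum>b\<in>G. (cmod (R (\<lambda>b'. f (c a b')) b))\<^sup>2)"
      using FG k(2) by (intro sum.cong refl) (auto simp: subset_eq)
    also have "\<dots> \<le> (\<Sum>a\<in>F. (op_norm Y R * l2_norm (\<lambda>b. f (c a b)))\<^sup>2)"
    proof (rule sum_mono)
      fix a assume "a \<in> F"
      then have sl: "(\<lambda>b. f (c a b)) \<in> l2 Y" using FG pairing_slice_l2[OF c f] by blast
      show "(\<Sum>b\<in>G. (cmod (R (\<lambda>b'. f (c a b')) b))\<^sup>2) \<le> (op_norm Y R * l2_norm (\<lambda>b. f (c a b)))\<^sup>2"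
        using l2_finite_le[OF op_closed[OF R sl] FG(2)] op_norm_bound[OF R sl]
        by (intro sum_le_of_L2_set_le) simp
    qed
    also have "\<dots> = (op_norm Y R)\<^sup>2 * (\<Sum>a\<in>F. (l2_norm (\<lambda>b. f (c a b)))\<^sup>2)"
      by (simp add: power_mult_distrib sum_distrib_left)
    also have "\<dots> \<le> (op_norm Y R)\<^sup>2 * (l2_norm f)\<^sup>2"
      using pairing_slice_sum[OF c f FG(1,3)] by (intro mult_left_mono) auto
    finally show ?thesis by (simp add: power_mult_distrib)
  qed
  from pairing_l2_bound[OF c k(1) this] show "k \<in> l2 X" "l2_norm k \<le> op_norm Y R * l2_norm f"
    using op_norm_nonneg[OF R] by auto
qed

definition tensor_vec :: "nat \<Rightarrow> ('h list \<Rightarrow> complex) \<Rightarrow> ('h list \<Rightarrow> complex) \<Rightarrow> 'h list \<Rightarrow> complex" where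
  "tensor_vec m f g = (\<lambda>zs. f (take m zs) * g (drop m zs))"

lemma l2_words_outside: "f \<in> l2 (words n) \<Longrightarrow> length xs \<noteq> n \<Longrightarrow> f xs = 0"
  using l2_D[of f "words n" xs] by (simp add: words_def)

lemma tensor_vec_append: "length xs = m \<Longrightarrow> tensor_vec m f g (xs @ ys) = f xs * g ys"
  by (simp add: tensor_vec_def)

lemma tensor_vec_closed:
  assumes f: "f \<in> l2 (words m)" and g: "g \<in> l2 (words n)"
  shows "tensor_vec m f g \<in> l2 (words (m + n))"
proof (rule pairing_l2_bound(1)[OF pairing_append])
  fix zs :: "'a list" assume zs: "zs \<notin> words (m + n)"
  then have "length (take m zs) \<noteq> m \<or> length (drop m zs) \<noteq> n" by (auto simp: words_def)
  then show "tensor_vec m f g zs = 0"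
    unfolding tensor_vec_def using l2_words_outside[OF f] l2_words_outside[OF g] by fastforce
next
  fix F G :: "'a list set" assume FG: "finite F" "finite G" "F \<subseteq> words m" "G \<subseteq> words n"
  have "(\<Sum>a\<in>F. \<Sum>b\<in>G. (cmod (tensor_vec m f g (a @ b)))\<^sup>2) = (\<Sum>a\<in>F. \<Sum>b\<in>G. (cmod (f a))\<^sup>2 * (cmod (g b))\<^sup>2)"
    using FG by (intro sum.cong refl) (auto simp: words_def tensor_vec_append norm_mult power_mult_distrib)
  also have "\<dots> = (\<Sum>a\<in>F. (cmod (f a))\<^sup>2) * (\<Sum>b\<in>G. (cmod (g b))\<^sup>2)" by (simp add: sum_product)
  also have "\<dots> \<le> (l2_norm f)\<^sup>2 * (l2_norm g)\<^sup>2"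
    using FG f g by (intro mult_mono sum_le_of_L2_set_le l2_finite_le sum_nonneg) auto
  finally show "(\<Sum>a\<in>F. \<Sum>b\<in>G. (cmod (tensor_vec m f g (a @ b)))\<^sup>2) \<le> (l2_norm f * l2_norm g)\<^sup>2"
    by (simp add: power_mult_distrib)
qed simp

lemma ket_tensor:
  assumes "length xs = m" shows "ket (xs @ ys) = tensor_vec m (ket xs) (ket ys)"
proof
  fix zs
  have "zs = xs @ ys \<longleftrightarrow> take m zs = xs \<and> drop m zs = ys"
    using assms by (metis append_eq_conv_conj append_take_drop_id)
  then show "ket (xs @ ys) zs = tensor_vec m (ket xs) (ket ys) zs" by (auto simp: ket_def tensor_vec_def)
qed

text \<open>\<open>tensor_op\<close> does not test the lengths of its words. For a prefix of wrong
  length the slice either vanishes or lies outside \<open>l2 (words n)\<close>, where operators are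
  0 by convention.\<close>

lemma op_slice_outside:
  assumes f: "f \<in> l2 (words (m + n))" and T: "T \<in> bounded_ops (words n)" and xs: "length xs \<noteq> m"
  shows "T (\<lambda>ys. f (xs @ ys)) = (\<lambda>_. 0)"
proof (cases "(\<lambda>ys. f (xs @ ys)) \<in> l2 (words n)")
  case True
  have "f (xs @ ys) = 0" for ys
    using l2_words_outside[OF True, of ys] l2_words_outside[OF f, of "xs @ ys"] xs by (cases "length ys = n") auto
  then show ?thesis by (simp add: op_zero[OF T])
qed (simp add: op_outside[OF T])

text \<open>The operator factors as (S \<otimes> 1)(1 \<otimes> T) with \<open>g f\<close> as
  intermediate vector, and \<open>pairing_apply\<close> bounds each factor; the two factors act on
  different coordinates, hence the pairing in both orders. The hypothesis \<open>out\<close>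
  excludes contributions of slices at indices outside \<open>Y\<close>. The abstract form covers
  words as well as cartesian products.\<close>

lemma pairing_op:
  assumes c: "pairing c Y Z X" and c': "pairing (\<lambda>z y. c y z) Z Y X"
    and S: "S \<in> bounded_ops Y" and T: "T \<in> bounded_ops Z"
    and out: "\<And>f y. f \<in> l2 X \<Longrightarrow> y \<notin> Y \<Longrightarrow> T (\<lambda>z. f (c y z)) = (\<lambda>_. 0)"
    and P: "\<And>f. f \<notin> l2 X \<Longrightarrow> P f = (\<lambda>_. 0)" "\<And>f x. f \<in> l2 X \<Longrightarrow> x \<notin> X \<Longrightarrow> P f x = 0"
      "\<And>f y z. f \<in> l2 X \<Longrightarrow> y \<in> Y \<Longrightarrow> z \<in> Z \<Longrightarrow> P f (c y z) = S (\<lambda>y'. T (\<lambda>z'. f (c y' z')) z) y"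
  shows "P \<in> bounded_ops X" "op_norm X P \<le> op_norm Y S * op_norm Z T"
proof -
  have inj: "inj_on (\<lambda>(a, b). c a b) (Y \<times> Z)" and X: "X = (\<lambda>(a, b). c a b) ` (Y \<times> Z)"
    using c by (auto simp: pairing_def)
  define dec where "dec = the_inv_into (Y \<times> Z) (\<lambda>(a, b). c a b)"
  have dec: "dec (c y z) = (y, z)" if "y \<in> Y" "z \<in> Z" for y z
    using the_inv_into_f_f[OF inj, of "(y, z)"] that by (simp add: dec_def)
  have cX: "c y z \<in> X" if "y \<in> Y" "z \<in> Z" for y z using that X by auto
  define h where "h f z = (\<lambda>y. T (\<lambda>z'. f (c y z')) z)" for f z
  define g where "g f x = (if x \<in> X then h f (snd (dec x)) (fst (dec x)) else 0)" for f x
  have gc: "g f (c y z) = h f z y" if "y \<in> Y" "z \<in> Z" for f y z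
    using that by (simp add: g_def dec cX)
  have gl2: "g f \<in> l2 X" "l2_norm (g f) \<le> op_norm Z T * l2_norm f" if f: "f \<in> l2 X" for f
  proof -
    have 2: "g f (c a b) = T (\<lambda>b'. f (c a b')) b" if "a \<in> Y" "b \<in> Z" for a b
      using gc[OF that] by (simp add: h_def)
    show "g f \<in> l2 X" "l2_norm (g f) \<le> op_norm Z T * l2_norm f"
      by (rule pairing_apply[OF c f T _ 2]; simp add: g_def)+
  qed
  have hg: "h f z = (\<lambda>y. g f (c y z))" if f: "f \<in> l2 X" and z: "z \<in> Z" for f z
  proof
    fix y show "h f z y = g f (c y z)"
      using out[OF f, of y] l2_D[OF pairing_slice_l2[OF c' gl2(1)[OF f] z], of y] gc[OF _ z, of y f]
      by (cases "y \<in> Y") (auto simp: h_def)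
  qed
  have hl2: "h f z \<in> l2 Y" if f: "f \<in> l2 X" and z: "z \<in> Z" for f z
    unfolding hg[OF f z] by (rule pairing_slice_l2[OF c' gl2(1)[OF f] z])
  have Pc: "P f (c y z) = S (h f z) y" if "f \<in> l2 X" "y \<in> Y" "z \<in> Z" for f y z
    using P(3)[OF that] by (simp add: h_def)
  have kl2: "P f \<in> l2 X \<and> l2_norm (P f) \<le> op_norm Y S * l2_norm (g f)" if f: "f \<in> l2 X" for f
  proof -
    have 2: "P f (c b a) = S (\<lambda>b'. g f (c b' a)) b" if "a \<in> Z" "b \<in> Y" for a b
      using that hg[OF f, of a] by (simp add: Pc[OF f])
    show ?thesis using pairing_apply[OF c' gl2(1)[OF f] S P(2)[OF f] 2] by auto
  qed
  have bound: "l2_norm (P f) \<le> (op_norm Y S * op_norm Z T) * l2_norm f" if f: "f \<in> l2 X" for f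
  proof -
    have "l2_norm (P f) \<le> op_norm Y S * l2_norm (g f)" using kl2[OF f] by blast
    also have "\<dots> \<le> op_norm Y S * (op_norm Z T * l2_norm f)"
      by (intro mult_left_mono gl2(2)[OF f] op_norm_nonneg[OF S])
    finally show ?thesis by (simp add: mult.assoc)
  qed
  have Peq: "P f = k" if f: "f \<in> l2 X" and k: "\<And>x. x \<notin> X \<Longrightarrow> k x = 0"
    "\<And>y z. y \<in> Y \<Longrightarrow> z \<in> Z \<Longrightarrow> S (h f z) y = k (c y z)" for f k
  proof
    fix x show "P f x = k x"
    proof (cases "x \<in> X")
      case True
      then obtain y z where "x = c y z" "y \<in> Y" "z \<in> Z" using X by auto
      then show ?thesis using Pc[OF f] k(2) by simp
    qed (simp add: P(2)[OF f] k(1))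
  qed
  have sl: "(\<lambda>z. f (c y z)) \<in> l2 Z" if "f \<in> l2 X" "y \<in> Y" for f y
    by (rule pairing_slice_l2[OF c that])
  show "P \<in> bounded_ops X"
  proof (rule bounded_opsI[OF P(1) _ _ _ bound])
    fix f f' assume f: "f \<in> l2 X" and f': "f' \<in> l2 X"
    have hh: "h (\<lambda>x. f x + f' x) z = (\<lambda>y. h f z y + h f' z y)" for z
    proof
      fix y show "h (\<lambda>x. f x + f' x) z y = h f z y + h f' z y"
        using out[OF l2_add[OF f f'], of y] out[OF f, of y] out[OF f', of y]
        by (cases "y \<in> Y") (simp_all add: h_def op_add[OF T] sl f f')
    qed
    show "P (\<lambda>x. f x + f' x) = (\<lambda>x. P f x + P f' x)"
      by (rule Peq[OF l2_add[OF f f']]) (simp_all add: P(2) f f' hh op_add[OF S] hl2 Pc)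
  next
    fix a f assume f: "f \<in> l2 X"
    have hh: "h (\<lambda>x. a * f x) z = (\<lambda>y. a * h f z y)" for z
    proof
      fix y show "h (\<lambda>x. a * f x) z y = a * h f z y"
        using out[OF l2_scale[OF f, of a], of y] out[OF f, of y]
        by (cases "y \<in> Y") (simp_all add: h_def op_scale[OF T] sl f)
    qed
    show "P (\<lambda>x. a * f x) = (\<lambda>x. a * P f x)"
      by (rule Peq[OF l2_scale[OF f]]) (simp_all add: P(2) f hh op_scale[OF S] hl2 Pc)
  qed (use kl2 in auto)
  show "op_norm X P \<le> op_norm Y S * op_norm Z T"
    by (rule op_norm_le[OF bound]) (use op_norm_nonneg[OF S] op_norm_nonneg[OF T] in auto)
qed

lemma
  assumes S: "S \<in> bounded_ops (words m)" and T: "T \<in> bounded_ops (words n)"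
  shows tensor_op_closed: "tensor_op m n S T \<in> bounded_ops (words (m + n))"
    and tensor_op_norm_le: "op_norm (words (m + n)) (tensor_op m n S T) \<le> op_norm (words m) S * op_norm (words n) T"
proof -
  have out: "T (\<lambda>ys. f (xs @ ys)) = (\<lambda>_. 0)" if "f \<in> l2 (words (m + n))" "xs \<notin> words m" for f xs
    using op_slice_outside[OF that(1) T] that(2) by (simp add: words_def)
  have P1: "tensor_op m n S T f = (\<lambda>_. 0)" if "f \<notin> l2 (words (m + n))" for f
    using that by (simp add: tensor_op_def)
  have P2: "tensor_op m n S T f zs = 0" if "f \<in> l2 (words (m + n))" "zs \<notin> words (m + n)" for f zs
  proof (cases "length (take m zs) = m")
    case True
    then have "length (drop m zs) \<noteq> n" using that by (auto simp: words_def)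
    then have "T u (drop m zs) = 0" for u using l2_words_outside[OF op_closed'[OF T]] by blast
    then show ?thesis using that by (simp add: tensor_op_def op_zero[OF S])
  next
    case False
    then show ?thesis using that l2_words_outside[OF op_closed'[OF S], of "take m zs"]
      by (simp add: tensor_op_def)
  qed
  have P3: "tensor_op m n S T f (xs @ ys) = S (\<lambda>xs'. T (\<lambda>ys'. f (xs' @ ys')) ys) xs"
    if "f \<in> l2 (words (m + n))" "xs \<in> words m" "ys \<in> words n" for f xs ys
    using that by (simp add: tensor_op_def words_def)
  show "tensor_op m n S T \<in> bounded_ops (words (m + n))"
    "op_norm (words (m + n)) (tensor_op m n S T) \<le> op_norm (words m) S * op_norm (words n) T"
    by (rule pairing_op[OF pairing_append pairing_swap S T]; rule out P1 P2 P3; assumption)+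
qed

lemma tensor_op_vec:
  assumes S: "S \<in> bounded_ops (words m)" and T: "T \<in> bounded_ops (words n)"
    and u: "u \<in> l2 (words m)" and v: "v \<in> l2 (words n)"
  shows "tensor_op m n S T (tensor_vec m u v) = tensor_vec m (S u) (T v)"
proof
  fix zs
  have tv: "tensor_vec m u v \<in> l2 (words (m + n))" by (rule tensor_vec_closed[OF u v])
  have *: "T (\<lambda>ys'. tensor_vec m u v (xs @ ys')) ys = T v ys * u xs" for xs ys
    using op_slice_outside[OF tv T, of xs] l2_words_outside[OF u, of xs]
    by (cases "length xs = m") (simp_all add: tensor_vec_append op_scale[OF T v])
  show "tensor_op m n S T (tensor_vec m u v) zs = tensor_vec m (S u) (T v) zs"
    using tv by (simp add: tensor_op_def * op_scale[OF S u]) (simp add: tensor_vec_def)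
qed

lemma tensor_op_ket:
  assumes "S \<in> bounded_ops (words m)" "T \<in> bounded_ops (words n)" "xs \<in> words m" "ys \<in> words n"
  shows "tensor_op m n S T (ket (xs @ ys)) = tensor_vec m (S (ket xs)) (T (ket ys))"
  using tensor_op_vec[OF assms(1,2) l2_ket l2_ket, of xs ys] ket_tensor[of xs m ys] assms(3,4)
  by (simp add: words_def)

lemma words_split:
  assumes "zs \<in> words (m + n)" obtains xs ys where "zs = xs @ ys" "xs \<in> words m" "ys \<in> words n"
  using that[of "take m zs" "drop m zs"] assms by (simp add: words_def)

text \<open>Basis vectors of the product suffice, which reduces bilinearity in the second factor,
  products, adjoints and associativity to \<open>tensor_op_ket\<close>.\<close>

lemma op_ext_tensor:
  assumes "P \<in> bounded_ops (words (m + n))" "Q \<in> bounded_ops (words (m + n))"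
    and "\<And>xs ys. xs \<in> words m \<Longrightarrow> ys \<in> words n \<Longrightarrow> P (ket (xs @ ys)) = Q (ket (xs @ ys))"
  shows "P = Q"
  by (rule op_ext_ket[OF assms(1,2)]) (use assms(3) in \<open>auto elim: words_split\<close>)

lemma tensor_op_add_left:
  "tensor_op m n (\<lambda>f x. S f x + S' f x) T = (\<lambda>f z. tensor_op m n S T f z + tensor_op m n S' T f z)"
  by (auto simp: tensor_op_def)

lemma tensor_op_scale_left: "tensor_op m n (\<lambda>f x. c * S f x) T = (\<lambda>f z. c * tensor_op m n S T f z)"
  by (auto simp: tensor_op_def)

lemma tensor_op_add_right:
  assumes S: "S \<in> bounded_ops (words m)" and T: "T \<in> bounded_ops (words n)" and T': "T' \<in> bounded_ops (words n)"
  shows "tensor_op m n S (\<lambda>f x. T f x + T' f x) = (\<lambda>f z. tensor_op m n S T f z + tensor_op m n S T' f z)"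
  by (rule op_ext_tensor[of _ m n])
     (auto simp: tensor_op_closed op_add_closed assms tensor_op_ket tensor_vec_def distrib_left)

lemma tensor_op_scale_right:
  assumes S: "S \<in> bounded_ops (words m)" and T: "T \<in> bounded_ops (words n)"
  shows "tensor_op m n S (\<lambda>f x. c * T f x) = (\<lambda>f z. c * tensor_op m n S T f z)"
  by (rule op_ext_tensor[of _ m n])
     (auto simp: tensor_op_closed op_scale_closed assms tensor_op_ket tensor_vec_def)

lemma tensor_op_mult:
  assumes "S \<in> bounded_ops (words m)" "T \<in> bounded_ops (words n)"
    "S' \<in> bounded_ops (words m)" "T' \<in> bounded_ops (words n)"
  shows "(\<lambda>f. tensor_op m n S T (tensor_op m n S' T' f)) = tensor_op m n (\<lambda>f. S (S' f)) (\<lambda>f. T (T' f))"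
  by (rule op_ext_tensor[of _ m n])
     (auto simp: tensor_op_closed op_mult_closed assms tensor_op_ket tensor_op_vec op_closed')

lemma op_adj_ket:
  assumes "x \<in> X" shows "op_adj X T (ket x) y = cnj (T (ket y) x)"
  using l2_ket[OF assms] by (simp add: op_adj_def l2_inner_commute[of _ "ket x"] l2_inner_ket)

lemma tensor_op_adj:
  assumes S: "S \<in> bounded_ops (words m)" and T: "T \<in> bounded_ops (words n)"
  shows "op_adj (words (m + n)) (tensor_op m n S T) = tensor_op m n (op_adj (words m) S) (op_adj (words n) T)"
proof (rule op_ext_tensor[of _ m n])
  note A = op_adj_closed[OF S] op_adj_closed[OF T]
  fix xs ys :: "'a list" assume xy: "xs \<in> words m" "ys \<in> words n"
  then have w: "xs @ ys \<in> words (m + n)" by (simp add: words_def)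
  show "op_adj (words (m + n)) (tensor_op m n S T) (ket (xs @ ys))
     = tensor_op m n (op_adj (words m) S) (op_adj (words n) T) (ket (xs @ ys))" (is "?l = ?r")
  proof
    fix zs show "?l zs = ?r zs"
    proof (cases "zs \<in> words (m + n)")
      case True
      then obtain xs' ys' where z: "zs = xs' @ ys'" "xs' \<in> words m" "ys' \<in> words n" by (rule words_split)
      show ?thesis using xy z w
        by (simp add: op_adj_ket tensor_op_ket S T A) (simp add: words_def tensor_vec_append op_adj_ket)
    next
      case False
      then show ?thesis
        using l2_D[OF op_closed'[OF op_adj_closed[OF tensor_op_closed[OF S T]]]] l2_D[OF op_closed'[OF tensor_op_closed[OF A]]]
        by simp
    qed
  qed
qed (use S T in \<open>auto simp: tensor_op_closed op_adj_closed\<close>)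

lemma tensor_vec_assoc:
  "tensor_vec (m + n) (tensor_vec m u v) w = tensor_vec m u (tensor_vec n v w)"
  by (auto simp: tensor_vec_def take_take drop_take add.commute min_def)

lemma tensor_op_assoc:
  assumes S: "S \<in> bounded_ops (words m)" and T: "T \<in> bounded_ops (words n)" and U: "U \<in> bounded_ops (words k)"
  shows "tensor_op (m + n) k (tensor_op m n S T) U = tensor_op m (n + k) S (tensor_op n k T U)"
proof (rule op_ext_tensor[of _ "m + n" k])
  show "tensor_op m (n + k) S (tensor_op n k T U) \<in> bounded_ops (words (m + n + k))"
    using tensor_op_closed[OF S tensor_op_closed[OF T U]] by (simp add: add.assoc)
  fix zs ws :: "'a list" assume "zs \<in> words (m + n)" and w: "ws \<in> words k"
  then obtain xs ys where z: "zs = xs @ ys" "xs \<in> words m" "ys \<in> words n" by (metis words_split)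
  then show "tensor_op (m + n) k (tensor_op m n S T) U (ket (zs @ ws)) =
      tensor_op m (n + k) S (tensor_op n k T U) (ket (zs @ ws))"
    using tensor_op_ket[OF tensor_op_closed[OF S T] U, of "xs @ ys" ws] w
      tensor_op_ket[OF S tensor_op_closed[OF T U], of xs "ys @ ws"]
      tensor_op_ket[OF S T z(2,3)] tensor_op_ket[OF T U z(3) w]
    by (simp add: words_def tensor_vec_assoc)
qed (use S T U in \<open>simp add: tensor_op_closed\<close>)

text \<open>A nonzero matrix entry of S factors out of the corresponding entries of S \<otimes>
  T.\<close>

lemma tensor_op_eq_0:
  assumes S: "S \<in> bounded_ops (words m)" and T: "T \<in> bounded_ops (words n)"
    and "S \<noteq> (\<lambda>f x. 0)" "tensor_op m n S T = (\<lambda>f x. 0)"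
  shows "T = (\<lambda>f x. 0)"
proof (rule op_ext_ket[OF T zero_bounded_op])
  fix ys :: "'a list" assume ys: "ys \<in> words n"
  obtain xs xs' where x: "xs \<in> words m" "S (ket xs) xs' \<noteq> 0"
    using op_ext_ket[OF S zero_bounded_op] assms(3) by metis
  have len: "length xs' = m" using l2_words_outside[OF op_closed'[OF S]] x(2) by blast
  show "T (ket ys) = (\<lambda>x. 0)"
  proof
    fix ys'
    have "0 = tensor_vec m (S (ket xs)) (T (ket ys)) (xs' @ ys')"
      using fun_cong[OF tensor_op_ket[OF S T x(1) ys], of "xs' @ ys'"] unfolding assms(4) by simp
    then show "T (ket ys) ys' = 0" using x(2) len by (simp add: tensor_vec_append)
  qed
qed

section \<open>Matrix amplifications\<close>

lemma l2_norm_sum: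
  assumes "\<And>i. i \<in> I \<Longrightarrow> f i \<in> l2 X"
  shows "l2_norm (\<lambda>x. \<Sum>i\<in>I. f i x) \<le> (\<Sum>i\<in>I. l2_norm (f i))"
  using assms
proof (induction I rule: infinite_finite_induct)
  case (insert i I)
  have "l2_norm (\<lambda>x. f i x + (\<Sum>i\<in>I. f i x)) \<le> l2_norm (f i) + l2_norm (\<lambda>x. \<Sum>i\<in>I. f i x)"
    using insert.prems by (intro l2_norm_triangle l2_sum) auto
  then show ?case using insert by simp
qed simp_all

lemma cstar_algebra_restrict:
  assumes A: "cstar_algebra A" and M: "closed_subalg A M"
  shows "cstar_algebra (A\<lparr>carrier := M\<rparr>)"
proof -
  interpret A: cstar_algebra A by (rule A)
  have MA [simp]: "x \<in> M \<Longrightarrow> x \<in> carrier A" for x using closed_subalg_subset[OF M] by auto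
  show ?thesis
  proof
    fix f assume f: "\<And>k::nat. f k \<in> carrier (A\<lparr>carrier := M\<rparr>)" and c: "ccauchy (A\<lparr>carrier := M\<rparr>) f"
    have "ccauchy A f" using c by (simp add: ccauchy_def cdiff_def)
    then obtain l where l: "l \<in> carrier A" "cconverges A f l" using A.complete[of f] f by auto
    then have "l \<in> M" using closed_subalg_limit[OF M, of f l] f by simp
    then show "\<exists>l\<in>carrier (A\<lparr>carrier := M\<rparr>). cconverges (A\<lparr>carrier := M\<rparr>) f l"
      using l by (auto simp: cconverges_def cdiff_def)
  qed (use closed_subalg_zero[OF M] closed_subalg_add[OF M] closed_subalg_scale[OF M] closed_subalg_mult[OF M]
       closed_subalg_adj[OF M] A.norm_eq_zero
       in \<open>simp_all add: A.add_assoc A.add_zero A.add_inverse A.scale_add_right A.scale_add_left A.scale_scale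
         A.scale_one A.mult_assoc A.mult_add_left A.mult_add_right A.mult_scale_left A.mult_scale_right
         A.adj_adj A.adj_add A.adj_scale A.adj_mult A.norm_nonneg A.norm_scale A.norm_triangle A.norm_mult
         A.cstar_identity A.add_comm A.add_left_comm\<close>)
qed

section \<open>Relabelling of index sets and tensor products on cartesian products\<close>

definition pull :: "'x set \<Rightarrow> ('x \<Rightarrow> 'y) \<Rightarrow> ('y \<Rightarrow> complex) \<Rightarrow> 'x \<Rightarrow> complex" where
  "pull X \<beta> f = (\<lambda>x. if x \<in> X then f (\<beta> x) else 0)"

lemma
  assumes \<beta>: "bij_betw \<beta> X Y" and f: "f \<in> l2 Y"
  shows pull_closed: "pull X \<beta> f \<in> l2 X" and l2_norm_pull: "l2_norm (pull X \<beta> f) = l2_norm f"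
proof -
  have s: "(\<lambda>y. (cmod (f y))\<^sup>2) summable_on UNIV" using f by (simp add: l2_def)
  have "(\<lambda>x. (cmod (f (\<beta> x)))\<^sup>2) summable_on X"
    using summable_on_reindex_bij_betw[OF \<beta>, of "\<lambda>y. (cmod (f y))\<^sup>2"] summable_on_subset_banach[OF s, of Y] by simp
  then have "(\<lambda>x. (cmod (pull X \<beta> f x))\<^sup>2) summable_on UNIV"
    by (subst (asm) summable_on_cong_neutral[where T=UNIV]) (auto simp: pull_def)
  then show "pull X \<beta> f \<in> l2 X" by (simp add: l2_def pull_def)
  have "(\<Sum>\<^sub>\<infinity>x. (cmod (pull X \<beta> f x))\<^sup>2) = (\<Sum>\<^sub>\<infinity>x\<in>X. (cmod (f (\<beta> x)))\<^sup>2)"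
    by (rule infsum_cong_neutral) (auto simp: pull_def)
  also have "\<dots> = (\<Sum>\<^sub>\<infinity>y\<in>Y. (cmod (f y))\<^sup>2)" by (rule infsum_reindex_bij_betw[OF \<beta>])
  also have "\<dots> = (\<Sum>\<^sub>\<infinity>y. (cmod (f y))\<^sup>2)" by (rule infsum_cong_neutral) (auto simp: l2_D[OF f])
  finally show "l2_norm (pull X \<beta> f) = l2_norm f" by (simp add: l2_norm_def)
qed

lemma pull_pull:
  assumes "bij_betw \<beta> X Y" "f \<in> l2 Y"
  shows "pull Y (inv_into X \<beta>) (pull X \<beta> f) = f"
  using assms l2_D[OF assms(2)]
  by (auto simp: pull_def fun_eq_iff bij_betw_inv_into_right bij_betwE[OF bij_betw_inv_into[OF assms(1)]])

text \<open>\<open>pull X \<beta>\<close> is a unitary, and conjugation by it preserves norms. The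
  operators are compared on basis vectors only, which determine them.\<close>

lemma op_norm_relabel:
  assumes \<beta>: "bij_betw \<beta> X Y" and T: "T \<in> bounded_ops X" and T': "T' \<in> bounded_ops Y"
    and eq: "\<And>x. x \<in> X \<Longrightarrow> T (ket x) = pull X \<beta> (T' (ket (\<beta> x)))"
  shows "op_norm X T = op_norm Y T'"
proof -
  define \<gamma> where "\<gamma> = inv_into X \<beta>"
  have \<gamma>: "bij_betw \<gamma> Y X" unfolding \<gamma>_def by (rule bij_betw_inv_into[OF \<beta>])
  define R where "R f = (if f \<in> l2 X then pull X \<beta> (T' (pull Y \<gamma> f)) else (\<lambda>_. 0))" for f
  have bound: "l2_norm (R f) \<le> op_norm Y T' * l2_norm f" if f: "f \<in> l2 X" for f
    using op_norm_bound[OF T' pull_closed[OF \<gamma> f]] l2_norm_pull[OF \<gamma> f] l2_norm_pull[OF \<beta> op_closed[OF T' pull_closed[OF \<gamma> f]]] f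
    by (simp add: R_def)
  have pull_lin: "pull X' b (\<lambda>x. f x + g x) = (\<lambda>x. pull X' b f x + pull X' b g x)"
    "pull X' b (\<lambda>x. c * f x) = (\<lambda>x. c * pull X' b f x)" for X' :: "'u set" and b :: "'u \<Rightarrow> 'v" and f g c
    by (auto simp: pull_def)
  have R: "R \<in> bounded_ops X"
    by (rule bounded_opsI[OF _ _ _ _ bound])
       (auto simp: R_def l2_add l2_scale pull_lin op_add[OF T'] op_scale[OF T'] pull_closed[OF \<gamma>]
         intro!: pull_closed[OF \<beta>] op_closed[OF T'])
  have "T = R"
  proof (rule op_ext_ket[OF T R])
    fix x assume x: "x \<in> X"
    have "pull Y \<gamma> (ket x) = ket (\<beta> x)"
      using x bij_betw_inv_into_left[OF \<beta>] bij_betw_inv_into_right[OF \<beta>] bij_betwE[OF \<beta>]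
      by (auto simp: pull_def ket_def \<gamma>_def fun_eq_iff)
    then show "T (ket x) = R (ket x)" using x by (simp add: eq R_def l2_ket)
  qed
  have "op_norm X T \<le> op_norm Y T'"
    unfolding \<open>T = R\<close> using bound op_norm_nonneg[OF T'] by (intro op_norm_le)
  moreover have "op_norm Y T' \<le> op_norm X T"
  proof (rule op_norm_le[OF _ op_norm_nonneg[OF T]])
    fix f assume f: "f \<in> l2 Y"
    have "R (pull X \<beta> f) = pull X \<beta> (T' f)"
      using pull_pull[OF \<beta> f] pull_closed[OF \<beta> f] by (simp add: R_def \<gamma>_def)
    then have "l2_norm (T' f) = l2_norm (T (pull X \<beta> f))"
      using l2_norm_pull[OF \<beta> op_closed[OF T' f]] \<open>T = R\<close> by simp
    also have "\<dots> \<le> op_norm X T * l2_norm f"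
      using op_norm_bound[OF T pull_closed[OF \<beta> f]] l2_norm_pull[OF \<beta> f] by simp
    finally show "l2_norm (T' f) \<le> op_norm X T * l2_norm f" .
  qed
  ultimately show ?thesis by simp
qed

lemma pairing_prod: "pairing Pair Y Z (Y \<times> Z)" "pairing (\<lambda>z y. (y, z)) Z Y (Y \<times> Z)"
  by (auto simp: pairing_def inj_on_def)

text \<open>The analogue of \<open>tensor_op\<close> on a cartesian product, which leaves the two
  index types independent. When only one of two algebras changes its representation, the factors
  live on words over different alphabets.\<close>

definition pten :: "'y set \<Rightarrow> 'z set \<Rightarrow> 'y oper \<Rightarrow> 'z oper \<Rightarrow> ('y \<times> 'z) oper" where
  "pten Y Z S T = (\<lambda>f. if f \<in> l2 (Y \<times> Z) then (\<lambda>(y, z). S (\<lambda>y'. T (\<lambda>z'. f (y', z')) z) y) else (\<lambda>_. 0))"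

definition pvec :: "('y \<Rightarrow> complex) \<Rightarrow> ('z \<Rightarrow> complex) \<Rightarrow> 'y \<times> 'z \<Rightarrow> complex" where
  "pvec u v = (\<lambda>(y, z). u y * v z)"

lemma pten_closed:
  assumes S: "S \<in> bounded_ops Y" and T: "T \<in> bounded_ops Z"
  shows "pten Y Z S T \<in> bounded_ops (Y \<times> Z)"
proof (rule pairing_op(1)[OF pairing_prod S T])
  fix f :: "'a \<times> 'b \<Rightarrow> complex" assume f: "f \<in> l2 (Y \<times> Z)"
  show "T (\<lambda>z. f (y, z)) = (\<lambda>_. 0)" if "y \<notin> Y" for y
  proof -
    have "(\<lambda>z. f (y, z)) = (\<lambda>_. 0)" using l2_D[OF f, of "(y, _)"] that by auto
    then show ?thesis by (simp add: op_zero[OF T])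
  qed
  show "pten Y Z S T f x = 0" if "x \<notin> Y \<times> Z" for x
  proof -
    obtain y z where x: "x = (y, z)" by (cases x)
    show ?thesis
    proof (cases "z \<in> Z")
      case True
      then show ?thesis using that f x l2_D[OF op_closed'[OF S]] by (simp add: pten_def)
    next
      case False
      then have "T u z = 0" for u using l2_D[OF op_closed'[OF T]] by blast
      then show ?thesis using f x by (simp add: pten_def op_zero[OF S])
    qed
  qed
qed (auto simp: pten_def)

lemma
  assumes u: "u \<in> l2 Y" and v: "v \<in> l2 Z"
  shows pvec_closed: "pvec u v \<in> l2 (Y \<times> Z)" and l2_norm_pvec_le: "l2_norm (pvec u v) \<le> l2_norm u * l2_norm v"
proof -
  have 1: "pvec u v x = 0" if "x \<notin> Y \<times> Z" for x
    using that l2_D[OF u] l2_D[OF v] by (auto simp: pvec_def split: prod.split)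
  have 2: "(\<Sum>a\<in>F. \<Sum>b\<in>G. (cmod (pvec u v (a, b)))\<^sup>2) \<le> (l2_norm u * l2_norm v)\<^sup>2"
    if FG: "finite F" "finite G" "F \<subseteq> Y" "G \<subseteq> Z" for F G
  proof -
    have "(\<Sum>a\<in>F. \<Sum>b\<in>G. (cmod (pvec u v (a, b)))\<^sup>2) = (\<Sum>a\<in>F. (cmod (u a))\<^sup>2) * (\<Sum>b\<in>G. (cmod (v b))\<^sup>2)"
      by (simp add: sum_product pvec_def norm_mult power_mult_distrib)
    also have "\<dots> \<le> (l2_norm u)\<^sup>2 * (l2_norm v)\<^sup>2"
      using FG u v by (intro mult_mono sum_le_of_L2_set_le l2_finite_le sum_nonneg) auto
    finally show ?thesis by (simp add: power_mult_distrib)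
  qed
  show "pvec u v \<in> l2 (Y \<times> Z)" "l2_norm (pvec u v) \<le> l2_norm u * l2_norm v"
    using pairing_l2_bound[OF pairing_prod(1) 1 2] by auto
qed

lemma ket_pvec: "ket (y, z) = pvec (ket y) (ket z)"
  by (auto simp: ket_def pvec_def fun_eq_iff)

lemma pten_vec:
  assumes "S \<in> bounded_ops Y" "T \<in> bounded_ops Z" "u \<in> l2 Y" "v \<in> l2 Z"
  shows "pten Y Z S T (pvec u v) = pvec (S u) (T v)"
proof
  have "S (\<lambda>x. u x * c) = (\<lambda>x. S u x * c)" for c
    using op_scale[OF assms(1,3), of c] by (simp add: mult.commute)
  then show "pten Y Z S T (pvec u v) x = pvec (S u) (T v) x" for x
    using pvec_closed[OF assms(3,4)] op_scale[OF assms(2,4)]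
    by (cases x) (simp add: pten_def pvec_def)
qed

text \<open>A list of pairs represents an element of the algebraic tensor product. Different lists
  may represent the same element, which is harmless as only norms of the resulting operators are
  compared.\<close>

definition psum :: "'y set \<Rightarrow> 'z set \<Rightarrow> ('y oper \<times> 'z oper) list \<Rightarrow> ('y \<times> 'z) oper" where
  "psum Y Z ps = (\<lambda>f x. \<Sum>(S, T)\<leftarrow>ps. pten Y Z S T f x)"

definition tsum :: "nat \<Rightarrow> nat \<Rightarrow> ('h list oper \<times> 'h list oper) list \<Rightarrow> 'h list oper" where
  "tsum m n ps = (\<lambda>f x. \<Sum>(S, T)\<leftarrow>ps. tensor_op m n S T f x)"

lemma psum_simps [simp]:
  "psum Y Z [] = (\<lambda>f x. 0)"
  "psum Y Z ((S, T) # ps) = (\<lambda>f x. pten Y Z S T f x + psum Y Z ps f x)"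
  by (simp_all add: psum_def)

lemma tsum_simps [simp]:
  "tsum m n [] = (\<lambda>f x. 0)"
  "tsum m n ((S, T) # ps) = (\<lambda>f x. tensor_op m n S T f x + tsum m n ps f x)"
  by (simp_all add: tsum_def)

lemma psum_closed: "set ps \<subseteq> bounded_ops Y \<times> bounded_ops Z \<Longrightarrow> psum Y Z ps \<in> bounded_ops (Y \<times> Z)"
  by (induction ps) (auto simp: zero_bounded_op intro!: op_add_closed pten_closed)

lemma tsum_closed: "set ps \<subseteq> bounded_ops (words m) \<times> bounded_ops (words n) \<Longrightarrow> tsum m n ps \<in> bounded_ops (words (m + n))"
  by (induction ps) (auto simp: zero_bounded_op intro!: op_add_closed tensor_op_closed)

lemma psum_vec:
  "set ps \<subseteq> bounded_ops Y \<times> bounded_ops Z \<Longrightarrow> u \<in> l2 Y \<Longrightarrow> v \<in> l2 Z \<Longrightarrow>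
   psum Y Z ps (pvec u v) = (\<lambda>(y, z). \<Sum>(S, T)\<leftarrow>ps. S u y * T v z)"
  by (induction ps) (auto simp: pten_vec fun_eq_iff, simp add: pvec_def)

text \<open>Makes a result about the first tensor factor available for the second one.\<close>

lemma psum_swap_norm:
  assumes ps: "set ps \<subseteq> bounded_ops Y \<times> bounded_ops Z"
  shows "op_norm (Y \<times> Z) (psum Y Z ps) = op_norm (Z \<times> Y) (psum Z Y (map prod.swap ps))"
proof (rule op_norm_relabel)
  show "bij_betw prod.swap (Y \<times> Z) (Z \<times> Y)" by (auto simp: bij_betw_def inj_on_def image_iff)
  have ps': "set (map prod.swap ps) \<subseteq> bounded_ops Z \<times> bounded_ops Y" using ps by auto
  show "psum Y Z ps \<in> bounded_ops (Y \<times> Z)" "psum Z Y (map prod.swap ps) \<in> bounded_ops (Z \<times> Y)"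
    using psum_closed[OF ps] psum_closed[OF ps'] by auto
  fix x assume x: "x \<in> Y \<times> Z"
  then obtain y z where yz: "x = (y, z)" "y \<in> Y" "z \<in> Z" by auto
  have sum: "(\<Sum>(S, T)\<leftarrow>ps. S (ket y) y' * T (ket z) z') = (\<Sum>(T, S)\<leftarrow>map prod.swap ps. T (ket z) z' * S (ket y) y')" for y' z'
    by (induction ps) (auto simp: mult.commute)
  have "psum Y Z ps (ket x) w = pull (Y \<times> Z) prod.swap (psum Z Y (map prod.swap ps) (ket (prod.swap x))) w" for w
  proof (cases "w \<in> Y \<times> Z")
    case True
    then show ?thesis
      using psum_vec[OF ps l2_ket[OF yz(2)] l2_ket[OF yz(3)]] psum_vec[OF ps' l2_ket[OF yz(3)] l2_ket[OF yz(2)]]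
      by (auto simp: pull_def yz ket_pvec sum simp del: map_map)
  qed (use l2_D[OF op_closed'[OF psum_closed[OF ps]], of w] in \<open>simp add: pull_def\<close>)
  then show "psum Y Z ps (ket x) = pull (Y \<times> Z) prod.swap (psum Z Y (map prod.swap ps) (ket (prod.swap x)))" by blast
qed

lemma tsum_vec:
  "set ps \<subseteq> bounded_ops (words m) \<times> bounded_ops (words n) \<Longrightarrow> xs \<in> words m \<Longrightarrow> ys \<in> words n \<Longrightarrow>
   length xs' = m \<Longrightarrow> tsum m n ps (ket (xs @ ys)) (xs' @ ys') = (\<Sum>(S, T)\<leftarrow>ps. S (ket xs) xs' * T (ket ys) ys')"
  by (induction ps) (auto simp: tensor_op_ket tensor_vec_append)

text \<open>Concatenation is a bijection from pairs of words onto longer words and intertwines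
  \<open>pten\<close> with \<open>tensor_op\<close>.\<close>

lemma tsum_norm:
  assumes ps: "set ps \<subseteq> bounded_ops (words m) \<times> bounded_ops (words n)"
  shows "op_norm (words (m + n)) (tsum m n ps) = op_norm (words m \<times> words n) (psum (words m) (words n) ps)"
proof (rule op_norm_relabel[symmetric])
  let ?Y = "words m :: 'a list set" and ?Z = "words n :: 'a list set"
  show "bij_betw (\<lambda>(a, b). a @ b) (?Y \<times> ?Z) (words (m + n))"
    using pairing_append[where 'h='a, of m n] by (simp add: pairing_def bij_betw_def)
  show "psum ?Y ?Z ps \<in> bounded_ops (?Y \<times> ?Z)" "tsum m n ps \<in> bounded_ops (words (m + n))"
    using psum_closed[OF ps] tsum_closed[OF ps] by auto
  fix x assume x: "x \<in> ?Y \<times> ?Z"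
  then obtain y z where yz: "x = (y, z)" "y \<in> ?Y" "z \<in> ?Z" by auto
  have "psum ?Y ?Z ps (ket x) w = pull (?Y \<times> ?Z) (\<lambda>(a, b). a @ b) (tsum m n ps (ket ((\<lambda>(a, b). a @ b) x))) w" for w
  proof (cases "w \<in> ?Y \<times> ?Z")
    case True
    then show ?thesis
      using psum_vec[OF ps l2_ket[OF yz(2)] l2_ket[OF yz(3)]] tsum_vec[OF ps yz(2,3), of "fst w" "snd w"]
      by (auto simp: pull_def yz ket_pvec words_def)
  qed (use l2_D[OF op_closed'[OF psum_closed[OF ps]], of w] in \<open>simp add: pull_def\<close>)
  then show "psum ?Y ?Z ps (ket x) = pull (?Y \<times> ?Z) (\<lambda>(a, b). a @ b) (tsum m n ps (ket ((\<lambda>(a, b). a @ b) x)))" by blast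
qed

text \<open>Finite compressions: operators on \<open>l2 (Y \<times> Z)\<close> that live on \<open>Y \<times> F\<close> for a finite set \<open>F \<subseteq> Z\<close> are
  \<open>F \<times> F\<close> matrices of operators on \<open>l2 Y\<close>.\<close>

definition amp :: "'y set \<Rightarrow> 'z set \<Rightarrow> 'z set \<Rightarrow> ('z \<Rightarrow> 'z \<Rightarrow> 'y oper) \<Rightarrow> ('y \<times> 'z) oper" where
  "amp Y Z F a = (\<lambda>g. if g \<in> l2 (Y \<times> Z)
     then (\<lambda>(y, z). if z \<in> F then \<Sum>j\<in>F. a z j (\<lambda>y'. g (y', j)) y else 0) else (\<lambda>_. 0))"

text \<open>The matrix entry of T in row i and column j, that is (1 \<otimes> <e_i|) T (1 \<otimes>
  |e_j>).\<close>

definition op_slice :: "'y set \<Rightarrow> 'z \<Rightarrow> 'z \<Rightarrow> ('y \<times> 'z) oper \<Rightarrow> 'y oper" where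
  "op_slice Y i j T = (\<lambda>f. if f \<in> l2 Y then (\<lambda>y. T (pvec f (ket j)) (y, i)) else (\<lambda>_. 0))"

text \<open>The projection 1 \<otimes> P_F. Writing \<open>UNIV\<close> for the first coordinate is
  the same as writing \<open>Y\<close>, because functions in l2 (Y x Z) vanish elsewhere.\<close>

definition compression :: "'y set \<Rightarrow> 'z set \<Rightarrow> 'z set \<Rightarrow> ('y \<times> 'z) oper" where
  "compression Y Z F = (\<lambda>g. if g \<in> l2 (Y \<times> Z) then l2_restrict (UNIV \<times> F) g else (\<lambda>_. 0))"

lemma compression_apply:
  "compression Y Z F g = (if g \<in> l2 (Y \<times> Z) then l2_restrict (UNIV \<times> F) g else (\<lambda>_. 0))"
  by (simp add: compression_def)

lemma l2_norm_ket_le: "l2_norm (ket x) \<le> 1"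
proof -
  have "(l2_norm (ket x))\<^sup>2 = cmod (l2_inner (ket x) (ket x))"
    using l2_inner_self[OF l2_ket, of x UNIV] by (simp add: norm_power)
  also have "\<dots> = 1" by (simp add: l2_inner_ket) (simp add: ket_def)
  finally have "(l2_norm (ket x))\<^sup>2 \<le> 1\<^sup>2" by simp
  then show ?thesis by (rule power2_le_imp_le) simp
qed

lemma slice_l2: "g \<in> l2 (Y \<times> Z) \<Longrightarrow> j \<in> Z \<Longrightarrow> (\<lambda>y. g (y, j)) \<in> l2 Y"
  using pairing_slice_l2[OF pairing_prod(2)] by fast

lemma slice_norm_le:
  assumes "g \<in> l2 (Y \<times> Z)" "j \<in> Z" shows "l2_norm (\<lambda>y. g (y, j)) \<le> l2_norm g"
  using pairing_slice_sum[OF pairing_prod(2) assms(1), of "{j}"] assms(2)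
  by (auto intro: power2_le_imp_le)

context
  fixes Y :: "'y set" and Z F :: "'z set"
  assumes F: "finite F" "F \<subseteq> Z"
begin

lemma amp_eq:
  assumes "g \<in> l2 (Y \<times> Z)"
  shows "amp Y Z F a g = (\<lambda>x. \<Sum>i\<in>F. \<Sum>j\<in>F. pvec (a i j (\<lambda>y. g (y, j))) (ket i) x)"
proof
  fix x show "amp Y Z F a g x = (\<Sum>i\<in>F. \<Sum>j\<in>F. pvec (a i j (\<lambda>y. g (y, j))) (ket i) x)"
    using assms sum_ket[OF F(1), of "\<lambda>i. \<Sum>j\<in>F. a i j (\<lambda>y. g (y, j)) (fst x)" "snd x"]
    by (cases x) (simp add: amp_def pvec_def sum_distrib_right)
qed

lemma amp_closed:
  assumes a: "\<And>i j. i \<in> F \<Longrightarrow> j \<in> F \<Longrightarrow> a i j \<in> bounded_ops Y"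
  shows "amp Y Z F a \<in> bounded_ops (Y \<times> Z)"
proof -
  have pv: "pvec (a i j (\<lambda>y. g (y, j))) (ket i) \<in> l2 (Y \<times> Z)" if "g \<in> l2 (Y \<times> Z)" "i \<in> F" "j \<in> F" for g i j
    using that F(2) by (intro pvec_closed op_closed[OF a] slice_l2[OF that(1)] l2_ket) auto
  have bound: "l2_norm (amp Y Z F a g) \<le> (\<Sum>i\<in>F. \<Sum>j\<in>F. op_norm Y (a i j)) * l2_norm g" if g: "g \<in> l2 (Y \<times> Z)" for g
  proof -
    have "l2_norm (amp Y Z F a g) \<le> (\<Sum>i\<in>F. l2_norm (\<lambda>x. \<Sum>j\<in>F. pvec (a i j (\<lambda>y. g (y, j))) (ket i) x))"
      unfolding amp_eq[OF g] by (rule l2_norm_sum[of _ _ "Y \<times> Z"]) (intro l2_sum pv[OF g])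
    also have "\<dots> \<le> (\<Sum>i\<in>F. \<Sum>j\<in>F. l2_norm (pvec (a i j (\<lambda>y. g (y, j))) (ket i)))"
      by (intro sum_mono l2_norm_sum[of _ _ "Y \<times> Z"] pv[OF g])
    also have "\<dots> \<le> (\<Sum>i\<in>F. \<Sum>j\<in>F. op_norm Y (a i j) * l2_norm g)"
    proof (intro sum_mono)
      fix i j assume ij: "i \<in> F" "j \<in> F"
      then have sl: "(\<lambda>y. g (y, j)) \<in> l2 Y" and jZ: "j \<in> Z" and iZ: "i \<in> Z" using slice_l2[OF g] F(2) by auto
      have "l2_norm (pvec (a i j (\<lambda>y. g (y, j))) (ket i)) \<le> l2_norm (a i j (\<lambda>y. g (y, j))) * l2_norm (ket i)"
        using ij iZ by (intro l2_norm_pvec_le[of _ Y _ Z] op_closed[OF a] sl l2_ket) auto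
      also have "\<dots> \<le> l2_norm (a i j (\<lambda>y. g (y, j)))" using l2_norm_ket_le by (intro mult_left_le) auto
      also have "\<dots> \<le> op_norm Y (a i j) * l2_norm (\<lambda>y. g (y, j))" by (rule op_norm_bound[OF a[OF ij] sl])
      also have "\<dots> \<le> op_norm Y (a i j) * l2_norm g"
        by (intro mult_left_mono slice_norm_le[OF g jZ] op_norm_nonneg a ij)
      finally show "l2_norm (pvec (a i j (\<lambda>y. g (y, j))) (ket i)) \<le> op_norm Y (a i j) * l2_norm g" .
    qed
    finally show ?thesis by (simp add: sum_distrib_right)
  qed
  have sl: "(\<lambda>y. g (y, j)) \<in> l2 Y" if "g \<in> l2 (Y \<times> Z)" "j \<in> F" for g j
    using slice_l2[OF that(1)] that(2) F(2) by auto
  show ?thesis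
  proof (rule bounded_opsI[OF _ _ _ _ bound])
    fix g assume g: "g \<in> l2 (Y \<times> Z)"
    show "amp Y Z F a g \<in> l2 (Y \<times> Z)" unfolding amp_eq[OF g] by (intro l2_sum pv[OF g])
  next
    fix f g assume f: "f \<in> l2 (Y \<times> Z)" and g: "g \<in> l2 (Y \<times> Z)"
    then show "amp Y Z F a (\<lambda>x. f x + g x) = (\<lambda>x. amp Y Z F a f x + amp Y Z F a g x)"
      by (auto simp: amp_def l2_add op_add[OF a] sl sum.distrib fun_eq_iff)
  next
    fix c f assume f: "f \<in> l2 (Y \<times> Z)"
    then show "amp Y Z F a (\<lambda>x. c * f x) = (\<lambda>x. c * amp Y Z F a f x)"
      by (auto simp: amp_def l2_scale op_scale[OF a] sl sum_distrib_left fun_eq_iff)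
  qed (auto simp: amp_def)
qed

lemma amp_cong: "(\<And>i j. i \<in> F \<Longrightarrow> j \<in> F \<Longrightarrow> a i j = b i j) \<Longrightarrow> amp Y Z F a = amp Y Z F b"
  by (auto simp: amp_def fun_eq_iff)

lemma amp_zero: "amp Y Z F (\<lambda>i j f x. 0) = (\<lambda>f x. 0)"
  by (auto simp: amp_def fun_eq_iff)

lemma amp_add: "(\<lambda>f x. amp Y Z F a f x + amp Y Z F b f x) = amp Y Z F (\<lambda>i j f x. a i j f x + b i j f x)"
  by (auto simp: amp_def fun_eq_iff sum.distrib)

lemma amp_scale: "(\<lambda>f x. c * amp Y Z F a f x) = amp Y Z F (\<lambda>i j f x. c * a i j f x)"
  by (auto simp: amp_def fun_eq_iff sum_distrib_left)

lemma amp_mult: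
  assumes a: "\<And>i j. i \<in> F \<Longrightarrow> j \<in> F \<Longrightarrow> a i j \<in> bounded_ops Y"
    and b: "\<And>i j. i \<in> F \<Longrightarrow> j \<in> F \<Longrightarrow> b i j \<in> bounded_ops Y"
  shows "(\<lambda>f. amp Y Z F a (amp Y Z F b f)) = amp Y Z F (\<lambda>i k f x. \<Sum>j\<in>F. a i j (b j k f) x)"
proof
  fix g show "amp Y Z F a (amp Y Z F b g) = amp Y Z F (\<lambda>i k f x. \<Sum>j\<in>F. a i j (b j k f) x) g"
  proof (cases "g \<in> l2 (Y \<times> Z)")
    case g: True
    have bg: "amp Y Z F b g \<in> l2 (Y \<times> Z)" by (rule op_closed[OF amp_closed[OF b] g])
    have sl: "(\<lambda>y. g (y, j)) \<in> l2 Y" if "j \<in> F" for j using slice_l2[OF g] that F(2) by auto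
    have "a i j (\<lambda>y. amp Y Z F b g (y, j)) y = (\<Sum>k\<in>F. a i j (b j k (\<lambda>y. g (y, k))) y)" if "i \<in> F" "j \<in> F" for i j y
      using g that op_sum[OF a[OF that], of F "\<lambda>k. b j k (\<lambda>y. g (y, k))"] op_closed[OF b sl]
      by (simp add: amp_def)
    then show ?thesis using g bg
      by (auto simp: amp_def[of Y Z F a] amp_def[of Y Z F "\<lambda>i k f x. \<Sum>j\<in>F. a i j (b j k f) x"] fun_eq_iff
          intro!: sum.swap)
  next
    case False
    then show ?thesis by (simp add: amp_def op_zero[OF amp_closed[OF a], unfolded amp_def, simplified])
  qed
qed

lemma l2_inner_pvec_ket:
  assumes u: "u \<in> l2 Y" and i: "i \<in> Z" and g: "g \<in> l2 (Y \<times> Z)"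
  shows "l2_inner (pvec u (ket i)) g = l2_inner u (\<lambda>y. g (y, i))"
proof -
  have "(\<Sum>\<^sub>\<infinity>x. cnj (pvec u (ket i) x) * g x) = (\<Sum>\<^sub>\<infinity>x\<in>(\<lambda>y. (y, i)) ` UNIV. cnj (pvec u (ket i) x) * g x)"
    by (rule infsum_cong_neutral) (auto simp: pvec_def ket_def image_iff)
  also have "\<dots> = (\<Sum>\<^sub>\<infinity>y. cnj (u y) * g (y, i))"
    by (subst infsum_reindex) (auto simp: inj_on_def pvec_def ket_def o_def)
  finally show ?thesis by (simp add: l2_inner_def)
qed

lemma l2_inner_amp:
  assumes a: "\<And>i j. i \<in> F \<Longrightarrow> j \<in> F \<Longrightarrow> a i j \<in> bounded_ops Y"
    and f: "f \<in> l2 (Y \<times> Z)" and g: "g \<in> l2 (Y \<times> Z)"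
  shows "l2_inner (amp Y Z F a f) g = (\<Sum>i\<in>F. \<Sum>j\<in>F. l2_inner (a i j (\<lambda>y. f (y, j))) (\<lambda>y. g (y, i)))"
proof -
  have sl: "(\<lambda>y. f (y, j)) \<in> l2 Y" if "j \<in> F" for j using slice_l2[OF f] that F(2) by auto
  have inner_sum: "l2_inner (\<lambda>x. \<Sum>i\<in>I. h i x) g = (\<Sum>i\<in>I. l2_inner (h i) g)"
    if "finite I" "\<And>i. i \<in> I \<Longrightarrow> h i \<in> l2 (Y \<times> Z)" for I :: "'z set" and h
    using that
  proof (induction I)
    case (insert i I)
    then show ?case using l2_inner_add_left[of "h i" "Y \<times> Z" "\<lambda>x. \<Sum>i\<in>I. h i x" g] g by (simp add: l2_sum)
  qed (simp add: l2_inner_def)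
  have pv: "pvec (a i j (\<lambda>y. f (y, j))) (ket i) \<in> l2 (Y \<times> Z)" if "i \<in> F" "j \<in> F" for i j
    using that F(2) by (intro pvec_closed op_closed[OF a] sl l2_ket) auto
  have "l2_inner (amp Y Z F a f) g = (\<Sum>i\<in>F. l2_inner (\<lambda>x. \<Sum>j\<in>F. pvec (a i j (\<lambda>y. f (y, j))) (ket i) x) g)"
    unfolding amp_eq[OF f] by (rule inner_sum[OF F(1)]) (intro l2_sum pv)
  also have "\<dots> = (\<Sum>i\<in>F. \<Sum>j\<in>F. l2_inner (pvec (a i j (\<lambda>y. f (y, j))) (ket i)) g)"
    by (intro sum.cong refl inner_sum[OF F(1)] pv)
  also have "\<dots> = (\<Sum>i\<in>F. \<Sum>j\<in>F. l2_inner (a i j (\<lambda>y. f (y, j))) (\<lambda>y. g (y, i)))"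
    using F(2) by (intro sum.cong refl l2_inner_pvec_ket op_closed[OF a] sl g) auto
  finally show ?thesis .
qed

lemma amp_adj:
  assumes a: "\<And>i j. i \<in> F \<Longrightarrow> j \<in> F \<Longrightarrow> a i j \<in> bounded_ops Y"
  shows "op_adj (Y \<times> Z) (amp Y Z F a) = amp Y Z F (\<lambda>i j. op_adj Y (a j i))"
proof (rule op_adj_unique[OF amp_closed[OF a]])
  have a': "op_adj Y (a j i) \<in> bounded_ops Y" if "i \<in> F" "j \<in> F" for i j using op_adj_closed[OF a] that by blast
  show "amp Y Z F (\<lambda>i j. op_adj Y (a j i)) \<in> bounded_ops (Y \<times> Z)" by (rule amp_closed[OF a'])
  fix f g assume f: "f \<in> l2 (Y \<times> Z)" and g: "g \<in> l2 (Y \<times> Z)"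
  have sl: "(\<lambda>y. h (y, j)) \<in> l2 Y" if "h \<in> l2 (Y \<times> Z)" "j \<in> F" for h j using slice_l2[OF that(1)] that F(2) by auto
  have "l2_inner (amp Y Z F (\<lambda>i j. op_adj Y (a j i)) g) f
     = (\<Sum>i\<in>F. \<Sum>j\<in>F. l2_inner (op_adj Y (a j i) (\<lambda>y. g (y, j))) (\<lambda>y. f (y, i)))"
    by (rule l2_inner_amp[OF a' g f])
  also have "\<dots> = (\<Sum>i\<in>F. \<Sum>j\<in>F. l2_inner (\<lambda>y. g (y, j)) (a j i (\<lambda>y. f (y, i))))"
    using f g by (intro sum.cong refl op_adj_inner a sl) auto
  also have "\<dots> = cnj (\<Sum>j\<in>F. \<Sum>i\<in>F. l2_inner (a j i (\<lambda>y. f (y, i))) (\<lambda>y. g (y, j)))"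
    by (subst sum.swap) (simp add: l2_inner_commute[of "\<lambda>y. g (y, _)"])
  also have "\<dots> = cnj (l2_inner (amp Y Z F a f) g)" by (simp add: l2_inner_amp[OF a f g])
  finally show "l2_inner f (amp Y Z F (\<lambda>i j. op_adj Y (a j i)) g) = l2_inner (amp Y Z F a f) g"
    by (subst l2_inner_commute) simp
qed auto

end

lemma compression_closed:
  "compression Y Z F \<in> bounded_ops (Y \<times> Z)" "op_norm (Y \<times> Z) (compression Y Z F) \<le> 1"
proof -
  have bound: "l2_norm (compression Y Z F g) \<le> 1 * l2_norm g" if "g \<in> l2 (Y \<times> Z)" for g
    using that l2_norm_restrict_le by (simp add: compression_def)
  show "compression Y Z F \<in> bounded_ops (Y \<times> Z)"
    by (rule bounded_opsI[OF _ _ _ _ bound])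
       (auto simp: compression_def l2_restrict_closed l2_add l2_scale, auto simp: l2_restrict_def)
  show "op_norm (Y \<times> Z) (compression Y Z F) \<le> 1" by (rule op_norm_le[OF bound]) auto
qed

lemma op_slice_closed:
  assumes T: "T \<in> bounded_ops (Y \<times> Z)" and ij: "i \<in> Z" "j \<in> Z"
  shows "op_slice Y i j T \<in> bounded_ops Y" "op_norm Y (op_slice Y i j T) \<le> op_norm (Y \<times> Z) T"
proof -
  have pv: "pvec f (ket j) \<in> l2 (Y \<times> Z)" if "f \<in> l2 Y" for f by (intro pvec_closed that l2_ket ij)
  have bound: "l2_norm (op_slice Y i j T f) \<le> op_norm (Y \<times> Z) T * l2_norm f" if f: "f \<in> l2 Y" for f
  proof -
    have "l2_norm (op_slice Y i j T f) \<le> l2_norm (T (pvec f (ket j)))"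
      using f slice_norm_le[OF op_closed[OF T pv[OF f]] ij(1)] by (simp add: op_slice_def)
    also have "\<dots> \<le> op_norm (Y \<times> Z) T * l2_norm (pvec f (ket j))" by (rule op_norm_bound[OF T pv[OF f]])
    also have "\<dots> \<le> op_norm (Y \<times> Z) T * (l2_norm f * 1)"
      using l2_norm_pvec_le[OF f l2_ket[OF ij(2)]] l2_norm_ket_le[of j]
      by (intro mult_left_mono op_norm_nonneg[OF T]) (meson order_trans mult_left_mono l2_norm_nonneg)
    finally show ?thesis by simp
  qed
  have "pvec (\<lambda>x. f x + g x) v = (\<lambda>x. pvec f v x + pvec g v x)" "pvec (\<lambda>x. c * f x) v = (\<lambda>x. c * pvec f v x)"
    for f g :: "'a \<Rightarrow> complex" and v :: "'b \<Rightarrow> complex" and c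
    by (auto simp: pvec_def fun_eq_iff algebra_simps)
  then show "op_slice Y i j T \<in> bounded_ops Y"
    by (intro bounded_opsI[OF _ _ _ _ bound])
       (auto simp: op_slice_def l2_add l2_scale pv op_add[OF T] op_scale[OF T] intro!: slice_l2[OF op_closed[OF T pv] ij(1)])
  show "op_norm Y (op_slice Y i j T) \<le> op_norm (Y \<times> Z) T"
    by (rule op_norm_le[OF bound]) (use op_norm_nonneg[OF T] in auto)
qed

lemma op_slice_add: "op_slice Y i j (\<lambda>f x. S f x + T f x) = (\<lambda>f x. op_slice Y i j S f x + op_slice Y i j T f x)"
  by (auto simp: op_slice_def)

lemma op_slice_scale: "op_slice Y i j (\<lambda>f x. c * T f x) = (\<lambda>f x. c * op_slice Y i j T f x)"
  by (auto simp: op_slice_def)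

lemma op_slice_pten:
  assumes "S \<in> bounded_ops Y" "T \<in> bounded_ops Z" "j \<in> Z"
  shows "op_slice Y i j (pten Y Z S T) = (\<lambda>f x. T (ket j) i * S f x)"
  by (auto simp: op_slice_def pten_vec assms l2_ket op_outside[OF assms(1)] fun_eq_iff) (simp add: pvec_def)

lemma op_slice_amp:
  assumes F: "finite F" "F \<subseteq> Z" and a: "\<And>i j. i \<in> F \<Longrightarrow> j \<in> F \<Longrightarrow> a i j \<in> bounded_ops Y" and ij: "i \<in> F" "j \<in> F"
  shows "op_slice Y i j (amp Y Z F a) = a i j"
proof
  fix f show "op_slice Y i j (amp Y Z F a) f = a i j f"
  proof (cases "f \<in> l2 Y")
    case f: True
    have pv: "pvec f (ket j) \<in> l2 (Y \<times> Z)" using ij F by (intro pvec_closed f l2_ket) auto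
    have "(\<Sum>k\<in>F. a i k (\<lambda>y'. pvec f (ket j) (y', k)) y) = (\<Sum>k\<in>F. if k = j then a i k f y else 0)" for y
      using ij by (intro sum.cong refl) (auto simp: pvec_def ket_def op_zero[OF a])
    then show ?thesis using f pv ij F by (simp add: op_slice_def amp_def fun_eq_iff)
  qed (simp add: op_slice_def op_outside[OF a[OF ij]])
qed

text \<open>A compressed vector is a finite sum of its slices tensored with basis vectors, so the
  matrix form follows from linearity of \<open>T\<close>.\<close>

lemma compression_eq_amp:
  assumes F: "finite F" "F \<subseteq> Z" and T: "T \<in> bounded_ops (Y \<times> Z)"
  shows "(\<lambda>g. compression Y Z F (T (compression Y Z F g))) = amp Y Z F (\<lambda>i j. op_slice Y i j T)"
proof
  fix g show "compression Y Z F (T (compression Y Z F g)) = amp Y Z F (\<lambda>i j. op_slice Y i j T) g"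
  proof (cases "g \<in> l2 (Y \<times> Z)")
    case g: True
    have sl: "(\<lambda>y. g (y, j)) \<in> l2 Y" if "j \<in> F" for j using slice_l2[OF g] that F by auto
    have pv: "pvec (\<lambda>y. g (y, j)) (ket j) \<in> l2 (Y \<times> Z)" if "j \<in> F" for j
      using that F by (intro pvec_closed sl l2_ket) auto
    have "compression Y Z F g = (\<lambda>x. \<Sum>j\<in>F. pvec (\<lambda>y. g (y, j)) (ket j) x)"
      using g F(1) by (auto simp: compression_def l2_restrict_def pvec_def ket_def fun_eq_iff
          if_distrib[of "\<lambda>x. _ * x"] sum.delta cong: if_cong)
    then have "T (compression Y Z F g) = (\<lambda>x. \<Sum>j\<in>F. T (pvec (\<lambda>y. g (y, j)) (ket j)) x)"
      using op_sum[OF T, of F "\<lambda>j. pvec (\<lambda>y. g (y, j)) (ket j)"] pv by simp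
    then show ?thesis
      using op_closed'[OF T, of "compression Y Z F g"] g sl
      by (auto simp: compression_apply[of Y Z F "T (compression Y Z F g)"] l2_restrict_def amp_def op_slice_def fun_eq_iff)
  next
    case False
    then show ?thesis by (simp add: compression_apply[of Y Z F g] op_zero[OF T] amp_def)
      (simp add: compression_apply l2_restrict_def)
  qed
qed

text \<open>A vector is nearly supported over finitely many points of \<open>Z\<close>, and its
  image is tested on finitely many coordinates; so finite compressions detect the norm.\<close>

lemma op_norm_le_compressions:
  assumes T: "T \<in> bounded_ops (Y \<times> Z)" and C: "0 \<le> C"
    and le: "\<And>F. finite F \<Longrightarrow> F \<subseteq> Z \<Longrightarrow> op_norm (Y \<times> Z) (\<lambda>g. compression Y Z F (T (compression Y Z F g))) \<le> C"
  shows "op_norm (Y \<times> Z) T \<le> C"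
proof (rule op_norm_le[OF _ C])
  fix g assume g: "g \<in> l2 (Y \<times> Z)"
  let ?P = "compression Y Z"
  note P = compression_closed(1)[of Y Z]
  show "l2_norm (T g) \<le> C * l2_norm g"
  proof (rule l2_norm_le[of "Y \<times> Z"])
    show "T g x = 0" if "x \<notin> Y \<times> Z" for x using l2_D[OF op_closed[OF T g] that] .
    fix G :: "('a \<times> 'b) set" assume G: "finite G"
    show "L2_set (\<lambda>x. cmod (T g x)) G \<le> C * l2_norm g"
    proof (rule field_le_epsilon)
      fix e :: real assume e: "0 < e"
      \<comment> \<open>The denominator is ||T|| + 1 because ||T|| may vanish; the error caused by
        cutting off \<open>g\<close> is then at most \<open>e\<close>.\<close>
      define e' where "e' = e / (op_norm (Y \<times> Z) T + 1)"
      have nT: "0 \<le> op_norm (Y \<times> Z) T" by (rule op_norm_nonneg[OF T])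
      then have e': "0 < e'" using e by (simp add: e'_def add_nonneg_pos)
      have "eventually (\<lambda>H. l2_norm (\<lambda>x. g x - l2_restrict H g x) < e') (finite_subsets_at_top UNIV)"
        using order_tendstoD(2)[OF l2_restrict_tendsto[OF g] e'] .
      then obtain H where H: "finite H" "l2_norm (\<lambda>x. g x - l2_restrict H g x) < e'"
        unfolding eventually_finite_subsets_at_top by blast
      \<comment> \<open>The points from \<open>H\<close> make the compressed vector close to
        \<open>g\<close>; those from \<open>G\<close> ensure that compressing the image does not
        change its coordinates in \<open>G\<close>.\<close>
      define F where "F = (snd ` H \<union> snd ` G) \<inter> Z"
      have F: "finite F" "F \<subseteq> Z" using H(1) G by (auto simp: F_def)
      have PF: "?P F g = l2_restrict (UNIV \<times> F) g" using g by (simp add: compression_def)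
      have PFl: "?P F g \<in> l2 (Y \<times> Z)" by (rule op_closed[OF P g])
      have "l2_norm (\<lambda>x. g x - ?P F g x) \<le> l2_norm (\<lambda>x. g x - l2_restrict H g x)"
      proof -
        have "g x - ?P F g x = l2_restrict (- (UNIV \<times> F)) (\<lambda>x. g x - l2_restrict H g x) x" for x
        proof (cases "x \<in> H")
          case True
          then have "snd x \<in> F \<or> snd x \<notin> Z" by (auto simp: F_def)
          then show ?thesis using l2_D[OF g, of x] True by (cases x) (auto simp: PF l2_restrict_def)
        qed (cases x, auto simp: PF l2_restrict_def)
        then have "(\<lambda>x. g x - ?P F g x) = l2_restrict (- (UNIV \<times> F)) (\<lambda>x. g x - l2_restrict H g x)" by blast
        then show ?thesis using l2_norm_restrict_le[OF l2_diff[OF g l2_restrict_closed[OF g]]] by simp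
      qed
      then have small: "l2_norm (\<lambda>x. g x - ?P F g x) < e'" using H(2) by linarith
      have Tl: "T (?P F g) \<in> l2 (Y \<times> Z)" by (rule op_closed[OF T PFl])
      have eqG: "?P F (T (?P F g)) x = T (?P F g) x" if "x \<in> G" for x
      proof (cases "x \<in> Y \<times> Z")
        case True
        then have "x \<in> UNIV \<times> F" using that by (force simp: F_def)
        then show ?thesis using Tl by (simp add: compression_apply[of Y Z F "T (compression Y Z F g)"] l2_restrict_def)
      next
        case False
        then show ?thesis using l2_D[OF Tl] l2_D[OF op_closed[OF P Tl]] by simp
      qed
      have "L2_set (\<lambda>x. cmod (T g x)) G = L2_set (\<lambda>x. cmod (?P F (T (?P F g)) x + T (\<lambda>x. g x - ?P F g x) x)) G"
        using op_diff[OF T g PFl] eqG by (intro L2_set_cong) auto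
      also have "\<dots> \<le> L2_set (\<lambda>x. cmod (?P F (T (?P F g)) x)) G + L2_set (\<lambda>x. cmod (T (\<lambda>x. g x - ?P F g x) x)) G"
        by (rule L2_set_cmod_triangle)
      also have "\<dots> \<le> l2_norm (?P F (T (?P F g))) + l2_norm (T (\<lambda>x. g x - ?P F g x))"
        by (intro add_mono l2_finite_le[of _ "Y \<times> Z"] op_closed'[OF P] op_closed'[OF T] G)
      also have "\<dots> \<le> C * l2_norm g + e"
      proof (rule add_mono)
        have c: "(\<lambda>g. ?P F (T (?P F g))) \<in> bounded_ops (Y \<times> Z)"
          by (rule op_mult_closed(1)[OF P op_mult_closed(1)[OF T P]])
        show "l2_norm (?P F (T (?P F g))) \<le> C * l2_norm g"
          using op_norm_bound[OF c g] mult_right_mono[OF le[OF F], of "l2_norm g"] by simp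
        have "l2_norm (T (\<lambda>x. g x - ?P F g x)) \<le> op_norm (Y \<times> Z) T * l2_norm (\<lambda>x. g x - ?P F g x)"
          by (rule op_norm_bound[OF T l2_diff[OF g PFl]])
        also have "\<dots> \<le> op_norm (Y \<times> Z) T * e'" using small nT by (intro mult_left_mono) auto
        also have "\<dots> \<le> e" using e nT by (simp add: e'_def field_simps)
        finally show "l2_norm (T (\<lambda>x. g x - ?P F g x)) \<le> e" .
      qed
      finally show "L2_set (\<lambda>x. cmod (T g x)) G \<le> C * l2_norm g + e" .
    qed
  qed
qed

section \<open>Norms of matrices over a C*-algebra\<close>

lemma star_mono_hom: "star_mono A B f \<Longrightarrow> star_hom A B f"
  by (simp add: star_mono_def)

lemma star_hom_comp: "star_hom A B f \<Longrightarrow> star_hom B C g \<Longrightarrow> star_hom A C (\<lambda>x. g (f x))"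
  by (simp add: star_hom_def)

lemma star_mono_comp: "star_mono A B f \<Longrightarrow> star_mono B C g \<Longrightarrow> star_mono A C (\<lambda>x. g (f x))"
  unfolding star_mono_def using star_hom_comp[of A B f C g] star_hom_closed[of A B f]
  by (auto simp: inj_on_def)

text \<open>One element \<open>c\<close> of the algebra serves both representations simultaneously,
  so that an entry of a product of matrices is given by the same element on both sides.\<close>

lemma star_hom_sum:
  assumes A: "cstar_algebra A" and \<pi>: "star_mono A (op_alg Y) \<pi>" and \<pi>': "star_mono A (op_alg Y') \<pi>'"
    and F: "finite F" and u: "\<And>j. j \<in> F \<Longrightarrow> u j \<in> carrier A"
  shows "\<exists>c\<in>carrier A. \<pi> c = (\<lambda>f x. \<Sum>j\<in>F. \<pi> (u j) f x) \<and> \<pi>' c = (\<lambda>f x. \<Sum>j\<in>F. \<pi>' (u j) f x)"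
  using F u
proof (induction F)
  case empty
  show ?case using star_hom_zero[OF A cstar_algebra_op_alg star_mono_hom[OF \<pi>]]
      star_hom_zero[OF A cstar_algebra_op_alg star_mono_hom[OF \<pi>']] cstar_algebra.zero_closed[OF A] by auto
next
  case (insert j F)
  then obtain c where c: "c \<in> carrier A" "\<pi> c = (\<lambda>f x. \<Sum>j\<in>F. \<pi> (u j) f x)" "\<pi>' c = (\<lambda>f x. \<Sum>j\<in>F. \<pi>' (u j) f x)"
    by auto
  have "u j \<in> carrier A" using insert by simp
  then show ?case using c insert.hyps
      star_hom_add[OF star_mono_hom[OF \<pi>], of "u j" c] star_hom_add[OF star_mono_hom[OF \<pi>'], of "u j" c]
    by (intro bexI[of _ "u j \<oplus>\<^bsub>A\<^esub> c"]) (simp_all add: cstar_algebra.add_closed[OF A])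
qed

text \<open>Matrices with entries in the range of \<open>\<pi>\<close> form a C*-algebra
  \<open>D\<close> of operators, and applying \<open>\<pi>'\<close> after the inverse of
  \<open>\<pi>\<close> to every entry is an injective *-homomorphism on it. Such maps are isometric,
  so no estimate of a matrix norm is made.\<close>

lemma amp_norm_eq:
  assumes A: "cstar_algebra A" and \<pi>: "star_mono A (op_alg Y) \<pi>" and \<pi>': "star_mono A (op_alg Y') \<pi>'"
    and F: "finite F" "F \<subseteq> Z" and a: "\<And>i j. i \<in> F \<Longrightarrow> j \<in> F \<Longrightarrow> a i j \<in> carrier A"
  shows "op_norm (Y' \<times> Z) (amp Y' Z F (\<lambda>i j. \<pi>' (a i j))) = op_norm (Y \<times> Z) (amp Y Z F (\<lambda>i j. \<pi> (a i j)))"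
proof -
  interpret A: cstar_algebra A by (rule A)
  let ?O = "op_alg (Y \<times> Z)" and ?O' = "op_alg (Y' \<times> Z)"
  interpret O: cstar_algebra ?O by (rule cstar_algebra_op_alg)
  note h = star_mono_hom[OF \<pi>] and h' = star_mono_hom[OF \<pi>']
  have inj: "inj_on \<pi> (carrier A)" using \<pi> by (simp add: star_mono_def)
  have inj': "inj_on \<pi>' (carrier A)" using \<pi>' by (simp add: star_mono_def)
  define E where "E a = amp Y Z F (\<lambda>i j. \<pi> (a i j))" for a
  define E' where "E' a = amp Y' Z F (\<lambda>i j. \<pi>' (a i j))" for a
  define K where "K = {a. \<forall>i\<in>F. \<forall>j\<in>F. a i j \<in> carrier A}"
  define D where "D = E ` K"
  have Kc: "\<pi> (a i j) \<in> bounded_ops Y" "\<pi>' (a i j) \<in> bounded_ops Y'" "a i j \<in> carrier A"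
    if "a \<in> K" "i \<in> F" "j \<in> F" for a i j
    using that star_hom_closed[OF h, of "a i j"] star_hom_closed[OF h', of "a i j"] by (auto simp: K_def)
  have Ec: "E a \<in> bounded_ops (Y \<times> Z)" "E' a \<in> bounded_ops (Y' \<times> Z)" if "a \<in> K" for a
    unfolding E_def E'_def using Kc[OF that] F by (auto intro!: amp_closed)
  have slice: "op_slice Y i j (E a) = \<pi> (a i j)" "op_slice Y' i j (E' a) = \<pi>' (a i j)"
    if "a \<in> K" "i \<in> F" "j \<in> F" for a i j
    unfolding E_def E'_def using op_slice_amp[OF F, of "\<lambda>i j. \<pi> (a i j)" Y i j]
      op_slice_amp[OF F, of "\<lambda>i j. \<pi>' (a i j)" Y' i j] Kc[OF that(1)] that by auto
  \<comment> \<open>Matrices in \<open>K\<close> that differ outside F x F give the same operator;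
    hence the definition through the slices of the operator.\<close>
  define \<theta> where "\<theta> T = E' (\<lambda>i j. inv_into (carrier A) \<pi> (op_slice Y i j T))" for T
  have \<theta>E: "\<theta> (E a) = E' a" if a: "a \<in> K" for a
    unfolding \<theta>_def E'_def
    by (rule amp_cong[OF F]) (simp add: slice[OF a] inv_into_f_f[OF inj] Kc(3)[OF a])
  have zero: "(\<lambda>f x. 0) = E (\<lambda>i j. \<zero>\<^bsub>A\<^esub>)" "(\<lambda>f x. 0) = E' (\<lambda>i j. \<zero>\<^bsub>A\<^esub>)" "(\<lambda>i j. \<zero>\<^bsub>A\<^esub>) \<in> K"
    using star_hom_zero[OF A cstar_algebra_op_alg h] star_hom_zero[OF A cstar_algebra_op_alg h']
      amp_zero[OF F, of Y] amp_zero[OF F, of Y']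
    by (auto simp: E_def E'_def K_def)
  have add: "(\<lambda>i j. a i j \<oplus>\<^bsub>A\<^esub> b i j) \<in> K" "(\<lambda>f x. E a f x + E b f x) = E (\<lambda>i j. a i j \<oplus>\<^bsub>A\<^esub> b i j)"
    "(\<lambda>f x. E' a f x + E' b f x) = E' (\<lambda>i j. a i j \<oplus>\<^bsub>A\<^esub> b i j)" if "a \<in> K" "b \<in> K" for a b
  proof -
    show "(\<lambda>i j. a i j \<oplus>\<^bsub>A\<^esub> b i j) \<in> K" using that by (auto simp: K_def)
    show "(\<lambda>f x. E a f x + E b f x) = E (\<lambda>i j. a i j \<oplus>\<^bsub>A\<^esub> b i j)"
      "(\<lambda>f x. E' a f x + E' b f x) = E' (\<lambda>i j. a i j \<oplus>\<^bsub>A\<^esub> b i j)"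
      unfolding E_def E'_def amp_add[OF F] using that
      by (auto intro!: amp_cong[OF F] simp: star_hom_add[OF h] star_hom_add[OF h'] Kc)
  qed
  have scale: "(\<lambda>i j. c \<odot>\<^bsub>A\<^esub> a i j) \<in> K" "(\<lambda>f x. c * E a f x) = E (\<lambda>i j. c \<odot>\<^bsub>A\<^esub> a i j)"
    "(\<lambda>f x. c * E' a f x) = E' (\<lambda>i j. c \<odot>\<^bsub>A\<^esub> a i j)" if "a \<in> K" for a c
  proof -
    show "(\<lambda>i j. c \<odot>\<^bsub>A\<^esub> a i j) \<in> K" using that by (auto simp: K_def)
    show "(\<lambda>f x. c * E a f x) = E (\<lambda>i j. c \<odot>\<^bsub>A\<^esub> a i j)" "(\<lambda>f x. c * E' a f x) = E' (\<lambda>i j. c \<odot>\<^bsub>A\<^esub> a i j)"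
      unfolding E_def E'_def amp_scale[OF F] using that
      by (auto intro!: amp_cong[OF F] simp: star_hom_scale[OF h] star_hom_scale[OF h'] Kc)
  qed
  have adj: "(\<lambda>i j. cadj A (a j i)) \<in> K" "op_adj (Y \<times> Z) (E a) = E (\<lambda>i j. cadj A (a j i))"
    "op_adj (Y' \<times> Z) (E' a) = E' (\<lambda>i j. cadj A (a j i))" if a: "a \<in> K" for a
  proof -
    show "(\<lambda>i j. cadj A (a j i)) \<in> K" using that by (auto simp: K_def)
    have "op_adj (Y \<times> Z) (E a) = amp Y Z F (\<lambda>i j. op_adj Y (\<pi> (a j i)))"
      unfolding E_def by (rule amp_adj[OF F Kc(1)[OF a]])
    also have "\<dots> = E (\<lambda>i j. cadj A (a j i))"
      unfolding E_def using a by (auto intro!: amp_cong[OF F] simp: star_hom_adj[OF h] Kc)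
    finally show "op_adj (Y \<times> Z) (E a) = E (\<lambda>i j. cadj A (a j i))" .
    have "op_adj (Y' \<times> Z) (E' a) = amp Y' Z F (\<lambda>i j. op_adj Y' (\<pi>' (a j i)))"
      unfolding E'_def by (rule amp_adj[OF F Kc(2)[OF a]])
    also have "\<dots> = E' (\<lambda>i j. cadj A (a j i))"
      unfolding E'_def using a by (auto intro!: amp_cong[OF F] simp: star_hom_adj[OF h'] Kc)
    finally show "op_adj (Y' \<times> Z) (E' a) = E' (\<lambda>i j. cadj A (a j i))" .
  qed
  have mult: "\<exists>c\<in>K. (\<lambda>f. E a (E b f)) = E c \<and> (\<lambda>f. E' a (E' b f)) = E' c" if ab: "a \<in> K" "b \<in> K" for a b
  proof -
    \<comment> \<open>A single matrix has to represent the product in both pictures, so each entry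
      is chosen with both properties at once.\<close>
    define Q where "Q i k c \<longleftrightarrow> c \<in> carrier A \<and> \<pi> c = (\<lambda>f x. \<Sum>j\<in>F. \<pi> (a i j \<cdot>\<^bsub>A\<^esub> b j k) f x) \<and>
        \<pi>' c = (\<lambda>f x. \<Sum>j\<in>F. \<pi>' (a i j \<cdot>\<^bsub>A\<^esub> b j k) f x)" for i k c
    define c where "c i k = (SOME c. Q i k c)" for i k
    have c: "Q i k (c i k)" if "i \<in> F" "k \<in> F" for i k
    proof -
      have "\<exists>c. Q i k c"
        unfolding Q_def Bex_def[symmetric] using that ab Kc(3) by (intro star_hom_sum[OF A \<pi> \<pi>' F(1)]) auto
      then show ?thesis unfolding c_def by (rule someI_ex)
    qed
    have "(\<lambda>f. E a (E b f)) = amp Y Z F (\<lambda>i k f x. \<Sum>j\<in>F. \<pi> (a i j) (\<pi> (b j k) f) x)"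
      unfolding E_def by (rule amp_mult[OF F Kc(1)[OF ab(1)] Kc(1)[OF ab(2)]])
    also have "\<dots> = E c"
      unfolding E_def by (rule amp_cong[OF F]) (use c ab Kc(3) in \<open>simp add: star_hom_mult[OF h] Q_def\<close>)
    finally have 1: "(\<lambda>f. E a (E b f)) = E c" .
    have "(\<lambda>f. E' a (E' b f)) = amp Y' Z F (\<lambda>i k f x. \<Sum>j\<in>F. \<pi>' (a i j) (\<pi>' (b j k) f) x)"
      unfolding E'_def by (rule amp_mult[OF F Kc(2)[OF ab(1)] Kc(2)[OF ab(2)]])
    also have "\<dots> = E' c"
      unfolding E'_def by (rule amp_cong[OF F]) (use c ab Kc(3) in \<open>simp add: star_hom_mult[OF h'] Q_def\<close>)
    finally have "(\<lambda>f. E' a (E' b f)) = E' c" .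
    with 1 show ?thesis using c by (intro bexI[of _ c]) (auto simp: K_def Q_def)
  qed
  \<comment> \<open>Closedness of \<open>D\<close>: the limit is fixed by the compression because
    every \<open>X n\<close> is, so it is the matrix of its slices. These are limits of slices of
    the \<open>X n\<close> and stay in the closed range of \<open>\<pi>\<close>.\<close>
  have lim: "T \<in> D" if T: "\<And>n. X n \<in> D" "T \<in> bounded_ops (Y \<times> Z)" "cconverges ?O X T" for X T
  proof -
    let ?P = "compression Y Z F"
    note P = compression_closed(1)[of Y Z F]
    define a where "a n = (SOME a. a \<in> K \<and> X n = E a)" for n
    have "a n \<in> K \<and> X n = E (a n)" for n
      unfolding a_def by (rule someI_ex[of "\<lambda>a. a \<in> K \<and> X n = E a"]) (use T(1)[of n] in \<open>auto simp: D_def\<close>)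
    then have a: "\<And>n. a n \<in> K" "\<And>n. X n = E (a n)" by blast+
    have Xc: "X n \<in> carrier ?O" for n using Ec(1)[OF a(1)] a(2) by simp
    have XP: "(\<lambda>g. ?P (X n (?P g))) = X n" for n
      unfolding compression_eq_amp[OF F Xc[unfolded op_alg_simps]]
      using amp_cong[OF F, of "\<lambda>i j. op_slice Y i j (X n)" "\<lambda>i j. \<pi> (a n i j)" Y] slice(1)[OF a(1)]
      by (simp add: a(2) E_def)
    have "cconverges ?O (\<lambda>n. ?P \<cdot>\<^bsub>?O\<^esub> (X n \<cdot>\<^bsub>?O\<^esub> ?P)) (?P \<cdot>\<^bsub>?O\<^esub> (T \<cdot>\<^bsub>?O\<^esub> ?P))"
      using P Xc T op_mult_closed(1)[OF _ P] by (intro O.converges_mult O.converges_const) auto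
    then have "cconverges ?O X (\<lambda>g. ?P (T (?P g)))" by (simp add: XP)
    moreover have "(\<lambda>g. ?P (T (?P g))) \<in> bounded_ops (Y \<times> Z)"
      by (rule op_mult_closed(1)[OF P op_mult_closed(1)[OF T(2) P]])
    ultimately have TP: "(\<lambda>g. ?P (T (?P g))) = T"
      by (intro O.converges_unique[OF Xc _ _ _ T(3)]) (simp_all add: T(2))
    have sl: "op_slice Y i j T \<in> \<pi> ` carrier A" if ij: "i \<in> F" "j \<in> F" for i j
    proof (rule closed_subalg_limit[OF closed_subalg_image[OF A cstar_algebra_op_alg \<pi>]])
      have ijZ: "i \<in> Z" "j \<in> Z" using ij F by auto
      show "op_slice Y i j (X n) \<in> \<pi> ` carrier A" for n
        using slice(1)[OF a(1) ij] Kc(3)[OF a(1) ij] by (simp add: a(2))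
      show "op_slice Y i j T \<in> carrier (op_alg Y)" using op_slice_closed(1)[OF T(2) ijZ] by simp
      interpret OY: cstar_algebra "op_alg Y" by (rule cstar_algebra_op_alg)
      show "cconverges (op_alg Y) (\<lambda>n. op_slice Y i j (X n)) (op_slice Y i j T)"
      proof (rule OY.converges_bound[OF T(3)[unfolded cconverges_def]])
        fix n
        have "cdiff (op_alg Y) (op_slice Y i j (X n)) (op_slice Y i j T) = op_slice Y i j (cdiff ?O (X n) T)"
          unfolding cdiff_op_alg op_slice_add op_slice_scale ..
        then show "op_norm Y (cdiff (op_alg Y) (op_slice Y i j (X n)) (op_slice Y i j T)) \<le> op_norm (Y \<times> Z) (cdiff ?O (X n) T)"
          using op_slice_closed(2)[OF _ ijZ, of "cdiff ?O (X n) T" Y] O.cdiff_closed[OF Xc, of T n] T(2) by simp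
      qed (use op_slice_closed(1)[OF _ ijZ] Xc T(2) in auto)
    qed
    have "T = E (\<lambda>i j. inv_into (carrier A) \<pi> (op_slice Y i j T))"
      unfolding E_def by (subst TP[symmetric], subst compression_eq_amp[OF F T(2)], rule amp_cong[OF F])
        (simp add: f_inv_into_f[OF sl])
    moreover have "(\<lambda>i j. inv_into (carrier A) \<pi> (op_slice Y i j T)) \<in> K"
      using inv_into_into[OF sl] by (auto simp: K_def)
    ultimately show ?thesis unfolding D_def by blast
  qed
  have D: "closed_subalg ?O D"
    unfolding closed_subalg_def
  proof (intro conjI ballI allI impI)
    show "D \<subseteq> carrier ?O" using Ec by (auto simp: D_def)
    show "\<zero>\<^bsub>?O\<^esub> \<in> D" using zero by (auto simp: D_def)
    fix x y assume "x \<in> D" "y \<in> D"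
    then obtain a b where ab: "a \<in> K" "b \<in> K" "x = E a" "y = E b" by (auto simp: D_def)
    show "x \<oplus>\<^bsub>?O\<^esub> y \<in> D" using add(1,2)[OF ab(1,2)] ab by (auto simp: D_def)
    show "x \<cdot>\<^bsub>?O\<^esub> y \<in> D" using mult[OF ab(1,2)] ab by (auto simp: D_def)
  next
    fix x c assume "x \<in> D"
    then obtain a where a: "a \<in> K" "x = E a" by (auto simp: D_def)
    show "c \<odot>\<^bsub>?O\<^esub> x \<in> D" using scale(1,2)[OF a(1)] a by (auto simp: D_def)
    show "cadj ?O x \<in> D" using adj(1,2)[OF a(1)] a by (auto simp: D_def)
  qed (use lim in auto)
  have \<theta>: "star_mono (?O\<lparr>carrier := D\<rparr>) ?O' \<theta>"
    unfolding star_mono_def star_hom_def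
  proof (intro conjI ballI allI inj_onI)
    fix x y assume "x \<in> carrier (?O\<lparr>carrier := D\<rparr>)" "y \<in> carrier (?O\<lparr>carrier := D\<rparr>)"
    then obtain a b where ab: "a \<in> K" "b \<in> K" "x = E a" "y = E b" by (auto simp: D_def)
    show "\<theta> (x \<oplus>\<^bsub>?O\<lparr>carrier := D\<rparr>\<^esub> y) = \<theta> x \<oplus>\<^bsub>?O'\<^esub> \<theta> y" using add[OF ab(1,2)] ab by (simp add: \<theta>E)
    obtain c where c: "c \<in> K" "(\<lambda>f. E a (E b f)) = E c" "(\<lambda>f. E' a (E' b f)) = E' c" using mult[OF ab(1,2)] by blast
    show "\<theta> (x \<cdot>\<^bsub>?O\<lparr>carrier := D\<rparr>\<^esub> y) = \<theta> x \<cdot>\<^bsub>?O'\<^esub> \<theta> y" using c ab by (simp add: \<theta>E)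
    show "x = y" if "\<theta> x = \<theta> y"
    proof -
      have "E' a = E' b" using that ab by (simp add: \<theta>E)
      then have "\<pi>' (a i j) = \<pi>' (b i j)" if "i \<in> F" "j \<in> F" for i j
        using slice(2)[OF ab(1) that] slice(2)[OF ab(2) that] by simp
      then have "a i j = b i j" if "i \<in> F" "j \<in> F" for i j
        using inj' Kc(3)[OF ab(1) that] Kc(3)[OF ab(2) that] that by (auto dest: inj_onD)
      then show ?thesis unfolding ab E_def by (intro amp_cong[OF F]) simp
    qed
  next
    fix x c assume "x \<in> carrier (?O\<lparr>carrier := D\<rparr>)"
    then obtain a where a: "a \<in> K" "x = E a" by (auto simp: D_def)
    show "\<theta> x \<in> carrier ?O'" using Ec[OF a(1)] a by (simp add: \<theta>E)
    show "\<theta> (c \<odot>\<^bsub>?O\<lparr>carrier := D\<rparr>\<^esub> x) = c \<odot>\<^bsub>?O'\<^esub> \<theta> x" using scale[OF a(1)] a by (simp add: \<theta>E)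
    show "\<theta> (cadj (?O\<lparr>carrier := D\<rparr>) x) = cadj ?O' (\<theta> x)" using adj[OF a(1)] a by (simp add: \<theta>E)
  qed
  have aK: "a \<in> K" using a by (simp add: K_def)
  have "op_norm (Y' \<times> Z) (\<theta> (E a)) = cnorm (?O\<lparr>carrier := D\<rparr>) (E a)"
    using star_mono_isometric[OF cstar_algebra_restrict[OF cstar_algebra_op_alg D] cstar_algebra_op_alg \<theta>, of "E a"] aK
    by (simp add: D_def)
  then show ?thesis using \<theta>E[OF aK] by (simp add: E_def E'_def)
qed

section \<open>Independence of the minimal tensor norm of the representations\<close>

text \<open>Slicing a \<otimes> T gives a multiplied by an entry of T, so both operators have the
  same matrix \<open>\<alpha>\<close> over \<open>A\<close>, seen through \<open>\<pi>\<close> and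
  through \<open>\<pi>'\<close>. Their finite compressions have equal norms by
  \<open>amp_norm_eq\<close>, and these determine the norms of the operators.\<close>

theorem psum_norm_eq:
  assumes A: "cstar_algebra A" and \<pi>: "star_mono A (op_alg Y) \<pi>" and \<pi>': "star_mono A (op_alg Y') \<pi>'"
    and ps: "set ps \<subseteq> carrier A \<times> bounded_ops Z"
  shows "op_norm (Y' \<times> Z) (psum Y' Z (map (\<lambda>(a, T). (\<pi>' a, T)) ps)) =
     op_norm (Y \<times> Z) (psum Y Z (map (\<lambda>(a, T). (\<pi> a, T)) ps))"
proof -
  interpret A: cstar_algebra A by (rule A)
  have slices: "\<exists>\<alpha>. \<forall>i\<in>Z. \<forall>j\<in>Z. \<alpha> i j \<in> carrier A \<and>
     op_slice Y i j (psum Y Z (map (\<lambda>(a, T). (\<pi> a, T)) ps)) = \<pi> (\<alpha> i j) \<and>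
     op_slice Y' i j (psum Y' Z (map (\<lambda>(a, T). (\<pi>' a, T)) ps)) = \<pi>' (\<alpha> i j)"
    using ps
  proof (induction ps)
    case Nil
    show ?case using star_hom_zero[OF A cstar_algebra_op_alg star_mono_hom[OF \<pi>]]
      star_hom_zero[OF A cstar_algebra_op_alg star_mono_hom[OF \<pi>']]
      by (intro exI[of _ "\<lambda>i j. \<zero>\<^bsub>A\<^esub>"]) (auto simp: op_slice_def)
  next
    case (Cons q ps)
    obtain a T where q: "q = (a, T)" "a \<in> carrier A" "T \<in> bounded_ops Z" using Cons.prems by (cases q) auto
    obtain \<alpha> where \<alpha>: "\<forall>i\<in>Z. \<forall>j\<in>Z. \<alpha> i j \<in> carrier A \<and>
     op_slice Y i j (psum Y Z (map (\<lambda>(a, T). (\<pi> a, T)) ps)) = \<pi> (\<alpha> i j) \<and>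
     op_slice Y' i j (psum Y' Z (map (\<lambda>(a, T). (\<pi>' a, T)) ps)) = \<pi>' (\<alpha> i j)"
      using Cons by auto
    have \<pi>a: "\<pi> a \<in> bounded_ops Y" "\<pi>' a \<in> bounded_ops Y'"
      using q star_hom_closed[OF star_mono_hom[OF \<pi>]] star_hom_closed[OF star_mono_hom[OF \<pi>']] by auto
    show ?case
      by (rule exI[of _ "\<lambda>i j. (T (ket j) i \<odot>\<^bsub>A\<^esub> a) \<oplus>\<^bsub>A\<^esub> \<alpha> i j"])
         (use \<alpha> q \<pi>a in \<open>auto simp: op_slice_add op_slice_pten star_hom_add[OF star_mono_hom[OF \<pi>]]
           star_hom_scale[OF star_mono_hom[OF \<pi>]] star_hom_add[OF star_mono_hom[OF \<pi>']] star_hom_scale[OF star_mono_hom[OF \<pi>']]\<close>)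
  qed
  then obtain \<alpha> where \<alpha>: "\<forall>i\<in>Z. \<forall>j\<in>Z. \<alpha> i j \<in> carrier A \<and>
     op_slice Y i j (psum Y Z (map (\<lambda>(a, T). (\<pi> a, T)) ps)) = \<pi> (\<alpha> i j) \<and>
     op_slice Y' i j (psum Y' Z (map (\<lambda>(a, T). (\<pi>' a, T)) ps)) = \<pi>' (\<alpha> i j)" by blast
  let ?x = "psum Y Z (map (\<lambda>(a, T). (\<pi> a, T)) ps)" and ?x' = "psum Y' Z (map (\<lambda>(a, T). (\<pi>' a, T)) ps)"
  have x: "?x \<in> bounded_ops (Y \<times> Z)" and x': "?x' \<in> bounded_ops (Y' \<times> Z)"
    using star_hom_closed[OF star_mono_hom[OF \<pi>]] star_hom_closed[OF star_mono_hom[OF \<pi>']]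
    by (auto intro!: psum_closed dest!: subsetD[OF ps])
  have eq: "op_norm (Y' \<times> Z) (\<lambda>g. compression Y' Z F (?x' (compression Y' Z F g)))
      = op_norm (Y \<times> Z) (\<lambda>g. compression Y Z F (?x (compression Y Z F g)))"
    if F: "finite F" "F \<subseteq> Z" for F
  proof -
    have "amp Y Z F (\<lambda>i j. op_slice Y i j ?x) = amp Y Z F (\<lambda>i j. \<pi> (\<alpha> i j))"
      "amp Y' Z F (\<lambda>i j. op_slice Y' i j ?x') = amp Y' Z F (\<lambda>i j. \<pi>' (\<alpha> i j))"
      using \<alpha> F by (auto intro!: amp_cong[OF F])
    then show ?thesis unfolding compression_eq_amp[OF F x] compression_eq_amp[OF F x']
      using amp_norm_eq[OF A \<pi> \<pi>' F, of \<alpha>] \<alpha> F by auto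
  qed
  have comp_le: "op_norm (V \<times> Z) (\<lambda>g. compression V Z F (T (compression V Z F g))) \<le> op_norm (V \<times> Z) T"
    if T: "T \<in> bounded_ops (V \<times> Z)" for V :: "'v set" and T F
  proof -
    note P = compression_closed[of V Z F]
    have "op_norm (V \<times> Z) (\<lambda>g. compression V Z F (T (compression V Z F g))) \<le>
      op_norm (V \<times> Z) (compression V Z F) * op_norm (V \<times> Z) (\<lambda>g. T (compression V Z F g))"
      by (rule op_mult_closed(2)[OF P(1) op_mult_closed(1)[OF T P(1)]])
    also have "\<dots> \<le> 1 * (op_norm (V \<times> Z) T * 1)"
      using P op_mult_closed(2)[OF T P(1)] op_norm_nonneg[OF T] op_norm_nonneg[OF op_mult_closed(1)[OF T P(1)]]
      by (intro mult_mono) (auto intro: order_trans[OF _ mult_left_le])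
    finally show ?thesis by simp
  qed
  have "op_norm (Y' \<times> Z) ?x' \<le> op_norm (Y \<times> Z) ?x"
    using eq comp_le[OF x] by (intro op_norm_le_compressions[OF x'] op_norm_nonneg[OF x]) simp
  moreover have "op_norm (Y \<times> Z) ?x \<le> op_norm (Y' \<times> Z) ?x'"
    using comp_le[OF x'] by (intro op_norm_le_compressions[OF x] op_norm_nonneg[OF x']) (simp flip: eq)
  ultimately show ?thesis by simp
qed

lemma represented_cstarD:
  assumes "represented_cstar A"
  shows represented_cstar_algebra: "cstar_algebra A"
    and represented_mono: "star_mono A (op_alg (words (deg A))) (rep A)"
    and represented_hom: "star_hom A (op_alg (words (deg A))) (rep A)"
    and rep_closed: "a \<in> carrier A \<Longrightarrow> rep A a \<in> bounded_ops (words (deg A))"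
  using assms star_hom_closed[of A "op_alg (words (deg A))" "rep A" a] by (auto simp: represented_cstar_def star_mono_def)

definition rep_sum :: "('a, 'h) rep_cstar \<Rightarrow> ('b, 'h) rep_cstar \<Rightarrow> ('a \<times> 'b) list \<Rightarrow> 'h list oper" where
  "rep_sum A B qs = tsum (deg A) (deg B) (map (\<lambda>(a, b). (rep A a, rep B b)) qs)"

text \<open>\<open>f\<close> followed by \<open>rep A'\<close> and \<open>g\<close> followed by
  \<open>rep B'\<close> are just other faithful representations of \<open>A\<close> and
  \<open>B\<close>. The representations are exchanged one factor at a time, with a swap in between
  because \<open>psum_norm_eq\<close> concerns the first factor.\<close>

lemma rep_sum_norm_eq:
  fixes A :: "('a, 'h) rep_cstar" and B :: "('b, 'h) rep_cstar"
    and A' :: "('c, 'k) rep_cstar" and B' :: "('d, 'k) rep_cstar"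
  assumes A: "represented_cstar A" and B: "represented_cstar B"
    and A': "represented_cstar A'" and B': "represented_cstar B'"
    and f: "star_mono A A' f" and g: "star_mono B B' g" and qs: "set qs \<subseteq> carrier A \<times> carrier B"
  shows "op_norm (words (deg A' + deg B')) (rep_sum A' B' (map (\<lambda>(a, b). (f a, g b)) qs)) =
    op_norm (words (deg A + deg B)) (rep_sum A B qs)"
proof -
  let ?Y = "words (deg A) :: 'h list set" and ?Z = "words (deg B) :: 'h list set"
  let ?Y' = "words (deg A') :: 'k list set" and ?Z' = "words (deg B') :: 'k list set"
  note fc = star_hom_closed[OF star_mono_hom[OF f]] and gc = star_hom_closed[OF star_mono_hom[OF g]]
  have \<pi>': "star_mono A (op_alg ?Y') (\<lambda>a. rep A' (f a))"
    by (rule star_mono_comp[OF f represented_mono[OF A']])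
  have \<rho>': "star_mono B (op_alg ?Z') (\<lambda>b. rep B' (g b))"
    by (rule star_mono_comp[OF g represented_mono[OF B']])
  have 0: "set (map (\<lambda>(a, b). (rep A a, rep B b)) qs) \<subseteq> bounded_ops ?Y \<times> bounded_ops ?Z"
    "set (map (\<lambda>(a, b). (rep A' (f a), rep B' (g b))) qs) \<subseteq> bounded_ops ?Y' \<times> bounded_ops ?Z'"
    "set (map (\<lambda>(a, b). (rep A' (f a), rep B b)) qs) \<subseteq> bounded_ops ?Y' \<times> bounded_ops ?Z"
    using qs rep_closed[OF A] rep_closed[OF B] rep_closed[OF A' fc] rep_closed[OF B' gc] by auto
  have sub: "set (map (\<lambda>(a, b). (a, rep B b)) qs) \<subseteq> carrier A \<times> bounded_ops ?Z"
    "set (map (\<lambda>(a, b). (b, rep A' (f a))) qs) \<subseteq> carrier B \<times> bounded_ops ?Y'"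
    using qs rep_closed[OF B] rep_closed[OF A' fc] by auto
  have "op_norm (words (deg A + deg B)) (rep_sum A B qs) = op_norm (?Y \<times> ?Z) (psum ?Y ?Z (map (\<lambda>(a, b). (rep A a, rep B b)) qs))"
    unfolding rep_sum_def by (rule tsum_norm[OF 0(1)])
  also have "\<dots> = op_norm (?Y' \<times> ?Z) (psum ?Y' ?Z (map (\<lambda>(a, b). (rep A' (f a), rep B b)) qs))"
    using psum_norm_eq[OF represented_cstar_algebra[OF A] represented_mono[OF A] \<pi>',
        of "map (\<lambda>(a, b). (a, rep B b)) qs" ?Z, OF sub(1)]
    by (simp add: comp_def case_prod_unfold)
  also have "\<dots> = op_norm (?Z \<times> ?Y') (psum ?Z ?Y' (map (\<lambda>(a, b). (rep B b, rep A' (f a))) qs))"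
    unfolding psum_swap_norm[OF 0(3)] by (simp add: comp_def case_prod_unfold)
  also have "\<dots> = op_norm (?Z' \<times> ?Y') (psum ?Z' ?Y' (map (\<lambda>(a, b). (rep B' (g b), rep A' (f a))) qs))"
    using psum_norm_eq[OF represented_cstar_algebra[OF B] represented_mono[OF B] \<rho>',
        of "map (\<lambda>(a, b). (b, rep A' (f a))) qs" ?Y', OF sub(2)]
    by (simp add: comp_def case_prod_unfold)
  also have "\<dots> = op_norm (?Y' \<times> ?Z') (psum ?Y' ?Z' (map (\<lambda>(a, b). (rep A' (f a), rep B' (g b))) qs))"
    unfolding psum_swap_norm[OF 0(2)] by (simp add: comp_def case_prod_unfold)
  also have "\<dots> = op_norm (words (deg A' + deg B')) (rep_sum A' B' (map (\<lambda>(a, b). (f a, g b)) qs))"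
    unfolding tsum_norm[OF 0(2), symmetric] rep_sum_def by (simp add: comp_def case_prod_unfold)
  finally show ?thesis by simp
qed

section \<open>Minimal tensor products and the maps between them\<close>

definition tensor_gens :: "('a, 'h) rep_cstar \<Rightarrow> ('b, 'h) rep_cstar \<Rightarrow> 'h list oper set" where
  "tensor_gens A B = {tensor_elem A B a b | a b. a \<in> carrier A \<and> b \<in> carrier B}"

lemma tensor_eq: "tensor A B = op_subalg (deg A + deg B) (closed_span (op_alg (words (deg A + deg B))) (tensor_gens A B))"
  by (simp add: tensor_def tensor_gens_def)

lemma tensor_simps [simp]: "deg (tensor A B) = deg A + deg B" "rep (tensor A B) = (\<lambda>T. T)"
  by (simp_all add: tensor_eq)

context
  fixes A :: "('a, 'h) rep_cstar" and B :: "('b, 'h) rep_cstar"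
  assumes A: "represented_cstar A" and B: "represented_cstar B"
begin

lemma tensor_elem_bounded:
  "a \<in> carrier A \<Longrightarrow> b \<in> carrier B \<Longrightarrow> tensor_elem A B a b \<in> bounded_ops (words (deg A + deg B))"
  unfolding tensor_elem_def by (intro tensor_op_closed rep_closed A B)

lemma tensor_gens_bounded: "tensor_gens A B \<subseteq> bounded_ops (words (deg A + deg B))"
  using tensor_elem_bounded by (auto simp: tensor_gens_def)

lemma tensor_elem_mult:
  assumes "a \<in> carrier A" "b \<in> carrier B" "a' \<in> carrier A" "b' \<in> carrier B"
  shows "(\<lambda>f. tensor_elem A B a b (tensor_elem A B a' b' f)) = tensor_elem A B (a \<cdot>\<^bsub>A\<^esub> a') (b \<cdot>\<^bsub>B\<^esub> b')"
  unfolding tensor_elem_def using assms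
  by (subst tensor_op_mult) (auto simp: rep_closed A B star_hom_mult[OF represented_hom[OF A]] star_hom_mult[OF represented_hom[OF B]])

lemma tensor_elem_adj:
  assumes "a \<in> carrier A" "b \<in> carrier B"
  shows "op_adj (words (deg A + deg B)) (tensor_elem A B a b) = tensor_elem A B (cadj A a) (cadj B b)"
  unfolding tensor_elem_def using assms
  by (subst tensor_op_adj) (auto simp: rep_closed A B star_hom_adj[OF represented_hom[OF A]] star_hom_adj[OF represented_hom[OF B]])

lemma tensor_elem_scale:
  assumes "a \<in> carrier A"
  shows "(\<lambda>f x. c * tensor_elem A B a b f x) = tensor_elem A B (c \<odot>\<^bsub>A\<^esub> a) b"
  unfolding tensor_elem_def using assms
  by (simp add: star_hom_scale[OF represented_hom[OF A]] tensor_op_scale_left)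

lemma closed_subalg_tensor:
  "closed_subalg (op_alg (words (deg A + deg B))) (closed_span (op_alg (words (deg A + deg B))) (tensor_gens A B))"
proof -
  interpret A: cstar_algebra A by (rule represented_cstar_algebra[OF A])
  interpret B: cstar_algebra B by (rule represented_cstar_algebra[OF B])
  show ?thesis
    by (rule cstar_algebra.closed_subalg_closed_span[OF cstar_algebra_op_alg])
       (use tensor_gens_bounded in \<open>auto simp: tensor_gens_def tensor_elem_mult tensor_elem_adj, blast+\<close>)
qed

lemma represented_tensor: "represented_cstar (tensor A B)"
  unfolding tensor_eq by (rule represented_op_subalg[OF closed_subalg_tensor])

lemma tensor_carrier_bounded: "carrier (tensor A B) \<subseteq> bounded_ops (words (deg A + deg B))"
  using closed_subalg_subset[OF closed_subalg_tensor] by (simp add: tensor_eq)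

lemma tensor_elem_closed: "a \<in> carrier A \<Longrightarrow> b \<in> carrier B \<Longrightarrow> tensor_elem A B a b \<in> carrier (tensor A B)"
  using cstar_algebra.closed_span_base[OF cstar_algebra_op_alg] by (fastforce simp: tensor_eq tensor_gens_def)

lemma tensor_hom_unique:
  assumes C: "cstar_algebra C" and h: "star_hom (tensor A B) C h" "star_hom (tensor A B) C h'"
    and eq: "\<And>a b. a \<in> carrier A \<Longrightarrow> b \<in> carrier B \<Longrightarrow> h (tensor_elem A B a b) = h' (tensor_elem A B a b)"
    and x: "x \<in> carrier (tensor A B)"
  shows "h x = h' x"
proof -
  have eq': "h t = h' t" if "t \<in> tensor_gens A B" for t
    using that eq unfolding tensor_gens_def by blast
  have x': "x \<in> closed_span (op_alg (words (deg A + deg B))) (tensor_gens A B)"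
    using x by (simp add: tensor_eq)
  show ?thesis
    by (rule star_hom_eq_on_span[OF tensor_gens_bounded
          represented_cstar_algebra[OF represented_tensor, unfolded tensor_eq] C
          h(1)[unfolded tensor_eq] h(2)[unfolded tensor_eq] eq' x'])
qed

lemma tensor_dense: "cdense (tensor A B) (lin_span (op_alg (words (deg A + deg B))) (tensor_gens A B))"
proof -
  interpret O: cstar_algebra "op_alg (words (deg A + deg B)) :: 'h list oper cstar" by (rule cstar_algebra_op_alg)
  show ?thesis
    using O.lin_span_closed_span[of "tensor_gens A B"] O.closed_span_eq[of "tensor_gens A B"] tensor_gens_bounded
    by (auto simp: cdense_def tensor_eq)
qed

lemma tensor_elem_inj:
  assumes "a \<in> carrier A" "b \<in> carrier B" "a \<noteq> \<zero>\<^bsub>A\<^esub>" "tensor_elem A B a b = (\<lambda>f x. 0)"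
  shows "b = \<zero>\<^bsub>B\<^esub>"
proof -
  have "rep A a \<noteq> (\<lambda>f x. 0)"
    using assms(1,3) represented_mono[OF A] star_hom_zero[OF represented_cstar_algebra[OF A] cstar_algebra_op_alg represented_hom[OF A]]
      cstar_algebra.zero_closed[OF represented_cstar_algebra[OF A]]
    by (auto simp: star_mono_def dest: inj_onD[of _ _ a "\<zero>\<^bsub>A\<^esub>"])
  then have "rep B b = (\<lambda>f x. 0)"
    using tensor_op_eq_0[OF rep_closed[OF A assms(1)] rep_closed[OF B assms(2)]] assms(4) by (simp add: tensor_elem_def)
  then show ?thesis
    using assms(2) represented_mono[OF B] star_hom_zero[OF represented_cstar_algebra[OF B] cstar_algebra_op_alg represented_hom[OF B]]
      cstar_algebra.zero_closed[OF represented_cstar_algebra[OF B]]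
    by (auto simp: star_mono_def dest: inj_onD[of _ _ b "\<zero>\<^bsub>B\<^esub>"])
qed

end

text \<open>The graph of f \<otimes> g on the algebraic tensor product. As an inductively generated
  relation it presupposes nothing about well-definedness, which comes from equality of
  norms.\<close>

inductive_set tensor_graph ::
  "('a, 'h) rep_cstar \<Rightarrow> ('b, 'h) rep_cstar \<Rightarrow> ('c, 'k) rep_cstar \<Rightarrow> ('d, 'k) rep_cstar \<Rightarrow>
   ('a \<Rightarrow> 'c) \<Rightarrow> ('b \<Rightarrow> 'd) \<Rightarrow> ('h list oper \<times> 'k list oper) set" for A B A' B' f g where
  tensor_graph_zero: "(\<lambda>_ _. 0, \<lambda>_ _. 0) \<in> tensor_graph A B A' B' f g"
| tensor_graph_base: "a \<in> carrier A \<Longrightarrow> b \<in> carrier B \<Longrightarrow>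
    (tensor_elem A B a b, tensor_elem A' B' (f a) (g b)) \<in> tensor_graph A B A' B' f g"
| tensor_graph_add: "(x, y) \<in> tensor_graph A B A' B' f g \<Longrightarrow> (x', y') \<in> tensor_graph A B A' B' f g \<Longrightarrow>
    (\<lambda>f z. x f z + x' f z, \<lambda>f z. y f z + y' f z) \<in> tensor_graph A B A' B' f g"
| tensor_graph_scale: "(x, y) \<in> tensor_graph A B A' B' f g \<Longrightarrow>
    (\<lambda>f z. c * x f z, \<lambda>f z. c * y f z) \<in> tensor_graph A B A' B' f g"

text \<open>Injectivity of the minimal tensor product. Related elements have equal norms by
  \<open>rep_sum_norm_eq\<close>, so \<open>star_graph_extension\<close> produces a map; density of
  elementary tensors makes it the only one, which identifies it with the description in
  \<open>tensor_map\<close>.\<close>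

theorem tensor_map_mono:
  fixes A :: "('a, 'h) rep_cstar" and B :: "('b, 'h) rep_cstar"
    and A' :: "('c, 'k) rep_cstar" and B' :: "('d, 'k) rep_cstar"
  assumes A: "represented_cstar A" and B: "represented_cstar B"
    and A': "represented_cstar A'" and B': "represented_cstar B'"
    and f: "star_mono A A' f" and g: "star_mono B B' g"
  shows "star_mono (tensor A B) (tensor A' B') (tensor_map A B A' B' f g)"
    and "\<And>a b. a \<in> carrier A \<Longrightarrow> b \<in> carrier B \<Longrightarrow>
      tensor_map A B A' B' f g (tensor_elem A B a b) = tensor_elem A' B' (f a) (g b)"
proof -
  let ?G = "tensor_graph A B A' B' f g" and ?L = "tensor A B" and ?M = "tensor A' B'"
  let ?W = "words (deg A + deg B)" and ?W' = "words (deg A' + deg B')"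
  note hf = star_mono_hom[OF f] and hg = star_mono_hom[OF g]
  note fc = star_hom_closed[OF hf] and gc = star_hom_closed[OF hg]
  interpret A: cstar_algebra A by (rule represented_cstar_algebra[OF A])
  interpret B: cstar_algebra B by (rule represented_cstar_algebra[OF B])
  interpret L: cstar_algebra ?L by (rule represented_cstar_algebra[OF represented_tensor[OF A B]])
  interpret M: cstar_algebra ?M by (rule represented_cstar_algebra[OF represented_tensor[OF A' B']])
  interpret O: cstar_algebra "op_alg ?W :: 'h list oper cstar" by (rule cstar_algebra_op_alg)
  interpret O': cstar_algebra "op_alg ?W' :: 'k list oper cstar" by (rule cstar_algebra_op_alg)
  have ops: "czero ?L = (\<lambda>_ _. 0)" "cadd ?L = (\<lambda>S T f x. S f x + T f x)" "cscale ?L = (\<lambda>c T f x. c * T f x)"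
    "cmult ?L = (\<lambda>S T f. S (T f))" "cadj ?L = op_adj ?W" "cnorm ?L = op_norm ?W"
    "czero ?M = (\<lambda>_ _. 0)" "cadd ?M = (\<lambda>S T f x. S f x + T f x)" "cscale ?M = (\<lambda>c T f x. c * T f x)"
    "cmult ?M = (\<lambda>S T f. S (T f))" "cadj ?M = op_adj ?W'" "cnorm ?M = op_norm ?W'"
    by (simp_all add: tensor_eq)
  have Gc: "x \<in> carrier ?L \<and> y \<in> carrier ?M" if "(x, y) \<in> ?G" for x y
    using that
  proof induction
    case tensor_graph_zero
    show ?case using L.zero_closed M.zero_closed by (simp add: ops)
  next
    case (tensor_graph_base a b)
    then show ?case using fc gc by (simp add: tensor_elem_closed A B A' B')
  next
    case (tensor_graph_add x y x' y')
    then show ?case using L.add_closed[of x x'] M.add_closed[of y y'] by (simp add: ops)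
  next
    case (tensor_graph_scale x y c)
    then show ?case using L.scale_closed[of x c] M.scale_closed[of y c] by (simp add: ops)
  qed
  then have Gb: "x \<in> bounded_ops ?W" "y \<in> bounded_ops ?W'" if "(x, y) \<in> ?G" for x y
    using that tensor_carrier_bounded[OF A B] tensor_carrier_bounded[OF A' B'] by blast+
  \<comment> \<open>Every pair in the graph stems from one list of elementary tensors, to which the
    norm equality applies; scalars are absorbed into the first factor.\<close>
  have list: "\<exists>qs. set qs \<subseteq> carrier A \<times> carrier B \<and> x = rep_sum A B qs \<and>
      y = rep_sum A' B' (map (\<lambda>(a, b). (f a, g b)) qs)" if "(x, y) \<in> ?G" for x y
    using that
  proof induction
    case tensor_graph_zero
    show ?case by (intro exI[of _ "[]"]) (simp add: rep_sum_def)
  next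
    case (tensor_graph_base a b)
    then show ?case by (intro exI[of _ "[(a, b)]"]) (simp add: rep_sum_def tensor_elem_def)
  next
    case (tensor_graph_add x y x' y')
    then obtain qs qs' where "set qs \<subseteq> carrier A \<times> carrier B \<and> x = rep_sum A B qs \<and> y = rep_sum A' B' (map (\<lambda>(a, b). (f a, g b)) qs)"
      "set qs' \<subseteq> carrier A \<times> carrier B \<and> x' = rep_sum A B qs' \<and> y' = rep_sum A' B' (map (\<lambda>(a, b). (f a, g b)) qs')" by blast
    then show ?case by (intro exI[of _ "qs @ qs'"]) (simp add: rep_sum_def tsum_def)
  next
    case (tensor_graph_scale x y c)
    then obtain qs where qs: "set qs \<subseteq> carrier A \<times> carrier B" "x = rep_sum A B qs" "y = rep_sum A' B' (map (\<lambda>(a, b). (f a, g b)) qs)" by blast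
    have "set (map (\<lambda>(a, b). (c \<odot>\<^bsub>A\<^esub> a, b)) qs) \<subseteq> carrier A \<times> carrier B \<and>
      (\<lambda>f z. c * rep_sum A B qs f z) = rep_sum A B (map (\<lambda>(a, b). (c \<odot>\<^bsub>A\<^esub> a, b)) qs) \<and>
      (\<lambda>f' z. c * rep_sum A' B' (map (\<lambda>(a, b). (f a, g b)) qs) f' z)
        = rep_sum A' B' (map (\<lambda>(a, b). (f a, g b)) (map (\<lambda>(a, b). (c \<odot>\<^bsub>A\<^esub> a, b)) qs))"
      using qs(1)
      by (induction qs) (auto simp: rep_sum_def fun_eq_iff distrib_left star_hom_scale[OF represented_hom[OF A]]
          star_hom_scale[OF represented_hom[OF A']] star_hom_scale[OF hf] fc tensor_op_scale_left)
    then show ?case using qs by blast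
  qed
  have mult1: "(\<lambda>f. x (x' f), \<lambda>f. y (y' f)) \<in> ?G" if "(x', y') \<in> ?G" and ab: "a \<in> carrier A" "b \<in> carrier B"
    and xy: "x = tensor_elem A B a b" "y = tensor_elem A' B' (f a) (g b)" for x y x' y' a b
    using that(1)
  proof induction
    case tensor_graph_zero
    show ?case using op_zero[OF tensor_elem_bounded[OF A B ab]] op_zero[OF tensor_elem_bounded[OF A' B' fc[OF ab(1)] gc[OF ab(2)]]]
      tensor_graph.tensor_graph_zero by (simp add: xy)
  next
    case (tensor_graph_base a' b')
    then show ?case unfolding xy
      using tensor_graph.tensor_graph_base[of "a \<cdot>\<^bsub>A\<^esub> a'" A "b \<cdot>\<^bsub>B\<^esub> b'" B A' B' f g] ab
      by (simp add: tensor_elem_mult[OF A B] tensor_elem_mult[OF A' B'] fc gc star_hom_mult[OF hf] star_hom_mult[OF hg])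
  next
    case (tensor_graph_add u v u' v')
    have "x (\<lambda>z. u f z + u' f z) = (\<lambda>z. x (u f) z + x (u' f) z)" for f
      unfolding xy
      by (rule op_add[OF tensor_elem_bounded[OF A B ab] op_closed'[OF Gb(1)[OF tensor_graph_add.hyps(1)]]
            op_closed'[OF Gb(1)[OF tensor_graph_add.hyps(2)]]])
    moreover have "y (\<lambda>z. v f z + v' f z) = (\<lambda>z. y (v f) z + y (v' f) z)" for f
      unfolding xy
      by (rule op_add[OF tensor_elem_bounded[OF A' B' fc[OF ab(1)] gc[OF ab(2)]]
            op_closed'[OF Gb(2)[OF tensor_graph_add.hyps(1)]] op_closed'[OF Gb(2)[OF tensor_graph_add.hyps(2)]]])
    ultimately show ?case using tensor_graph.tensor_graph_add[OF tensor_graph_add.IH] by simp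
  next
    case (tensor_graph_scale u v c)
    have "x (\<lambda>z. c * u f z) = (\<lambda>z. c * x (u f) z)" for f
      unfolding xy by (rule op_scale[OF tensor_elem_bounded[OF A B ab]]) (use Gb tensor_graph_scale op_closed' in blast)
    moreover have "y (\<lambda>z. c * v f z) = (\<lambda>z. c * y (v f) z)" for f
      unfolding xy by (rule op_scale[OF tensor_elem_bounded[OF A' B' fc[OF ab(1)] gc[OF ab(2)]]])
        (use Gb tensor_graph_scale op_closed' in blast)
    ultimately show ?case using tensor_graph.tensor_graph_scale[OF tensor_graph_scale.IH] by simp
  qed
  have mult: "(\<lambda>f. x (x' f), \<lambda>f. y (y' f)) \<in> ?G" if "(x, y) \<in> ?G" and xy': "(x', y') \<in> ?G" for x y x' y'
    using that(1)
  proof induction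
    case (tensor_graph_base a b)
    then show ?case by (intro mult1[OF xy']) auto
  qed (auto intro: tensor_graph.intros)
  have adj: "(op_adj ?W x, op_adj ?W' y) \<in> ?G" if "(x, y) \<in> ?G" for x y
    using that
  proof induction
    case tensor_graph_zero
    show ?case using O.adj_zero O'.adj_zero tensor_graph.tensor_graph_zero by simp
  next
    case (tensor_graph_base a b)
    then show ?case using tensor_graph.tensor_graph_base[of "cadj A a" A "cadj B b" B A' B' f g]
      by (simp add: tensor_elem_adj[OF A B] tensor_elem_adj[OF A' B'] fc gc star_hom_adj[OF hf] star_hom_adj[OF hg])
  next
    case (tensor_graph_add x y x' y')
    then show ?case using Gb[OF tensor_graph_add.hyps(1)] Gb[OF tensor_graph_add.hyps(2)] O.adj_add[of x x'] O'.adj_add[of y y']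
        tensor_graph.tensor_graph_add[OF tensor_graph_add.IH] by simp
  next
    case (tensor_graph_scale x y c)
    then show ?case using Gb[OF tensor_graph_scale.hyps(1)] O.adj_scale[of x c] O'.adj_scale[of y c]
        tensor_graph.tensor_graph_scale[OF tensor_graph_scale.IH, of "cnj c"] by simp
  qed
  have dense: "cdense ?L (fst ` ?G)"
  proof -
    have "lin_span (op_alg ?W) (tensor_gens A B) \<subseteq> fst ` ?G"
    proof
      fix x assume "x \<in> lin_span (op_alg ?W) (tensor_gens A B)"
      then have "\<exists>y. (x, y) \<in> ?G"
        by induction (auto simp: tensor_gens_def intro: tensor_graph.intros)
      then show "x \<in> fst ` ?G" by force
    qed
    then show ?thesis using tensor_dense[OF A B] Gc unfolding cdense_def by (fastforce simp: subset_eq)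
  qed
  have norm: "cnorm ?M y = cnorm ?L x" if "(x, y) \<in> ?G" for x y
    using list[OF that] rep_sum_norm_eq[OF A B A' B' f g] by (auto simp: ops)
  obtain h where h: "star_mono ?L ?M h" "\<And>x y. (x, y) \<in> ?G \<Longrightarrow> h x = y"
    by (rule star_graph_extension[OF L.cstar_algebra_axioms M.cstar_algebra_axioms, of ?G])
       (use Gc mult adj norm dense in \<open>auto simp: ops intro: tensor_graph.intros\<close>)
  \<comment> \<open>The description in \<open>tensor_map\<close> also fixes the values outside the
    carrier.\<close>
  define h' where "h' = restrict h (carrier ?L)"
  have eqh: "h' x = h x" if "x \<in> carrier ?L" for x using that by (simp add: h'_def)
  have h'm: "star_mono ?L ?M h'"
    using h(1) unfolding star_mono_def star_hom_def by (auto simp: eqh inj_on_def)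
  have h'e: "h' (tensor_elem A B a b) = tensor_elem A' B' (f a) (g b)" if "a \<in> carrier A" "b \<in> carrier B" for a b
    using h(2)[OF tensor_graph_base[OF that]] tensor_elem_closed[OF A B that] by (simp add: eqh)
  have "tensor_map A B A' B' f g = h'"
    unfolding tensor_map_def
  proof (rule the_equality)
    show "h' \<in> extensional (carrier ?L) \<and> star_hom ?L ?M h' \<and>
      (\<forall>a\<in>carrier A. \<forall>b\<in>carrier B. h' (tensor_elem A B a b) = tensor_elem A' B' (f a) (g b))"
      using star_mono_hom[OF h'm] h'e by (auto simp: h'_def)
    fix k assume k: "k \<in> extensional (carrier ?L) \<and> star_hom ?L ?M k \<and>
      (\<forall>a\<in>carrier A. \<forall>b\<in>carrier B. k (tensor_elem A B a b) = tensor_elem A' B' (f a) (g b))"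
    show "k = h'"
    proof (rule extensionalityI[of _ "carrier ?L"])
      fix x assume "x \<in> carrier ?L"
      then show "k x = h' x"
        using tensor_hom_unique[OF A B M.cstar_algebra_axioms, of k h' x] k star_mono_hom[OF h'm] h'e by simp
    qed (use k in \<open>auto simp: h'_def\<close>)
  qed
  then show "star_mono (tensor A B) (tensor A' B') (tensor_map A B A' B' f g)"
    "\<And>a b. a \<in> carrier A \<Longrightarrow> b \<in> carrier B \<Longrightarrow>
      tensor_map A B A' B' f g (tensor_elem A B a b) = tensor_elem A' B' (f a) (g b)"
    using h'm h'e by auto
qed

section \<open>Algebras identified with their images, and associativity of the tensor
  product\<close>

definition concrete :: "('a, 'h) rep_cstar \<Rightarrow> ('h list oper, 'h) rep_cstar" where
  "concrete A = op_subalg (deg A) (rep A ` carrier A)"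

lemma concrete_simps [simp]: "deg (concrete A) = deg A" "rep (concrete A) = (\<lambda>T. T)"
  "carrier (concrete A) = rep A ` carrier A"
  by (simp_all add: concrete_def)

lemma represented_concrete: "represented_cstar A \<Longrightarrow> represented_cstar (concrete A)"
  unfolding concrete_def by (intro represented_op_subalg rep_closed_subalg)

lemma rep_mono_concrete: "represented_cstar A \<Longrightarrow> star_mono A (concrete A) (rep A)"
  using represented_mono[of A] by (auto simp: star_mono_def star_hom_def concrete_def)

lemma concrete_mono_inv:
  assumes "represented_cstar A" shows "star_mono (concrete A) A (inv_into (carrier A) (rep A))"
proof -
  interpret A: cstar_algebra A by (rule represented_cstar_algebra[OF assms])
  have inj: "inj_on (rep A) (carrier A)" using represented_mono[OF assms] by (simp add: star_mono_def)
  note h = star_mono_hom[OF rep_mono_concrete[OF assms]]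
  have "inv_into (carrier A) (rep A) (rep A x) = x" if "x \<in> carrier A" for x
    using that inj by simp
  then show ?thesis unfolding star_mono_def star_hom_def
    by (auto simp: inj_on_def simp flip: star_hom_add[OF h] star_hom_scale[OF h] star_hom_mult[OF h] star_hom_adj[OF h])
qed

lemma tensor_elem_concrete [simp]:
  "tensor_elem (concrete A) B (rep A a) b = tensor_elem A B a b"
  "tensor_elem A (concrete B) a (rep B b) = tensor_elem A B a b"
  by (simp_all add: tensor_elem_def)

text \<open>An algebra and its image under the representation have the same elementary tensors, so
  the identification made in the base case of \<open>list_alg\<close> is invisible inside tensor
  products.\<close>

lemma tensor_concrete [simp]: "tensor (concrete A) B = tensor A B" "tensor A (concrete B) = tensor A B"
proof -
  have "tensor_gens (concrete A) B = tensor_gens A B" "tensor_gens A (concrete B) = tensor_gens A B"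
    by (force simp: tensor_gens_def tensor_elem_def)+
  then show "tensor (concrete A) B = tensor A B" "tensor A (concrete B) = tensor A B"
    by (simp_all add: tensor_eq)
qed

text \<open>The map x \<mapsto> x \<otimes> c is linear and bounded, so an inclusion known on
  generators extends to closed spans.\<close>

lemma closed_span_tensor_left:
  assumes E: "E \<subseteq> bounded_ops (words m)" and c: "c \<in> bounded_ops (words n)" and G: "G \<subseteq> bounded_ops (words (m + n))"
    and EG: "\<And>e. e \<in> E \<Longrightarrow> tensor_op m n e c \<in> closed_span (op_alg (words (m + n))) G"
    and x: "x \<in> closed_span (op_alg (words m)) E"
  shows "tensor_op m n x c \<in> closed_span (op_alg (words (m + n))) G"
proof -
  interpret O: cstar_algebra "op_alg (words (m + n)) :: 'a list oper cstar" by (rule cstar_algebra_op_alg)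
  interpret Om: cstar_algebra "op_alg (words m) :: 'a list oper cstar" by (rule cstar_algebra_op_alg)
  let ?S = "closed_span (op_alg (words (m + n))) G"
  have E': "E \<subseteq> carrier (op_alg (words m))" and G': "G \<subseteq> carrier (op_alg (words (m + n)))" using E G by auto
  obtain X where X: "\<And>k. X k \<in> lin_span (op_alg (words m)) E" "cconverges (op_alg (words m)) X x"
    using Om.closed_span_dense[OF E' x] by blast
  have b: "X k \<in> bounded_ops (words m)" for k using Om.lin_span_subset[OF E'] X(1) by auto
  have xb: "x \<in> bounded_ops (words m)" using Om.closed_span_subset_carrier[OF E'] x by auto
  have L: "tensor_op m n y c \<in> ?S" if "y \<in> lin_span (op_alg (words m)) E" for y
    using that
  proof induction
    case lin_span_zero
    have "tensor_op m n (\<lambda>f x. 0) c = (\<lambda>f x. 0)" by (auto simp: tensor_op_def)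
    then show ?case using O.closed_span_zero by simp
  next
    case (lin_span_add y z)
    then show ?case using O.closed_span_add by (simp add: tensor_op_add_left)
  next
    case (lin_span_scale y a)
    then show ?case using O.closed_span_scale by (simp add: tensor_op_scale_left)
  qed (rule EG)
  have "cconverges (op_alg (words (m + n))) (\<lambda>k. tensor_op m n (X k) c) (tensor_op m n x c)"
  proof (rule O.converges_bound)
    show "(\<lambda>k. op_norm (words m) (cdiff (op_alg (words m)) (X k) x) * op_norm (words n) c) \<longlonglongrightarrow> 0"
      using tendsto_mult_right[OF X(2)[unfolded cconverges_def], of "op_norm (words n) c"] by simp
    fix k
    have "cdiff (op_alg (words (m + n))) (tensor_op m n (X k) c) (tensor_op m n x c)
       = tensor_op m n (cdiff (op_alg (words m)) (X k) x) c"
      unfolding cdiff_op_alg tensor_op_add_left tensor_op_scale_left ..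
    moreover have "cdiff (op_alg (words m)) (X k) x \<in> bounded_ops (words m)" using Om.cdiff_closed[of "X k" x] b xb by simp
    ultimately show "op_norm (words (m + n)) (cdiff (op_alg (words (m + n))) (tensor_op m n (X k) c) (tensor_op m n x c))
       \<le> op_norm (words m) (cdiff (op_alg (words m)) (X k) x) * op_norm (words n) c"
      using tensor_op_norm_le[OF _ c] by simp
  qed (use b xb c in \<open>auto intro: tensor_op_closed\<close>)
  then show ?thesis using O.closed_span_closed[OF O.closed_span_subset_carrier[OF G'], of "\<lambda>k. tensor_op m n (X k) c"] L X(1)
    tensor_op_closed[OF xb c] by simp
qed

lemma closed_span_tensor_right:
  assumes E: "E \<subseteq> bounded_ops (words n)" and c: "c \<in> bounded_ops (words m)" and G: "G \<subseteq> bounded_ops (words (m + n))"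
    and EG: "\<And>e. e \<in> E \<Longrightarrow> tensor_op m n c e \<in> closed_span (op_alg (words (m + n))) G"
    and x: "x \<in> closed_span (op_alg (words n)) E"
  shows "tensor_op m n c x \<in> closed_span (op_alg (words (m + n))) G"
proof -
  interpret O: cstar_algebra "op_alg (words (m + n)) :: 'a list oper cstar" by (rule cstar_algebra_op_alg)
  interpret On: cstar_algebra "op_alg (words n) :: 'a list oper cstar" by (rule cstar_algebra_op_alg)
  let ?S = "closed_span (op_alg (words (m + n))) G"
  have E': "E \<subseteq> carrier (op_alg (words n))" and G': "G \<subseteq> carrier (op_alg (words (m + n)))" using E G by auto
  obtain X where X: "\<And>k. X k \<in> lin_span (op_alg (words n)) E" "cconverges (op_alg (words n)) X x"
    using On.closed_span_dense[OF E' x] by blast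
  have Lb: "y \<in> bounded_ops (words n)" if "y \<in> lin_span (op_alg (words n)) E" for y
    using On.lin_span_subset[OF E'] that by auto
  note b = Lb[OF X(1)]
  have xb: "x \<in> bounded_ops (words n)" using On.closed_span_subset_carrier[OF E'] x by auto
  have L: "tensor_op m n c y \<in> ?S" if "y \<in> lin_span (op_alg (words n)) E" for y
    using that
  proof induction
    case lin_span_zero
    have "tensor_op m n c (\<lambda>f x. 0) = (\<lambda>f x. 0)" by (auto simp: tensor_op_def op_zero[OF c])
    then show ?case using O.closed_span_zero by simp
  next
    case (lin_span_add y z)
    then show ?case using O.closed_span_add by (simp add: tensor_op_add_right[OF c] Lb)
  next
    case (lin_span_scale y a)
    then show ?case using O.closed_span_scale by (simp add: tensor_op_scale_right[OF c] Lb)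
  qed (rule EG)
  have "cconverges (op_alg (words (m + n))) (\<lambda>k. tensor_op m n c (X k)) (tensor_op m n c x)"
  proof (rule O.converges_bound)
    show "(\<lambda>k. op_norm (words m) c * op_norm (words n) (cdiff (op_alg (words n)) (X k) x)) \<longlonglongrightarrow> 0"
      using tendsto_mult_left[OF X(2)[unfolded cconverges_def], of "op_norm (words m) c"] by simp
    fix k
    have "cdiff (op_alg (words (m + n))) (tensor_op m n c (X k)) (tensor_op m n c x)
       = tensor_op m n c (cdiff (op_alg (words n)) (X k) x)"
      unfolding cdiff_op_alg tensor_op_add_right[OF c b op_scale_closed(1)[OF xb]] tensor_op_scale_right[OF c xb] ..
    moreover have "cdiff (op_alg (words n)) (X k) x \<in> bounded_ops (words n)" using On.cdiff_closed[of "X k" x] b xb by simp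
    ultimately show "op_norm (words (m + n)) (cdiff (op_alg (words (m + n))) (tensor_op m n c (X k)) (tensor_op m n c x))
       \<le> op_norm (words m) c * op_norm (words n) (cdiff (op_alg (words n)) (X k) x)"
      using tensor_op_norm_le[OF c] by simp
  qed (use b xb c in \<open>auto intro: tensor_op_closed\<close>)
  then show ?thesis using O.closed_span_closed[OF O.closed_span_subset_carrier[OF G'], of "\<lambda>k. tensor_op m n c (X k)"] L X(1)
    tensor_op_closed[OF c xb] by simp
qed

lemma tensor_elem_assoc:
  assumes "represented_cstar A" "represented_cstar B" "represented_cstar C"
    and "a \<in> carrier A" "b \<in> carrier B" "c \<in> carrier C"
  shows "tensor_elem (tensor A B) C (tensor_elem A B a b) c = tensor_elem A (tensor B C) a (tensor_elem B C b c)"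
  by (simp add: tensor_elem_def tensor_op_assoc rep_closed assms)

definition tensor_gens3 ::
  "('a, 'h) rep_cstar \<Rightarrow> ('b, 'h) rep_cstar \<Rightarrow> ('c, 'h) rep_cstar \<Rightarrow> 'h list oper set" where
  "tensor_gens3 A B C = {tensor_elem (tensor A B) C (tensor_elem A B a b) c | a b c.
     a \<in> carrier A \<and> b \<in> carrier B \<and> c \<in> carrier C}"

text \<open>Both bracketings are the closed span of the same triple tensors. The equality is literal
  because word lengths add associatively and \<open>tensor_op_assoc\<close> is an equation between
  operators.\<close>

lemma
  fixes A :: "('a, 'h) rep_cstar" and B :: "('b, 'h) rep_cstar" and C :: "('c, 'h) rep_cstar"
  assumes A: "represented_cstar A" and B: "represented_cstar B" and C: "represented_cstar C"
  shows tensor_eq3: "tensor (tensor A B) C = op_subalg (deg A + deg B + deg C)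
      (closed_span (op_alg (words (deg A + deg B + deg C))) (tensor_gens3 A B C))"
    and tensor_assoc: "tensor (tensor A B) C = tensor A (tensor B C)"
    and tensor_gens3_bounded: "tensor_gens3 A B C \<subseteq> bounded_ops (words (deg A + deg B + deg C))"
proof -
  let ?n = "deg A + deg B + deg C"
  let ?O = "op_alg (words ?n) :: 'h list oper cstar"
  interpret O: cstar_algebra ?O by (rule cstar_algebra_op_alg)
  note AB = represented_tensor[OF A B] and BC = represented_tensor[OF B C]
  have g3: "tensor_gens3 A B C \<subseteq> tensor_gens (tensor A B) C"
    using tensor_elem_closed[OF A B] by (auto simp: tensor_gens3_def tensor_gens_def)
  have g3': "tensor_gens3 A B C \<subseteq> tensor_gens A (tensor B C)"
    using tensor_elem_closed[OF B C] tensor_elem_assoc[OF A B C] by (fastforce simp: tensor_gens3_def tensor_gens_def)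
  have b: "tensor_gens (tensor A B) C \<subseteq> bounded_ops (words ?n)" using tensor_gens_bounded[OF AB C] by simp
  have b': "tensor_gens A (tensor B C) \<subseteq> bounded_ops (words ?n)" using tensor_gens_bounded[OF A BC] by (simp add: add.assoc)
  show b3: "tensor_gens3 A B C \<subseteq> bounded_ops (words ?n)" using g3 b by blast
  have "tensor_gens (tensor A B) C \<subseteq> closed_span ?O (tensor_gens3 A B C)"
  proof
    fix z assume "z \<in> tensor_gens (tensor A B) C"
    then obtain x c where z: "z = tensor_elem (tensor A B) C x c" "x \<in> carrier (tensor A B)" "c \<in> carrier C"
      by (auto simp: tensor_gens_def)
    have "tensor_op (deg A + deg B) (deg C) x (rep C c) \<in> closed_span ?O (tensor_gens3 A B C)"
      by (rule closed_span_tensor_left[OF tensor_gens_bounded[OF A B] rep_closed[OF C z(3)] b3])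
         (use z in \<open>auto simp: tensor_eq tensor_gens_def tensor_gens3_def tensor_elem_def[of "op_subalg _ _"]
            intro!: subsetD[OF O.closed_span_base]\<close>)
    then show "z \<in> closed_span ?O (tensor_gens3 A B C)" by (simp add: z tensor_elem_def)
  qed
  then have "closed_span ?O (tensor_gens (tensor A B) C) = closed_span ?O (tensor_gens3 A B C)"
    using O.closed_span_minimal[of "tensor_gens (tensor A B) C" "tensor_gens3 A B C"]
      O.closed_span_minimal[of "tensor_gens3 A B C" "tensor_gens (tensor A B) C"] b b3 g3
      O.closed_span_base[of "tensor_gens (tensor A B) C"] by auto
  then show e: "tensor (tensor A B) C = op_subalg ?n (closed_span ?O (tensor_gens3 A B C))"
    by (simp add: tensor_eq[of "tensor A B"])
  have "tensor_gens A (tensor B C) \<subseteq> closed_span ?O (tensor_gens3 A B C)"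
  proof
    fix z assume "z \<in> tensor_gens A (tensor B C)"
    then obtain x a where z: "z = tensor_elem A (tensor B C) a x" "x \<in> carrier (tensor B C)" "a \<in> carrier A"
      by (auto simp: tensor_gens_def)
    have "tensor_op (deg A) (deg B + deg C) (rep A a) x \<in> closed_span (op_alg (words (deg A + (deg B + deg C)))) (tensor_gens3 A B C)"
    proof (rule closed_span_tensor_right[OF tensor_gens_bounded[OF B C] rep_closed[OF A z(3)]])
      show "tensor_gens3 A B C \<subseteq> bounded_ops (words (deg A + (deg B + deg C)))" using b3 by (simp add: add.assoc)
      show "x \<in> closed_span (op_alg (words (deg B + deg C))) (tensor_gens B C)" using z by (simp add: tensor_eq)
      fix e assume "e \<in> tensor_gens B C"
      then obtain b c where e: "e = tensor_elem B C b c" "b \<in> carrier B" "c \<in> carrier C" by (auto simp: tensor_gens_def)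
      have "tensor_elem A (tensor B C) a e \<in> tensor_gens3 A B C"
        unfolding tensor_gens3_def e(1) using tensor_elem_assoc[OF A B C z(3) e(2,3)] z(3) e(2,3) by force
      then show "tensor_op (deg A) (deg B + deg C) (rep A a) e \<in> closed_span (op_alg (words (deg A + (deg B + deg C)))) (tensor_gens3 A B C)"
        using O.closed_span_base[of "tensor_gens3 A B C"] by (auto simp: tensor_elem_def[of A "tensor B C"] add.assoc)
    qed
    then show "z \<in> closed_span ?O (tensor_gens3 A B C)" by (simp add: z tensor_elem_def add.assoc)
  qed
  then have "closed_span ?O (tensor_gens A (tensor B C)) = closed_span ?O (tensor_gens3 A B C)"
    using O.closed_span_minimal[of "tensor_gens A (tensor B C)" "tensor_gens3 A B C"]
      O.closed_span_minimal[of "tensor_gens3 A B C" "tensor_gens A (tensor B C)"] b' b3 g3'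
      O.closed_span_base[of "tensor_gens A (tensor B C)"] by auto
  then show "tensor (tensor A B) C = tensor A (tensor B C)"
    unfolding e by (simp add: tensor_eq[of A] add.assoc)
qed

lemma tensor3_hom_unique:
  assumes A: "represented_cstar A" and B: "represented_cstar B" and C: "represented_cstar C" and M: "cstar_algebra M"
    and h: "star_hom (tensor (tensor A B) C) M h" "star_hom (tensor (tensor A B) C) M h'"
    and eq: "\<And>a b c. a \<in> carrier A \<Longrightarrow> b \<in> carrier B \<Longrightarrow> c \<in> carrier C \<Longrightarrow>
       h (tensor_elem (tensor A B) C (tensor_elem A B a b) c) = h' (tensor_elem (tensor A B) C (tensor_elem A B a b) c)"
    and x: "x \<in> carrier (tensor (tensor A B) C)"
  shows "h x = h' x"
proof -
  note T = tensor_eq3[OF A B C]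
  have eq': "h t = h' t" if "t \<in> tensor_gens3 A B C" for t
    using that eq unfolding tensor_gens3_def by blast
  have x': "x \<in> closed_span (op_alg (words (deg A + deg B + deg C))) (tensor_gens3 A B C)"
    using x by (simp add: T)
  show ?thesis
    by (rule star_hom_eq_on_span[OF tensor_gens3_bounded[OF A B C]
          represented_cstar_algebra[OF represented_tensor[OF represented_tensor[OF A B] C], unfolded T] M
          h(1)[unfolded T] h(2)[unfolded T] eq' x'])
qed

section \<open>Iterated tensor products along partitions\<close>

definition chain :: "real list \<Rightarrow> bool" where
  "chain xs \<longleftrightarrow> 2 \<le> length xs \<and> sorted_wrt (<) xs \<and> 0 < hd xs"

lemma chain_Cons: "xs \<noteq> [] \<Longrightarrow> chain (r # s # xs) \<longleftrightarrow> 0 < r \<and> r < s \<and> chain (s # xs)"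
  by (cases xs) (auto simp: chain_def)

lemma chain_pair: "chain [r, s] \<longleftrightarrow> 0 < r \<and> r < s"
  by (auto simp: chain_def)

lemma chain_not_short [simp]: "\<not> chain []" "\<not> chain [s]"
  by (auto simp: chain_def)

lemma chain_append: "chain (xs @ s # ys) \<Longrightarrow> xs \<noteq> [] \<Longrightarrow> chain (xs @ [s])"
  "chain (xs @ s # ys) \<Longrightarrow> ys \<noteq> [] \<Longrightarrow> chain (s # ys)"
  by (cases xs; auto simp: chain_def sorted_wrt_append Suc_le_eq)+

lemma chain_hd_last: "chain xs \<Longrightarrow> 0 < hd xs \<and> hd xs < last xs"
proof -
  assume c: "chain xs"
  then obtain r s ys where xs: "xs = r # s # ys"
    by (auto simp: chain_def numeral_2_eq_2 Suc_le_length_iff)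
  have "last (s # ys) \<in> set (s # ys)" by (rule last_in_set) simp
  then have "r < last (s # ys)" using c by (auto simp: chain_def xs)
  then show ?thesis using c by (simp add: chain_def xs)
qed

lemma list_alg_Cons: "ys \<noteq> [] \<Longrightarrow> list_alg A (r # s # ys) = tensor (A r s) (list_alg A (s # ys))"
  by (cases ys) auto

lemma list_unit_Cons:
  "ys \<noteq> [] \<Longrightarrow> list_unit A p (r # s # ys) = tensor_elem (A r s) (list_alg A (s # ys)) (p r s) (list_unit A p (s # ys))"
  by (cases ys) auto

lemma list_refine_Cons:
  "ys \<noteq> [] \<Longrightarrow> list_refine A \<Delta> (r # s # ys) J =
     tensor_map (A r s) (list_alg A (s # ys)) (part_alg A (J \<inter> {r..s})) (part_alg A (J \<inter> {s..last ys}))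
       (refine_top A \<Delta> (sorted_list_of_set (J \<inter> {r..s}))) (list_refine A \<Delta> (s # ys) J)"
  by (cases ys) auto

lemma list_alg_pair: "list_alg A [s, t] = concrete (A s t)"
  by (simp add: concrete_def)

lemma star_mono_id: "cstar_algebra A \<Longrightarrow> star_mono A A (\<lambda>x. x)"
  by (simp add: star_mono_def star_hom_def)

lemma partitionsD:
  assumes "I \<in> partitions s t"
  shows "finite I" "s \<in> I" "t \<in> I" "I \<subseteq> {s..t}" "s \<le> t" "Min I = s" "Max I = t"
  using assms by (auto simp: partitions_def intro!: Min_eqI Max_eqI dest: subsetD)

lemma partitions_Int: "finite K \<Longrightarrow> s \<in> K \<Longrightarrow> t \<in> K \<Longrightarrow> s \<le> t \<Longrightarrow> K \<inter> {s..t} \<in> partitions s t"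
  by (auto simp: partitions_def)

lemma partitions_Un: "I \<in> partitions r s \<Longrightarrow> J \<in> partitions s t \<Longrightarrow> I \<union> J \<in> partitions r t"
  by (fastforce simp: partitions_def)

lemma partitions_Un_Int:
  assumes I: "I \<in> partitions r s" and J: "J \<in> partitions s t"
  shows "(I \<union> J) \<inter> {r..s} = I" "(I \<union> J) \<inter> {s..t} = J"
proof -
  have sI: "r \<le> x" "x \<le> s" if "x \<in> I" for x using subsetD[OF partitionsD(4)[OF I] that] by simp_all
  have sJ: "s \<le> x" "x \<le> t" if "x \<in> J" for x using subsetD[OF partitionsD(4)[OF J] that] by simp_all
  have J1: "x \<in> I" if "x \<in> J" "x \<le> s" for x
    using order.antisym[OF that(2) sJ(1)[OF that(1)]] partitionsD(3)[OF I] by simp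
  have I1: "x \<in> J" if "x \<in> I" "s \<le> x" for x
    using order.antisym[OF sI(2)[OF that(1)] that(2)] partitionsD(2)[OF J] by simp
  have "x \<in> (I \<union> J) \<inter> {r..s} \<longleftrightarrow> x \<in> I" for x
    using sI[of x] J1[of x] by (cases "x \<in> I") auto
  then show "(I \<union> J) \<inter> {r..s} = I" by (rule set_eqI)
  have "x \<in> (I \<union> J) \<inter> {s..t} \<longleftrightarrow> x \<in> J" for x
    using sJ[of x] I1[of x] by (cases "x \<in> J") auto
  then show "(I \<union> J) \<inter> {s..t} = J" by (rule set_eqI)
qed

lemma sorted_list_partition:
  assumes "I \<in> partitions s t" "s < t"
  shows "hd (sorted_list_of_set I) = s" "last (sorted_list_of_set I) = t"
    "sorted_wrt (<) (sorted_list_of_set I)" "2 \<le> length (sorted_list_of_set I)" "set (sorted_list_of_set I) = I"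
proof -
  note I = partitionsD[OF assms(1)]
  have ne: "sorted_list_of_set I \<noteq> []" "I \<noteq> {}" using I by auto
  show set: "set (sorted_list_of_set I) = I" using I by simp
  show srt: "sorted_wrt (<) (sorted_list_of_set I)" by (rule strict_sorted_list_of_set)
  show "hd (sorted_list_of_set I) = s"
    using I ne by (simp add: sorted_list_of_set_nonempty)
  have "{s, t} \<subseteq> I" "card {s, t} = 2" using I assms(2) by auto
  then have "2 \<le> card I" using card_mono[OF I(1), of "{s, t}"] by simp
  then show "2 \<le> length (sorted_list_of_set I)" by simp
  have "last (sorted_list_of_set I) \<in> I" using last_in_set[OF ne(1)] set by simp
  moreover have "x \<le> last (sorted_list_of_set I)" if xI: "x \<in> I" for x
  proof -
    obtain k where k: "k < length (sorted_list_of_set I)" "x = sorted_list_of_set I ! k"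
      using xI in_set_conv_nth[of x "sorted_list_of_set I"] set by auto
    then show ?thesis using sorted_nth_mono[OF sorted_sorted_list_of_set[of I], of k "length (sorted_list_of_set I) - 1"] ne
      by (simp add: last_conv_nth)
  qed
  ultimately have "Max I = last (sorted_list_of_set I)" using I(1) by (intro Max_eqI)
  then show "last (sorted_list_of_set I) = t" using I by simp
qed

lemma chain_partition: "I \<in> partitions s t \<Longrightarrow> 0 < s \<Longrightarrow> s < t \<Longrightarrow> chain (sorted_list_of_set I)"
  using sorted_list_partition[of I s t] by (auto simp: chain_def)

lemma sorted_list_split:
  assumes I: "I \<in> partitions r s" and J: "J \<in> partitions s t" and rst: "r < s" "s < t"
  obtains us ys where "sorted_list_of_set I = us @ [s]" "sorted_list_of_set J = s # ys"
    "sorted_list_of_set (I \<union> J) = us @ s # ys" "us \<noteq> []" "ys \<noteq> []"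
proof -
  define us where "us = butlast (sorted_list_of_set I)"
  define ys where "ys = tl (sorted_list_of_set J)"
  have neI: "sorted_list_of_set I \<noteq> []" and neJ: "sorted_list_of_set J \<noteq> []"
    using sorted_list_partition(4)[OF I rst(1)] sorted_list_partition(4)[OF J rst(2)] by (metis list.size(3) not_numeral_le_zero)+
  have 1: "sorted_list_of_set I = us @ [s]"
    using append_butlast_last_id[OF neI] sorted_list_partition(2)[OF I rst(1)] by (simp add: us_def)
  have 2: "sorted_list_of_set J = s # ys"
    using neJ sorted_list_partition(1)[OF J rst(2)] by (cases "sorted_list_of_set J") (auto simp: ys_def)
  have "sorted_wrt (<) (us @ s # ys)"
    using sorted_list_partition(3)[OF I rst(1)] sorted_list_partition(3)[OF J rst(2)] unfolding 1 2
    by (fastforce simp: sorted_wrt_append)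
  moreover have "set (us @ s # ys) = I \<union> J"
    using sorted_list_partition(5)[OF I rst(1)] sorted_list_partition(5)[OF J rst(2)] unfolding 1 2 by auto
  ultimately have 3: "sorted_list_of_set (I \<union> J) = us @ s # ys"
    by (metis sorted_list_of_set.idem_if_sorted_distinct strict_sorted_iff)
  have "us \<noteq> []" "ys \<noteq> []" using sorted_list_partition(4)[OF I rst(1)] sorted_list_partition(4)[OF J rst(2)] unfolding 1 2 by auto
  with 1 2 3 show ?thesis using that by blast
qed

lemma chain_induct [consumes 1, case_names pair Cons]:
  assumes "chain xs" and "\<And>r s. 0 < r \<Longrightarrow> r < s \<Longrightarrow> P [r, s]"
    and "\<And>r s ys. 0 < r \<Longrightarrow> r < s \<Longrightarrow> chain (s # ys) \<Longrightarrow> ys \<noteq> [] \<Longrightarrow> P (s # ys) \<Longrightarrow> P (r # s # ys)"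
  shows "P xs"
  using assms(1)
proof (induction xs)
  case (Cons r xs)
  then obtain s ys where xs: "xs = s # ys" by (cases xs) auto
  show ?case using Cons assms(2,3) by (cases "ys = []") (auto simp: xs chain_Cons chain_pair)
qed simp

section \<open>Refinement maps of a subproduct system\<close>

locale subproduct_system =
  fixes A :: "('a, 'h) alg_family" and \<Delta> :: "('a, 'h) comult_family"
  assumes sys: "cstar_subproduct_system A \<Delta>"
begin

lemma rep_A: "0 < s \<Longrightarrow> s < t \<Longrightarrow> represented_cstar (A s t)"
  using sys by (simp add: cstar_subproduct_system_def)

lemma \<Delta>_mono: "0 < r \<Longrightarrow> r < s \<Longrightarrow> s < t \<Longrightarrow> star_mono (A r t) (tensor (A r s) (A s t)) (\<Delta> r s t)"
  using sys by (simp add: cstar_subproduct_system_def)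

lemma list_alg_represented: "chain xs \<Longrightarrow> represented_cstar (list_alg A xs) \<and> rep (list_alg A xs) = (\<lambda>T. T)"
proof (induction xs rule: chain_induct)
  case (pair r s)
  then show ?case using represented_concrete[OF rep_A] by (simp add: list_alg_pair del: list_alg.simps)
next
  case (Cons r s ys)
  then show ?case using represented_tensor[OF rep_A[OF Cons.hyps(1,2)] conjunct1[OF Cons.IH]] by (simp add: list_alg_Cons)
qed

lemma list_alg_rep: "chain xs \<Longrightarrow> represented_cstar (list_alg A xs)"
  using list_alg_represented by blast

text \<open>\<open>list_alg\<close> splits off the first interval; associativity of the tensor
  product permits a cut at any interior point, which then belongs to both pieces.\<close>

lemma list_alg_append:
  "chain (xs @ s # ys) \<Longrightarrow> xs \<noteq> [] \<Longrightarrow> ys \<noteq> [] \<Longrightarrow>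
   list_alg A (xs @ s # ys) = tensor (list_alg A (xs @ [s])) (list_alg A (s # ys))"
proof (induction xs)
  case (Cons r xs)
  show ?case
  proof (cases xs)
    case Nil
    then show ?thesis using Cons.prems by (simp add: list_alg_Cons list_alg_pair del: list_alg.simps)
  next
    case xs: (Cons r' xs')
    have c: "chain (r' # xs' @ s # ys)" "0 < r" "r < r'" using Cons.prems by (auto simp: xs chain_Cons)
    have c': "chain (r' # xs' @ [s])" "chain (s # ys)" using chain_append[of "r' # xs'" s ys] c Cons.prems by auto
    have "list_alg A (r' # xs' @ s # ys) = tensor (list_alg A (r' # xs' @ [s])) (list_alg A (s # ys))"
      using Cons.IH c Cons.prems xs by simp
    then show ?thesis
      using tensor_assoc[OF rep_A[OF c(2,3)] list_alg_rep[OF c'(1)] list_alg_rep[OF c'(2)]]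
      by (simp add: xs list_alg_Cons)
  qed
qed simp

lemma part_alg_Un:
  assumes "I \<in> partitions r s" "J \<in> partitions s t" "0 < r" "r < s" "s < t"
  shows "part_alg A (I \<union> J) = tensor (part_alg A I) (part_alg A J)"
proof -
  obtain us ys where u: "sorted_list_of_set I = us @ [s]" "sorted_list_of_set J = s # ys"
    "sorted_list_of_set (I \<union> J) = us @ s # ys" "us \<noteq> []" "ys \<noteq> []"
    using sorted_list_split[OF assms(1,2,4,5)] .
  have "chain (us @ s # ys)"
    using chain_partition[OF partitions_Un[OF assms(1,2)]] assms by (simp flip: u(3))
  then show ?thesis using list_alg_append u by (simp add: part_alg_def)
qed

lemma part_alg_rep: "I \<in> partitions s t \<Longrightarrow> 0 < s \<Longrightarrow> s < t \<Longrightarrow> represented_cstar (part_alg A I)"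
  unfolding part_alg_def by (intro list_alg_rep chain_partition)

lemma refine_top_pair: "refine_top A \<Delta> [s, t] = rep (A s t)"
  by (simp add: refine_top.simps)

lemma refine_top_triple: "refine_top A \<Delta> [r, s, t] = \<Delta> r s t"
  by (simp add: refine_top.simps numeral_2_eq_2 numeral_3_eq_3)

lemma refine_top_snoc:
  "3 \<le> length ys \<Longrightarrow> refine_top A \<Delta> (ys @ [t]) = (\<lambda>a. tensor_map (A (hd ys) (last ys)) (A (last ys) t) (list_alg A ys)
     (A (last ys) t) (refine_top A \<Delta> ys) (\<lambda>x. x) (\<Delta> (hd ys) (last ys) t a))"
  by (subst refine_top.simps) (auto simp: Let_def hd_append)

text \<open>\<open>refine_top\<close> peels off the last point whereas \<open>list_alg\<close> peels
  off the first. The cases are the branches of \<open>refine_top\<close>, each with the facts that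
  reassemble \<open>list_alg\<close> from the right.\<close>

lemma chain_snoc_cases:
  assumes "chain (ys @ [t])"
  obtains (pair) s where "ys = [s]" "0 < s" "s < t"
    | (triple) r s where "ys = [r, s]" "0 < r" "r < s" "s < t"
    | (long) us r where "ys = us @ [r]" "3 \<le> length ys" "us \<noteq> []" "chain ys" "0 < r" "r < t" "hd ys < r" "0 < hd ys" "chain (us @ r # [t])"
proof -
  have len: "1 \<le> length ys" using assms by (auto simp: chain_def)
  consider "length ys = 1" | "length ys = 2" | "3 \<le> length ys" using len by linarith
  then show thesis
  proof cases
    case 1
    then obtain s where "ys = [s]" by (auto simp: length_Suc_conv)
    then show thesis using pair assms by (auto simp: chain_def)
  next
    case 2
    then obtain r s where "ys = [r, s]" by (auto simp: length_Suc_conv numeral_2_eq_2)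
    then show thesis using triple assms by (auto simp: chain_def)
  next
    case 3
    then have "ys \<noteq> []" by auto
    then obtain us r where ys: "ys = us @ [r]" by (metis rev_exhaust)
    have us: "us \<noteq> []" using 3 ys by auto
    have c: "chain (us @ r # [t])" using assms ys by simp
    have cy: "chain ys" using chain_append(1)[OF c us] ys by simp
    have "hd ys < r" "0 < hd ys" using chain_hd_last[OF cy] ys by auto
    moreover have "r < t" using chain_append(2)[OF c] by (simp add: chain_pair)
    ultimately show thesis using long[OF ys 3 us cy] c by simp
  qed
qed

lemma refine_top_mono: "chain zs \<Longrightarrow> star_mono (A (hd zs) (last zs)) (list_alg A zs) (refine_top A \<Delta> zs)"
proof (induction zs rule: rev_induct)
  case (snoc t ys)
  from snoc.prems show ?case
  proof (cases rule: chain_snoc_cases)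
    case (pair s)
    then show ?thesis using rep_mono_concrete[OF rep_A] by (simp add: refine_top_pair list_alg_pair del: list_alg.simps)
  next
    case (triple r s)
    then show ?thesis using \<Delta>_mono by (simp add: refine_top_triple list_alg_Cons list_alg_pair del: list_alg.simps)
  next
    case (long us r)
    have l: "last ys = r" using long by simp
    have "star_mono (tensor (A (hd ys) r) (A r t)) (tensor (list_alg A ys) (A r t))
       (tensor_map (A (hd ys) r) (A r t) (list_alg A ys) (A r t) (refine_top A \<Delta> ys) (\<lambda>x. x))"
      using snoc.IH[OF long(4)] l long rep_A[of "hd ys" r] rep_A[of r t] list_alg_rep[OF long(4)]
      by (intro tensor_map_mono(1) star_mono_id represented_cstar_algebra) auto
    from star_mono_comp[OF \<Delta>_mono[OF long(8,7,6)] this]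
    have "star_mono (A (hd ys) t) (tensor (list_alg A ys) (A r t)) (refine_top A \<Delta> (ys @ [t]))"
      unfolding refine_top_snoc[OF long(2)] l .
    moreover have "list_alg A (ys @ [t]) = tensor (list_alg A ys) (A r t)"
      using list_alg_append[OF long(9) long(3)] long(1) by (simp add: list_alg_pair del: list_alg.simps)
    ultimately show ?thesis using long by (simp add: hd_append)
  qed
qed simp

lemma list_refine_pair: "list_refine A \<Delta> [s, t] K =
   (\<lambda>x. refine_top A \<Delta> (sorted_list_of_set (K \<inter> {s..t})) (inv_into (carrier (A s t)) (rep (A s t)) x))"
  by simp

lemma Int_interval_Un: "r \<le> s \<Longrightarrow> s \<le> (t::real) \<Longrightarrow> K \<inter> {r..s} \<union> K \<inter> {s..t} = K \<inter> {r..t}"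
  by auto

lemma part_alg_interval_Un:
  assumes "finite K" "r \<in> K" "s \<in> K" "t \<in> K" "0 < r" "r < s" "s < t"
  shows "part_alg A (K \<inter> {r..t}) = tensor (part_alg A (K \<inter> {r..s})) (part_alg A (K \<inter> {s..t}))"
  using part_alg_Un[OF partitions_Int[of K r s] partitions_Int[of K s t]] assms Int_interval_Un[of r s t K] by simp

lemma part_alg_interval_rep:
  "finite K \<Longrightarrow> r \<in> K \<Longrightarrow> s \<in> K \<Longrightarrow> 0 < r \<Longrightarrow> r < s \<Longrightarrow> represented_cstar (part_alg A (K \<inter> {r..s}))"
  using part_alg_rep[OF partitions_Int[of K r s]] by simp

lemma refine_top_interval:
  assumes "finite K" "r \<in> K" "s \<in> K" "0 < r" "r < s"
  shows "star_mono (A r s) (part_alg A (K \<inter> {r..s})) (refine_top A \<Delta> (sorted_list_of_set (K \<inter> {r..s})))"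
proof -
  have I: "K \<inter> {r..s} \<in> partitions r s" using assms by (intro partitions_Int) auto
  show ?thesis using refine_top_mono[OF chain_partition[OF I]] assms sorted_list_partition[OF I]
    by (simp add: part_alg_def)
qed

lemma list_refine_mono:
  "chain xs \<Longrightarrow> finite K \<Longrightarrow> set xs \<subseteq> K \<Longrightarrow>
   star_mono (list_alg A xs) (part_alg A (K \<inter> {hd xs..last xs})) (list_refine A \<Delta> xs K)"
proof (induction xs rule: chain_induct)
  case (pair r s)
  then show ?case using star_mono_comp[OF concrete_mono_inv[OF rep_A] refine_top_interval[of K r s]]
    by (simp add: list_refine_pair list_alg_pair del: list_alg.simps list_refine.simps)
next
  case (Cons r s ys)
  have l: "s < last ys" "last ys \<in> K" "0 < s"
    using chain_hd_last[OF Cons.hyps(3)] Cons.hyps Cons.prems by (auto simp: subset_eq)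
  have K: "finite K" "r \<in> K" "s \<in> K" using Cons.prems by auto
  have IH: "star_mono (list_alg A (s # ys)) (part_alg A (K \<inter> {s..last ys})) (list_refine A \<Delta> (s # ys) K)"
    using Cons.IH Cons.prems Cons.hyps by simp
  have "star_mono (tensor (A r s) (list_alg A (s # ys))) (tensor (part_alg A (K \<inter> {r..s})) (part_alg A (K \<inter> {s..last ys})))
     (list_refine A \<Delta> (r # s # ys) K)"
    unfolding list_refine_Cons[OF Cons.hyps(4)]
    by (rule tensor_map_mono(1)[OF rep_A[OF Cons.hyps(1,2)] list_alg_rep[OF Cons.hyps(3)]
          part_alg_interval_rep[OF K Cons.hyps(1,2)] part_alg_interval_rep[OF K(1,3) l(2,3,1)]
          refine_top_interval[OF K Cons.hyps(1,2)] IH])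
  moreover have "part_alg A (K \<inter> {hd (r # s # ys)..last (r # s # ys)}) = tensor (part_alg A (K \<inter> {r..s})) (part_alg A (K \<inter> {s..last ys}))"
    using part_alg_interval_Un[OF K l(2) Cons.hyps(1,2) l(1)] Cons.hyps(4) by simp
  ultimately show ?case by (simp only: list_alg_Cons[OF Cons.hyps(4)])
qed

text \<open>Only points between the ends of the chain are looked at. A union of partitions of
  adjacent intervals can therefore be replaced by either of them on its own side.\<close>

lemma list_refine_cong:
  "chain xs \<Longrightarrow> K \<inter> {hd xs..last xs} = K' \<inter> {hd xs..last xs} \<Longrightarrow> list_refine A \<Delta> xs K = list_refine A \<Delta> xs K'"
proof (induction xs rule: chain_induct)
  case (Cons r s ys)
  have l: "s < last ys" using chain_hd_last[OF Cons.hyps(3)] Cons.hyps by simp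
  have eq: "K \<inter> {r..last ys} = K' \<inter> {r..last ys}" using Cons.prems Cons.hyps(4) by simp
  have "K \<inter> {a..b} = K' \<inter> {a..b}" if "r \<le> a" "b \<le> last ys" for a b
  proof -
    have sub: "{a..b} = {r..last ys} \<inter> {a..b}" using that by auto
    show ?thesis by (subst (1 2) sub) (simp only: Int_assoc[symmetric] eq)
  qed
  then have "K \<inter> {r..s} = K' \<inter> {r..s}" "K \<inter> {s..last ys} = K' \<inter> {s..last ys}"
    using Cons.hyps(2) l by simp_all
  moreover from this have "list_refine A \<Delta> (s # ys) K = list_refine A \<Delta> (s # ys) K'"
    using Cons.IH Cons.hyps(4) by simp
  ultimately show ?case by (simp only: list_refine_Cons[OF Cons.hyps(4)])
qed (simp add: list_refine_pair del: list_refine.simps)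

text \<open>\<open>list_refine\<close> is defined by splitting off the first interval; here it is
  cut at an arbitrary point. Both sides are *-homomorphisms, so they are compared on elementary
  tensors: with two factors if \<open>xs\<close> is a single point, otherwise with three, where
  associativity applies.\<close>

lemma list_refine_append:
  assumes "chain (xs @ s # ys)" "xs \<noteq> []" "ys \<noteq> []" "finite K" "set (xs @ s # ys) \<subseteq> K" "z \<in> carrier (list_alg A (xs @ s # ys))"
  shows "list_refine A \<Delta> (xs @ s # ys) K z = tensor_map (list_alg A (xs @ [s])) (list_alg A (s # ys))
     (part_alg A (K \<inter> {hd xs..s})) (part_alg A (K \<inter> {s..last ys}))
     (list_refine A \<Delta> (xs @ [s]) K) (list_refine A \<Delta> (s # ys) K) z"
  using assms
proof (induction xs arbitrary: z)
  case (Cons r xs)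
  let ?Y = "list_alg A (s # ys)" and ?Q = "part_alg A (K \<inter> {s..last ys})"
  have cY: "chain (s # ys)" using chain_append(2)[OF Cons.prems(1)] Cons.prems by simp
  have cX: "chain (r # xs @ [s])" using chain_append(1)[OF Cons.prems(1)] by simp
  have l: "s < last ys" "last ys \<in> K" "s \<in> K" "0 < s" "r \<in> K" "r < s" "0 < r"
    using chain_hd_last[OF cY] chain_hd_last[OF cX] Cons.prems by (auto simp: subset_eq)
  note K = Cons.prems(4)
  have Y: "represented_cstar ?Y" by (rule list_alg_rep[OF cY])
  have Q: "represented_cstar ?Q" using K l by (intro part_alg_interval_rep) auto
  have rY: "star_mono ?Y ?Q (list_refine A \<Delta> (s # ys) K)"
    using list_refine_mono[OF cY K] Cons.prems by simp
  let ?P = "part_alg A (K \<inter> {r..s})"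
  have P: "represented_cstar ?P" using K l by (intro part_alg_interval_rep) auto
  have whole: "part_alg A (K \<inter> {r..last ys}) = tensor ?P ?Q" using K l by (intro part_alg_interval_Un) auto
  have lhs: "star_mono (list_alg A (r # xs @ s # ys)) (tensor ?P ?Q) (list_refine A \<Delta> (r # xs @ s # ys) K)"
    using list_refine_mono[OF Cons.prems(1) K Cons.prems(5)] Cons.prems(3) whole by simp
  have rX: "star_mono (list_alg A (r # xs @ [s])) ?P (list_refine A \<Delta> (r # xs @ [s]) K)"
    using list_refine_mono[OF cX K] Cons.prems by simp
  have alg: "list_alg A (r # xs @ s # ys) = tensor (list_alg A (r # xs @ [s])) ?Y"
    using list_alg_append[OF Cons.prems(1-3)] by simp
  note tm = tensor_map_mono[OF list_alg_rep[OF cX] Y P Q rX rY]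
  have M: "cstar_algebra (tensor ?P ?Q)" by (rule represented_cstar_algebra[OF represented_tensor[OF P Q]])
  show ?case
  proof (cases xs)
    case Nil
    \<comment> \<open>The left algebra is the concrete image of \<open>A r s\<close> and has the
      same tensor products; on elementary tensors the inverse of the representation inside
      \<open>list_refine\<close> cancels.\<close>
    have A': "represented_cstar (A r s)" using l by (intro rep_A)
    have X: "list_alg A (r # xs @ [s]) = concrete (A r s)" by (simp add: Nil list_alg_pair del: list_alg.simps)
    have inv: "inv_into (carrier (A r s)) (rep (A r s)) (rep (A r s) a) = a" if "a \<in> carrier (A r s)" for a
      using represented_mono[OF A'] that by (simp add: star_mono_def)
    have "list_refine A \<Delta> (r # s # ys) K z = tensor_map (list_alg A (r # xs @ [s])) ?Y ?P ?Q
       (list_refine A \<Delta> (r # xs @ [s]) K) (list_refine A \<Delta> (s # ys) K) z"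
    proof (rule tensor_hom_unique[OF A' Y M, where h = "list_refine A \<Delta> (r # s # ys) K" and x = z
          and h' = "tensor_map (list_alg A (r # xs @ [s])) ?Y ?P ?Q (list_refine A \<Delta> (r # xs @ [s]) K) (list_refine A \<Delta> (s # ys) K)"])
      show "star_hom (tensor (A r s) ?Y) (tensor ?P ?Q) (list_refine A \<Delta> (r # s # ys) K)"
        using star_mono_hom[OF lhs] Cons.prems(3) by (simp add: Nil list_alg_Cons)
      show "star_hom (tensor (A r s) ?Y) (tensor ?P ?Q) (tensor_map (list_alg A (r # xs @ [s])) ?Y ?P ?Q
          (list_refine A \<Delta> (r # xs @ [s]) K) (list_refine A \<Delta> (s # ys) K))"
        using star_mono_hom[OF tm(1)] by (simp add: X)
      show "z \<in> carrier (tensor (A r s) ?Y)" using Cons.prems(6) alg X by simp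
      fix a y assume a: "a \<in> carrier (A r s)" and y: "y \<in> carrier ?Y"
      have "list_refine A \<Delta> (r # s # ys) K (tensor_elem (A r s) ?Y a y) =
         tensor_elem ?P ?Q (refine_top A \<Delta> (sorted_list_of_set (K \<inter> {r..s})) a) (list_refine A \<Delta> (s # ys) K y)"
        unfolding list_refine_Cons[OF Cons.prems(3)]
        by (rule tensor_map_mono(2)[OF A' Y P Q refine_top_interval rY a y]) (use K l in auto)
      moreover have "rep (A r s) a \<in> carrier (list_alg A (r # xs @ [s]))" unfolding X using a by simp
      from tm(2)[OF this y] have "tensor_map (list_alg A (r # xs @ [s])) ?Y ?P ?Q
          (list_refine A \<Delta> (r # xs @ [s]) K) (list_refine A \<Delta> (s # ys) K) (tensor_elem (A r s) ?Y a y) =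
          tensor_elem ?P ?Q (refine_top A \<Delta> (sorted_list_of_set (K \<inter> {r..s})) a) (list_refine A \<Delta> (s # ys) K y)"
        unfolding X tensor_elem_concrete by (simp add: Nil inv[OF a])
      ultimately show "list_refine A \<Delta> (r # s # ys) K (tensor_elem (A r s) ?Y a y) =
         tensor_map (list_alg A (r # xs @ [s])) ?Y ?P ?Q
          (list_refine A \<Delta> (r # xs @ [s]) K) (list_refine A \<Delta> (s # ys) K) (tensor_elem (A r s) ?Y a y)" by simp
    qed
    then show ?thesis by (simp add: Nil)
  next
    case xs: (Cons r' xs')
    let ?X = "list_alg A (r' # xs' @ [s])" and ?P1 = "part_alg A (K \<inter> {r..r'})" and ?P2 = "part_alg A (K \<inter> {r'..s})"
    have c: "chain (r' # xs' @ s # ys)" "0 < r" "r < r'" using Cons.prems by (auto simp: xs chain_Cons)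
    have cX': "chain (r' # xs' @ [s])" using chain_append(1)[of "r' # xs'" s ys] c Cons.prems by auto
    have l': "r' \<in> K" "0 < r'" "r' < s" using chain_hd_last[OF cX'] Cons.prems by (auto simp: xs)
    have A': "represented_cstar (A r r')" using c by (intro rep_A)
    have X: "represented_cstar ?X" by (rule list_alg_rep[OF cX'])
    have P1: "represented_cstar ?P1" and P2: "represented_cstar ?P2" using K l l' c by (auto intro: part_alg_interval_rep)
    have P12: "?P = tensor ?P1 ?P2" using K l l' c by (intro part_alg_interval_Un) auto
    have P2Q: "part_alg A (K \<inter> {r'..last ys}) = tensor ?P2 ?Q" using K l l' c by (intro part_alg_interval_Un) auto
    have rA: "star_mono (A r r') ?P1 (refine_top A \<Delta> (sorted_list_of_set (K \<inter> {r..r'})))"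
      using K l l' c by (intro refine_top_interval) auto
    have rX': "star_mono ?X ?P2 (list_refine A \<Delta> (r' # xs' @ [s]) K)"
      using list_refine_mono[OF cX' K] Cons.prems by (simp add: xs)
    have algX: "list_alg A (r # xs @ [s]) = tensor (A r r') ?X" by (simp add: xs list_alg_Cons)
    have algXY: "list_alg A (r' # xs' @ s # ys) = tensor ?X ?Y" using list_alg_append[of "r' # xs'" s ys] c Cons.prems by simp
    have rXY: "star_mono (tensor ?X ?Y) (tensor ?P2 ?Q) (list_refine A \<Delta> (r' # xs' @ s # ys) K)"
      using list_refine_mono[OF c(1) K] Cons.prems by (simp add: xs algXY P2Q)
    show ?thesis
      unfolding append_Cons
    proof (rule tensor3_hom_unique[OF A' X Y M, where h = "list_refine A \<Delta> (r # xs @ s # ys) K" and x = z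
          and h' = "tensor_map (list_alg A (r # xs @ [s])) ?Y (part_alg A (K \<inter> {hd (r # xs)..s})) ?Q
            (list_refine A \<Delta> (r # xs @ [s]) K) (list_refine A \<Delta> (s # ys) K)"])
      show "star_hom (tensor (tensor (A r r') ?X) ?Y) (tensor ?P ?Q) (list_refine A \<Delta> (r # xs @ s # ys) K)"
        using star_mono_hom[OF lhs] by (simp add: alg algX)
      show "star_hom (tensor (tensor (A r r') ?X) ?Y) (tensor ?P ?Q) (tensor_map (list_alg A (r # xs @ [s])) ?Y
          (part_alg A (K \<inter> {hd (r # xs)..s})) ?Q (list_refine A \<Delta> (r # xs @ [s]) K) (list_refine A \<Delta> (s # ys) K))"
        using star_mono_hom[OF tm(1)] by (simp add: algX)
      show "z \<in> carrier (tensor (tensor (A r r') ?X) ?Y)" using Cons.prems(6) by (simp add: alg algX)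
      fix a x y assume a: "a \<in> carrier (A r r')" and x: "x \<in> carrier ?X" and y: "y \<in> carrier ?Y"
      let ?a = "refine_top A \<Delta> (sorted_list_of_set (K \<inter> {r..r'})) a" and ?x = "list_refine A \<Delta> (r' # xs' @ [s]) K x"
        and ?y = "list_refine A \<Delta> (s # ys) K y"
      have mem: "?a \<in> carrier ?P1" "?x \<in> carrier ?P2" "?y \<in> carrier ?Q"
        using star_hom_closed[OF star_mono_hom[OF rA] a] star_hom_closed[OF star_mono_hom[OF rX'] x]
          star_hom_closed[OF star_mono_hom[OF rY] y] by auto
      have xy: "tensor_elem ?X ?Y x y \<in> carrier (tensor ?X ?Y)" by (rule tensor_elem_closed[OF X Y x y])
      have IH: "list_refine A \<Delta> (r' # xs' @ s # ys) K (tensor_elem ?X ?Y x y) = tensor_elem ?P2 ?Q ?x ?y"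
        using Cons.IH[of "tensor_elem ?X ?Y x y"] c Cons.prems xy tensor_map_mono(2)[OF X Y P2 Q rX' rY x y]
        by (simp add: xs algXY)
      \<comment> \<open>Rebracket, split off the first interval, apply the induction hypothesis to
        the remaining two factors, and bracket back.\<close>
      have "list_refine A \<Delta> (r # xs @ s # ys) K (tensor_elem (tensor (A r r') ?X) ?Y (tensor_elem (A r r') ?X a x) y)
         = list_refine A \<Delta> (r # r' # xs' @ s # ys) K (tensor_elem (A r r') (tensor ?X ?Y) a (tensor_elem ?X ?Y x y))"
        using tensor_elem_assoc[OF A' X Y a x y] by (simp add: xs)
      also have "\<dots> = tensor_elem ?P1 (tensor ?P2 ?Q) ?a (tensor_elem ?P2 ?Q ?x ?y)"
        using tensor_map_mono(2)[OF A' represented_tensor[OF X Y] P1 represented_tensor[OF P2 Q] rA rXY a xy] IH Cons.prems(3)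
        by (simp add: list_refine_Cons algXY P2Q)
      also have "\<dots> = tensor_elem ?P ?Q (tensor_elem ?P1 ?P2 ?a ?x) ?y"
        using tensor_elem_assoc[OF P1 P2 Q mem] by (simp add: P12)
      also have "tensor_elem ?P1 ?P2 ?a ?x = list_refine A \<Delta> (r # xs @ [s]) K (tensor_elem (A r r') ?X a x)"
        using tensor_map_mono(2)[OF A' X P1 P2 rA rX' a x] by (simp add: xs list_refine_Cons)
      also have "tensor_elem ?P ?Q \<dots> ?y = tensor_map (list_alg A (r # xs @ [s])) ?Y ?P ?Q (list_refine A \<Delta> (r # xs @ [s]) K)
          (list_refine A \<Delta> (s # ys) K) (tensor_elem (tensor (A r r') ?X) ?Y (tensor_elem (A r r') ?X a x) y)"
        using tm(2)[of "tensor_elem (A r r') ?X a x" y] y tensor_elem_closed[OF A' X a x] by (simp add: algX)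
      finally show "list_refine A \<Delta> (r # xs @ s # ys) K (tensor_elem (tensor (A r r') ?X) ?Y (tensor_elem (A r r') ?X a x) y) =
        tensor_map (list_alg A (r # xs @ [s])) ?Y (part_alg A (K \<inter> {hd (r # xs)..s})) ?Q (list_refine A \<Delta> (r # xs @ [s]) K)
          (list_refine A \<Delta> (s # ys) K) (tensor_elem (tensor (A r r') ?X) ?Y (tensor_elem (A r r') ?X a x) y)" by simp
    qed
  qed
qed simp

lemma refine_mono:
  assumes "I \<in> partitions s t" "J \<in> partitions s t" "I \<subseteq> J" "0 < s" "s < t"
  shows "star_mono (part_alg A I) (part_alg A J) (refine A \<Delta> I J)"
proof -
  have "J \<inter> {s..t} = J" using partitionsD[OF assms(2)] by auto
  then show ?thesis
    using list_refine_mono[OF chain_partition[OF assms(1,4,5)], of J] sorted_list_partition[OF assms(1,5)] assms(3)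
      partitionsD(1)[OF assms(2)]
    by (simp add: refine_def part_alg_def)
qed

text \<open>The point \<open>s\<close> belongs to all four partitions, so refinement to its left and
  refinement to its right do not interact.\<close>

lemma refine_Un:
  assumes I: "I \<in> partitions r s" "I' \<in> partitions r s" "I \<subseteq> I'" and J: "J \<in> partitions s t" "J' \<in> partitions s t" "J \<subseteq> J'"
    and rst: "0 < r" "r < s" "s < t" and x: "x \<in> carrier (part_alg A (I \<union> J))"
  shows "refine A \<Delta> (I \<union> J) (I' \<union> J') x =
    tensor_map (part_alg A I) (part_alg A J) (part_alg A I') (part_alg A J') (refine A \<Delta> I I') (refine A \<Delta> J J') x"
proof -
  obtain us ys where u: "sorted_list_of_set I = us @ [s]" "sorted_list_of_set J = s # ys"
    "sorted_list_of_set (I \<union> J) = us @ s # ys" "us \<noteq> []" "ys \<noteq> []"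
    using sorted_list_split[OF I(1) J(1) rst(2,3)] .
  have c: "chain (us @ s # ys)"
    using chain_partition[OF partitions_Un[OF I(1) J(1)]] rst by (simp flip: u(3))
  have hl: "hd us = r" "last ys = t"
    using sorted_list_partition[OF I(1) rst(2)] sorted_list_partition[OF J(1) rst(3)] u by (auto simp: hd_append)
  note eI = partitions_Un_Int(1)[OF I(2) J(2)] and eJ = partitions_Un_Int(2)[OF I(2) J(2)]
  have cI: "list_refine A \<Delta> (us @ [s]) (I' \<union> J') = list_refine A \<Delta> (us @ [s]) I'"
    by (rule list_refine_cong) (use chain_append(1)[OF c u(4)] hl u eI partitionsD(4)[OF I(2)] in \<open>auto simp: hd_append\<close>)
  have cJ: "list_refine A \<Delta> (s # ys) (I' \<union> J') = list_refine A \<Delta> (s # ys) J'"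
    by (rule list_refine_cong) (use chain_append(2)[OF c u(5)] hl u eJ partitionsD(4)[OF J(2)] in auto)
  have fin: "finite (I' \<union> J')" using partitionsD(1)[OF I(2)] partitionsD(1)[OF J(2)] by simp
  have "set (us @ s # ys) \<subseteq> I' \<union> J'"
    using sorted_list_partition(5)[OF partitions_Un[OF I(1) J(1)]] rst I(3) J(3) u(3) by auto
  from list_refine_append[OF c u(4,5) fin this] x show ?thesis
    by (simp add: refine_def part_alg_def u hl cI cJ eI[unfolded part_alg_def] eJ)
qed

lemma refine_elem:
  assumes I: "I \<in> partitions r s" "I' \<in> partitions r s" "I \<subseteq> I'" and J: "J \<in> partitions s t" "J' \<in> partitions s t" "J \<subseteq> J'"
    and rst: "0 < r" "r < s" "s < t" and xy: "x \<in> carrier (part_alg A I)" "y \<in> carrier (part_alg A J)"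
  shows "refine A \<Delta> (I \<union> J) (I' \<union> J') (tensor_elem (part_alg A I) (part_alg A J) x y) =
    tensor_elem (part_alg A I') (part_alg A J') (refine A \<Delta> I I' x) (refine A \<Delta> J J' y)"
proof -
  have s0: "0 < s" using rst by simp
  note R = part_alg_rep[OF I(1) rst(1,2)] part_alg_rep[OF J(1) s0 rst(3)]
    part_alg_rep[OF I(2) rst(1,2)] part_alg_rep[OF J(2) s0 rst(3)]
  have "tensor_elem (part_alg A I) (part_alg A J) x y \<in> carrier (part_alg A (I \<union> J))"
    using tensor_elem_closed[OF R(1,2) xy] part_alg_Un[OF I(1) J(1) rst] by simp
  from refine_Un[OF I J rst this] show ?thesis
    using tensor_map_mono(2)[OF R refine_mono[OF I rst(1,2)] refine_mono[OF J s0 rst(3)] xy] by simp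
qed

end

section \<open>Isomorphisms of directed limits\<close>

text \<open>Directedness puts any two elements over one index, which makes the set of pairs
  (\<open>\<alpha> i x\<close>, \<open>\<beta> i x\<close>) closed under the operations; equality of
  norms extends the correspondence to the closures. For surjectivity the target is only asked to be
  generated as a closed subalgebra, a condition that elementary tensors meet directly.\<close>

lemma directed_iso:
  assumes L: "cstar_algebra L" and M: "cstar_algebra M"
    and B: "\<And>i. i \<in> D \<Longrightarrow> cstar_algebra (B i)"
    and \<alpha>: "\<And>i. i \<in> D \<Longrightarrow> star_hom (B i) L (\<alpha> i)" and \<beta>: "\<And>i. i \<in> D \<Longrightarrow> star_hom (B i) M (\<beta> i)"
    and norm: "\<And>i x. i \<in> D \<Longrightarrow> x \<in> carrier (B i) \<Longrightarrow> cnorm M (\<beta> i x) = cnorm L (\<alpha> i x)"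
    and directed: "\<And>i j. i \<in> D \<Longrightarrow> j \<in> D \<Longrightarrow> \<exists>k\<in>D.
      (\<forall>x\<in>carrier (B i). \<exists>z\<in>carrier (B k). \<alpha> k z = \<alpha> i x \<and> \<beta> k z = \<beta> i x) \<and>
      (\<forall>y\<in>carrier (B j). \<exists>z\<in>carrier (B k). \<alpha> k z = \<alpha> j y \<and> \<beta> k z = \<beta> j y)"
    and dense: "cdense L (\<Union>i\<in>D. \<alpha> i ` carrier (B i))"
    and gen: "\<And>R. closed_subalg M R \<Longrightarrow> (\<And>i x. i \<in> D \<Longrightarrow> x \<in> carrier (B i) \<Longrightarrow> \<beta> i x \<in> R) \<Longrightarrow> carrier M \<subseteq> R"
  shows "\<exists>!\<delta>. \<delta> \<in> extensional (carrier L) \<and> star_iso L M \<delta> \<and> (\<forall>i\<in>D. \<forall>x\<in>carrier (B i). \<delta> (\<alpha> i x) = \<beta> i x)"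
proof -
  interpret L: cstar_algebra L by (rule L)
  interpret M: cstar_algebra M by (rule M)
  define G where "G = {(\<alpha> i x, \<beta> i x) | i x. i \<in> D \<and> x \<in> carrier (B i)}"
  have GI: "(\<alpha> i x, \<beta> i x) \<in> G" if "i \<in> D" "x \<in> carrier (B i)" for i x using that by (auto simp: G_def)
  \<comment> \<open>Two pairs are moved to a common index, where sums and products can be
    formed.\<close>
  have G2: "\<exists>k x z. k \<in> D \<and> x \<in> carrier (B k) \<and> z \<in> carrier (B k) \<and> a = \<alpha> k x \<and> b = \<beta> k x \<and> c = \<alpha> k z \<and> d = \<beta> k z"
    if ab: "(a, b) \<in> G" and cd: "(c, d) \<in> G" for a b c d
  proof -
    obtain i x j y where ij: "i \<in> D" "x \<in> carrier (B i)" "a = \<alpha> i x" "b = \<beta> i x" "j \<in> D" "y \<in> carrier (B j)" "c = \<alpha> j y" "d = \<beta> j y"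
      using ab cd unfolding G_def by blast
    from directed[OF ij(1,5)] ij show ?thesis by metis
  qed
  obtain h where h: "star_mono L M h" "\<And>x y. (x, y) \<in> G \<Longrightarrow> h x = y"
  proof (rule star_graph_extension[OF L M, of G])
    show "G \<subseteq> carrier L \<times> carrier M" using star_hom_closed[OF \<alpha>] star_hom_closed[OF \<beta>] by (auto simp: G_def)
    show "cdense L (fst ` G)"
    proof -
      have "fst ` G = (\<Union>i\<in>D. \<alpha> i ` carrier (B i))" by (force simp: G_def)
      then show ?thesis using dense by simp
    qed
    fix x y x' y' assume "(x, y) \<in> G" "(x', y') \<in> G"
    then obtain k u v where k: "k \<in> D" "u \<in> carrier (B k)" "v \<in> carrier (B k)" "x = \<alpha> k u" "y = \<beta> k u" "x' = \<alpha> k v" "y' = \<beta> k v"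
      using G2 by blast
    interpret Bk: cstar_algebra "B k" by (rule B[OF k(1)])
    show "(x \<oplus>\<^bsub>L\<^esub> x', y \<oplus>\<^bsub>M\<^esub> y') \<in> G"
      using GI[OF k(1), of "u \<oplus>\<^bsub>B k\<^esub> v"] k by (simp add: star_hom_add[OF \<alpha>] star_hom_add[OF \<beta>])
    show "(x \<cdot>\<^bsub>L\<^esub> x', y \<cdot>\<^bsub>M\<^esub> y') \<in> G"
      using GI[OF k(1), of "u \<cdot>\<^bsub>B k\<^esub> v"] k by (simp add: star_hom_mult[OF \<alpha>] star_hom_mult[OF \<beta>])
  next
    fix x y c assume "(x, y) \<in> G"
    then obtain k u where k: "k \<in> D" "u \<in> carrier (B k)" "x = \<alpha> k u" "y = \<beta> k u" by (auto simp: G_def)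
    interpret Bk: cstar_algebra "B k" by (rule B[OF k(1)])
    show "(c \<odot>\<^bsub>L\<^esub> x, c \<odot>\<^bsub>M\<^esub> y) \<in> G"
      using GI[OF k(1), of "c \<odot>\<^bsub>B k\<^esub> u"] k by (simp add: star_hom_scale[OF \<alpha>] star_hom_scale[OF \<beta>])
    show "(cadj L x, cadj M y) \<in> G"
      using GI[OF k(1), of "cadj (B k) u"] k by (simp add: star_hom_adj[OF \<alpha>] star_hom_adj[OF \<beta>])
    show "cnorm M y = cnorm L x" using norm k by simp
  qed blast
  \<comment> \<open>The range of an isometric *-homomorphism is a closed subalgebra, so generation
    by the values of \<open>\<beta>\<close> is enough.\<close>
  have "carrier M \<subseteq> h ` carrier L"
  proof (rule gen[OF closed_subalg_image[OF L M h(1)]])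
    fix i x assume ix: "i \<in> D" "x \<in> carrier (B i)"
    then show "\<beta> i x \<in> h ` carrier L"
      using h(2)[OF GI[OF ix]] star_hom_closed[OF \<alpha>[OF ix(1)] ix(2)] by force
  qed
  then have iso: "bij_betw h (carrier L) (carrier M)"
    using h(1) star_hom_closed[OF star_mono_hom[OF h(1)]] unfolding star_mono_def bij_betw_def by blast
  \<comment> \<open>Uniqueness is claimed among functions, so the values outside the carrier have to
    be fixed.\<close>
  define \<delta> where "\<delta> = restrict h (carrier L)"
  have \<delta>: "\<delta> x = h x" if "x \<in> carrier L" for x using that by (simp add: \<delta>_def)
  have "star_iso L M \<delta>"
    unfolding star_iso_def
  proof
    show "star_hom L M \<delta>" using star_mono_hom[OF h(1)] by (auto simp: star_hom_def \<delta>)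
    show "bij_betw \<delta> (carrier L) (carrier M)" using iso by (simp add: bij_betw_cong[OF \<delta>])
  qed
  moreover have "\<delta> (\<alpha> i x) = \<beta> i x" if "i \<in> D" "x \<in> carrier (B i)" for i x
    using h(2)[OF GI[OF that]] star_hom_closed[OF \<alpha>[OF that(1)] that(2)] by (simp add: \<delta>)
  ultimately have ex: "\<delta> \<in> extensional (carrier L) \<and> star_iso L M \<delta> \<and> (\<forall>i\<in>D. \<forall>x\<in>carrier (B i). \<delta> (\<alpha> i x) = \<beta> i x)"
    by (simp add: \<delta>_def)
  show ?thesis
  proof (rule ex1I[of _ \<delta>])
    show "\<delta> \<in> extensional (carrier L) \<and> star_iso L M \<delta> \<and> (\<forall>i\<in>D. \<forall>x\<in>carrier (B i). \<delta> (\<alpha> i x) = \<beta> i x)" by (rule ex)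
    fix k assume k: "k \<in> extensional (carrier L) \<and> star_iso L M k \<and> (\<forall>i\<in>D. \<forall>x\<in>carrier (B i). k (\<alpha> i x) = \<beta> i x)"
    show "k = \<delta>"
    proof (rule extensionalityI[of _ "carrier L"])
      fix x assume x: "x \<in> carrier L"
      show "k x = \<delta> x"
        by (rule star_hom_eq_on_dense[OF L M _ _ dense _ x]) (use k ex in \<open>auto simp: star_iso_def\<close>)
    qed (use k ex in auto)
  qed
qed

section \<open>Generation of tensor products and tensoring with projections\<close>

lemma tensor_elem_diff_norm:
  assumes A: "represented_cstar A" and B: "represented_cstar B"
    and a: "a \<in> carrier A" "a' \<in> carrier A" and b: "b \<in> carrier B" "b' \<in> carrier B"
  shows "cnorm (tensor A B) (cdiff (tensor A B) (tensor_elem A B a b) (tensor_elem A B a' b)) \<le> cnorm A (cdiff A a a') * cnorm B b"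
    and "cnorm (tensor A B) (cdiff (tensor A B) (tensor_elem A B a b) (tensor_elem A B a b')) \<le> cnorm A a * cnorm B (cdiff B b b')"
proof -
  interpret A: cstar_algebra A by (rule represented_cstar_algebra[OF A])
  interpret B: cstar_algebra B by (rule represented_cstar_algebra[OF B])
  note isoA = star_mono_isometric[OF A.cstar_algebra_axioms cstar_algebra_op_alg represented_mono[OF A]]
  note isoB = star_mono_isometric[OF B.cstar_algebra_axioms cstar_algebra_op_alg represented_mono[OF B]]
  note rc = star_hom_cdiff[OF A.cstar_algebra_axioms represented_hom[OF A]]
    star_hom_cdiff[OF B.cstar_algebra_axioms represented_hom[OF B]]
  have le: "op_norm (words (deg A + deg B)) (tensor_elem A B x y) \<le> cnorm A x * cnorm B y"
    if "x \<in> carrier A" "y \<in> carrier B" for x y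
    using tensor_op_norm_le[OF rep_closed[OF A that(1)] rep_closed[OF B that(2)]] isoA[OF that(1)] isoB[OF that(2)]
    by (simp add: tensor_elem_def)
  have 1: "cdiff (tensor A B) (tensor_elem A B a b) (tensor_elem A B a' b) = tensor_elem A B (cdiff A a a') b"
    using a b rc(1)[OF a] tensor_op_add_left[of "deg A" "deg B" "rep A a" "\<lambda>f x. -1 * rep A a' f x" "rep B b"]
      tensor_op_scale_left[of "deg A" "deg B" "-1" "rep A a'" "rep B b"]
    by (simp add: tensor_eq tensor_elem_def cdiff_op_alg)
  show "cnorm (tensor A B) (cdiff (tensor A B) (tensor_elem A B a b) (tensor_elem A B a' b)) \<le> cnorm A (cdiff A a a') * cnorm B b"
    unfolding 1 using le[of "cdiff A a a'" b] a b by (simp add: tensor_eq)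
  have 2: "cdiff (tensor A B) (tensor_elem A B a b) (tensor_elem A B a b') = tensor_elem A B a (cdiff B b b')"
    using a b rc(2)[OF b] tensor_op_add_right[OF rep_closed[OF A a(1)] rep_closed[OF B b(1)] op_scale_closed(1)[OF rep_closed[OF B b(2)]], of "-1"]
      tensor_op_scale_right[OF rep_closed[OF A a(1)] rep_closed[OF B b(2)], of "-1"]
    by (simp add: tensor_eq tensor_elem_def cdiff_op_alg)
  show "cnorm (tensor A B) (cdiff (tensor A B) (tensor_elem A B a b) (tensor_elem A B a b')) \<le> cnorm A a * cnorm B (cdiff B b b')"
    unfolding 2 using le[of a "cdiff B b b'"] a b by (simp add: tensor_eq)
qed

text \<open>a \<otimes> b is continuous in each variable: first \<open>a\<close> is freed from
  \<open>S\<close>, then \<open>b\<close> from \<open>T\<close>, and elementary tensors span a dense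
  subspace.\<close>

lemma tensor_generated:
  assumes A: "represented_cstar A" and B: "represented_cstar B" and S: "cdense A S" and T: "cdense B T"
    and R: "closed_subalg (tensor A B) R" and ST: "\<And>a b. a \<in> S \<Longrightarrow> b \<in> T \<Longrightarrow> tensor_elem A B a b \<in> R"
  shows "carrier (tensor A B) \<subseteq> R"
proof -
  interpret A: cstar_algebra A by (rule represented_cstar_algebra[OF A])
  interpret B: cstar_algebra B by (rule represented_cstar_algebra[OF B])
  interpret M: cstar_algebra "tensor A B" by (rule represented_cstar_algebra[OF represented_tensor[OF A B]])
  let ?M = "tensor A B"
  have SA: "S \<subseteq> carrier A" and TB: "T \<subseteq> carrier B" using S T by (auto simp: cdense_def)
  note te = tensor_elem_closed[OF A B]
  have 1: "tensor_elem A B a b \<in> R" if a: "a \<in> carrier A" and b: "b \<in> T" for a b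
  proof -
    obtain X where X: "\<And>n. X n \<in> S" "cconverges A X a"
      using A.approx_sequence[OF a _ SA] S a unfolding cdense_def by blast
    have Xc: "X n \<in> carrier A" for n using X SA by blast
    have bB: "b \<in> carrier B" using b TB by blast
    have "cconverges ?M (\<lambda>n. tensor_elem A B (X n) b) (tensor_elem A B a b)"
    proof (rule M.converges_bound)
      show "(\<lambda>n. cnorm A (cdiff A (X n) a) * cnorm B b) \<longlonglongrightarrow> 0"
        using tendsto_mult_right[OF X(2)[unfolded cconverges_def], of "cnorm B b"] by simp
    qed (use te Xc a bB tensor_elem_diff_norm(1)[OF A B Xc a bB bB] in auto)
    then show ?thesis using closed_subalg_limit[OF R, of "\<lambda>n. tensor_elem A B (X n) b"] ST X(1) b te a bB by blast
  qed
  have 2: "tensor_elem A B a b \<in> R" if a: "a \<in> carrier A" and b: "b \<in> carrier B" for a b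
  proof -
    obtain X where X: "\<And>n. X n \<in> T" "cconverges B X b"
      using B.approx_sequence[OF b _ TB] T b unfolding cdense_def by blast
    have Xc: "X n \<in> carrier B" for n using X TB by blast
    have "cconverges ?M (\<lambda>n. tensor_elem A B a (X n)) (tensor_elem A B a b)"
    proof (rule M.converges_bound)
      show "(\<lambda>n. cnorm A a * cnorm B (cdiff B (X n) b)) \<longlonglongrightarrow> 0"
        using tendsto_mult_left[OF X(2)[unfolded cconverges_def], of "cnorm A a"] by simp
    qed (use te Xc a b tensor_elem_diff_norm(2)[OF A B a a Xc b] in auto)
    then show ?thesis using closed_subalg_limit[OF R, of "\<lambda>n. tensor_elem A B a (X n)"] 1[OF a X(1)] te a b by blast
  qed
  show ?thesis
  proof
    fix z assume z: "z \<in> carrier ?M"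
    let ?W = "words (deg A + deg B)"
    have L: "y \<in> R" if "y \<in> lin_span (op_alg ?W) (tensor_gens A B)" for y
      using that
    proof induction
      case lin_span_zero then show ?case using closed_subalg_zero[OF R] by (simp add: tensor_eq)
    next
      case (lin_span_base x) then show ?case using 2 by (auto simp: tensor_gens_def)
    next
      case (lin_span_add x y) then show ?case using closed_subalg_add[OF R, of x y] by (simp add: tensor_eq)
    next
      case (lin_span_scale x c) then show ?case using closed_subalg_scale[OF R, of x c] by (simp add: tensor_eq)
    qed
    obtain X where "\<And>n. X n \<in> lin_span (op_alg ?W) (tensor_gens A B)" "cconverges ?M X z"
      using M.approx_sequence[OF z] tensor_dense[OF A B] z unfolding cdense_def by blast
    then show "z \<in> R" using closed_subalg_limit[OF R, of X z] L z by blast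
  qed
qed

text \<open>Idempotence and self-adjointness of \<open>q\<close> give multiplicativity and
  compatibility with adjoints; injectivity comes from \<open>q\<close> being nonzero. By these maps
  units are adjoined to a partition.\<close>

lemma
  assumes B: "represented_cstar B" and C: "represented_cstar C" and q: "is_projection C q" "q \<noteq> \<zero>\<^bsub>C\<^esub>"
  shows tensor_projection_right: "star_mono B (tensor B C) (\<lambda>x. tensor_elem B C x q)"
    and tensor_projection_left: "star_mono B (tensor C B) (\<lambda>x. tensor_elem C B q x)"
proof -
  interpret B: cstar_algebra B by (rule represented_cstar_algebra[OF B])
  interpret C: cstar_algebra C by (rule represented_cstar_algebra[OF C])
  have qC: "q \<in> carrier C" and qa: "cadj C q = q" and qq: "q \<cdot>\<^bsub>C\<^esub> q = q" using q by (auto simp: is_projection_def)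
  note hB = represented_hom[OF B]
  note rB = rep_closed[OF B] and rC = rep_closed[OF C qC]
  have h1: "star_hom B (tensor B C) (\<lambda>x. tensor_elem B C x q)"
    unfolding star_hom_def
  proof (intro conjI ballI allI)
    fix x y assume xy: "x \<in> carrier B" "y \<in> carrier B"
    show "tensor_elem B C (x \<oplus>\<^bsub>B\<^esub> y) q = tensor_elem B C x q \<oplus>\<^bsub>tensor B C\<^esub> tensor_elem B C y q"
      using xy by (simp add: tensor_eq tensor_elem_def star_hom_add[OF hB] tensor_op_add_left)
    show "tensor_elem B C (x \<cdot>\<^bsub>B\<^esub> y) q = tensor_elem B C x q \<cdot>\<^bsub>tensor B C\<^esub> tensor_elem B C y q"
      using tensor_elem_mult[OF B C xy(1) qC xy(2) qC] qq by (simp add: tensor_eq)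
  next
    fix x c assume x: "x \<in> carrier B"
    show "tensor_elem B C x q \<in> carrier (tensor B C)" by (rule tensor_elem_closed[OF B C x qC])
    show "tensor_elem B C (c \<odot>\<^bsub>B\<^esub> x) q = c \<odot>\<^bsub>tensor B C\<^esub> tensor_elem B C x q"
      using tensor_elem_scale[OF B C x] by (simp add: tensor_eq)
    show "tensor_elem B C (cadj B x) q = cadj (tensor B C) (tensor_elem B C x q)"
      using tensor_elem_adj[OF B C x qC] qa by (simp add: tensor_eq)
  qed
  have h2: "star_hom B (tensor C B) (\<lambda>x. tensor_elem C B q x)"
    unfolding star_hom_def
  proof (intro conjI ballI allI)
    fix x y assume xy: "x \<in> carrier B" "y \<in> carrier B"
    show "tensor_elem C B q (x \<oplus>\<^bsub>B\<^esub> y) = tensor_elem C B q x \<oplus>\<^bsub>tensor C B\<^esub> tensor_elem C B q y"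
      using xy by (simp add: tensor_eq tensor_elem_def star_hom_add[OF hB] tensor_op_add_right rB rC)
    show "tensor_elem C B q (x \<cdot>\<^bsub>B\<^esub> y) = tensor_elem C B q x \<cdot>\<^bsub>tensor C B\<^esub> tensor_elem C B q y"
      using tensor_elem_mult[OF C B qC xy(1) qC xy(2)] qq by (simp add: tensor_eq)
  next
    fix x c assume x: "x \<in> carrier B"
    show "tensor_elem C B q x \<in> carrier (tensor C B)" by (rule tensor_elem_closed[OF C B qC x])
    show "tensor_elem C B q (c \<odot>\<^bsub>B\<^esub> x) = c \<odot>\<^bsub>tensor C B\<^esub> tensor_elem C B q x"
      using x by (simp add: tensor_eq tensor_elem_def star_hom_scale[OF hB] tensor_op_scale_right rB rC)
    show "tensor_elem C B q (cadj B x) = cadj (tensor C B) (tensor_elem C B q x)"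
      using tensor_elem_adj[OF C B qC x] qa by (simp add: tensor_eq)
  qed
  have inj: "inj_on f (carrier B)" if f: "star_hom B M f" and M: "cstar_algebra M"
    and ker: "\<And>x. x \<in> carrier B \<Longrightarrow> f x = \<zero>\<^bsub>M\<^esub> \<Longrightarrow> x = \<zero>\<^bsub>B\<^esub>" for f and M :: "('z, 'y) cstar_scheme"
  proof (rule inj_onI)
    fix x y assume xy: "x \<in> carrier B" "y \<in> carrier B" "f x = f y"
    interpret M: cstar_algebra M by (rule M)
    have "f (cdiff B x y) = \<zero>\<^bsub>M\<^esub>"
      using xy star_hom_closed[OF f] by (simp add: star_hom_cdiff[OF B.cstar_algebra_axioms f])
    then have "cdiff B x y = \<zero>\<^bsub>B\<^esub>" using ker xy by simp
    then show "x = y" using xy by (simp add: B.cdiff_eq_zero_iff)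
  qed
  have z: "\<zero>\<^bsub>tensor B C\<^esub> = (\<lambda>f x. 0)" "\<zero>\<^bsub>tensor C B\<^esub> = (\<lambda>f x. 0)" by (simp_all add: tensor_eq)
  show "star_mono B (tensor B C) (\<lambda>x. tensor_elem B C x q)"
    unfolding star_mono_def
  proof (intro conjI h1 inj[OF h1 represented_cstar_algebra[OF represented_tensor[OF B C]]])
    fix x assume "x \<in> carrier B" "tensor_elem B C x q = \<zero>\<^bsub>tensor B C\<^esub>"
    then show "x = \<zero>\<^bsub>B\<^esub>" using tensor_elem_inj[OF B C _ qC, of x] q(2) z by auto
  qed
  show "star_mono B (tensor C B) (\<lambda>x. tensor_elem C B q x)"
    unfolding star_mono_def
  proof (intro conjI h2 inj[OF h2 represented_cstar_algebra[OF represented_tensor[OF C B]]])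
    fix x assume "x \<in> carrier B" "tensor_elem C B q x = \<zero>\<^bsub>tensor C B\<^esub>"
    then show "x = \<zero>\<^bsub>B\<^esub>" using tensor_elem_inj[OF C B qC, of x] q(2) z by auto
  qed
qed

lemma star_mono_projection:
  assumes "cstar_algebra A" "cstar_algebra B" "star_mono A B f" "is_projection A q" "q \<noteq> \<zero>\<^bsub>A\<^esub>"
  shows "is_projection B (f q)" "f q \<noteq> \<zero>\<^bsub>B\<^esub>"
proof -
  note h = star_mono_hom[OF assms(3)]
  have q: "q \<in> carrier A" using assms(4) by (simp add: is_projection_def)
  show "is_projection B (f q)"
    using assms(4) star_hom_closed[OF h q] star_hom_adj[OF h q] star_hom_mult[OF h q q] by (simp add: is_projection_def)
  show "f q \<noteq> \<zero>\<^bsub>B\<^esub>"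
    using assms(3,5) q cstar_algebra.zero_closed[OF assms(1)]
    by (auto simp: star_mono_def simp flip: star_hom_zero[OF assms(1,2) h] dest: inj_onD)
qed

section \<open>Units along partitions\<close>

locale unital_subproduct_system = subproduct_system A \<Delta>
  for A :: "('a, 'h) alg_family" and \<Delta> :: "('a, 'h) comult_family" +
  fixes p :: "real \<Rightarrow> real \<Rightarrow> 'a"
  assumes unit: "cstar_unit A \<Delta> p"
begin

lemma unit_projection: "0 < s \<Longrightarrow> s < t \<Longrightarrow> is_projection (A s t) (p s t)"
  and unit_nonzero: "0 < s \<Longrightarrow> s < t \<Longrightarrow> p s t \<noteq> \<zero>\<^bsub>A s t\<^esub>"
  and \<Delta>_unit: "0 < r \<Longrightarrow> r < s \<Longrightarrow> s < t \<Longrightarrow> \<Delta> r s t (p r t) = tensor_elem (A r s) (A s t) (p r s) (p s t)"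
  using unit by (simp_all add: cstar_unit_def)

lemma unit_closed: "0 < s \<Longrightarrow> s < t \<Longrightarrow> p s t \<in> carrier (A s t)"
  using unit_projection by (simp add: is_projection_def)

lemma list_unit_closed: "chain xs \<Longrightarrow> list_unit A p xs \<in> carrier (list_alg A xs)"
proof (induction xs rule: chain_induct)
  case (pair r s)
  then show ?case using unit_closed by (simp add: list_alg_pair del: list_alg.simps)
next
  case (Cons r s ys)
  then show ?case
    using tensor_elem_closed[OF rep_A list_alg_rep unit_closed] by (simp add: list_alg_Cons list_unit_Cons)
qed

lemma list_unit_append:
  "chain (xs @ s # ys) \<Longrightarrow> xs \<noteq> [] \<Longrightarrow> ys \<noteq> [] \<Longrightarrow> list_unit A p (xs @ s # ys) =
   tensor_elem (list_alg A (xs @ [s])) (list_alg A (s # ys)) (list_unit A p (xs @ [s])) (list_unit A p (s # ys))"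
proof (induction xs)
  case (Cons r xs)
  show ?case
  proof (cases xs)
    case Nil
    then show ?thesis using Cons.prems by (simp add: list_unit_Cons list_alg_pair del: list_alg.simps)
  next
    case xs: (Cons r' xs')
    have c: "chain (r' # xs' @ s # ys)" "0 < r" "r < r'" using Cons.prems by (auto simp: xs chain_Cons)
    have c': "chain (r' # xs' @ [s])" "chain (s # ys)" using chain_append[of "r' # xs'" s ys] c Cons.prems by auto
    have "list_alg A (r' # xs' @ s # ys) = tensor (list_alg A (r' # xs' @ [s])) (list_alg A (s # ys))"
      using list_alg_append[of "r' # xs'" s ys] c Cons.prems by simp
    then show ?thesis
      using tensor_elem_assoc[OF rep_A[OF c(2,3)] list_alg_rep[OF c'(1)] list_alg_rep[OF c'(2)] unit_closed[OF c(2,3)]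
          list_unit_closed[OF c'(1)] list_unit_closed[OF c'(2)]] Cons.IH c Cons.prems
      by (simp add: xs list_alg_Cons list_unit_Cons)
  qed
qed simp

text \<open>The defining relation of a unit, iterated along the recursion of
  \<open>refine_top\<close>.\<close>

lemma refine_top_unit: "chain zs \<Longrightarrow> refine_top A \<Delta> zs (p (hd zs) (last zs)) = list_unit A p zs"
proof (induction zs rule: rev_induct)
  case (snoc t ys)
  from snoc.prems show ?case
  proof (cases rule: chain_snoc_cases)
    case (pair s)
    then show ?thesis by (simp add: refine_top_pair)
  next
    case (triple r s)
    then show ?thesis using \<Delta>_unit by (simp add: refine_top_triple list_unit_Cons list_alg_pair del: list_alg.simps)
  next
    case (long us r)
    have l: "last ys = r" using long by simp
    have R: "represented_cstar (A (hd ys) r)" "represented_cstar (A r t)" "represented_cstar (list_alg A ys)"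
      using long rep_A list_alg_rep by auto
    have m: "star_mono (A (hd ys) r) (list_alg A ys) (refine_top A \<Delta> ys)" using refine_top_mono[OF long(4)] l by simp
    have "refine_top A \<Delta> (ys @ [t]) (p (hd ys) t) = tensor_elem (list_alg A ys) (A r t) (list_unit A p ys) (p r t)"
      unfolding refine_top_snoc[OF long(2)] l
      using tensor_map_mono(2)[OF R(1,2,3,2) m star_mono_id[OF represented_cstar_algebra[OF R(2)]] unit_closed unit_closed]
        snoc.IH[OF long(4)] long(5-8) l \<Delta>_unit[of "hd ys" r t]
      by simp
    also have "\<dots> = list_unit A p (ys @ [t])"
      using list_unit_append[OF long(9) long(3)] long(1) by (simp add: list_alg_pair del: list_alg.simps)
    finally show ?thesis using long by (simp add: hd_append)
  qed
qed simp

lemma sorted_list_pair: "s < t \<Longrightarrow> sorted_list_of_set {s, t :: real} = [s, t]"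
  by (simp add: sorted_list_of_set_insert_remove)

lemma pair_partition: "s \<le> t \<Longrightarrow> {s, t} \<in> partitions s t"
  by (auto simp: partitions_def)

lemma part_alg_pair: "s < t \<Longrightarrow> part_alg A {s, t} = concrete (A s t)"
  by (simp add: part_alg_def sorted_list_pair list_alg_pair del: list_alg.simps)

lemma part_unit_pair: "s < t \<Longrightarrow> part_unit A p {s, t} = rep (A s t) (p s t)"
  by (simp add: part_unit_def sorted_list_pair)

text \<open>The unit of an adjoined interval refines to exactly the factor that
  \<open>refine_unit\<close> inserts; this makes the two inductive systems match.\<close>

lemma refine_pair_unit:
  assumes "J \<in> partitions s t" "0 < s" "s < t"
  shows "refine A \<Delta> {s, t} J (part_unit A p {s, t}) = part_unit A p J"
proof -
  have J: "J \<inter> {s..t} = J" using partitionsD[OF assms(1)] by auto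
  have "inv_into (carrier (A s t)) (rep (A s t)) (rep (A s t) (p s t)) = p s t"
    using represented_mono[OF rep_A[OF assms(2,3)]] unit_closed[OF assms(2,3)] by (simp add: star_mono_def)
  then show ?thesis
    using refine_top_unit[OF chain_partition[OF assms]] sorted_list_partition[OF assms(1,3)] assms J
    by (simp add: refine_def sorted_list_pair part_unit_pair list_refine_pair part_unit_def[of A p J] del: list_refine.simps)
qed

lemma part_unit_pair_projection:
  assumes "0 < s" "s < t"
  shows "is_projection (part_alg A {s, t}) (part_unit A p {s, t})" "part_unit A p {s, t} \<noteq> \<zero>\<^bsub>part_alg A {s, t}\<^esub>"
  using star_mono_projection[OF represented_cstar_algebra represented_cstar_algebra rep_mono_concrete unit_projection unit_nonzero]
    rep_A[OF assms] represented_concrete[OF rep_A[OF assms]] assms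
  by (simp_all add: part_alg_pair part_unit_pair)

end

section \<open>Consequences of the definition of an inductive limit\<close>

lemma inductive_limitD:
  assumes "inductive_limit D le B f L \<phi>"
  shows inductive_limit_cstar: "cstar_algebra L"
    and inductive_limit_hom: "i \<in> D \<Longrightarrow> star_hom (B i) L (\<phi> i)"
    and inductive_limit_compat: "i \<in> D \<Longrightarrow> j \<in> D \<Longrightarrow> le i j \<Longrightarrow> x \<in> carrier (B i) \<Longrightarrow> \<phi> j (f i j x) = \<phi> i x"
    and inductive_limit_norm: "i \<in> D \<Longrightarrow> x \<in> carrier (B i) \<Longrightarrow>
      cnorm L (\<phi> i x) = (INF j\<in>{j\<in>D. le i j}. cnorm (B j) (f i j x))"
    and inductive_limit_dense: "cdense L (\<Union>i\<in>D. \<phi> i ` carrier (B i))"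
proof -
  show h: "i \<in> D \<Longrightarrow> star_hom (B i) L (\<phi> i)" for i using assms by (simp add: inductive_limit_def)
  show "cdense L (\<Union>i\<in>D. \<phi> i ` carrier (B i))"
    using assms star_hom_closed[OF h] unfolding cdense_def inductive_limit_def by fastforce
qed (use assms in \<open>auto simp: inductive_limit_def\<close>)

text \<open>For isometric connecting maps the infimum that defines the norm of a limit runs over a
  constant; the element \<open>a\<close> guards against an empty index set.\<close>

lemma INF_const_eq:
  fixes c :: real
  assumes "a \<in> S" "\<And>j. j \<in> S \<Longrightarrow> f j = c" shows "(INF j\<in>S. f j) = c"
proof -
  have "f ` S = {c}" using assms by auto
  then show ?thesis by simp
qed

lemma closed_subalg_dense_eq:
  assumes M: "cstar_algebra M" and R: "closed_subalg M R" and S: "cdense M S" "S \<subseteq> R"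
  shows "carrier M \<subseteq> R"
proof
  interpret M: cstar_algebra M by (rule M)
  fix x assume x: "x \<in> carrier M"
  obtain X where "\<And>n. X n \<in> S" "cconverges M X x"
    using M.approx_sequence[OF x] S(1) x unfolding cdense_def by blast
  then show "x \<in> R" using closed_subalg_limit[OF R, of X x] S(2) x by blast
qed

section \<open>The inductive dilation and its unit\<close>

locale dilation = unital_subproduct_system A \<Delta> p
  for A :: "('a, 'h) alg_family" and \<Delta> :: "('a, 'h) comult_family" and p :: "real \<Rightarrow> real \<Rightarrow> 'a" +
  fixes As :: "('b, 'k) alg_family" and \<phi> :: "real set \<Rightarrow> 'h list oper \<Rightarrow> 'b"
  assumes dil: "inductive_dilation A \<Delta> As \<phi>"
begin

lemma rep_As: "0 < s \<Longrightarrow> s < t \<Longrightarrow> represented_cstar (As s t)"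
  and lim_As: "0 < s \<Longrightarrow> s < t \<Longrightarrow> inductive_limit (partitions s t) (\<subseteq>) (part_alg A) (refine A \<Delta>) (As s t) \<phi>"
  using dil by (simp_all add: inductive_dilation_def)

lemma \<phi>_compat: "0 < s \<Longrightarrow> s < t \<Longrightarrow> I \<in> partitions s t \<Longrightarrow> J \<in> partitions s t \<Longrightarrow> I \<subseteq> J \<Longrightarrow>
    x \<in> carrier (part_alg A I) \<Longrightarrow> \<phi> J (refine A \<Delta> I J x) = \<phi> I x"
  using inductive_limit_compat[OF lim_As] by blast

lemma part_alg_cstar: "I \<in> partitions s t \<Longrightarrow> 0 < s \<Longrightarrow> s < t \<Longrightarrow> cstar_algebra (part_alg A I)"
  using part_alg_rep represented_cstar_algebra by blast

lemma \<phi>_norm: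
  assumes "0 < s" "s < t" "I \<in> partitions s t" "x \<in> carrier (part_alg A I)"
  shows "cnorm (As s t) (\<phi> I x) = cnorm (part_alg A I) x"
  unfolding inductive_limit_norm[OF lim_As[OF assms(1,2)] assms(3,4)]
proof (rule INF_const_eq[of I])
  fix J assume "J \<in> {J \<in> partitions s t. I \<subseteq> J}"
  then have J: "J \<in> partitions s t" "I \<subseteq> J" by auto
  show "cnorm (part_alg A J) (refine A \<Delta> I J x) = cnorm (part_alg A I) x"
    by (rule star_mono_isometric[OF part_alg_cstar[OF assms(3,1,2)] part_alg_cstar[OF J(1) assms(1,2)]
          refine_mono[OF assms(3) J assms(1,2)] assms(4)])
qed (use assms in auto)

lemma \<phi>_mono:
  assumes "0 < s" "s < t" "I \<in> partitions s t"
  shows "star_mono (part_alg A I) (As s t) (\<phi> I)"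
proof -
  note h = inductive_limit_hom[OF lim_As[OF assms(1,2)] assms(3)]
  interpret I: cstar_algebra "part_alg A I" by (rule part_alg_cstar[OF assms(3,1,2)])
  interpret S: cstar_algebra "As s t" by (rule represented_cstar_algebra[OF rep_As[OF assms(1,2)]])
  have "x = y" if xy: "x \<in> carrier (part_alg A I)" "y \<in> carrier (part_alg A I)" "\<phi> I x = \<phi> I y" for x y
    using \<phi>_norm[OF assms, of "cdiff (part_alg A I) x y"] xy star_hom_closed[OF h]
    by (simp add: star_hom_cdiff[OF I.cstar_algebra_axioms h] I.norm_cdiff_eq_zero)
  then show ?thesis using h by (auto simp: star_mono_def inj_on_def)
qed

lemma \<phi>_closed:
  "0 < s \<Longrightarrow> s < t \<Longrightarrow> I \<in> partitions s t \<Longrightarrow> x \<in> carrier (part_alg A I) \<Longrightarrow> \<phi> I x \<in> carrier (As s t)"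
  using star_hom_closed[OF star_mono_hom[OF \<phi>_mono]] .

abbreviation sharp where "sharp \<equiv> sharp_comult A As \<phi>"

abbreviation \<phi>_tensor where
  "\<phi>_tensor r s t I J \<equiv> tensor_map (part_alg A I) (part_alg A J) (As r s) (As s t) (\<phi> I) (\<phi> J)"

lemma \<phi>_tensor_mono:
  assumes "0 < r" "r < s" "s < t" and I: "I \<in> partitions r s" and J: "J \<in> partitions s t"
  shows "star_mono (part_alg A (I \<union> J)) (tensor (As r s) (As s t)) (\<phi>_tensor r s t I J)"
    and "x \<in> carrier (part_alg A I) \<Longrightarrow> y \<in> carrier (part_alg A J) \<Longrightarrow>
      \<phi>_tensor r s t I J (tensor_elem (part_alg A I) (part_alg A J) x y) = tensor_elem (As r s) (As s t) (\<phi> I x) (\<phi> J y)"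
proof -
  have s: "0 < s" using assms by simp
  note * = tensor_map_mono[OF part_alg_rep[OF I assms(1,2)] part_alg_rep[OF J s assms(3)] rep_As[OF assms(1,2)]
      rep_As[OF s assms(3)] \<phi>_mono[OF assms(1,2) I] \<phi>_mono[OF s assms(3) J]]
  show "star_mono (part_alg A (I \<union> J)) (tensor (As r s) (As s t)) (\<phi>_tensor r s t I J)"
    using *(1) part_alg_Un[OF I J assms(1-3)] by simp
  show "x \<in> carrier (part_alg A I) \<Longrightarrow> y \<in> carrier (part_alg A J) \<Longrightarrow>
      \<phi>_tensor r s t I J (tensor_elem (part_alg A I) (part_alg A J) x y) = tensor_elem (As r s) (As s t) (\<phi> I x) (\<phi> J y)"
    using *(2) .
qed

text \<open>On elementary tensors this is compatibility of \<open>\<phi>\<close> in each factor, as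
  the refinement of a union acts separately on its two parts.\<close>

lemma \<phi>_tensor_compat:
  assumes rst: "0 < r" "r < s" "s < t" and I: "I \<in> partitions r s" "I' \<in> partitions r s" "I \<subseteq> I'"
    and J: "J \<in> partitions s t" "J' \<in> partitions s t" "J \<subseteq> J'" and x: "x \<in> carrier (part_alg A (I \<union> J))"
  shows "\<phi>_tensor r s t I' J' (refine A \<Delta> (I \<union> J) (I' \<union> J') x) = \<phi>_tensor r s t I J x"
proof -
  have s: "0 < s" using rst by simp
  note U = partitions_Un[OF I(1) J(1)] partitions_Un[OF I(2) J(2)]
  have ref: "star_mono (part_alg A (I \<union> J)) (part_alg A (I' \<union> J')) (refine A \<Delta> (I \<union> J) (I' \<union> J'))"
    using refine_mono[OF U] I(3) J(3) rst by auto
  note eq = part_alg_Un[OF I(1) J(1) rst]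
  note rI = part_alg_rep[OF I(1) rst(1,2)] and rJ = part_alg_rep[OF J(1) s rst(3)]
  have M: "cstar_algebra (tensor (As r s) (As s t))"
    using represented_cstar_algebra[OF represented_tensor[OF rep_As rep_As]] rst by simp
  show ?thesis
  proof (rule tensor_hom_unique[OF rI rJ M, where x = x and h' = "\<phi>_tensor r s t I J"
        and h = "\<lambda>x. \<phi>_tensor r s t I' J' (refine A \<Delta> (I \<union> J) (I' \<union> J') x)"])
    show "star_hom (tensor (part_alg A I) (part_alg A J)) (tensor (As r s) (As s t))
        (\<lambda>x. \<phi>_tensor r s t I' J' (refine A \<Delta> (I \<union> J) (I' \<union> J') x))"
      using star_hom_comp[OF star_mono_hom[OF ref] star_mono_hom[OF \<phi>_tensor_mono(1)[OF rst I(2) J(2)]]] by (simp add: eq)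
    show "star_hom (tensor (part_alg A I) (part_alg A J)) (tensor (As r s) (As s t)) (\<phi>_tensor r s t I J)"
      using star_mono_hom[OF \<phi>_tensor_mono(1)[OF rst I(1) J(1)]] by (simp add: eq)
    show "x \<in> carrier (tensor (part_alg A I) (part_alg A J))" using x by (simp add: eq)
    fix a b assume ab: "a \<in> carrier (part_alg A I)" "b \<in> carrier (part_alg A J)"
    have "refine A \<Delta> I I' a \<in> carrier (part_alg A I')" "refine A \<Delta> J J' b \<in> carrier (part_alg A J')"
      using star_hom_closed[OF star_mono_hom[OF refine_mono]] I J rst s ab by blast+
    then show "\<phi>_tensor r s t I' J' (refine A \<Delta> (I \<union> J) (I' \<union> J') (tensor_elem (part_alg A I) (part_alg A J) a b)) =
      \<phi>_tensor r s t I J (tensor_elem (part_alg A I) (part_alg A J) a b)"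
      using refine_elem[OF I J rst ab] \<phi>_tensor_mono(2)[OF rst I(2) J(2)] \<phi>_tensor_mono(2)[OF rst I(1) J(1) ab]
        \<phi>_compat[OF rst(1,2) I ab(1)] \<phi>_compat[OF s rst(3) J ab(2)] by simp
  qed
qed

text \<open>Pairs (I, J) index two isometric families on the same algebras,
  \<open>\<phi> (I \<union> J)\<close> and \<phi> I \<otimes> \<phi> J, because the algebra of
  \<open>I \<union> J\<close> is literally the tensor product of the two parts. The statement
  justifies the description in \<open>sharp_comult\<close>.\<close>

lemma sharp_ex1:
  assumes rst: "0 < r" "r < s" "s < t"
  shows "\<exists>!h. h \<in> extensional (carrier (As r t)) \<and> star_iso (As r t) (tensor (As r s) (As s t)) h \<and>
     (\<forall>I\<in>partitions r s. \<forall>J\<in>partitions s t. \<forall>x\<in>carrier (part_alg A (I \<union> J)). h (\<phi> (I \<union> J) x) = \<phi>_tensor r s t I J x)"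
proof -
  have s: "0 < s" and rt: "r < t" using rst by auto
  let ?D = "partitions r s \<times> partitions s t"
  let ?B = "\<lambda>(I, J). part_alg A (I \<union> J)" and ?\<alpha> = "\<lambda>(I, J). \<phi> (I \<union> J)" and ?\<beta> = "\<lambda>(I, J). \<phi>_tensor r s t I J"
  let ?L = "As r t" and ?M = "tensor (As r s) (As s t)"
  have U: "I \<union> J \<in> partitions r t" if "(I, J) \<in> ?D" for I J using that partitions_Un by auto
  have L: "cstar_algebra ?L" by (rule represented_cstar_algebra[OF rep_As[OF rst(1) rt]])
  have M: "cstar_algebra ?M" by (rule represented_cstar_algebra[OF represented_tensor[OF rep_As[OF rst(1,2)] rep_As[OF s rst(3)]]])
  have "\<exists>!h. h \<in> extensional (carrier ?L) \<and> star_iso ?L ?M h \<and> (\<forall>i\<in>?D. \<forall>x\<in>carrier (?B i). h (?\<alpha> i x) = ?\<beta> i x)"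
  proof (rule directed_iso[OF L M])
    fix i x assume i: "i \<in> ?D" and x: "x \<in> carrier (?B i)"
    obtain I J where IJ: "i = (I, J)" "I \<in> partitions r s" "J \<in> partitions s t" using i by auto
    have xu: "x \<in> carrier (part_alg A (I \<union> J))" using x IJ by simp
    have u: "I \<union> J \<in> partitions r t" using U i IJ by simp
    show "cnorm ?M (?\<beta> i x) = cnorm ?L (?\<alpha> i x)"
      using star_mono_isometric[OF part_alg_cstar[OF u rst(1) rt] M \<phi>_tensor_mono(1)[OF rst IJ(2,3)] xu]
        \<phi>_norm[OF rst(1) rt u xu] by (simp add: IJ)
  next
    fix i assume i: "i \<in> ?D"
    then show "cstar_algebra (?B i)" "star_hom (?B i) ?L (?\<alpha> i)" "star_hom (?B i) ?M (?\<beta> i)"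
      using part_alg_cstar[OF U rst(1) rt] star_mono_hom[OF \<phi>_mono[OF rst(1) rt U]] star_mono_hom[OF \<phi>_tensor_mono(1)[OF rst]] by auto
  next
    fix i j assume "i \<in> ?D" "j \<in> ?D"
    then obtain I J I' J' where ij: "i = (I, J)" "j = (I', J')" and
      P: "I \<in> partitions r s" "J \<in> partitions s t" "I' \<in> partitions r s" "J' \<in> partitions s t" by auto
    let ?I = "I \<union> I'" and ?J = "J \<union> J'"
    have Q: "?I \<in> partitions r s" "?J \<in> partitions s t" using P by (auto simp: partitions_def)
    have *: "\<exists>z\<in>carrier (?B (?I, ?J)). ?\<alpha> (?I, ?J) z = \<phi> (K \<union> H) x \<and> ?\<beta> (?I, ?J) z = \<phi>_tensor r s t K H x"
      if KH: "K \<in> partitions r s" "H \<in> partitions s t" "K \<subseteq> ?I" "H \<subseteq> ?J" and x: "x \<in> carrier (part_alg A (K \<union> H))" for K H x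
    proof (rule bexI[of _ "refine A \<Delta> (K \<union> H) (?I \<union> ?J) x"])
      have sub: "K \<union> H \<subseteq> ?I \<union> ?J" using KH by auto
      show "refine A \<Delta> (K \<union> H) (?I \<union> ?J) x \<in> carrier (?B (?I, ?J))"
        using star_hom_closed[OF star_mono_hom[OF refine_mono[OF partitions_Un[OF KH(1,2)] partitions_Un[OF Q] sub rst(1) rt]] x] by simp
      show "?\<alpha> (?I, ?J) (refine A \<Delta> (K \<union> H) (?I \<union> ?J) x) = \<phi> (K \<union> H) x \<and>
          ?\<beta> (?I, ?J) (refine A \<Delta> (K \<union> H) (?I \<union> ?J) x) = \<phi>_tensor r s t K H x"
        using \<phi>_compat[OF rst(1) rt partitions_Un[OF KH(1,2)] partitions_Un[OF Q] sub x]
          \<phi>_tensor_compat[OF rst KH(1) Q(1) KH(3) KH(2) Q(2) KH(4) x] by simp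
    qed
    show "\<exists>k\<in>?D. (\<forall>x\<in>carrier (?B i). \<exists>z\<in>carrier (?B k). ?\<alpha> k z = ?\<alpha> i x \<and> ?\<beta> k z = ?\<beta> i x) \<and>
      (\<forall>y\<in>carrier (?B j). \<exists>z\<in>carrier (?B k). ?\<alpha> k z = ?\<alpha> j y \<and> ?\<beta> k z = ?\<beta> j y)"
      by (rule bexI[of _ "(?I, ?J)"]) (use *[OF P(1,2)] *[OF P(3,4)] Q in \<open>auto simp: ij\<close>)
  next
    have "(\<Union>K\<in>partitions r t. \<phi> K ` carrier (part_alg A K)) \<subseteq> (\<Union>i\<in>?D. ?\<alpha> i ` carrier (?B i))"
    proof (intro UN_least subsetI)
      fix K y assume K: "K \<in> partitions r t" and "y \<in> \<phi> K ` carrier (part_alg A K)"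
      then obtain x where x: "x \<in> carrier (part_alg A K)" "y = \<phi> K x" by blast
      \<comment> \<open>A partition of [r, t] may miss \<open>s\<close>; adjoining it gives a finer
        partition that splits at \<open>s\<close>, so the unions of pairs are cofinal.\<close>
      define K' where "K' = insert s K"
      have K': "K' \<in> partitions r t" using K rst by (auto simp: K'_def partitions_def)
      have IJ: "(K' \<inter> {r..s}, K' \<inter> {s..t}) \<in> ?D"
        using partitionsD[OF K] rst by (auto simp: K'_def partitions_def)
      have K'eq: "K' \<inter> {r..s} \<union> K' \<inter> {s..t} = K'" using Int_interval_Un[of r s t K'] rst partitionsD(4)[OF K'] by auto
      have sub: "K \<subseteq> K'" by (auto simp: K'_def)
      have "refine A \<Delta> K K' x \<in> carrier (part_alg A K')"
        by (rule star_hom_closed[OF star_mono_hom[OF refine_mono[OF K K' sub rst(1) rt]] x(1)])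
      moreover have "y = \<phi> K' (refine A \<Delta> K K' x)" using \<phi>_compat[OF rst(1) rt K K' sub x(1)] x(2) by simp
      ultimately have "y \<in> ?\<alpha> (K' \<inter> {r..s}, K' \<inter> {s..t}) ` carrier (?B (K' \<inter> {r..s}, K' \<inter> {s..t}))"
        by (simp add: K'eq)
      then show "y \<in> (\<Union>i\<in>?D. ?\<alpha> i ` carrier (?B i))" using IJ by blast
    qed
    moreover have "(\<Union>i\<in>?D. ?\<alpha> i ` carrier (?B i)) \<subseteq> carrier ?L"
      using \<phi>_closed[OF rst(1) rt U] by auto
    ultimately show "cdense ?L (\<Union>i\<in>?D. ?\<alpha> i ` carrier (?B i))"
      using inductive_limit_dense[OF lim_As[OF rst(1) rt]] unfolding cdense_def by (meson subsetD)
  next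
    fix R assume R: "closed_subalg ?M R" and mem: "\<And>i x. i \<in> ?D \<Longrightarrow> x \<in> carrier (?B i) \<Longrightarrow> ?\<beta> i x \<in> R"
    \<comment> \<open>Images of partitions are dense in both factors, and their elementary tensors
      are values of \<open>\<phi>_tensor\<close>.\<close>
    show "carrier ?M \<subseteq> R"
    proof (rule tensor_generated[OF rep_As[OF rst(1,2)] rep_As[OF s rst(3)]
          inductive_limit_dense[OF lim_As[OF rst(1,2)]] inductive_limit_dense[OF lim_As[OF s rst(3)]] R])
      fix a b assume "a \<in> (\<Union>I\<in>partitions r s. \<phi> I ` carrier (part_alg A I))" "b \<in> (\<Union>J\<in>partitions s t. \<phi> J ` carrier (part_alg A J))"
      then obtain I J x y where IJ: "I \<in> partitions r s" "J \<in> partitions s t" "x \<in> carrier (part_alg A I)" "y \<in> carrier (part_alg A J)"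
        "a = \<phi> I x" "b = \<phi> J y" by blast
      have "tensor_elem (part_alg A I) (part_alg A J) x y \<in> carrier (part_alg A (I \<union> J))"
        using tensor_elem_closed[OF part_alg_rep part_alg_rep] part_alg_Un[OF IJ(1,2) rst] IJ rst s by simp
      then have "\<phi>_tensor r s t I J (tensor_elem (part_alg A I) (part_alg A J) x y) \<in> R"
        using mem[of "(I, J)" "tensor_elem (part_alg A I) (part_alg A J) x y"] IJ(1,2) by simp
      then show "tensor_elem (As r s) (As s t) a b \<in> R"
        unfolding \<phi>_tensor_mono(2)[OF rst IJ(1-4)] IJ(5,6) .
    qed
  qed
  then show ?thesis by simp
qed

lemma
  assumes rst: "0 < r" "r < s" "s < t"
  shows sharp_iso: "star_iso (As r t) (tensor (As r s) (As s t)) (sharp r s t)"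
    and sharp_\<phi>: "I \<in> partitions r s \<Longrightarrow> J \<in> partitions s t \<Longrightarrow> x \<in> carrier (part_alg A (I \<union> J)) \<Longrightarrow>
      sharp r s t (\<phi> (I \<union> J) x) = \<phi>_tensor r s t I J x"
  using theI'[OF sharp_ex1[OF rst]] unfolding sharp_comult_def by blast+

lemma sharp_unit_eq: "s < t \<Longrightarrow> sharp_unit A p \<phi> s t = \<phi> {s, t} (part_unit A p {s, t})"
  by (simp add: sharp_unit_def part_unit_pair)

lemma part_unit_pair_closed: "0 < s \<Longrightarrow> s < t \<Longrightarrow> part_unit A p {s, t} \<in> carrier (part_alg A {s, t})"
  using part_unit_pair_projection by (simp add: is_projection_def)

text \<open>Inverts the isomorphism explicitly on elements that come from partitions; the embeddings
  of intervals are evaluated on such elements.\<close>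

lemma sharp_inv:
  assumes rst: "0 < r" "r < s" "s < t" and IJ: "I \<in> partitions r s" "J \<in> partitions s t"
    and xy: "x \<in> carrier (part_alg A I)" "y \<in> carrier (part_alg A J)"
  shows "inv_into (carrier (As r t)) (sharp r s t) (tensor_elem (As r s) (As s t) (\<phi> I x) (\<phi> J y)) =
    \<phi> (I \<union> J) (tensor_elem (part_alg A I) (part_alg A J) x y)"
    and "sharp r s t (\<phi> (I \<union> J) (tensor_elem (part_alg A I) (part_alg A J) x y)) = tensor_elem (As r s) (As s t) (\<phi> I x) (\<phi> J y)"
    and "tensor_elem (part_alg A I) (part_alg A J) x y \<in> carrier (part_alg A (I \<union> J))"
proof -
  have s: "0 < s" and rt: "r < t" using rst by auto
  show z: "tensor_elem (part_alg A I) (part_alg A J) x y \<in> carrier (part_alg A (I \<union> J))"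
    using tensor_elem_closed[OF part_alg_rep part_alg_rep] part_alg_Un[OF IJ rst] IJ xy rst s by simp
  show eq: "sharp r s t (\<phi> (I \<union> J) (tensor_elem (part_alg A I) (part_alg A J) x y)) = tensor_elem (As r s) (As s t) (\<phi> I x) (\<phi> J y)"
    using sharp_\<phi>[OF rst IJ z] \<phi>_tensor_mono(2)[OF rst IJ xy] by simp
  have "inj_on (sharp r s t) (carrier (As r t))"
    using sharp_iso[OF rst] by (simp add: star_iso_def bij_betw_def)
  then show "inv_into (carrier (As r t)) (sharp r s t) (tensor_elem (As r s) (As s t) (\<phi> I x) (\<phi> J y)) =
    \<phi> (I \<union> J) (tensor_elem (part_alg A I) (part_alg A J) x y)"
    using \<phi>_closed[OF rst(1) rt partitions_Un[OF IJ] z] by (simp flip: eq)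
qed

section \<open>Embeddings of intervals as extensions of partitions by units\<close>

abbreviation embed where "embed \<equiv> interval_embed As sharp (sharp_unit A p \<phi>)"

definition ext_right :: "real \<Rightarrow> real \<Rightarrow> real set \<Rightarrow> 'h list oper \<Rightarrow> 'h list oper" where
  "ext_right t v I x = tensor_elem (part_alg A I) (part_alg A {t, v}) x (part_unit A p {t, v})"

definition ext_left :: "real \<Rightarrow> real \<Rightarrow> real set \<Rightarrow> 'h list oper \<Rightarrow> 'h list oper" where
  "ext_left u s I x = tensor_elem (part_alg A {u, s}) (part_alg A I) (part_unit A p {u, s}) x"

lemma ext_right_mono:
  assumes "0 < s" "s < t" "t < v" "I \<in> partitions s t"
  shows "star_mono (part_alg A I) (part_alg A (I \<union> {t, v})) (ext_right t v I)"
proof -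
  have t: "0 < t" using assms by simp
  note P = pair_partition[of t v]
  show ?thesis
    using tensor_projection_right[OF part_alg_rep[OF assms(4,1,2)] part_alg_rep[OF P t] part_unit_pair_projection[OF t]]
      part_alg_Un[OF assms(4) P assms(1,2)] assms by (simp add: ext_right_def[abs_def])
qed

lemma ext_left_mono:
  assumes "0 < u" "u < s" "s < t" "I \<in> partitions s t"
  shows "star_mono (part_alg A I) (part_alg A ({u, s} \<union> I)) (ext_left u s I)"
proof -
  have s: "0 < s" using assms by simp
  note P = pair_partition[of u s]
  show ?thesis
    using tensor_projection_left[OF part_alg_rep[OF assms(4) s assms(3)] part_alg_rep[OF P assms(1)] part_unit_pair_projection[OF assms(1)]]
      part_alg_Un[OF P assms(4,1)] assms by (simp add: ext_left_def[abs_def])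
qed

text \<open>Refinement acts separately on the two sides of \<open>t\<close>, and the coarse unit on
  the right refines to \<open>part_unit A p H\<close>.\<close>

lemma refine_ext_right:
  assumes "0 < s" "s < t" "t < v" "I \<in> partitions s t" "M \<in> partitions s t" "I \<subseteq> M" "H \<in> partitions t v" "x \<in> carrier (part_alg A I)"
  shows "refine A \<Delta> (I \<union> {t, v}) (M \<union> H) (ext_right t v I x) =
     tensor_elem (part_alg A M) (part_alg A H) (refine A \<Delta> I M x) (part_unit A p H)"
proof -
  have "0 < t" "{t, v} \<subseteq> H" "{t, v} \<in> partitions t v" using assms partitionsD[OF assms(7)] by (auto simp: pair_partition)
  then show ?thesis unfolding ext_right_def
    using refine_elem[OF assms(4-6), of "{t, v}" v H x "part_unit A p {t, v}"] assms refine_pair_unit part_unit_pair_closed by simp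
qed

lemma refine_ext_left:
  assumes "0 < u" "u < s" "s < t" "I \<in> partitions s t" "M \<in> partitions s t" "I \<subseteq> M" "H \<in> partitions u s" "x \<in> carrier (part_alg A I)"
  shows "refine A \<Delta> ({u, s} \<union> I) (H \<union> M) (ext_left u s I x) =
     tensor_elem (part_alg A H) (part_alg A M) (part_unit A p H) (refine A \<Delta> I M x)"
proof -
  have "{u, s} \<subseteq> H" "{u, s} \<in> partitions u s" using assms partitionsD[OF assms(7)] by (auto simp: pair_partition)
  then show ?thesis unfolding ext_left_def
    using refine_elem[of "{u, s}" u s H I t M "part_unit A p {u, s}" x] assms refine_pair_unit part_unit_pair_closed by simp
qed

text \<open>A part of \<open>K\<close> outside the open interval (s, t) is a single point precisely
  when the corresponding end points coincide, so the tests on cardinalities become comparisons of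
  end points.\<close>

lemma refine_unit_eq:
  assumes I: "I \<in> partitions s t" and K: "K \<in> partitions u v" "I \<subseteq> K" and st: "0 < s" "s < t"
  defines "lo \<equiv> K \<inter> {u..s}" and "mid \<equiv> K \<inter> {s..t}" and "hi \<equiv> K \<inter> {t..v}"
  shows "refine_unit A \<Delta> p I K x =
    (let z = (if t = v then refine A \<Delta> I mid x
        else tensor_elem (part_alg A mid) (part_alg A hi) (refine A \<Delta> I mid x) (part_unit A p hi))
     in if u = s then z else tensor_elem (part_alg A lo) (part_alg A (mid \<union> hi)) (part_unit A p lo) z)"
proof -
  note Id = partitionsD[OF I] and Kd = partitionsD[OF K(1)]
  have stK: "s \<in> K" "t \<in> K" "u \<le> s" "t \<le> v" using Id Kd K by auto
  have lo: "{j \<in> K. j \<le> s} = lo" and hi: "{j \<in> K. t \<le> j} = hi" using Kd by (auto simp: lo_def hi_def)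
  have "card lo = 1 \<longleftrightarrow> u = s"
  proof
    assume "card lo = 1"
    moreover have "u \<in> lo" "s \<in> lo" using stK Kd by (auto simp: lo_def)
    ultimately show "u = s" by (auto simp: card_1_singleton_iff)
  next
    assume "u = s" then have "lo = {s}" using stK by (auto simp: lo_def)
    then show "card lo = 1" by simp
  qed
  moreover have "card hi = 1 \<longleftrightarrow> t = v"
  proof
    assume "card hi = 1"
    moreover have "v \<in> hi" "t \<in> hi" using stK Kd by (auto simp: hi_def)
    ultimately show "t = v" by (auto simp: card_1_singleton_iff)
  next
    assume "t = v" then have "hi = {t}" using stK by (auto simp: hi_def)
    then show "card hi = 1" by simp
  qed
  ultimately show ?thesis
    unfolding refine_unit_def Id(6,7) lo hi mid_def[symmetric] Let_def by simp
qed

text \<open>The same \<open>I'\<close> and \<open>e\<close> have to serve every \<open>K\<close>,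
  because they are fixed by the interval alone. They are obtained rather than defined since the four
  cases of \<open>interval_embed\<close> give different formulas; where end points coincide there is
  no interval to carry a unit and nothing is adjoined.\<close>

lemma embed_extension:
  assumes uv: "0 < u" "u \<le> s" "s < t" "t \<le> v" and I: "I \<in> partitions s t"
  obtains I' e where "I' \<in> partitions u v" "star_mono (part_alg A I) (part_alg A I') e"
    "\<And>x. x \<in> carrier (part_alg A I) \<Longrightarrow> embed (s, t) (u, v) (\<phi> I x) = \<phi> I' (e x)"
    "\<And>K. K \<in> partitions u v \<Longrightarrow> I \<subseteq> K \<Longrightarrow> I' \<subseteq> K"
    "\<And>K x. K \<in> partitions u v \<Longrightarrow> I \<subseteq> K \<Longrightarrow> x \<in> carrier (part_alg A I) \<Longrightarrow> refine_unit A \<Delta> p I K x = refine A \<Delta> I' K (e x)"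
proof -
  have s: "0 < s" and t: "0 < t" and usv: "u < v" "s < v" "u < t" using uv by auto
  note Id = partitionsD[OF I]
  have stK: "finite K" "s \<in> K" "t \<in> K" "u \<in> K" "v \<in> K" "K \<subseteq> {u..v}" if "K \<in> partitions u v" "I \<subseteq> K" for K
    using partitionsD[OF that(1)] that(2) Id by auto
  have mid: "K \<inter> {s..t} \<in> partitions s t" "I \<subseteq> K \<inter> {s..t}" if "K \<in> partitions u v" "I \<subseteq> K" for K
    using stK[OF that] that(2) Id uv by (auto intro: partitions_Int)
  consider "u = s" "t = v" | "u = s" "t < v" | "u < s" "t = v" | "u < s" "t < v" using uv by linarith
  then show thesis
  proof cases
    case 1
    show thesis
    proof (rule that[of I "\<lambda>x. x"])
      show "star_mono (part_alg A I) (part_alg A I) (\<lambda>x. x)" by (rule star_mono_id[OF part_alg_cstar[OF I s uv(3)]])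
      fix K x assume K: "K \<in> partitions u v" "I \<subseteq> K"
      have "K \<inter> {s..t} = K" using stK[OF K] 1 by auto
      then show "refine_unit A \<Delta> p I K x = refine A \<Delta> I K x" using 1 by (simp add: refine_unit_eq[OF I K s uv(3)])
    qed (use 1 I in \<open>auto simp: interval_embed_def\<close>)
  next
    case 2
    show thesis
    proof (rule that[of "I \<union> {t, v}" "ext_right t v I"])
      show "I \<union> {t, v} \<in> partitions u v" using partitions_Un[OF I pair_partition[of t v]] 2 by simp
      show "star_mono (part_alg A I) (part_alg A (I \<union> {t, v})) (ext_right t v I)" by (rule ext_right_mono[OF s uv(3) 2(2) I])
      fix x assume x: "x \<in> carrier (part_alg A I)"
      show "embed (s, t) (u, v) (\<phi> I x) = \<phi> (I \<union> {t, v}) (ext_right t v I x)"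
        using sharp_inv(1)[OF s uv(3) 2(2) I pair_partition x part_unit_pair_closed[OF t 2(2)]] 2
        by (simp add: interval_embed_def sharp_unit_eq ext_right_def)
      fix K assume K: "K \<in> partitions u v" "I \<subseteq> K"
      have Keq: "K \<inter> {s..t} \<union> K \<inter> {t..v} = K" using Int_interval_Un[of s t v K] stK[OF K] 2 uv by auto
      show "refine_unit A \<Delta> p I K x = refine A \<Delta> (I \<union> {t, v}) K (ext_right t v I x)"
        using refine_ext_right[OF s uv(3) 2(2) I mid[OF K] partitions_Int[of K t v] x] stK[OF K] 2
        by (simp add: refine_unit_eq[OF I K s uv(3)] Keq)
    qed (use stK in blast)
  next
    case 3
    show thesis
    proof (rule that[of "{u, s} \<union> I" "ext_left u s I"])
      show "{u, s} \<union> I \<in> partitions u v" using partitions_Un[OF pair_partition[of u s] I] 3 by simp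
      show "star_mono (part_alg A I) (part_alg A ({u, s} \<union> I)) (ext_left u s I)" by (rule ext_left_mono[OF uv(1) 3(1) uv(3) I])
      fix x assume x: "x \<in> carrier (part_alg A I)"
      show "embed (s, t) (u, v) (\<phi> I x) = \<phi> ({u, s} \<union> I) (ext_left u s I x)"
        using sharp_inv(1)[OF uv(1) 3(1) uv(3) pair_partition I part_unit_pair_closed[OF uv(1) 3(1)] x] 3
        by (simp add: interval_embed_def sharp_unit_eq ext_left_def)
      fix K assume K: "K \<in> partitions u v" "I \<subseteq> K"
      have Keq: "K \<inter> {u..s} \<union> K \<inter> {s..t} = K" using Int_interval_Un[of u s t K] stK[OF K] 3 uv by auto
      \<comment> \<open>For t = v the right part is the single point \<open>t\<close>, which already
        belongs to the middle part.\<close>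
      have "K \<inter> {s..t} \<union> K \<inter> {t..v} = K \<inter> {s..t}" using stK[OF K] 3 uv by auto
      then show "refine_unit A \<Delta> p I K x = refine A \<Delta> ({u, s} \<union> I) K (ext_left u s I x)"
        using refine_ext_left[OF uv(1) 3(1) uv(3) I mid[OF K] partitions_Int[of K u s] x] stK(1-4)[OF K] 3(1)
        by (simp add: refine_unit_eq[OF I K s uv(3)] Keq 3(2)[symmetric])
    qed (use stK in blast)
  next
    case 4
    let ?I = "I \<union> {t, v}"
    have I1: "?I \<in> partitions s v" using partitions_Un[OF I pair_partition[of t v]] 4 by simp
    show thesis
    proof (rule that[of "{u, s} \<union> ?I" "\<lambda>x. ext_left u s ?I (ext_right t v I x)"])
      show "{u, s} \<union> ?I \<in> partitions u v" using partitions_Un[OF pair_partition[of u s] I1] 4 by simp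
      note er = ext_right_mono[OF s uv(3) 4(2) I]
      show "star_mono (part_alg A I) (part_alg A ({u, s} \<union> ?I)) (\<lambda>x. ext_left u s ?I (ext_right t v I x))"
        by (rule star_mono_comp[OF er ext_left_mono[OF uv(1) 4(1) usv(2) I1]])
      fix x assume x: "x \<in> carrier (part_alg A I)"
      note y = star_hom_closed[OF star_mono_hom[OF er] x]
      let ?q = "sharp_unit A p \<phi> u s" and ?r = "sharp_unit A p \<phi> t v"
      have q: "?q \<in> carrier (As u s)"
        using \<phi>_closed[OF uv(1) 4(1) pair_partition part_unit_pair_closed[OF uv(1) 4(1)]] 4 by (simp add: sharp_unit_eq)
      have \<phi>y: "\<phi> ?I (ext_right t v I x) \<in> carrier (As s v)" by (rule \<phi>_closed[OF s usv(2) I1 y])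
      \<comment> \<open>The nested inverses in \<open>interval_embed\<close> are evaluated by
        exhibiting preimages: that of the inner map is the unit tensored with
        \<open>\<phi> ?I (ext_right t v I x)\<close>, and \<open>sharp_inv\<close> then provides
        that of the outer one.\<close>
      have D: "sharp s t v (\<phi> ?I (ext_right t v I x)) = tensor_elem (As s t) (As t v) (\<phi> I x) ?r"
        using sharp_inv(2)[OF s uv(3) 4(2) I pair_partition x part_unit_pair_closed[OF t 4(2)]] 4
        by (simp add: sharp_unit_eq ext_right_def)
      note R = rep_As[OF uv(1) 4(1)] rep_As[OF s usv(2)] rep_As[OF s uv(3)] rep_As[OF t 4(2)]
      have Dm: "star_mono (As s v) (tensor (As s t) (As t v)) (sharp s t v)"
        using sharp_iso[OF s uv(3) 4(2)] by (simp add: star_iso_def star_mono_def bij_betw_def)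
      note T = tensor_map_mono[OF R(1,2,1) represented_tensor[OF R(3,4)] star_mono_id[OF represented_cstar_algebra[OF R(1)]] Dm]
      let ?T = "tensor_map (As u s) (As s v) (As u s) (tensor (As s t) (As t v)) (\<lambda>y. y) (sharp s t v)"
      have "inj_on ?T (carrier (tensor (As u s) (As s v)))" using T(1) by (simp add: star_mono_def)
      then have "inv_into (carrier (tensor (As u s) (As s v))) ?T (?T (tensor_elem (As u s) (As s v) ?q (\<phi> ?I (ext_right t v I x))))
         = tensor_elem (As u s) (As s v) ?q (\<phi> ?I (ext_right t v I x))"
        using tensor_elem_closed[OF R(1,2) q \<phi>y] by simp
      then have "inv_into (carrier (tensor (As u s) (As s v))) ?T (tensor_elem (As u s) (tensor (As s t) (As t v)) ?q
          (tensor_elem (As s t) (As t v) (\<phi> I x) ?r)) = tensor_elem (As u s) (As s v) ?q (\<phi> ?I (ext_right t v I x))"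
        using T(2)[OF q \<phi>y] D by simp
      then show "embed (s, t) (u, v) (\<phi> I x) = \<phi> ({u, s} \<union> ?I) (ext_left u s ?I (ext_right t v I x))"
        using sharp_inv(1)[OF uv(1) 4(1) usv(2) pair_partition I1 part_unit_pair_closed[OF uv(1) 4(1)] y] 4
        by (simp add: interval_embed_def sharp_unit_eq[of u s] ext_left_def)
      fix K assume K: "K \<in> partitions u v" "I \<subseteq> K"
      have Keq: "K \<inter> {s..t} \<union> K \<inter> {t..v} = K \<inter> {s..v}" "K \<inter> {u..s} \<union> K \<inter> {s..v} = K"
        using Int_interval_Un[of s t v K] Int_interval_Un[of u s v K] stK[OF K] 4 uv by auto
      have mid': "K \<inter> {s..v} \<in> partitions s v" "?I \<subseteq> K \<inter> {s..v}"
        using stK[OF K] K(2) Id uv by (auto intro: partitions_Int)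
      show "refine_unit A \<Delta> p I K x = refine A \<Delta> ({u, s} \<union> ?I) K (ext_left u s ?I (ext_right t v I x))"
        using refine_ext_right[OF s uv(3) 4(2) I mid[OF K] partitions_Int[of K t v] x]
          refine_ext_left[OF uv(1) 4(1) usv(2) I1 mid' partitions_Int[of K u s] y] stK[OF K] 4
        by (simp add: refine_unit_eq[OF I K s uv(3)] Keq Let_def)
    qed (use stK in blast)
  qed
qed

end

section \<open>The directed set of all partitions and the isomorphism of the two limits\<close>

lemma all_partitionsE:
  assumes "I \<in> all_partitions" obtains s t where "0 < s" "s < t" "I \<in> partitions s t"
  using assms by (auto simp: all_partitions_def)

lemma all_partitionsI: "0 < s \<Longrightarrow> s < t \<Longrightarrow> I \<in> partitions s t \<Longrightarrow> I \<in> all_partitions"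
  by (auto simp: all_partitions_def)

lemma partitions_subset_bounds:
  assumes "I \<in> partitions s t" "K \<in> partitions u v" "I \<subseteq> K" shows "u \<le> s" "t \<le> v"
  using partitionsD[OF assms(1)] partitionsD[OF assms(2)] assms(3) by auto

lemma all_partitions_Un:
  assumes "I \<in> all_partitions" "J \<in> all_partitions" shows "I \<union> J \<in> all_partitions"
proof -
  obtain s t where I: "0 < s" "s < t" "I \<in> partitions s t" by (rule all_partitionsE[OF assms(1)])
  obtain s' t' where J: "0 < s'" "s' < t'" "J \<in> partitions s' t'" by (rule all_partitionsE[OF assms(2)])
  have "I \<union> J \<subseteq> {min s s'..max t t'}"
  proof
    fix x assume "x \<in> I \<union> J"
    then show "x \<in> {min s s'..max t t'}"
      using subsetD[OF partitionsD(4)[OF I(3)], of x] subsetD[OF partitionsD(4)[OF J(3)], of x]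
      by (auto simp: min_le_iff_disj le_max_iff_disj)
  qed
  moreover have "min s s' \<in> I \<union> J" "max t t' \<in> I \<union> J" "finite (I \<union> J)"
    using partitionsD(1-3)[OF I(3)] partitionsD(1-3)[OF J(3)] by (simp_all add: min_def max_def)
  ultimately have "I \<union> J \<in> partitions (min s s') (max t t')" by (simp add: partitions_def)
  then show ?thesis using I J by (intro all_partitionsI) auto
qed

lemma interval_le_iff: "s < t \<Longrightarrow> interval_le (s, t) (u, v) \<longleftrightarrow> u \<le> s \<and> t \<le> v"
  by (auto simp: interval_le_def greaterThanLessThan_subseteq_greaterThanLessThan)

theorem theorem5p3:
  fixes A :: "real \<Rightarrow> real \<Rightarrow> ('a, 'h) rep_cstar"
    and \<Delta> :: "real \<Rightarrow> real \<Rightarrow> real \<Rightarrow> 'a \<Rightarrow> 'h list oper"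
    and p :: "real \<Rightarrow> real \<Rightarrow> 'a"
    and As :: "real \<Rightarrow> real \<Rightarrow> ('b, 'k) rep_cstar"
    and \<phi> :: "real set \<Rightarrow> 'h list oper \<Rightarrow> 'b"
    and L :: "'c cstar" and \<psi> :: "real \<times> real \<Rightarrow> 'b \<Rightarrow> 'c"
    and C :: "'d cstar" and \<eta> :: "real set \<Rightarrow> 'h list oper \<Rightarrow> 'd"
  assumes "cstar_subproduct_system A \<Delta>"
    and "cstar_unit A \<Delta> p"
    and "inductive_dilation A \<Delta> As \<phi>"
    and "diamond_algebra A p As \<phi> L \<psi>"
    and "unit_limit_algebra A \<Delta> p C \<eta>"
  shows "\<exists>!\<delta>. \<delta> \<in> extensional (carrier C) \<and> star_iso C L \<delta> \<and>
    (\<forall>s t. 0 < s \<and> s < t \<longrightarrow> (\<forall>I\<in>partitions s t. \<forall>x\<in>carrier (part_alg A I).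
       \<delta> (\<eta> I x) = \<psi> (s, t) (\<phi> I x)))"
proof -
  interpret dilation A \<Delta> p As \<phi> by unfold_locales (fact assms)+
  note limL = assms(4)[unfolded diamond_algebra_def]
  note limC = assms(5)[unfolded unit_limit_algebra_def]
  have L: "cstar_algebra L" by (rule inductive_limit_cstar[OF limL])
  have C: "cstar_algebra C" by (rule inductive_limit_cstar[OF limC])
  have \<psi>h: "star_hom (As s t) L (\<psi> (s, t))" if "0 < s" "s < t" for s t
    using inductive_limit_hom[OF limL, of "(s, t)"] that by (simp add: intervals_def)
  \<comment> \<open>\<open>Min I\<close> and \<open>Max I\<close> recover the interval from the
    partition, so that the second family is indexed by partitions alone.\<close>
  define \<beta> where "\<beta> I x = \<psi> (Min I, Max I) (\<phi> I x)" for I x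
  have \<beta>: "\<beta> I x = \<psi> (s, t) (\<phi> I x)" if "I \<in> partitions s t" for I s t x
    using partitionsD(6,7)[OF that] by (simp add: \<beta>_def)
  have \<beta>h: "star_hom (part_alg A I) L (\<beta> I)" if "0 < s" "s < t" "I \<in> partitions s t" for I s t
    using star_hom_comp[OF star_mono_hom[OF \<phi>_mono[OF that]] \<psi>h[OF that(1,2)]] \<beta>[OF that(3)] by presburger
  \<comment> \<open>The witness is \<open>refine_unit A \<Delta> p I K x\<close>: one element with
    the right image in both limits.\<close>
  have compat: "\<exists>z\<in>carrier (part_alg A K). \<eta> K z = \<eta> I x \<and> \<beta> K z = \<beta> I x"
    if IK: "I \<in> all_partitions" "K \<in> all_partitions" "I \<subseteq> K" and x: "x \<in> carrier (part_alg A I)" for I K x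
  proof -
    obtain s t where I: "0 < s" "s < t" "I \<in> partitions s t" by (rule all_partitionsE[OF IK(1)])
    obtain u v where K: "0 < u" "u < v" "K \<in> partitions u v" by (rule all_partitionsE[OF IK(2)])
    note le = partitions_subset_bounds[OF I(3) K(3) IK(3)]
    obtain I' e where e: "I' \<in> partitions u v" "star_mono (part_alg A I) (part_alg A I') e"
      "\<And>x. x \<in> carrier (part_alg A I) \<Longrightarrow> embed (s, t) (u, v) (\<phi> I x) = \<phi> I' (e x)"
      "\<And>K. K \<in> partitions u v \<Longrightarrow> I \<subseteq> K \<Longrightarrow> I' \<subseteq> K"
      "\<And>K x. K \<in> partitions u v \<Longrightarrow> I \<subseteq> K \<Longrightarrow> x \<in> carrier (part_alg A I) \<Longrightarrow> refine_unit A \<Delta> p I K x = refine A \<Delta> I' K (e x)"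
      by (rule embed_extension[OF K(1) le(1) I(2) le(2) I(3)]) (rule that)
    have ex: "e x \<in> carrier (part_alg A I')" by (rule star_hom_closed[OF star_mono_hom[OF e(2)] x])
    have I'K: "I' \<subseteq> K" by (rule e(4)[OF K(3) IK(3)])
    have z: "refine_unit A \<Delta> p I K x \<in> carrier (part_alg A K)"
      unfolding e(5)[OF K(3) IK(3) x] by (rule star_hom_closed[OF star_mono_hom[OF refine_mono[OF e(1) K(3) I'K K(1,2)]] ex])
    have "\<beta> K (refine_unit A \<Delta> p I K x) = \<psi> (u, v) (\<phi> I' (e x))"
      unfolding \<beta>[OF K(3)] e(5)[OF K(3) IK(3) x] \<phi>_compat[OF K(1,2) e(1) K(3) I'K ex] ..
    also have "\<dots> = \<psi> (u, v) (embed (s, t) (u, v) (\<phi> I x))" by (simp add: e(3)[OF x])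
    also have "\<dots> = \<psi> (s, t) (\<phi> I x)"
      using inductive_limit_compat[OF limL, of "(s, t)" "(u, v)" "\<phi> I x"] I K le \<phi>_closed[OF I x]
      by (simp add: intervals_def interval_le_iff)
    also have "\<dots> = \<beta> I x" by (rule \<beta>[OF I(3), symmetric])
    finally show ?thesis using z inductive_limit_compat[OF limC IK x] by blast
  qed
  have "\<exists>!\<delta>. \<delta> \<in> extensional (carrier C) \<and> star_iso C L \<delta> \<and>
    (\<forall>I\<in>all_partitions. \<forall>x\<in>carrier (part_alg A I). \<delta> (\<eta> I x) = \<beta> I x)"
  proof (rule directed_iso[OF C L])
    fix I x assume Ia: "I \<in> all_partitions" and x: "x \<in> carrier (part_alg A I)"
    obtain s t where I: "0 < s" "s < t" "I \<in> partitions s t" by (rule all_partitionsE[OF Ia])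
    note cI = part_alg_cstar[OF I(3,1,2)]
    \<comment> \<open>Each map \<open>refine_unit\<close> is the extension \<open>e\<close> followed
      by a refinement, hence isometric, and the infimum is taken over a constant.\<close>
    have "cnorm C (\<eta> I x) = cnorm (part_alg A I) x"
      unfolding inductive_limit_norm[OF limC Ia x]
    proof (rule INF_const_eq[of I])
      fix K assume "K \<in> {K \<in> all_partitions. I \<subseteq> K}"
      then have IK: "K \<in> all_partitions" "I \<subseteq> K" by auto
      obtain u v where K: "0 < u" "u < v" "K \<in> partitions u v" by (rule all_partitionsE[OF IK(1)])
      note le = partitions_subset_bounds[OF I(3) K(3) IK(2)]
      obtain I' e where e: "I' \<in> partitions u v" "star_mono (part_alg A I) (part_alg A I') e"
        "\<And>K. K \<in> partitions u v \<Longrightarrow> I \<subseteq> K \<Longrightarrow> I' \<subseteq> K"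
        "\<And>K x. K \<in> partitions u v \<Longrightarrow> I \<subseteq> K \<Longrightarrow> x \<in> carrier (part_alg A I) \<Longrightarrow> refine_unit A \<Delta> p I K x = refine A \<Delta> I' K (e x)"
        by (rule embed_extension[OF K(1) le(1) I(2) le(2) I(3)]) (rule that)
      show "cnorm (part_alg A K) (refine_unit A \<Delta> p I K x) = cnorm (part_alg A I) x"
        unfolding e(4)[OF K(3) IK(2) x]
        using star_mono_isometric[OF cI part_alg_cstar[OF K(3,1,2)]
            star_mono_comp[OF e(2) refine_mono[OF e(1) K(3) e(3)[OF K(3) IK(2)] K(1,2)]] x] .
    qed (use Ia in auto)
    \<comment> \<open>On elements \<open>\<phi> I x\<close> the embeddings of intervals preserve
      norms for a similar reason: there \<open>e\<close> is followed by the isometric map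
      \<open>\<phi> I'\<close>.\<close>
    moreover have "cnorm L (\<beta> I x) = cnorm (part_alg A I) x"
    proof -
      have "cnorm L (\<psi> (s, t) (\<phi> I x)) = (INF j\<in>{j \<in> intervals. interval_le (s, t) j}.
          cnorm (case j of (s, t) \<Rightarrow> As s t) (embed (s, t) j (\<phi> I x)))"
        using inductive_limit_norm[OF limL, of "(s, t)" "\<phi> I x"] I \<phi>_closed[OF I x] by (simp add: intervals_def)
      also have "\<dots> = cnorm (part_alg A I) x"
      proof (rule INF_const_eq[of "(s, t)"])
        fix j assume "j \<in> {j \<in> intervals. interval_le (s, t) j}"
        then obtain u v where uv: "j = (u, v)" "0 < u" "u < v" "u \<le> s" "t \<le> v"
          using I by (cases j) (auto simp: intervals_def interval_le_iff)
        obtain I' e where e: "I' \<in> partitions u v" "star_mono (part_alg A I) (part_alg A I') e"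
          "\<And>x. x \<in> carrier (part_alg A I) \<Longrightarrow> embed (s, t) (u, v) (\<phi> I x) = \<phi> I' (e x)"
          by (rule embed_extension[OF uv(2,4) I(2) uv(5) I(3)]) (rule that)
        have "cnorm (As u v) (\<phi> I' (e x)) = cnorm (part_alg A I) x"
          using star_mono_isometric[OF cI represented_cstar_algebra[OF rep_As[OF uv(2,3)]]
              star_mono_comp[OF e(2) \<phi>_mono[OF uv(2,3) e(1)]] x] .
        then show "cnorm (case j of (s, t) \<Rightarrow> As s t) (embed (s, t) j (\<phi> I x)) = cnorm (part_alg A I) x"
          using e(3)[OF x] by (simp add: uv(1))
      qed (use I in \<open>auto simp: intervals_def interval_le_iff\<close>)
      finally show ?thesis by (simp add: \<beta>[OF I(3)])
    qed
    ultimately show "cnorm L (\<beta> I x) = cnorm C (\<eta> I x)" by simp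
  next
    fix I assume Ia: "I \<in> all_partitions"
    obtain s t where I: "0 < s" "s < t" "I \<in> partitions s t" by (rule all_partitionsE[OF Ia])
    show "cstar_algebra (part_alg A I)" by (rule part_alg_cstar[OF I(3,1,2)])
    show "star_hom (part_alg A I) C (\<eta> I)" by (rule inductive_limit_hom[OF limC Ia])
    show "star_hom (part_alg A I) L (\<beta> I)" by (rule \<beta>h[OF I])
  next
    fix I J assume IJ: "I \<in> all_partitions" "J \<in> all_partitions"
    show "\<exists>K\<in>all_partitions. (\<forall>x\<in>carrier (part_alg A I). \<exists>z\<in>carrier (part_alg A K). \<eta> K z = \<eta> I x \<and> \<beta> K z = \<beta> I x) \<and>
      (\<forall>y\<in>carrier (part_alg A J). \<exists>z\<in>carrier (part_alg A K). \<eta> K z = \<eta> J y \<and> \<beta> K z = \<beta> J y)"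
      using compat[OF IJ(1) all_partitions_Un[OF IJ]] compat[OF IJ(2) all_partitions_Un[OF IJ]] all_partitions_Un[OF IJ]
      by (intro bexI[of _ "I \<union> J"]) auto
  next
    show "cdense C (\<Union>I\<in>all_partitions. \<eta> I ` carrier (part_alg A I))" by (rule inductive_limit_dense[OF limC])
  next
    fix R assume R: "closed_subalg L R" and mem: "\<And>I x. I \<in> all_partitions \<Longrightarrow> x \<in> carrier (part_alg A I) \<Longrightarrow> \<beta> I x \<in> R"
    interpret L: cstar_algebra L by (rule L)
    \<comment> \<open>\<open>R\<close> is only known to contain the values of \<open>\<psi>\<close>
      on images of partitions; their density in \<open>As s t\<close>, contractivity of
      \<open>\<psi> (s, t)\<close> and closedness of \<open>R\<close> give the rest.\<close>
    have "\<psi> (s, t) y \<in> R" if st: "0 < s" "s < t" and y: "y \<in> carrier (As s t)" for s t y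
    proof -
      interpret S: cstar_algebra "As s t" by (rule represented_cstar_algebra[OF rep_As[OF st]])
      note h = \<psi>h[OF st]
      obtain X where X: "\<And>n. X n \<in> (\<Union>I\<in>partitions s t. \<phi> I ` carrier (part_alg A I))" "cconverges (As s t) X y"
        by (rule S.approx_sequence[OF y, of "\<Union>I\<in>partitions s t. \<phi> I ` carrier (part_alg A I)"])
          (use inductive_limit_dense[OF lim_As[OF st]] y in \<open>auto simp: cdense_def\<close>)
      have Xc: "X n \<in> carrier (As s t)" for n using X(1)[of n] \<phi>_closed[OF st] by auto
      have XR: "\<psi> (s, t) (X n) \<in> R" for n
      proof -
        obtain I x where "I \<in> partitions s t" "x \<in> carrier (part_alg A I)" "X n = \<phi> I x" using X(1)[of n] by blast
        then show ?thesis using mem[OF all_partitionsI[OF st]] \<beta> by metis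
      qed
      have "cconverges L (\<lambda>n. \<psi> (s, t) (X n)) (\<psi> (s, t) y)"
      proof (rule L.converges_bound[OF X(2)[unfolded cconverges_def]])
        fix n show "cnorm L (cdiff L (\<psi> (s, t) (X n)) (\<psi> (s, t) y)) \<le> cnorm (As s t) (cdiff (As s t) (X n) y)"
          using star_hom_contractive[OF S.cstar_algebra_axioms L h S.cdiff_closed[OF Xc y]]
          by (simp add: star_hom_cdiff[OF S.cstar_algebra_axioms h Xc y])
      qed (use star_hom_closed[OF h] Xc y in auto)
      then show ?thesis by (rule closed_subalg_limit[OF R XR star_hom_closed[OF h y]])
    qed
    then show "carrier L \<subseteq> R"
      by (intro closed_subalg_dense_eq[OF L R inductive_limit_dense[OF limL]]) (auto simp: intervals_def)
  qed
  moreover have eq: "(\<forall>I\<in>all_partitions. \<forall>x\<in>carrier (part_alg A I). \<delta> (\<eta> I x) = \<beta> I x) \<longleftrightarrow>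
    (\<forall>s t. 0 < s \<and> s < t \<longrightarrow> (\<forall>I\<in>partitions s t. \<forall>x\<in>carrier (part_alg A I). \<delta> (\<eta> I x) = \<psi> (s, t) (\<phi> I x)))" for \<delta>
  proof (intro iffI ballI allI impI)
    fix s t I x
    assume *: "\<forall>I\<in>all_partitions. \<forall>x\<in>carrier (part_alg A I). \<delta> (\<eta> I x) = \<beta> I x" "0 < s \<and> s < t"
      "I \<in> partitions s t" "x \<in> carrier (part_alg A I)"
    then have "I \<in> all_partitions" by (intro all_partitionsI[of s t]) auto
    then show "\<delta> (\<eta> I x) = \<psi> (s, t) (\<phi> I x)" using * \<beta>[OF *(3), of x] by simp
  next
    fix I x
    assume *: "\<forall>s t. 0 < s \<and> s < t \<longrightarrow> (\<forall>I\<in>partitions s t. \<forall>x\<in>carrier (part_alg A I). \<delta> (\<eta> I x) = \<psi> (s, t) (\<phi> I x))"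
      "I \<in> all_partitions" "x \<in> carrier (part_alg A I)"
    obtain s t where I: "0 < s" "s < t" "I \<in> partitions s t" by (rule all_partitionsE[OF *(2)])
    show "\<delta> (\<eta> I x) = \<beta> I x" using *(1,3) I \<beta>[OF I(3), of x] by simp
  qed
  ultimately show ?thesis by (simp only: eq)
qed

end
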